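(* Let $n\ge1$, $0\le\alpha<n$, let $\omega,\sigma$ be measures on $\mathbb{R}^n$ that are both in $A_\infty$, and let $T$ be an $\alpha$-fractional singular integral on $\mathbb{R}^n$. Assume that the fractional condition $\mathcal{A}_2^\alpha(\omega,\sigma)<\infty$ holds (along with its dual $\mathcal{A}_2^\alpha(\sigma,\omega)<\infty$), and that the testing conditions hold: there are finite constants $\mathfrak{T},\mathfrak{T}^*$ such that for all cubes $I\subset\mathbb{R}^n$ $$\|T(\mathbf{1}_I\,d\sigma)\|_{L^2(\omega)}^2\le \mathfrak{T}^2\,\sigma(I),\qquad \|T^*(\mathbf{1}_I\,d\omega)\|_{L^2(\sigma)}^2\le (\mathfrak{T}^* )^2\,\omega(I).$$ Then $T$ is bounded from $L^2(\sigma)$ to $L^2(\omega)$: there is a constant $C$ such that $\|T(f\,d\sigma)\|_{L^2(\omega)}\le C\|f\|_{L^2(\sigma)}$ for all $f\in L^2(\sigma)$.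
   Context: A measure $\mu$ is in $A_\infty$ if $d\mu=w(x)\,dx$ with $w$ a nonnegative, locally integrable, not a.e. zero function and there exist $C,\varepsilon>0$ such that $\frac{w(E)}{w(I)}\le C\left(\frac{|E|}{|I|}\right)^{\varepsilon}$ for all cubes $I\subset\mathbb{R}^n$ and measurable $E\subset I$, where $w(E)=\int_E w$. The fractional two weight condition: with supremum over all cubes $I\subset\mathbb{R}^n$, $$\mathcal{A}^\alpha_2(\omega,\sigma)=\sup_I\left(\frac{\omega(I)}{|I|^{1-\alpha/n}}\right)^{1/2}\left(\frac{\sigma(I)}{|I|^{1-\alpha/n}}\right)^{1/2}.$$ An $\alpha$-fractional singular integral ($0\le\alpha<n$) is an operator $T$ with kernel $K(x,y)$, defined for $x\neq y$, such that for some $C>0$, $0<\delta\le1$: $|K(x,y)|\le C|x-y|^{\alpha-n}$, $|\nabla_x K(x,y)|\le C|x-y|^{\alpha-n-1}$, and $|\nabla_xK(x,y)-\nabla_xK(x',y)|\le C\left(\frac{|x-x'|}{|x-y|}\right)^{\delta}|x-y|^{\alpha-n-1}$ whenever $|x-x'|\le\frac12|x-y|$, with the same estimates for $K^*(x,y)=K(y,x)$. For a measure $\mu$, $T(f\,d\mu)(x)=\int K(x,y)f(y)\,d\mu(y)$, interpreted as usual through smooth truncations of the kernel away from the diagonal and infinity: the testing inequalities and the conclusion are understood to hold for all truncations with constants independent of the truncation. $T^*$ is the operator with kernel $K^*$. *)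

theory Defs
  imports "HOL-Analysis.Analysis"
begin

(* Cubes have sides parallel to the axes and positive side length. *)
definition cubes :: "(real ^ 'n) set set" where
  "cubes = {cbox a (\<chi> i. a $ i + l) | a l. l > 0}"

definition A_infty :: "(real ^ 'n) measure \<Rightarrow> bool" where
  "A_infty \<mu> \<longleftrightarrow>
    (\<exists>w :: real ^ 'n \<Rightarrow> real.
      w \<in> borel_measurable lborel \<and>
      (\<forall>x. 0 \<le> w x) \<and>
      (\<forall>S. compact S \<longrightarrow> set_integrable lborel S w) \<and>
      \<not> (AE x in lborel. w x = 0) \<and>
      \<mu> = density lborel (\<lambda>x. ennreal (w x))) \<and>
    (\<exists>C \<epsilon>. 0 < C \<and> 0 < \<epsilon> \<and>
      (\<forall>I\<in>cubes. \<forall>E\<in>sets lborel. E \<subseteq> I \<longrightarrow>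
        measure \<mu> E / measure \<mu> I \<le> C * (measure lborel E / measure lborel I) powr \<epsilon>))"

(* The real-valued measure is the intended mass only when the measures are finite on cubes,
   as is the case for A_infty measures; the supremum itself may be infinite. *)
definition A2_frac :: "real \<Rightarrow> (real ^ 'n) measure \<Rightarrow> (real ^ 'n) measure \<Rightarrow> ennreal" where
  "A2_frac \<alpha> \<omega> \<sigma> =
    (SUP I\<in>cubes. ennreal
      (sqrt (measure \<omega> I / measure lborel I powr (1 - \<alpha> / real CARD('n))) *
       sqrt (measure \<sigma> I / measure lborel I powr (1 - \<alpha> / real CARD('n)))))"

definition grad1 :: "(real ^ 'n \<Rightarrow> real ^ 'n \<Rightarrow> complex) \<Rightarrow> real ^ 'n \<Rightarrow> real ^ 'n \<Rightarrow> complex ^ 'n" where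
  "grad1 K x y = (\<chi> i. frechet_derivative (\<lambda>u. K u y) (at x) (axis i 1))"

definition adjoint_kernel :: "('a \<Rightarrow> 'a \<Rightarrow> complex) \<Rightarrow> 'a \<Rightarrow> 'a \<Rightarrow> complex" where
  "adjoint_kernel K x y = K y x"

definition kernel_estimates ::
    "real \<Rightarrow> real \<Rightarrow> real \<Rightarrow> (real ^ 'n \<Rightarrow> real ^ 'n \<Rightarrow> complex) \<Rightarrow> bool" where
  "kernel_estimates \<alpha> C \<delta> K \<longleftrightarrow>
    (\<forall>x y. x \<noteq> y \<longrightarrow>
      norm (K x y) \<le> C * norm (x - y) powr (\<alpha> - real CARD('n)) \<and>
      (\<lambda>u. K u y) differentiable (at x) \<and>
      norm (grad1 K x y) \<le> C * norm (x - y) powr (\<alpha> - real CARD('n) - 1) \<and>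
      (\<forall>x'. norm (x - x') \<le> norm (x - y) / 2 \<longrightarrow>
        norm (grad1 K x y - grad1 K x' y)
          \<le> C * (norm (x - x') / norm (x - y)) powr \<delta>
              * norm (x - y) powr (\<alpha> - real CARD('n) - 1)))"

(* Values of K on the diagonal are unconstrained. *)
definition fractional_kernel :: "real \<Rightarrow> (real ^ 'n \<Rightarrow> real ^ 'n \<Rightarrow> complex) \<Rightarrow> bool" where
  "fractional_kernel \<alpha> K \<longleftrightarrow>
    (\<exists>C \<delta>. 0 < C \<and> 0 < \<delta> \<and> \<delta> \<le> 1 \<and>
      kernel_estimates \<alpha> C \<delta> K \<and> kernel_estimates \<alpha> C \<delta> (adjoint_kernel K))"

definition smooth :: "(real \<Rightarrow> real) \<Rightarrow> bool" where
  "smooth \<phi> \<longleftrightarrow> (\<forall>k t. (deriv ^^ k) \<phi> field_differentiable (at t))"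

definition cutoff_profile :: "(real \<Rightarrow> real) \<Rightarrow> bool" where
  "cutoff_profile \<phi> \<longleftrightarrow>
    smooth \<phi> \<and> (\<forall>t. 0 \<le> \<phi> t \<and> \<phi> t \<le> 1) \<and>
    (\<exists>a b. 0 < a \<and> a < b \<and> (\<forall>t\<le>a. \<phi> t = 0) \<and> (\<forall>t\<ge>b. \<phi> t = 1))"

(* Smooth truncation of the kernel to the region where |x - y| lies, up to constants
   depending on the profile, between r and R. *)
definition truncated_kernel ::
    "(real \<Rightarrow> real) \<Rightarrow> real \<Rightarrow> real \<Rightarrow> (real ^ 'n \<Rightarrow> real ^ 'n \<Rightarrow> complex)
      \<Rightarrow> real ^ 'n \<Rightarrow> real ^ 'n \<Rightarrow> complex" where
  "truncated_kernel \<phi> r R K x y =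
    of_real (\<phi> (norm (x - y) / r) * (1 - \<phi> (norm (x - y) / R))) * K x y"

definition trunc_op ::
    "(real \<Rightarrow> real) \<Rightarrow> real \<Rightarrow> real \<Rightarrow> (real ^ 'n \<Rightarrow> real ^ 'n \<Rightarrow> complex)
      \<Rightarrow> (real ^ 'n) measure \<Rightarrow> (real ^ 'n \<Rightarrow> complex) \<Rightarrow> real ^ 'n \<Rightarrow> complex" where
  "trunc_op \<phi> r R K \<mu> f x = (LINT y|\<mu>. truncated_kernel \<phi> r R K x y * f y)"

definition L2_space :: "'a measure \<Rightarrow> ('a \<Rightarrow> complex) set" where
  "L2_space \<mu> = {f \<in> borel_measurable \<mu>. integrable \<mu> (\<lambda>x. (norm (f x))\<^sup>2)}"

definition L2_norm :: "'a measure \<Rightarrow> ('a \<Rightarrow> complex) \<Rightarrow> real" where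
  "L2_norm \<mu> f = sqrt (LINT x|\<mu>. (norm (f x))\<^sup>2)"

definition testing_condition ::
    "(real \<Rightarrow> real) \<Rightarrow> (real ^ 'n \<Rightarrow> real ^ 'n \<Rightarrow> complex)
      \<Rightarrow> (real ^ 'n) measure \<Rightarrow> (real ^ 'n) measure \<Rightarrow> real \<Rightarrow> bool" where
  "testing_condition \<phi> K \<sigma> \<omega> \<TT> \<longleftrightarrow>
    (\<forall>r R. 0 < r \<and> r < R \<longrightarrow>
      (\<forall>I\<in>cubes.
        trunc_op \<phi> r R K \<sigma> (indicator I) \<in> L2_space \<omega> \<and>
        (L2_norm \<omega> (trunc_op \<phi> r R K \<sigma> (indicator I)))\<^sup>2 \<le> \<TT>\<^sup>2 * measure \<sigma> I))"

definition bounded_L2 ::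
    "(real \<Rightarrow> real) \<Rightarrow> (real ^ 'n \<Rightarrow> real ^ 'n \<Rightarrow> complex)
      \<Rightarrow> (real ^ 'n) measure \<Rightarrow> (real ^ 'n) measure \<Rightarrow> real \<Rightarrow> bool" where
  "bounded_L2 \<phi> K \<sigma> \<omega> C \<longleftrightarrow>
    (\<forall>r R. 0 < r \<and> r < R \<longrightarrow>
      (\<forall>f\<in>L2_space \<sigma>.
        trunc_op \<phi> r R K \<sigma> f \<in> L2_space \<omega> \<and>
        L2_norm \<omega> (trunc_op \<phi> r R K \<sigma> f) \<le> C * L2_norm \<sigma> f))"

end

theory Submission imports Defs begin

text \<open>Because both measures are in \<open>A\<^sub>\<infinity>\<close> the theorem has a direct proof on one fixed dyadic grid,
  with no random grids, no energy condition and no Haar decomposition into good and bad cubes.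
  Fix a cube and its dyadic subcubes of side at least \<open>2 ^ (- N)\<close> times its own, and let
  \<open>E\<^sub>k\<close>, \<open>D\<^sub>k = E\<^sub>k\<^sub>+\<^sub>1 - E\<^sub>k\<close> be the weighted averaging and difference operators of level \<open>k\<close>, with respect to
  \<open>\<sigma>\<close> on the left and \<open>\<omega>\<close> on the right of the bilinear form. Then
  \<open>B(f, g) = B(E\<^sub>0 f, E\<^sub>0 g) + (\<Sum>k. B(D\<^sub>k f, E\<^sub>k g) + B(E\<^sub>k f, D\<^sub>k g) + B(D\<^sub>k f, D\<^sub>k g))\<close>,
  and all cubes that interact have the same side.
  In \<open>B(D\<^sub>k f, E\<^sub>k g)\<close> one subtracts the paraproduct over the principal cubes of \<open>g\<close>, which is controlled by
  testing. What remains is estimated by kernel smoothness: two cubes of the same level whose ancestors first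
  become adjacent after \<open>j\<close> generations interact with a factor \<open>2 ^ (- j)\<close> times \<open>A\<^sub>2\<close>, and the differences of averages
  of \<open>g\<close> between adjacent cubes are square summable because \<open>A\<^sub>\<infinity>\<close> weights put little mass near boundaries.
  The Carleson sequences of principal cubes may be moved from one weight to the other since \<open>A\<^sub>\<infinity>\<close> weights are
  mutually comparable; this costs only a factor polynomial in \<open>j\<close>.
  The bound is independent of \<open>N\<close>, so it passes to continuous functions, and a duality argument with
  the continuous functions \<open>T f\<close> themselves extends it to \<open>L\<^sup>2\<close>.\<close>

section \<open>Finite dyadic trees\<close>

text \<open>Testing controls the operator on indicators only, while differences of one function meet
  averages of the other over cubes that may touch. Between cubes of equal side, touching pairs are
  left to testing. Any other pair has a first generation \<open>j\<close> at which the ancestors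
  touch; one generation below that they are a distance comparable to their side apart, so the mean
  zero of one difference gains \<open>2 ^ (- j)\<close>, while the kernel size at that scale is
  balanced by the fractional condition there. What remains are \<open>s\<close>-averages of
  oscillations of \<open>w\<close>-averages of \<open>g\<close>. Their Carleson property is known
  for \<open>w\<close> only, so mixing in \<open>s\<close> forces the passage between the measures,
  which goes through Lebesgue measure. Up to \<open>core_bound\<close> everything is finite
  combinatorics of a tree with an adjacency relation: no convergence question arises, and the
  constants are explicit expressions in which the depth does not occur. The kernel enters them only
  through testing and a Lipschitz bound uniform over truncations; boundedness and support of a
  single truncation are used qualitatively.\<close>

locale dyadic_tree =
  fixes D :: "'c set" and lev :: "'c \<Rightarrow> nat" and par :: "'c \<Rightarrow> 'c" and root :: 'c and N :: nat
  assumes fin_D: "finite D"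
    and root_in: "root \<in> D"
    and lev_le: "I \<in> D \<Longrightarrow> lev I \<le> N"
    and lev_root: "I \<in> D \<Longrightarrow> lev I = 0 \<longleftrightarrow> I = root"
    and par_in: "I \<in> D \<Longrightarrow> I \<noteq> root \<Longrightarrow> par I \<in> D"
    and par_lev: "I \<in> D \<Longrightarrow> I \<noteq> root \<Longrightarrow> lev I = Suc (lev (par I))"
begin

definition ch :: "'c \<Rightarrow> 'c set" where
  "ch I = {c\<in>D. c \<noteq> root \<and> par c = I}"

definition anc :: "nat \<Rightarrow> 'c \<Rightarrow> 'c" where
  "anc i I = (par ^^ i) I"

text \<open>The bound \<open>i \<le> lev L\<close> keeps the iterates of \<open>par\<close> inside
  the tree: at the root \<open>par\<close> is unconstrained.\<close>

definition desc :: "nat \<Rightarrow> 'c \<Rightarrow> 'c set" where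
  "desc i M = {L\<in>D. i \<le> lev L \<and> anc i L = M}"

definition below :: "'c \<Rightarrow> 'c set" where
  "below M = {L\<in>D. \<exists>i\<le>lev L. anc i L = M}"

definition leaves :: "'c \<Rightarrow> 'c set" where
  "leaves M = {x\<in>below M. lev x = N}"

lemma anc_0 [simp]: "anc 0 I = I"
  by (simp add: anc_def)

lemma anc_Suc: "anc (Suc i) I = anc i (par I)"
  by (simp add: anc_def funpow_swap1)

lemma anc_Suc': "anc (Suc i) I = par (anc i I)"
  by (simp add: anc_def)

lemma anc_add: "anc (i + j) I = anc i (anc j I)"
  by (simp add: anc_def funpow_add)

lemma anc_in_lev: "I \<in> D \<Longrightarrow> i \<le> lev I \<Longrightarrow> anc i I \<in> D \<and> lev (anc i I) = lev I - i"
proof (induction i)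
  case (Suc i)
  then have a: "anc i I \<in> D" "lev (anc i I) = lev I - i" by auto
  then have "anc i I \<noteq> root" using lev_root[of "anc i I"] Suc.prems by auto
  then show ?case using par_in[OF a(1)] par_lev[OF a(1)] a Suc.prems by (auto simp: anc_Suc')
qed simp

lemma anc_in: "I \<in> D \<Longrightarrow> i \<le> lev I \<Longrightarrow> anc i I \<in> D"
  and lev_anc: "I \<in> D \<Longrightarrow> i \<le> lev I \<Longrightarrow> lev (anc i I) = lev I - i"
  using anc_in_lev by auto

lemma anc_lev: "I \<in> D \<Longrightarrow> anc (lev I) I = root"
  using anc_in_lev[of I "lev I"] lev_root by auto

lemma ch_in: "c \<in> ch I \<Longrightarrow> c \<in> D" and ch_par: "c \<in> ch I \<Longrightarrow> par c = I"
  and ch_lev: "c \<in> ch I \<Longrightarrow> lev c = Suc (lev I)" and ch_par_in: "c \<in> ch I \<Longrightarrow> I \<in> D"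
  using par_lev par_in by (auto simp: ch_def)

lemma in_ch_par: "I \<in> D \<Longrightarrow> I \<noteq> root \<Longrightarrow> I \<in> ch (par I)"
  by (simp add: ch_def)

lemma fin_ch [simp]: "finite (ch I)"
  using fin_D by (simp add: ch_def)

lemma fin_below [simp]: "finite (below I)"
  using fin_D by (simp add: below_def)

lemma fin_desc [simp]: "finite (desc i I)"
  using fin_D by (simp add: desc_def)

lemma fin_leaves [simp]: "finite (leaves I)"
  by (simp add: leaves_def)

lemma ch_leaf: "I \<in> D \<Longrightarrow> lev I = N \<Longrightarrow> ch I = {}"
  using ch_lev lev_le ch_in by fastforce

lemma below_in: "L \<in> below I \<Longrightarrow> L \<in> D"
  by (simp add: below_def)

lemma below_self [simp]: "I \<in> D \<Longrightarrow> I \<in> below I"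
  by (auto simp: below_def intro!: exI[of _ 0])

lemma below_lev: "L \<in> below I \<Longrightarrow> lev I \<le> lev L"
  using lev_anc by (force simp: below_def)

lemma below_in': "L \<in> below I \<Longrightarrow> I \<in> D"
  using anc_in by (force simp: below_def)

lemma below_iff: "L \<in> below I \<longleftrightarrow> L \<in> D \<and> lev I \<le> lev L \<and> anc (lev L - lev I) L = I"
proof
  assume "L \<in> below I"
  then obtain i where i: "L \<in> D" "i \<le> lev L" "anc i L = I" by (auto simp: below_def)
  with lev_anc[of L i] have "lev L - lev I = i" by auto
  with i below_lev[OF \<open>L \<in> below I\<close>] show "L \<in> D \<and> lev I \<le> lev L \<and> anc (lev L - lev I) L = I" by auto
qed (auto simp: below_def intro!: exI[of _ "lev L - lev I"])

lemma below_trans: "K \<in> below L \<Longrightarrow> L \<in> below I \<Longrightarrow> K \<in> below I"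
proof -
  assume a: "K \<in> below L" "L \<in> below I"
  then obtain i j where "K \<in> D" "i \<le> lev K" "anc i K = L" "j \<le> lev L" "anc j L = I"
    by (auto simp: below_def)
  with lev_anc[of K i] show ?thesis
    by (auto simp: below_def anc_add intro!: exI[of _ "j + i"])
qed

lemma below_anc: "I \<in> D \<Longrightarrow> i \<le> lev I \<Longrightarrow> I \<in> below (anc i I)"
  by (auto simp: below_def)

lemma below_root: "below root = D"
  using anc_lev by (auto simp: below_def)

lemma below_comparable:
  assumes "L \<in> below I" "L \<in> below J" "lev I \<le> lev J" shows "J \<in> below I"
proof -
  from assms have a: "L \<in> D" "anc (lev L - lev I) L = I" "anc (lev L - lev J) L = J"
    "lev I \<le> lev L" "lev J \<le> lev L" by (auto simp: below_iff)
  have "anc (lev J - lev I) J = anc ((lev J - lev I) + (lev L - lev J)) L"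
    using a by (simp only: anc_add)
  also have "(lev J - lev I) + (lev L - lev J) = lev L - lev I" using a assms(3) by simp
  also have "anc \<dots> L = I" using a by simp
  finally show ?thesis using assms below_in'[OF assms(2)] by (simp add: below_iff)
qed

lemma below_eq_lev: "L \<in> below I \<Longrightarrow> L \<in> below J \<Longrightarrow> lev I = lev J \<Longrightarrow> I = J"
  by (metis below_iff)

lemma below_decomp:
  assumes "I \<in> D" shows "below I = insert I (\<Union>c\<in>ch I. below c)"
proof (intro set_eqI iffI)
  fix L assume L: "L \<in> below I"
  then obtain i where i: "L \<in> D" "i \<le> lev L" "anc i L = I" by (auto simp: below_def)
  show "L \<in> insert I (\<Union>c\<in>ch I. below c)"
  proof (cases i)
    case (Suc k)
    let ?c = "anc k L"
    have c: "?c \<in> D" "lev ?c = lev L - k" using anc_in_lev i Suc by auto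
    then have "?c \<noteq> root" using lev_root[of ?c] i Suc by auto
    with c i Suc have "?c \<in> ch I" by (auto simp: ch_def anc_Suc')
    moreover have "L \<in> below ?c" using i Suc below_anc[of L k] by simp
    ultimately show ?thesis by auto
  qed (use i in auto)
next
  fix L assume "L \<in> insert I (\<Union>c\<in>ch I. below c)"
  moreover have "L \<in> below I" if c: "c \<in> ch I" and L: "L \<in> below c" for c
  proof -
    have "c \<in> below I" using c ch_lev[OF c] by (auto simp: below_def ch_def anc_def intro!: exI[of _ 1])
    then show ?thesis using L below_trans by blast
  qed
  ultimately show "L \<in> below I" using assms by auto
qed

lemma ch_below: "c \<in> ch I \<Longrightarrow> c \<in> below I"
  using below_decomp[of I] ch_par_in[of c I] below_self[OF ch_in[of c I]] by auto

lemma below_ch_disj: "c \<in> ch I \<Longrightarrow> c' \<in> ch I \<Longrightarrow> c \<noteq> c' \<Longrightarrow> below c \<inter> below c' = {}"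
  using below_eq_lev ch_lev by fastforce

lemma below_ch_self: "c \<in> ch I \<Longrightarrow> I \<notin> below c"
  using below_lev ch_lev by fastforce

lemma sum_below:
  assumes "I \<in> D" shows "sum F (below I) = F I + (\<Sum>c\<in>ch I. sum F (below c))"
proof -
  have "sum F (below I) = F I + sum F (\<Union>c\<in>ch I. below c)"
    using below_ch_self by (subst below_decomp[OF assms], subst sum.insert) auto
  also have "sum F (\<Union>c\<in>ch I. below c) = (\<Sum>c\<in>ch I. sum F (below c))"
    by (rule sum.UNION_disjoint) (use below_ch_disj in auto)
  finally show ?thesis .
qed

lemma tree_induct [consumes 1, case_names step]:
  assumes "I \<in> D" and step: "\<And>I. I \<in> D \<Longrightarrow> (\<And>c. c \<in> ch I \<Longrightarrow> P c) \<Longrightarrow> P I"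
  shows "P I"
  using assms(1)
proof (induction "N - lev I" arbitrary: I rule: less_induct)
  case less
  show ?case
  proof (rule step[OF less.prems])
    fix c assume c: "c \<in> ch I"
    show "P c" by (rule less.hyps) (use ch_lev[OF c] ch_in[OF c] lev_le[of c] in auto)
  qed
qed

lemma leaves_leaf: "I \<in> D \<Longrightarrow> lev I = N \<Longrightarrow> leaves I = {I}"
  using below_decomp[of I] ch_leaf[of I] by (auto simp: leaves_def)

lemma leaves_decomp: "I \<in> D \<Longrightarrow> lev I < N \<Longrightarrow> leaves I = (\<Union>c\<in>ch I. leaves c)"
  using below_decomp[of I] by (auto simp: leaves_def)

lemma leaves_disj: "c \<in> ch I \<Longrightarrow> c' \<in> ch I \<Longrightarrow> c \<noteq> c' \<Longrightarrow> leaves c \<inter> leaves c' = {}"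
  using below_ch_disj by (fastforce simp: leaves_def)

lemma sum_leaves:
  assumes "I \<in> D" "lev I < N" shows "sum F (leaves I) = (\<Sum>c\<in>ch I. sum F (leaves c))"
  by (subst leaves_decomp[OF assms], rule sum.UNION_disjoint) (use leaves_disj in auto)

lemma leaves_below: "x \<in> leaves I \<Longrightarrow> x \<in> below I" and leaves_lev: "x \<in> leaves I \<Longrightarrow> lev x = N"
  and leaves_in: "x \<in> leaves I \<Longrightarrow> x \<in> D" and leaves_in': "x \<in> leaves I \<Longrightarrow> I \<in> D"
  using below_in below_in' by (auto simp: leaves_def)

lemma leaves_mono: "J \<in> below I \<Longrightarrow> leaves J \<subseteq> leaves I"
  using below_trans by (auto simp: leaves_def)

lemma leaves_iff: "x \<in> leaves I \<longleftrightarrow> x \<in> D \<and> lev x = N \<and> lev I \<le> N \<and> anc (N - lev I) x = I"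
  by (auto simp: leaves_def below_iff)

lemma desc_0 [simp]: "I \<in> D \<Longrightarrow> desc 0 I = {I}"
  by (auto simp: desc_def)

lemma desc_in: "L \<in> desc i M \<Longrightarrow> L \<in> D" and desc_lev: "L \<in> desc i M \<Longrightarrow> lev L = lev M + i"
  and desc_anc: "L \<in> desc i M \<Longrightarrow> anc i L = M" and desc_in': "L \<in> desc i M \<Longrightarrow> M \<in> D"
  using anc_in_lev by (auto simp: desc_def)

lemma desc_below: "L \<in> desc i M \<Longrightarrow> L \<in> below M"
  by (auto simp: desc_def below_def)

lemma below_desc: "L \<in> below M \<Longrightarrow> L \<in> desc (lev L - lev M) M"
  by (simp add: below_iff desc_def)

lemma in_desc_anc: "I \<in> D \<Longrightarrow> i \<le> lev I \<Longrightarrow> I \<in> desc i (anc i I)"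
  by (simp add: desc_def)

lemma desc_Suc: assumes "M \<in> D" shows "desc (Suc i) M = (\<Union>c\<in>ch M. desc i c)"
proof (intro set_eqI iffI)
  fix L assume L: "L \<in> desc (Suc i) M"
  then have a: "L \<in> D" "Suc i \<le> lev L" "anc (Suc i) L = M" by (auto simp: desc_def)
  have c: "anc i L \<in> D" "lev (anc i L) = lev L - i" using anc_in_lev a by auto
  then have "anc i L \<noteq> root" using lev_root[of "anc i L"] a by auto
  then have "anc i L \<in> ch M" using c a by (auto simp: ch_def anc_Suc')
  moreover have "L \<in> desc i (anc i L)" using a by (simp add: desc_def)
  ultimately show "L \<in> (\<Union>c\<in>ch M. desc i c)" by auto
next
  fix L assume "L \<in> (\<Union>c\<in>ch M. desc i c)"
  then obtain c where c: "c \<in> ch M" "L \<in> desc i c" by auto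
  then show "L \<in> desc (Suc i) M"
    using desc_lev[OF c(2)] ch_lev[OF c(1)] ch_par[OF c(1)] by (auto simp: desc_def anc_Suc')
qed

lemma sum_desc_Suc: assumes "M \<in> D"
  shows "sum F (desc (Suc i) M) = (\<Sum>c\<in>ch M. sum F (desc i c))"
proof -
  have "desc i c \<inter> desc i c' = {}" if "c \<noteq> c'" for c c' using that by (auto simp: desc_def)
  then show ?thesis by (subst desc_Suc[OF assms], intro sum.UNION_disjoint) auto
qed

lemma sum_group_desc:
  assumes "P \<subseteq> {L\<in>D. i \<le> lev L}"
  shows "sum F P = (\<Sum>Q\<in>D. sum F (desc i Q \<inter> P))"
proof -
  have f: "finite P" using assms fin_D finite_subset[of P D] by auto
  have "sum F P = (\<Sum>Q\<in>D. sum F {L\<in>P. anc i L = Q})"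
    by (rule sum.group[symmetric]) (use assms f fin_D anc_in in auto)
  also have "\<dots> = (\<Sum>Q\<in>D. sum F (desc i Q \<inter> P))"
    by (intro sum.cong refl) (use assms in \<open>auto simp: desc_def\<close>)
  finally show ?thesis .
qed

lemma sum_desc_all: "sum F {L\<in>D. i \<le> lev L} = (\<Sum>Q\<in>D. sum F (desc i Q))"
proof -
  have "desc i Q \<inter> {L\<in>D. i \<le> lev L} = desc i Q" for Q by (auto simp: desc_def)
  then show ?thesis using sum_group_desc[OF order_refl, of F i] by simp
qed

text \<open>Positivity and additivity together force every cube of level below \<open>N\<close> to
  have children, which the tree axioms alone do not provide.\<close>

definition weight :: "('c \<Rightarrow> real) \<Rightarrow> bool" where
  "weight \<mu> \<longleftrightarrow> (\<forall>I\<in>D. 0 < \<mu> I) \<and> (\<forall>I\<in>D. lev I < N \<longrightarrow> \<mu> I = (\<Sum>c\<in>ch I. \<mu> c))"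

lemma weight_pos: "weight \<mu> \<Longrightarrow> I \<in> D \<Longrightarrow> 0 < \<mu> I"
  and weight_ch: "weight \<mu> \<Longrightarrow> I \<in> D \<Longrightarrow> lev I < N \<Longrightarrow> (\<Sum>c\<in>ch I. \<mu> c) = \<mu> I"
  by (auto simp: weight_def)

lemma weight_leaves: "weight \<mu> \<Longrightarrow> I \<in> D \<Longrightarrow> sum \<mu> (leaves I) = \<mu> I"
proof (rotate_tac, induction I rule: tree_induct)
  case (step I)
  show ?case
  proof (cases "lev I = N")
    case False
    then have "lev I < N" using lev_le step by fastforce
    then show ?thesis using step by (simp add: sum_leaves weight_ch)
  qed (use step leaves_leaf in auto)
qed

lemma weight_desc: "weight \<mu> \<Longrightarrow> I \<in> D \<Longrightarrow> lev I + i \<le> N \<Longrightarrow> sum \<mu> (desc i I) = \<mu> I"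
proof (induction i arbitrary: I)
  case (Suc i)
  have "sum \<mu> (desc (Suc i) I) = (\<Sum>c\<in>ch I. sum \<mu> (desc i c))" using Suc sum_desc_Suc by blast
  also have "\<dots> = (\<Sum>c\<in>ch I. \<mu> c)"
    by (intro sum.cong refl Suc.IH) (use Suc.prems ch_in ch_lev in auto)
  also have "\<dots> = \<mu> I" using Suc.prems by (intro weight_ch) auto
  finally show ?case .
qed simp

text \<open>Past the depth of the tree the left side is an empty sum. The inequality therefore holds
  for all \<open>i\<close>, and later sums over generations need no case distinction on
  levels.\<close>

lemma weight_desc_le: assumes "weight \<mu>" "I \<in> D" shows "sum \<mu> (desc i I) \<le> \<mu> I"
proof (cases "lev I + i \<le> N")
  case False
  then have "desc i I = {}" using desc_lev desc_in lev_le by fastforce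
  then show ?thesis using weight_pos[OF assms] by simp
qed (use weight_desc assms in auto)

lemma weight_mono: assumes "weight \<mu>" "L \<in> below I" shows "\<mu> L \<le> \<mu> I"
proof -
  have "\<mu> L = sum \<mu> (leaves L)" using weight_leaves assms below_in by metis
  also have "\<dots> \<le> sum \<mu> (leaves I)"
    by (rule sum_mono2) (use leaves_mono assms weight_pos leaves_in in \<open>auto intro: less_imp_le\<close>)
  also have "\<dots> = \<mu> I" using weight_leaves assms below_in' by metis
  finally show ?thesis .
qed

text \<open>Discrete substitute for the \<open>A\<^sub>\<infinity>\<close> comparison of two measures on subsets of a cube.\<close>

definition comparable :: "('c \<Rightarrow> real) \<Rightarrow> ('c \<Rightarrow> real) \<Rightarrow> real \<Rightarrow> real \<Rightarrow> bool" where
  "comparable \<mu> \<nu> \<kappa> \<theta> \<longleftrightarrow>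
    (\<forall>L\<in>D. \<forall>E\<subseteq>leaves L. sum \<mu> E \<le> \<kappa> * \<mu> L \<longrightarrow> sum \<nu> E \<le> \<theta> * \<nu> L)"

text \<open>The mass is kept outside the coefficients, so that one and the same sequence can be
  tested against two weights.\<close>

definition carleson :: "('c \<Rightarrow> real) \<Rightarrow> ('c \<Rightarrow> real) \<Rightarrow> real \<Rightarrow> bool" where
  "carleson \<mu> a M \<longleftrightarrow> (\<forall>L\<in>D. (\<Sum>I\<in>below L. a I * \<mu> I) \<le> M * \<mu> L)"

text \<open>On leaves \<open>x\<close> of \<open>I\<close> this is the function obtained by summing
  \<open>a J\<close> times the indicator of \<open>J\<close> over all \<open>J\<close> below
  \<open>I\<close>, evaluated at \<open>x\<close>.\<close>

definition acc :: "('c \<Rightarrow> real) \<Rightarrow> 'c \<Rightarrow> 'c \<Rightarrow> real" where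
  "acc a I x = (\<Sum>i\<le>N - lev I. a (anc i x))"

lemma acc_ch: assumes "c \<in> ch I" "x \<in> leaves c" shows "acc a I x = a I + acc a c x"
proof -
  have l: "N - lev I = Suc (N - lev c)" using ch_lev[OF assms(1)] leaves_in'[OF assms(2)] lev_le by force
  have "anc (Suc (N - lev c)) x = I"
    using assms ch_par[OF assms(1)] by (simp add: anc_Suc' leaves_iff)
  then show ?thesis unfolding acc_def l by simp
qed

lemma acc_leaf: "I \<in> D \<Longrightarrow> lev I = N \<Longrightarrow> acc a I I = a I"
  by (simp add: acc_def)

text \<open>Fubini between cubes and leaves. Only additivity over leaves is assumed of
  \<open>\<mu>\<close>, so that the lemma also applies to the mass \<open>w * avn w g\<close> of a
  function in \<open>stop_norm\<close>.\<close>

lemma acc_sum: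
  assumes \<mu>: "\<And>J. J \<in> D \<Longrightarrow> sum \<mu> (leaves J) = \<mu> J" and I: "I \<in> D" shows "(\<Sum>J\<in>below I. a J * \<mu> J) = (\<Sum>x\<in>leaves I. \<mu> x * acc a I x)"
  using I
proof (induction I rule: tree_induct)
  case (step I)
  show ?case
  proof (cases "lev I = N")
    case True
    then show ?thesis using step by (simp add: sum_below ch_leaf leaves_leaf acc_leaf)
  next
    case False
    then have l: "lev I < N" using lev_le step by fastforce
    have "(\<Sum>J\<in>below I. a J * \<mu> J) = a I * \<mu> I + (\<Sum>c\<in>ch I. \<Sum>x\<in>leaves c. \<mu> x * acc a c x)"
      using step by (simp add: sum_below)
    also have "a I * \<mu> I = (\<Sum>c\<in>ch I. \<Sum>x\<in>leaves c. \<mu> x * a I)"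
      using l step(1) \<mu> by (simp flip: sum_distrib_right sum_leaves)
    also have "\<dots> + (\<Sum>c\<in>ch I. \<Sum>x\<in>leaves c. \<mu> x * acc a c x)
        = (\<Sum>c\<in>ch I. \<Sum>x\<in>leaves c. \<mu> x * acc a I x)"
      by (simp flip: sum.distrib add: acc_ch algebra_simps)
    also have "\<dots> = (\<Sum>x\<in>leaves I. \<mu> x * acc a I x)" using l step by (simp add: sum_leaves)
    finally show ?thesis .
  qed
qed

text \<open>John--Nirenberg: off a set of small \<open>\<mu>\<close>-measure \<open>acc a L\<close> is bounded, and comparability makes the
  exceptional set small for \<open>\<nu>\<close> as well, so the extremal Carleson ratio for \<open>\<nu>\<close> can be absorbed.\<close>

lemma carleson_transfer:
  assumes \<mu>: "weight \<mu>" and \<nu>: "weight \<nu>" and cmp: "comparable \<mu> \<nu> \<kappa> \<theta>"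
    and \<kappa>: "0 < \<kappa>" and \<theta>: "0 \<le> \<theta>" "\<theta> < 1" and M: "0 < M"
    and a: "\<And>I. I \<in> D \<Longrightarrow> 0 \<le> a I" and car: "carleson \<mu> a M"
  shows "carleson \<nu> a (M / (\<kappa> * (1 - \<theta>)))"
proof -
  define T where "T I = (\<Sum>J\<in>below I. a J * \<nu> J)" for I
  define \<Lambda> where "\<Lambda> = M / \<kappa>"
  \<comment> \<open>The best constant is finite because the tree is; this is what makes it
    legitimate to absorb \<open>B * \<theta>\<close> at the end.\<close>
  define B where "B = Max ((\<lambda>I. T I / \<nu> I) ` D)"
  have \<Lambda>: "0 < \<Lambda>" using M \<kappa> by (simp add: \<Lambda>_def)
  have TB: "T I \<le> B * \<nu> I" if "I \<in> D" for I
  proof -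
    have "T I / \<nu> I \<le> B" unfolding B_def using that fin_D by (intro Max_ge) auto
    then show ?thesis using weight_pos[OF \<nu> that] by (simp add: field_simps)
  qed
  have T0: "0 \<le> T I" for I unfolding T_def
    using a weight_pos[OF \<nu>] below_in by (intro sum_nonneg mult_nonneg_nonneg) (auto intro: less_imp_le)
  \<comment> \<open>Here \<open>s\<close> stands for the coefficients already collected on the
    ancestors of \<open>I\<close>. While the total stays below \<open>\<Lambda>\<close>, a cube is
    paid for out of the remaining budget \<open>\<Lambda> - s\<close>; once it exceeds
    \<open>\<Lambda>\<close>, all leaves of the cube are exceptional and the crude bound by
    \<open>B\<close> suffices.\<close>
  have budget: "\<forall>s\<le>\<Lambda>. T I \<le> (\<Lambda> - s) * \<nu> I + B * sum \<nu> {x\<in>leaves I. s + acc a I x > \<Lambda>}"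
    if "I \<in> D" for I
    using that
  proof (induction I rule: tree_induct)
    case (step I)
    show ?case
    proof (intro allI impI)
      fix s assume s: "s \<le> \<Lambda>"
      have accge: "a I \<le> acc a I x" if "x \<in> leaves I" for x
      proof -
        have "anc (N - lev I) x = I" "N - lev I \<le> lev x" "x \<in> D" using that by (auto simp: leaves_iff)
        then show ?thesis unfolding acc_def
          by (metis (mono_tags, lifting) member_le_sum[of "N - lev I" "{..N - lev I}" "\<lambda>i. a (anc i x)"]
              Diff_iff a anc_in atMost_iff finite_atMost order_refl order_trans)
      qed
      show "T I \<le> (\<Lambda> - s) * \<nu> I + B * sum \<nu> {x\<in>leaves I. s + acc a I x > \<Lambda>}"
      proof (cases "s + a I > \<Lambda>")
        case True
        then have "{x\<in>leaves I. s + acc a I x > \<Lambda>} = leaves I" using accge by force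
        then show ?thesis using TB[OF step(1)] weight_leaves[OF \<nu> step(1)] s weight_pos[OF \<nu> step(1)]
          by (simp add: add_increasing)
      next
        case False
        show ?thesis
        proof (cases "lev I = N")
          case True
          have "{x\<in>leaves I. s + acc a I x > \<Lambda>} = {}"
            using False True step(1) by (auto simp: leaves_leaf acc_leaf)
          moreover have "T I \<le> (\<Lambda> - s) * \<nu> I"
            using False True step(1) weight_pos[OF \<nu> step(1)] by (simp add: T_def sum_below ch_leaf)
          ultimately show ?thesis by (simp only: sum.empty)
        next
          case F: False
          then have l: "lev I < N" using lev_le step by fastforce
          let ?E = "\<lambda>c. {x\<in>leaves c. s + a I + acc a c x > \<Lambda>}"
          have E: "{x\<in>leaves I. s + acc a I x > \<Lambda>} = (\<Union>c\<in>ch I. ?E c)"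
            using leaves_decomp[OF step(1) l] by (auto simp: acc_ch)
          have Es: "sum \<nu> (\<Union>c\<in>ch I. ?E c) = (\<Sum>c\<in>ch I. sum \<nu> (?E c))"
            by (rule sum.UNION_disjoint) (use leaves_disj in auto)
          have "T I = a I * \<nu> I + (\<Sum>c\<in>ch I. T c)"
            using step(1) by (simp add: T_def sum_below)
          also have "(\<Sum>c\<in>ch I. T c) \<le> (\<Sum>c\<in>ch I. (\<Lambda> - (s + a I)) * \<nu> c + B * sum \<nu> (?E c))"
            by (intro sum_mono) (use step(2) False in auto)
          also have "\<dots> = (\<Lambda> - (s + a I)) * \<nu> I + B * sum \<nu> {x\<in>leaves I. s + acc a I x > \<Lambda>}"
            unfolding E Es using weight_ch[OF \<nu> step(1) l]
            by (simp add: sum.distrib flip: sum_distrib_left)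
          finally show ?thesis by (simp add: algebra_simps)
        qed
      qed
    qed
  qed
  have B0: "0 \<le> B" using TB[OF root_in] T0[of root] weight_pos[OF \<nu> root_in]
    by (metis dual_order.trans zero_le_mult_iff not_less)
  have key: "T L \<le> (\<Lambda> + B * \<theta>) * \<nu> L" if L: "L \<in> D" for L
  proof -
    let ?E = "{x\<in>leaves L. 0 + acc a L x > \<Lambda>}"
    \<comment> \<open>Chebyshev's inequality for \<open>acc a L\<close>; the choice
      \<open>\<Lambda> = M / \<kappa>\<close> makes the exceptional set just small enough for
      \<open>comparable\<close>.\<close>
    have "sum \<mu> ?E * \<Lambda> \<le> (\<Sum>x\<in>?E. \<mu> x * acc a L x)"
      unfolding sum_distrib_right by (intro sum_mono mult_left_mono)
        (auto intro!: less_imp_le[OF weight_pos[OF \<mu>]] leaves_in)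
    also have "\<dots> \<le> (\<Sum>x\<in>leaves L. \<mu> x * acc a L x)"
    proof (rule sum_mono2)
      fix x assume "x \<in> leaves L - ?E"
      then have x: "x \<in> D" "lev x = N" by (auto simp: leaves_iff)
      then have "0 \<le> acc a L x" unfolding acc_def using x by (auto intro!: sum_nonneg a anc_in)
      then show "0 \<le> \<mu> x * acc a L x" using weight_pos[OF \<mu> x(1)] by simp
    qed auto
    also have "\<dots> = (\<Sum>J\<in>below L. a J * \<mu> J)" by (rule acc_sum[OF weight_leaves[OF \<mu>] L, symmetric])
    also have "\<dots> \<le> M * \<mu> L" using car L by (simp add: carleson_def)
    finally have "sum \<mu> ?E * \<Lambda> \<le> M * \<mu> L" .
    moreover have "s \<le> \<kappa> * m" if "s * \<Lambda> \<le> M * m" for s m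
    proof -
      have "M * s \<le> M * (\<kappa> * m)" using that \<kappa> by (simp add: \<Lambda>_def pos_divide_le_eq mult.commute mult.left_commute)
      then show ?thesis using M by simp
    qed
    ultimately have "sum \<mu> ?E \<le> \<kappa> * \<mu> L" by simp
    moreover have "?E \<subseteq> leaves L" by simp
    ultimately have E: "sum \<nu> ?E \<le> \<theta> * \<nu> L" using cmp L unfolding comparable_def by metis
    have "T L \<le> (\<Lambda> - 0) * \<nu> L + B * sum \<nu> ?E" using budget[OF L] \<Lambda> by (meson less_imp_le)
    also have "\<dots> \<le> (\<Lambda> - 0) * \<nu> L + B * (\<theta> * \<nu> L)" using E B0 mult_left_mono by (intro add_left_mono) blast
    finally show ?thesis by (simp add: algebra_simps)
  qed
  have "B \<le> \<Lambda> + B * \<theta>"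
  proof -
    have "T I / \<nu> I \<le> \<Lambda> + B * \<theta>" if "I \<in> D" for I
      using key[OF that] weight_pos[OF \<nu> that] by (simp add: field_simps)
    then show ?thesis unfolding B_def using fin_D root_in by (subst Max_le_iff) (auto simp: B_def[symmetric])
  qed
  then have "B \<le> M / (\<kappa> * (1 - \<theta>))" using \<theta> \<kappa> by (simp add: \<Lambda>_def field_simps)
  then show ?thesis unfolding carleson_def
    using TB weight_pos[OF \<nu>] unfolding T_def by (meson mult_right_mono order_trans less_imp_le)
qed

end

section \<open>Weighted averages and martingale differences\<close>

lemma cs_sum:
  fixes a b :: "'i \<Rightarrow> real"
  assumes "\<And>i. i \<in> A \<Longrightarrow> 0 \<le> a i" "\<And>i. i \<in> A \<Longrightarrow> 0 \<le> b i"
  shows "(\<Sum>i\<in>A. sqrt (a i) * sqrt (b i)) \<le> sqrt (\<Sum>i\<in>A. a i) * sqrt (\<Sum>i\<in>A. b i)"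
proof -
  have "(\<Sum>i\<in>A. sqrt (a i) * sqrt (b i))\<^sup>2 \<le> (\<Sum>i\<in>A. (sqrt (a i))\<^sup>2) * (\<Sum>i\<in>A. (sqrt (b i))\<^sup>2)"
    by (rule Cauchy_Schwarz_ineq_sum)
  also have "\<dots> = (\<Sum>i\<in>A. a i) * (\<Sum>i\<in>A. b i)" using assms by (simp cong: sum.cong)
  finally show ?thesis by (simp flip: real_sqrt_mult add: real_le_rsqrt)
qed

lemma sum_sq_le_card:
  fixes t :: "'i \<Rightarrow> real"
  shows "(\<Sum>i\<in>A. t i)\<^sup>2 \<le> real (card A) * (\<Sum>i\<in>A. (t i)\<^sup>2)"
  using Cauchy_Schwarz_ineq_sum[of "\<lambda>_. 1" t A] by simp

lemma sum_geometric_le: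
  fixes r :: real
  assumes "0 \<le> r" "r < 1" shows "(\<Sum>i<n. r ^ i) \<le> 1 / (1 - r)"
  using sum_le_suminf[of "\<lambda>i. r ^ i" "{..<n}"] assms by (simp add: suminf_geometric summable_geometric)

text \<open>Cauchy-Schwarz with weights \<open>r ^ i\<close>: terms whose squares decay faster than
  \<open>r ^ i\<close> can be summed at a cost independent of their number.\<close>

lemma sum_sq_geometric_le:
  fixes t :: "nat \<Rightarrow> real"
  assumes "0 < r" "r < 1"
  shows "(\<Sum>i<n. t i)\<^sup>2 \<le> 1 / (1 - r) * (\<Sum>i<n. (t i)\<^sup>2 / r ^ i)"
proof -
  have "(\<Sum>i<n. t i)\<^sup>2 = (\<Sum>i<n. sqrt (r ^ i) * (t i / sqrt (r ^ i)))\<^sup>2" using assms by simp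
  also have "\<dots> \<le> (\<Sum>i<n. (sqrt (r ^ i))\<^sup>2) * (\<Sum>i<n. (t i / sqrt (r ^ i))\<^sup>2)"
    by (rule Cauchy_Schwarz_ineq_sum)
  also have "\<dots> = (\<Sum>i<n. r ^ i) * (\<Sum>i<n. (t i)\<^sup>2 / r ^ i)"
    using assms by (simp add: power_divide)
  also have "\<dots> \<le> 1 / (1 - r) * (\<Sum>i<n. (t i)\<^sup>2 / r ^ i)"
    using assms by (intro mult_right_mono sum_geometric_le sum_nonneg) auto
  finally show ?thesis .
qed

lemma sq_add_le: "(x + y)\<^sup>2 \<le> 2 * x\<^sup>2 + 2 * (y::real)\<^sup>2"
  using sum_squares_bound[of x y] by (simp add: power2_sum)

lemma norm_diff_sq_le: "(norm (x - z))\<^sup>2 \<le> 2 * (norm (x - y))\<^sup>2 + 2 * (norm (y - z :: complex))\<^sup>2"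
proof -
  have "norm (x - z) \<le> norm (x - y) + norm (y - z)"
    using norm_triangle_ineq[of "x - y" "y - z"] by simp
  then have "(norm (x - z))\<^sup>2 \<le> (norm (x - y) + norm (y - z))\<^sup>2" by (intro power_mono) auto
  also have "\<dots> \<le> 2 * (norm (x - y))\<^sup>2 + 2 * (norm (y - z))\<^sup>2" by (rule sq_add_le)
  finally show ?thesis .
qed

lemma Re_of_real_mult_left: "Re (of_real a * z) = a * Re z"
  by simp

lemma norm_diff_expand:
  "(norm (a - z))\<^sup>2 = (norm (a - b))\<^sup>2 + (norm (b - z))\<^sup>2 + 2 * Re ((a - b) * cnj (b - z))"
  unfolding cmod_power2 by (simp add: power2_eq_square algebra_simps)

context dyadic_tree begin

lemma sum_ch_all: "sum F (D - {root}) = (\<Sum>I\<in>D. sum F (ch I))"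
proof -
  have "sum F (D - {root}) = (\<Sum>I\<in>D. sum F {c\<in>D - {root}. par c = I})"
    by (rule sum.group[symmetric]) (use fin_D par_in in auto)
  also have "\<dots> = (\<Sum>I\<in>D. sum F (ch I))" by (intro sum.cong refl) (auto simp: ch_def)
  finally show ?thesis .
qed

text \<open>Functions constant on the cells of level \<open>N\<close> are represented by their values on leaves.\<close>

definition av :: "('c \<Rightarrow> real) \<Rightarrow> ('c \<Rightarrow> complex) \<Rightarrow> 'c \<Rightarrow> complex" where
  "av \<mu> f I = (\<Sum>x\<in>leaves I. of_real (\<mu> x) * f x) / of_real (\<mu> I)"

definition avn :: "('c \<Rightarrow> real) \<Rightarrow> ('c \<Rightarrow> complex) \<Rightarrow> 'c \<Rightarrow> real" where
  "avn \<mu> f I = (\<Sum>x\<in>leaves I. \<mu> x * norm (f x)) / \<mu> I"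

text \<open>The squared norm of the martingale difference \<open>Df \<mu> f I\<close>, see
  \<open>nrm_Df\<close>.\<close>

definition dl :: "('c \<Rightarrow> real) \<Rightarrow> ('c \<Rightarrow> complex) \<Rightarrow> 'c \<Rightarrow> real" where
  "dl \<mu> f I = (\<Sum>c\<in>ch I. \<mu> c * (norm (av \<mu> f c - av \<mu> f I))\<^sup>2)"

text \<open>This is the squared norm; square roots are written out where they are needed.\<close>

definition nrm :: "('c \<Rightarrow> real) \<Rightarrow> ('c \<Rightarrow> complex) \<Rightarrow> 'c \<Rightarrow> real" where
  "nrm \<mu> f I = (\<Sum>x\<in>leaves I. \<mu> x * (norm (f x))\<^sup>2)"

definition indic :: "'c \<Rightarrow> 'c \<Rightarrow> complex" where
  "indic I x = (if x \<in> leaves I then 1 else 0)"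

definition Df :: "('c \<Rightarrow> real) \<Rightarrow> ('c \<Rightarrow> complex) \<Rightarrow> 'c \<Rightarrow> 'c \<Rightarrow> complex" where
  "Df \<mu> f I x = (\<Sum>c\<in>ch I. (av \<mu> f c - av \<mu> f I) * indic c x)"

lemma weight_nonneg: assumes "weight \<mu>" "I \<in> D" shows "0 \<le> \<mu> I"
  using weight_pos[OF assms] by simp

lemma dl_nonneg: assumes "weight \<mu>" shows "0 \<le> dl \<mu> f I"
  unfolding dl_def by (intro sum_nonneg mult_nonneg_nonneg weight_nonneg[OF assms] ch_in) auto

lemma nrm_nonneg: assumes "weight \<mu>" shows "0 \<le> nrm \<mu> f I"
  unfolding nrm_def by (intro sum_nonneg mult_nonneg_nonneg weight_nonneg[OF assms]) (auto intro: leaves_in)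

lemma avn_nonneg: assumes "weight \<mu>" "I \<in> D" shows "0 \<le> avn \<mu> f I"
  unfolding avn_def using weight_nonneg[OF assms(1)] assms(2)
  by (intro divide_nonneg_nonneg sum_nonneg mult_nonneg_nonneg) (auto intro: leaves_in)

lemma norm_av_le: assumes "weight \<mu>" "I \<in> D" shows "norm (av \<mu> f I) \<le> avn \<mu> f I"
proof -
  have "norm (\<Sum>x\<in>leaves I. of_real (\<mu> x) * f x) \<le> (\<Sum>x\<in>leaves I. \<mu> x * norm (f x))"
    by (rule sum_norm_le) (use weight_nonneg[OF assms(1) leaves_in] in \<open>auto simp: norm_mult\<close>)
  then show ?thesis using weight_pos[OF assms]
    by (simp add: av_def avn_def norm_divide divide_right_mono)
qed

lemma av_leaf: "weight \<mu> \<Longrightarrow> I \<in> D \<Longrightarrow> lev I = N \<Longrightarrow> av \<mu> f I = f I"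
  using weight_pos[of \<mu> I] by (simp add: av_def leaves_leaf)

lemma avn_leaf: "weight \<mu> \<Longrightarrow> I \<in> D \<Longrightarrow> lev I = N \<Longrightarrow> avn \<mu> f I = norm (f I)"
  using weight_pos[of \<mu> I] by (simp add: avn_def leaves_leaf)

lemma av_sum: "weight \<mu> \<Longrightarrow> I \<in> D \<Longrightarrow> of_real (\<mu> I) * av \<mu> f I = (\<Sum>x\<in>leaves I. of_real (\<mu> x) * f x)"
  using weight_pos[of \<mu> I] by (simp add: av_def)

lemma avn_sum: "weight \<mu> \<Longrightarrow> I \<in> D \<Longrightarrow> \<mu> I * avn \<mu> f I = (\<Sum>x\<in>leaves I. \<mu> x * norm (f x))"
  using weight_pos[of \<mu> I] by (simp add: avn_def)

lemma av_ch: "weight \<mu> \<Longrightarrow> I \<in> D \<Longrightarrow> lev I < N \<Longrightarrow>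
    (\<Sum>c\<in>ch I. of_real (\<mu> c) * av \<mu> f c) = of_real (\<mu> I) * av \<mu> f I"
  by (simp add: av_sum ch_in sum_leaves)

lemma avn_ch: "weight \<mu> \<Longrightarrow> I \<in> D \<Longrightarrow> lev I < N \<Longrightarrow>
    (\<Sum>c\<in>ch I. \<mu> c * avn \<mu> f c) = \<mu> I * avn \<mu> f I"
  by (simp add: avn_sum ch_in sum_leaves)

text \<open>The cross terms cancel because the deviations of the children from their mean have
  weighted sum zero. The point \<open>z\<close> is left free: \<open>energy\<close> takes it to be
  0, and \<open>variance_desc\<close> lets it be an arbitrary reference value.\<close>

lemma variance:
  assumes \<mu>: "weight \<mu>" and I: "I \<in> D" "lev I < N"
  shows "(\<Sum>c\<in>ch I. \<mu> c * (norm (av \<mu> f c - z))\<^sup>2) = dl \<mu> f I + \<mu> I * (norm (av \<mu> f I - z))\<^sup>2"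
proof -
  let ?p = "av \<mu> f"
  define R where "R c = Re ((?p c - ?p I) * cnj (?p I - z))" for c
  have z: "(\<Sum>c\<in>ch I. of_real (\<mu> c) * (?p c - ?p I)) = 0"
    unfolding right_diff_distrib sum_subtractf av_ch[OF \<mu> I] weight_ch[OF \<mu> I, symmetric]
    by (simp flip: sum_distrib_right)
  have "(\<Sum>c\<in>ch I. \<mu> c * R c) = (\<Sum>c\<in>ch I. Re ((of_real (\<mu> c) * (?p c - ?p I)) * cnj (?p I - z)))"
    unfolding R_def by (simp only: mult.assoc Re_of_real_mult_left)
  also have "\<dots> = Re ((\<Sum>c\<in>ch I. of_real (\<mu> c) * (?p c - ?p I)) * cnj (?p I - z))"
    by (simp only: sum_distrib_right Re_sum)
  finally have R0: "(\<Sum>c\<in>ch I. \<mu> c * R c) = 0" by (simp add: z)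
  have "(\<Sum>c\<in>ch I. \<mu> c * (norm (?p c - z))\<^sup>2)
      = (\<Sum>c\<in>ch I. \<mu> c * (norm (?p c - ?p I))\<^sup>2 + \<mu> c * (norm (?p I - z))\<^sup>2 + 2 * (\<mu> c * R c))"
    unfolding R_def by (intro sum.cong refl, subst norm_diff_expand[of _ z "?p I"]) (simp only: distrib_left mult.left_commute)
  also have "\<dots> = dl \<mu> f I + \<mu> I * (norm (?p I - z))\<^sup>2 + 2 * (\<Sum>c\<in>ch I. \<mu> c * R c)"
    unfolding dl_def weight_ch[OF \<mu> I, symmetric] by (simp only: sum.distrib sum_distrib_right sum_distrib_left)
  finally show ?thesis using R0 by simp
qed

lemma dl_leaf: "I \<in> D \<Longrightarrow> lev I = N \<Longrightarrow> dl \<mu> f I = 0"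
  by (simp add: dl_def ch_leaf)

text \<open>Plancherel's identity for martingale differences, by passing \<open>variance\<close>
  with \<open>z = 0\<close> up from the leaves.\<close>

lemma energy:
  assumes \<mu>: "weight \<mu>" and I: "I \<in> D"
  shows "(\<Sum>J\<in>below I. dl \<mu> f J) + \<mu> I * (norm (av \<mu> f I))\<^sup>2 = nrm \<mu> f I"
  using I
proof (induction I rule: tree_induct)
  case (step I)
  show ?case
  proof (cases "lev I = N")
    case True
    then show ?thesis using step(1) \<mu> by (simp add: sum_below ch_leaf dl_leaf nrm_def leaves_leaf av_leaf)
  next
    case False
    then have l: "lev I < N" using lev_le step by fastforce
    have "nrm \<mu> f I = (\<Sum>c\<in>ch I. nrm \<mu> f c)" using l step(1) by (simp add: nrm_def sum_leaves)
    also have "\<dots> = (\<Sum>c\<in>ch I. (\<Sum>J\<in>below c. dl \<mu> f J) + \<mu> c * (norm (av \<mu> f c))\<^sup>2)"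
      using step(2) by simp
    also have "\<dots> = (\<Sum>J\<in>below I. dl \<mu> f J) + \<mu> I * (norm (av \<mu> f I))\<^sup>2"
      using variance[OF \<mu> step(1) l, of f 0] step(1) by (simp add: sum.distrib sum_below)
    finally show ?thesis by simp
  qed
qed

lemma energy_root_le: "weight \<mu> \<Longrightarrow> (\<Sum>J\<in>D. dl \<mu> f J) \<le> nrm \<mu> f root"
  and energy_av_le: "weight \<mu> \<Longrightarrow> I \<in> D \<Longrightarrow> \<mu> I * (norm (av \<mu> f I))\<^sup>2 \<le> nrm \<mu> f I"
  using energy[of \<mu> root f] energy[of \<mu> I f] root_in weight_pos[of \<mu> root]
    sum_nonneg[of "below I" "dl \<mu> f"] dl_nonneg[of \<mu> f]
  by (auto simp: below_root) (smt (verit) mult_nonneg_nonneg zero_le_power2)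

lemma variance_desc:
  assumes \<mu>: "weight \<mu>"
  shows "R \<in> D \<Longrightarrow> lev R + j \<le> N \<Longrightarrow> (\<Sum>J\<in>desc j R. \<mu> J * (norm (av \<mu> f J - z))\<^sup>2)
    = (\<Sum>i<j. \<Sum>L\<in>desc i R. dl \<mu> f L) + \<mu> R * (norm (av \<mu> f R - z))\<^sup>2"
proof (induction j arbitrary: R)
  case (Suc j)
  have l: "lev R < N" using Suc by auto
  have "(\<Sum>J\<in>desc (Suc j) R. \<mu> J * (norm (av \<mu> f J - z))\<^sup>2)
      = (\<Sum>c\<in>ch R. (\<Sum>i<j. \<Sum>L\<in>desc i c. dl \<mu> f L) + \<mu> c * (norm (av \<mu> f c - z))\<^sup>2)"
    using Suc.prems Suc.IH ch_in ch_lev by (simp add: sum_desc_Suc)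
  also have "\<dots> = (\<Sum>i<j. \<Sum>L\<in>desc (Suc i) R. dl \<mu> f L) + (dl \<mu> f R + \<mu> R * (norm (av \<mu> f R - z))\<^sup>2)"
    unfolding sum.distrib variance[OF \<mu> Suc.prems(1) l]
    by (subst sum.swap) (simp add: sum_desc_Suc Suc.prems(1))
  also have "\<dots> = (\<Sum>i<Suc j. \<Sum>L\<in>desc i R. dl \<mu> f L) + \<mu> R * (norm (av \<mu> f R - z))\<^sup>2"
    using Suc.prems by (simp add: sum.lessThan_Suc_shift del: sum.lessThan_Suc)
  finally show ?case .
qed simp

lemma indic_ch: "c \<in> ch I \<Longrightarrow> c' \<in> ch I \<Longrightarrow> x \<in> leaves c \<Longrightarrow> indic c' x = (if c' = c then 1 else 0)"
  using leaves_disj by (fastforce simp: indic_def)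

lemma Df_val: assumes "d \<in> ch J" "x \<in> leaves d" shows "Df \<mu> f J x = av \<mu> f d - av \<mu> f J"
proof -
  have "Df \<mu> f J x = (\<Sum>c\<in>ch J. if c = d then av \<mu> f c - av \<mu> f J else 0)"
    unfolding Df_def by (intro sum.cong refl) (use indic_ch assms in auto)
  then show ?thesis using assms by simp
qed

lemma Df_zero: "x \<notin> leaves J \<Longrightarrow> Df \<mu> f J x = 0"
  using leaves_mono[OF ch_below] unfolding Df_def by (intro sum.neutral) (auto simp: indic_def)

lemma leaves_disjoint:
  assumes "I \<notin> below J" "J \<notin> below I" shows "leaves I \<inter> leaves J = {}"
  using below_comparable assms leaves_below by (metis disjoint_iff nle_le)

lemma av_Df_inside: assumes \<mu>: "weight \<mu>" and "d \<in> ch J" "I \<in> below d"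
  shows "av \<mu> (Df \<mu> f J) I = av \<mu> f d - av \<mu> f J"
proof -
  have I: "I \<in> D" using assms below_in by auto
  have "(\<Sum>x\<in>leaves I. of_real (\<mu> x) * Df \<mu> f J x) = (\<Sum>x\<in>leaves I. of_real (\<mu> x) * (av \<mu> f d - av \<mu> f J))"
    using Df_val[OF assms(2)] leaves_mono[OF assms(3)] by (intro sum.cong refl) auto
  also have "\<dots> = of_real (sum \<mu> (leaves I)) * (av \<mu> f d - av \<mu> f J)"
    by (simp add: sum_distrib_right)
  finally show ?thesis using weight_leaves[OF \<mu> I] weight_pos[OF \<mu> I] by (simp add: av_def)
qed

lemma av_Df_outside: "leaves I \<inter> leaves J = {} \<Longrightarrow> av \<mu> (Df \<mu> f J) I = 0"
  unfolding av_def using Df_zero by (metis (no_types, lifting) disjoint_iff div_0 mult_zero_right sum.neutral)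

lemma sum_Df_zero: assumes \<mu>: "weight \<mu>" and "J \<in> below I"
  shows "(\<Sum>x\<in>leaves I. of_real (\<mu> x) * Df \<mu> f J x) = 0"
proof -
  have J: "J \<in> D" using assms below_in by auto
  have "(\<Sum>x\<in>leaves I. of_real (\<mu> x) * Df \<mu> f J x) = (\<Sum>x\<in>leaves J. of_real (\<mu> x) * Df \<mu> f J x)"
    by (rule sum.mono_neutral_right) (use leaves_mono[OF assms(2)] Df_zero in auto)
  also have "\<dots> = 0"
  proof (cases "lev J = N")
    case True
    then show ?thesis using J by (simp add: Df_def ch_leaf)
  next
    case False
    then have l: "lev J < N" using lev_le J by fastforce
    have "(\<Sum>x\<in>leaves J. of_real (\<mu> x) * Df \<mu> f J x)
        = (\<Sum>c\<in>ch J. \<Sum>x\<in>leaves c. of_real (\<mu> x) * (av \<mu> f c - av \<mu> f J))"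
      using J l Df_val by (simp add: sum_leaves)
    also have "\<dots> = (\<Sum>c\<in>ch J. of_real (\<mu> c) * (av \<mu> f c - av \<mu> f J))"
      by (intro sum.cong refl) (use weight_leaves[OF \<mu>] ch_in in \<open>auto simp flip: sum_distrib_right of_real_sum\<close>)
    also have "\<dots> = of_real (\<mu> J) * av \<mu> f J - of_real (\<Sum>c\<in>ch J. \<mu> c) * av \<mu> f J"
      by (simp only: right_diff_distrib sum_subtractf av_ch[OF \<mu> J l] sum_distrib_right of_real_sum)
    finally show ?thesis using weight_ch[OF \<mu> J l] by simp
  qed
  finally show ?thesis .
qed

lemma av_Df_above: "weight \<mu> \<Longrightarrow> J \<in> below I \<Longrightarrow> av \<mu> (Df \<mu> f J) I = 0"
  by (simp add: av_def sum_Df_zero)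

text \<open>Orthogonality of the differences, in the form of increments: below a child of
  \<open>J\<close> the function \<open>Df \<mu> f J\<close> is constant, above \<open>J\<close> it
  has mean zero, and away from \<open>J\<close> it vanishes, so only \<open>I = J\<close> leaves an
  increment.\<close>

lemma av_Df_diff:
  assumes \<mu>: "weight \<mu>" and J: "J \<in> D" and c: "c \<in> ch I"
  shows "av \<mu> (Df \<mu> f J) c - av \<mu> (Df \<mu> f J) I = (if J = I then av \<mu> f c - av \<mu> f I else 0)"
proof -
  have I: "I \<in> D" using c ch_par_in by auto
  consider "J = I" | d where "d \<in> ch J" "I \<in> below d" | "J \<noteq> I" "J \<in> below I"
    | "I \<notin> below J" "J \<notin> below I"
    using below_decomp[OF J] by auto
  then show ?thesis
  proof cases
    case 1
    then show ?thesis using av_Df_inside[OF \<mu> c below_self[OF ch_in[OF c]]] av_Df_above[OF \<mu>] J by auto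
  next
    case 2
    have "J \<noteq> I" using 2 below_ch_self by auto
    moreover have "c \<in> below d" using 2 c ch_below below_trans by blast
    ultimately show ?thesis using 2 av_Df_inside[OF \<mu>] by auto
  next
    case 3
    have "av \<mu> (Df \<mu> f J) c = 0"
    proof (cases "J \<in> below c")
      case True
      then show ?thesis using av_Df_above[OF \<mu>] by auto
    next
      case False
      have "c \<notin> below J"
      proof
        assume cJ: "c \<in> below J"
        have "lev I < lev J" proof -
          have "lev J \<noteq> lev I" using below_eq_lev[OF below_self[OF J] 3(2)] 3(1) by blast
          then show ?thesis using below_lev[OF 3(2)] by linarith
        qed
        then have "lev J = lev c" using below_lev[OF cJ] ch_lev[OF c] by auto
        then have "c = J" using cJ J below_eq_lev[OF below_self[OF ch_in[OF c]] cJ] by auto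
        then show False using False J by simp
      qed
      then show ?thesis using av_Df_outside leaves_disjoint False by blast
    qed
    then show ?thesis using 3 av_Df_above[OF \<mu>] by auto
  next
    case 4
    have "leaves I \<inter> leaves J = {}" using 4 leaves_disjoint by blast
    moreover from this have "leaves c \<inter> leaves J = {}" using leaves_mono[OF ch_below[OF c]] by auto
    moreover have "J \<noteq> I" using 4 I by auto
    ultimately show ?thesis using av_Df_outside by simp
  qed
qed

lemma av_lin: "av \<mu> (\<lambda>x. \<Sum>J\<in>P. a J * u J x) I = (\<Sum>J\<in>P. a J * av \<mu> (u J) I)"
  unfolding av_def sum_divide_distrib sum_distrib_left
  by (subst sum.swap) (simp add: sum_distrib_left algebra_simps)

text \<open>By \<open>av_Df_diff\<close> the increments of the sum at \<open>I\<close> are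
  \<open>a I\<close> times those of \<open>f\<close>, and its mean over the root vanishes, so
  \<open>energy\<close> gives the norm. In the paraproduct the multipliers are the averages of
  \<open>g\<close> over the cubes that share one principal cube.\<close>

lemma martingale_transform:
  assumes \<mu>: "weight \<mu>"
  shows "nrm \<mu> (\<lambda>x. \<Sum>J\<in>D. a J * Df \<mu> f J x) root = (\<Sum>J\<in>D. (norm (a J))\<^sup>2 * dl \<mu> f J)"
proof -
  let ?F = "\<lambda>x. \<Sum>J\<in>D. a J * Df \<mu> f J x"
  have d: "av \<mu> ?F c - av \<mu> ?F I = a I * (av \<mu> f c - av \<mu> f I)" if "c \<in> ch I" for c I
  proof -
    have "av \<mu> ?F c - av \<mu> ?F I = (\<Sum>J\<in>D. a J * (av \<mu> (Df \<mu> f J) c - av \<mu> (Df \<mu> f J) I))"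
      unfolding av_lin by (simp add: algebra_simps sum_subtractf)
    also have "\<dots> = (\<Sum>J\<in>D. if J = I then a J * (av \<mu> f c - av \<mu> f I) else 0)"
      by (intro sum.cong refl) (use av_Df_diff[OF \<mu> _ that] in auto)
    finally show ?thesis using ch_par_in[OF that] fin_D by simp
  qed
  have "dl \<mu> ?F I = (norm (a I))\<^sup>2 * dl \<mu> f I" for I
    unfolding dl_def sum_distrib_left
    by (intro sum.cong refl) (use d in \<open>simp add: norm_mult power_mult_distrib\<close>)
  moreover have "av \<mu> ?F root = 0"
    unfolding av_lin using av_Df_above[OF \<mu>] below_root by (intro sum.neutral) auto
  ultimately show ?thesis using energy[OF \<mu> root_in, of ?F] by (simp add: below_root)
qed

lemma nrm_Df: assumes "weight \<mu>" "I \<in> D" shows "nrm \<mu> (Df \<mu> f I) root = dl \<mu> f I"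
proof -
  have "(\<Sum>J\<in>D. (if J = I then 1 else 0) * Df \<mu> f J x) = Df \<mu> f I x" for x
  proof -
    have "(\<Sum>J\<in>D. (if J = I then 1 else 0) * Df \<mu> f J x) = (\<Sum>J\<in>D. if J = I then Df \<mu> f J x else 0)"
      by (intro sum.cong) auto
    then show ?thesis using assms fin_D by simp
  qed
  then have "nrm \<mu> (Df \<mu> f I) root = nrm \<mu> (\<lambda>x. \<Sum>J\<in>D. (if J = I then 1 else 0) * Df \<mu> f J x) root"
    by simp
  also have "\<dots> = (\<Sum>J\<in>D. (norm ((if J = I then 1 else 0) :: complex))\<^sup>2 * dl \<mu> f J)"
    by (rule martingale_transform[OF assms(1)])
  also have "(\<Sum>J\<in>D. (norm ((if J = I then 1 else 0) :: complex))\<^sup>2 * dl \<mu> f J)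
      = (\<Sum>J\<in>D. if J = I then dl \<mu> f J else 0)"
    by (intro sum.cong) auto
  also have "\<dots> = dl \<mu> f I" using assms fin_D by simp
  finally show ?thesis .
qed

end

section \<open>Adjacent cubes, doubling and thin boundaries on the tree\<close>

locale dyadic_adj = dyadic_tree D lev par root N
  for D :: "'c set" and lev par root N +
  fixes adj :: "'c \<Rightarrow> 'c \<Rightarrow> bool" and deg :: nat
  assumes adj_refl: "I \<in> D \<Longrightarrow> adj I I"
    and adj_sym: "adj I J \<Longrightarrow> adj J I"
    and adj_lev: "I \<in> D \<Longrightarrow> J \<in> D \<Longrightarrow> adj I J \<Longrightarrow> lev I = lev J"
    and adj_par: "I \<in> D \<Longrightarrow> J \<in> D \<Longrightarrow> adj I J \<Longrightarrow> I \<noteq> root \<Longrightarrow> adj (par I) (par J)"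
    and adj_deg: "I \<in> D \<Longrightarrow> card {J\<in>D. adj I J} \<le> deg"
begin

definition nb :: "'c \<Rightarrow> 'c set" where "nb I = {J\<in>D. adj I J}"

text \<open>Neighbours are taken inside the tree only, so no cube counts as a boundary cube of the
  root.\<close>

definition boundary :: "'c \<Rightarrow> 'c \<Rightarrow> bool" where
  "boundary Q L \<longleftrightarrow> (\<exists>R\<in>nb Q. R \<notin> below L)"

definition doubling :: "('c \<Rightarrow> real) \<Rightarrow> real \<Rightarrow> bool" where
  "doubling \<mu> d \<longleftrightarrow> (\<forall>I\<in>D. \<forall>J\<in>nb I. \<mu> J \<le> d * \<mu> I) \<and> (\<forall>I\<in>D. \<forall>c\<in>ch I. \<mu> I \<le> d * \<mu> c)"

text \<open>A boundary layer of relative width \<open>2 ^ (- s)\<close> should carry a power of that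
  proportion of the mass; \<open>\<eta>\<close> is this power of one half.\<close>

definition thin_boundary :: "('c \<Rightarrow> real) \<Rightarrow> real \<Rightarrow> real \<Rightarrow> bool" where
  "thin_boundary \<mu> C \<eta> \<longleftrightarrow>
    (\<forall>L\<in>D. \<forall>s. sum \<mu> {Q\<in>desc s L. boundary Q L} \<le> C * \<eta> ^ s * \<mu> L)"

lemma fin_nb [simp]: "finite (nb I)"
  using fin_D by (simp add: nb_def)

lemma nb_in: "J \<in> nb I \<Longrightarrow> J \<in> D"
  by (simp add: nb_def)

lemma nb_lev: "I \<in> D \<Longrightarrow> J \<in> nb I \<Longrightarrow> lev J = lev I"
  using adj_lev by (auto simp: nb_def)

lemma nb_sym: "Q \<in> D \<Longrightarrow> R \<in> nb Q \<Longrightarrow> Q \<in> nb R"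
  by (simp add: nb_def adj_sym[of Q R])

lemma nb_card: "I \<in> D \<Longrightarrow> real (card (nb I)) \<le> real deg"
  using adj_deg by (simp add: nb_def)

lemma nb_sum_le:
  assumes "doubling \<mu> d" "weight \<mu>" "I \<in> D" shows "sum \<mu> (nb I) \<le> real deg * (d * \<mu> I)"
proof -
  have b: "\<And>J. J \<in> nb I \<Longrightarrow> \<mu> J \<le> d * \<mu> I" using assms by (auto simp: doubling_def)
  have "I \<in> nb I" using assms adj_refl by (simp add: nb_def)
  then have "0 \<le> d * \<mu> I" using b[of I] weight_pos[OF assms(2,3)] by linarith
  then have "real (card (nb I)) * (d * \<mu> I) \<le> real deg * (d * \<mu> I)"
    using nb_card[OF assms(3)] by (intro mult_right_mono) auto
  then show ?thesis using sum_bounded_above[of "nb I" \<mu> "d * \<mu> I"] b by simp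
qed

lemma sum_nb_swap: "(\<Sum>I\<in>D. \<Sum>J\<in>nb I. F I J) = (\<Sum>I\<in>D. \<Sum>J\<in>nb I. F J I)"
proof -
  have "(\<Sum>I\<in>D. \<Sum>J\<in>nb I. F I J) = (\<Sum>I\<in>D. \<Sum>J\<in>D. if adj I J then F I J else 0)"
    by (rule sum.cong[OF refl]) (simp add: nb_def sum.inter_filter fin_D)
  also have "\<dots> = (\<Sum>J\<in>D. \<Sum>I\<in>D. if adj I J then F I J else 0)" by (rule sum.swap)
  also have "\<dots> = (\<Sum>J\<in>D. \<Sum>I\<in>nb J. F I J)"
  proof (rule sum.cong[OF refl])
    fix J
    have "(\<Sum>I\<in>D. if adj I J then F I J else 0) = (\<Sum>I\<in>D. if adj J I then F I J else 0)"
      using adj_sym by (intro sum.cong refl) auto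
    then show "(\<Sum>I\<in>D. if adj I J then F I J else 0) = (\<Sum>I\<in>nb J. F I J)"
      by (simp add: nb_def sum.inter_filter fin_D)
  qed
  finally show ?thesis .
qed

lemma anc_chain:
  fixes p :: "'c \<Rightarrow> complex"
  shows "norm (p Q - p (anc i Q)) \<le> (\<Sum>k<i. norm (p (anc k Q) - p (anc (Suc k) Q)))"
proof (induction i)
  case (Suc i)
  have "norm (p Q - p (anc (Suc i) Q)) \<le> norm (p Q - p (anc i Q)) + norm (p (anc i Q) - p (anc (Suc i) Q))"
    using norm_triangle_ineq[of "p Q - p (anc i Q)" "p (anc i Q) - p (anc (Suc i) Q)"] by simp
  then show ?case using Suc by simp
qed simp

text \<open>The averages over adjacent cubes \<open>Q\<close>, \<open>R\<close> are compared through their first common ancestor. Below it \<open>Q\<close>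
  lies near the boundary of each of its ancestors, and thin boundaries make the contribution of the
  \<open>i\<close>-th ancestor geometrically small in \<open>i\<close>.\<close>

lemma adjacent_differences:
  assumes \<mu>: "weight \<mu>" and dbl: "doubling \<mu> d" and d: "0 \<le> d"
    and thin: "thin_boundary \<mu> C \<eta>" and C: "0 \<le> C" and \<eta>: "0 < \<eta>" "\<eta> < 1"
  shows "(\<Sum>Q\<in>D. \<Sum>R\<in>nb Q. \<mu> Q * (norm (av \<mu> g Q - av \<mu> g R))\<^sup>2)
     \<le> 2 * (1 + d) * real deg * C / (1 - sqrt \<eta>)\<^sup>2 * nrm \<mu> g root"
proof -
  let ?p = "av \<mu> g"
  \<comment> \<open>The decay \<open>\<eta> ^ i\<close> is split in two halves \<open>r ^ i\<close>:
    one pays for Cauchy-Schwarz over the ancestors, the other for the final sum over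
    \<open>i\<close>. Each contributes a factor \<open>1 / (1 - r)\<close>.\<close>
  define r where "r = sqrt \<eta>"
  have r: "0 < r" "r < 1" "r * r = \<eta>" using \<eta> by (auto simp: r_def)
  define t where "t Q i = (if boundary Q (anc i Q) then norm (?p (anc i Q) - ?p (anc (Suc i) Q)) else 0)" for Q i
  define Y where "Y Q = (\<Sum>i<lev Q. t Q i)" for Q
  have t0: "0 \<le> t Q i" for Q i by (simp add: t_def)
  have Y0: "0 \<le> Y Q" for Q unfolding Y_def using t0 by (intro sum_nonneg)
  have ex: "\<exists>K. norm (?p Q - ?p K) \<le> Y Q \<and> norm (?p R - ?p K) \<le> Y R" if QR: "Q \<in> D" "R \<in> nb Q" for Q R
  proof -
    have R: "R \<in> D" "lev R = lev Q" "Q \<in> nb R" using nb_in[OF QR(2)] nb_lev[OF QR] nb_sym[OF QR] by simp_all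
    define i where "i = (LEAST i. anc i Q = anc i R)"
    have e: "anc (lev Q) Q = anc (lev Q) R" using anc_lev[OF QR(1)] anc_lev[OF R(1)] R by simp
    have i: "anc i Q = anc i R" "i \<le> lev Q" unfolding i_def
      using e by (rule LeastI, rule Least_le)
    have ne: "anc k Q \<noteq> anc k R" if "k < i" for k using that not_less_Least unfolding i_def by auto
    have b: "boundary Q (anc k Q)" "boundary R (anc k R)" if "k < i" for k
    proof -
      have k: "lev Q - lev (anc k Q) = k" "lev R - lev (anc k R) = k"
        using lev_anc[OF QR(1), of k] lev_anc[OF R(1), of k] that i R by auto
      have "R \<notin> below (anc k Q)" using ne[OF that] k R by (metis below_iff)
      moreover have "Q \<notin> below (anc k R)" using ne[OF that] k R by (metis below_iff)
      ultimately show "boundary Q (anc k Q)" "boundary R (anc k R)"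
        using QR R by (auto simp: boundary_def)
    qed
    have "norm (?p Q - ?p (anc i Q)) \<le> (\<Sum>k<i. t Q k)"
      using anc_chain[of ?p Q i] b by (simp add: t_def)
    also have "\<dots> \<le> Y Q" unfolding Y_def using i t0 by (intro sum_mono2) auto
    finally have 1: "norm (?p Q - ?p (anc i Q)) \<le> Y Q" .
    have "norm (?p R - ?p (anc i R)) \<le> (\<Sum>k<i. t R k)"
      using anc_chain[of ?p R i] b by (simp add: t_def)
    also have "\<dots> \<le> Y R" unfolding Y_def using i t0 R by (intro sum_mono2) auto
    finally show ?thesis using 1 i by metis
  qed
  have sq: "(norm (?p Q - ?p R))\<^sup>2 \<le> 2 * (Y Q)\<^sup>2 + 2 * (Y R)\<^sup>2" if QR: "Q \<in> D" "R \<in> nb Q" for Q R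
  proof -
    obtain K where "norm (?p Q - ?p K) \<le> Y Q" "norm (?p R - ?p K) \<le> Y R" using ex[OF QR] by auto
    then have "(norm (?p Q - ?p K))\<^sup>2 \<le> (Y Q)\<^sup>2" "(norm (?p K - ?p R))\<^sup>2 \<le> (Y R)\<^sup>2"
      by (auto intro!: power_mono simp: norm_minus_commute)
    then show ?thesis using norm_diff_sq_le[of "?p Q" "?p R" "?p K"] by linarith
  qed
  have Ysum: "(\<Sum>Q\<in>D. \<mu> Q * (Y Q)\<^sup>2) \<le> C / (1 - r)\<^sup>2 * nrm \<mu> g root"
  proof -
    have "(\<Sum>Q\<in>D. \<mu> Q * (Y Q)\<^sup>2) \<le> (\<Sum>Q\<in>D. \<mu> Q * (1 / (1 - r) * (\<Sum>i<lev Q. (t Q i)\<^sup>2 / r ^ i)))"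
      unfolding Y_def using r
      by (intro sum_mono mult_left_mono sum_sq_geometric_le less_imp_le[OF weight_pos[OF \<mu>]]) auto
    also have "\<dots> = 1 / (1 - r) * (\<Sum>Q\<in>D. \<Sum>i<lev Q. \<mu> Q * (t Q i)\<^sup>2 / r ^ i)"
      by (simp add: sum_distrib_left mult.left_commute)
    finally have 1: "(\<Sum>Q\<in>D. \<mu> Q * (Y Q)\<^sup>2)
      \<le> 1 / (1 - r) * (\<Sum>Q\<in>D. \<Sum>i<lev Q. \<mu> Q * (t Q i)\<^sup>2 / r ^ i)" .
    have "(\<Sum>Q\<in>D. \<Sum>i<lev Q. \<mu> Q * (t Q i)\<^sup>2 / r ^ i)
        = (\<Sum>Q\<in>D. \<Sum>i<N. if i < lev Q then \<mu> Q * (t Q i)\<^sup>2 / r ^ i else 0)"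
    proof (rule sum.cong[OF refl])
      fix Q assume "Q \<in> D"
      then have "{..<lev Q} = {i\<in>{..<N}. i < lev Q}" using lev_le by fastforce
      then show "(\<Sum>i<lev Q. \<mu> Q * (t Q i)\<^sup>2 / r ^ i) = (\<Sum>i<N. if i < lev Q then \<mu> Q * (t Q i)\<^sup>2 / r ^ i else 0)"
        by (simp only: sum.inter_filter finite_lessThan)
    qed
    also have "\<dots> = (\<Sum>i<N. \<Sum>Q\<in>{Q\<in>D. i < lev Q}. \<mu> Q * (t Q i)\<^sup>2 / r ^ i)"
      by (subst sum.swap) (simp add: sum.inter_filter fin_D)
    also have "\<dots> \<le> (\<Sum>i<N. C * r ^ i * nrm \<mu> g root)"
    proof (intro sum_mono)
      fix i
      let ?P = "{Q\<in>D. i < lev Q}"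
      let ?d = "\<lambda>L. (norm (?p L - ?p (par L)))\<^sup>2"
      \<comment> \<open>Cubes are grouped by their \<open>i\<close>-th ancestor \<open>L\<close>. In
        \<open>t\<close> only boundary cubes of \<open>L\<close> survive, of total mass at most
        \<open>C * \<eta> ^ i * \<mu> L\<close>, and half of this decay cancels the division by
        \<open>r ^ i\<close>. What is left is a sum of martingale differences.\<close>
      have "(\<Sum>Q\<in>?P. \<mu> Q * (t Q i)\<^sup>2 / r ^ i) = (\<Sum>L\<in>D. \<Sum>Q\<in>desc i L \<inter> ?P. \<mu> Q * (t Q i)\<^sup>2 / r ^ i)"
        by (rule sum_group_desc) auto
      also have "\<dots> \<le> (\<Sum>L\<in>D. if L = root then 0 else C * r ^ i * (\<mu> L * ?d L))"
      proof (intro sum_mono)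
        fix L assume L: "L \<in> D"
        show "(\<Sum>Q\<in>desc i L \<inter> ?P. \<mu> Q * (t Q i)\<^sup>2 / r ^ i) \<le> (if L = root then 0 else C * r ^ i * (\<mu> L * ?d L))"
        proof (cases "L = root")
          case True
          then have "desc i L \<inter> ?P = {}" using desc_lev lev_root[OF root_in] by force
          then show ?thesis using True by simp
        next
          case False
          have "(\<Sum>Q\<in>desc i L \<inter> ?P. \<mu> Q * (t Q i)\<^sup>2 / r ^ i)
              = (\<Sum>Q\<in>desc i L \<inter> ?P. if boundary Q L then \<mu> Q * (?d L / r ^ i) else 0)"
            by (intro sum.cong refl) (auto simp: t_def desc_def anc_Suc')
          also have "\<dots> \<le> (\<Sum>Q\<in>desc i L. if boundary Q L then \<mu> Q * (?d L / r ^ i) else 0)"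
            using r desc_in by (intro sum_mono2)
              (auto intro!: mult_nonneg_nonneg divide_nonneg_nonneg less_imp_le[OF weight_pos[OF \<mu>]])
          also have "\<dots> = sum \<mu> {Q\<in>desc i L. boundary Q L} * (?d L / r ^ i)"
            unfolding sum_distrib_right by (simp only: sum.inter_filter[OF fin_desc])
          also have "\<dots> \<le> C * \<eta> ^ i * \<mu> L * (?d L / r ^ i)"
            using thin L r by (intro mult_right_mono) (auto simp: thin_boundary_def)
          also have "\<dots> = C * r ^ i * (\<mu> L * ?d L)"
            using r by (simp add: r(3)[symmetric] power_mult_distrib)
          finally show ?thesis using False by simp
        qed
      qed
      also have "\<dots> = (\<Sum>L\<in>D - {root}. C * r ^ i * (\<mu> L * ?d L))"
        using root_in fin_D by (subst sum.remove[of _ root]) (auto intro!: sum.cong)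
      also have "\<dots> = C * r ^ i * (\<Sum>I\<in>D. \<Sum>L\<in>ch I. \<mu> L * ?d L)"
        by (simp add: sum_ch_all flip: sum_distrib_left)
      also have "(\<Sum>I\<in>D. \<Sum>L\<in>ch I. \<mu> L * ?d L) = (\<Sum>I\<in>D. dl \<mu> g I)"
        unfolding dl_def by (intro sum.cong refl) (auto simp: ch_par)
      also have "C * r ^ i * \<dots> \<le> C * r ^ i * nrm \<mu> g root"
        using energy_root_le[OF \<mu>, of g] C r by (intro mult_left_mono) auto
      finally show "(\<Sum>Q\<in>?P. \<mu> Q * (t Q i)\<^sup>2 / r ^ i) \<le> C * r ^ i * nrm \<mu> g root" .
    qed
    also have "(\<Sum>i<N. C * r ^ i * nrm \<mu> g root) = C * nrm \<mu> g root * (\<Sum>i<N. r ^ i)"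
      unfolding sum_distrib_left by (intro sum.cong refl) (simp only: mult_ac)
    also have "\<dots> \<le> C * nrm \<mu> g root * (1 / (1 - r))"
      using r C nrm_nonneg[OF \<mu>] by (intro mult_left_mono sum_geometric_le) auto
    finally have "1 / (1 - r) * (\<Sum>Q\<in>D. \<Sum>i<lev Q. \<mu> Q * (t Q i)\<^sup>2 / r ^ i)
        \<le> 1 / (1 - r) * (C * nrm \<mu> g root * (1 / (1 - r)))" using r by (intro mult_left_mono) auto
    with 1 show ?thesis by (simp add: power2_eq_square)
  qed
  have "(\<Sum>Q\<in>D. \<Sum>R\<in>nb Q. \<mu> Q * (norm (?p Q - ?p R))\<^sup>2)
      \<le> (\<Sum>Q\<in>D. \<Sum>R\<in>nb Q. 2 * \<mu> Q * (Y Q)\<^sup>2 + 2 * d * \<mu> R * (Y R)\<^sup>2)"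
  proof (intro sum_mono)
    fix Q R assume QR: "Q \<in> D" "R \<in> nb Q"
    then have "Q \<in> nb R" by (rule nb_sym)
    then have m: "\<mu> Q \<le> d * \<mu> R" using dbl nb_in[OF QR(2)] by (auto simp: doubling_def)
    have "\<mu> Q * (norm (?p Q - ?p R))\<^sup>2 \<le> \<mu> Q * (2 * (Y Q)\<^sup>2 + 2 * (Y R)\<^sup>2)"
      using sq[OF QR] weight_pos[OF \<mu> QR(1)] by (intro mult_left_mono) auto
    also have "\<dots> = 2 * \<mu> Q * (Y Q)\<^sup>2 + \<mu> Q * (2 * (Y R)\<^sup>2)" by (simp add: algebra_simps)
    also have "\<dots> \<le> 2 * \<mu> Q * (Y Q)\<^sup>2 + d * \<mu> R * (2 * (Y R)\<^sup>2)"
      using m by (intro add_left_mono mult_right_mono) auto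
    finally show "\<mu> Q * (norm (?p Q - ?p R))\<^sup>2 \<le> 2 * \<mu> Q * (Y Q)\<^sup>2 + 2 * d * \<mu> R * (Y R)\<^sup>2"
      by (simp add: algebra_simps)
  qed
  also have "\<dots> = (\<Sum>Q\<in>D. \<Sum>R\<in>nb Q. 2 * \<mu> Q * (Y Q)\<^sup>2) + (\<Sum>Q\<in>D. \<Sum>R\<in>nb Q. 2 * d * \<mu> Q * (Y Q)\<^sup>2)"
    unfolding sum.distrib by (subst (2) sum_nb_swap) simp
  also have "\<dots> = (\<Sum>Q\<in>D. real (card (nb Q)) * (2 * (1 + d) * (\<mu> Q * (Y Q)\<^sup>2)))"
    by (simp flip: sum.distrib add: algebra_simps)
  also have "\<dots> \<le> (\<Sum>Q\<in>D. real deg * (2 * (1 + d) * (\<mu> Q * (Y Q)\<^sup>2)))"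
    using nb_card d by (intro sum_mono mult_right_mono mult_nonneg_nonneg less_imp_le[OF weight_pos[OF \<mu>]]) auto
  also have "\<dots> = 2 * (1 + d) * real deg * (\<Sum>Q\<in>D. \<mu> Q * (Y Q)\<^sup>2)"
    unfolding sum_distrib_left by (intro sum.cong refl) (simp only: mult_ac)
  also have "\<dots> \<le> 2 * (1 + d) * real deg * (C / (1 - r)\<^sup>2 * nrm \<mu> g root)"
    using Ysum d by (intro mult_left_mono) auto
  finally show ?thesis by (simp add: r_def)
qed

end

section \<open>Principal cubes\<close>

context dyadic_tree begin

text \<open>The recursion counts generations up to the root, since \<open>par\<close> itself offers
  no structural recursion. A new principal cube starts where \<open>a\<close> exceeds twice its
  value on the current one.\<close>

primrec stn :: "('c \<Rightarrow> real) \<Rightarrow> nat \<Rightarrow> 'c \<Rightarrow> 'c" where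
  "stn a 0 I = I"
| "stn a (Suc n) I = (if 2 * a (stn a n (par I)) < a I then I else stn a n (par I))"

text \<open>The smallest principal cube containing a given cube.\<close>

definition st :: "('c \<Rightarrow> real) \<Rightarrow> 'c \<Rightarrow> 'c" where
  "st a I = stn a (lev I) I"

lemma st_root [simp]: "st a root = root"
  using lev_root[OF root_in] by (simp add: st_def)

lemma st_ch: "c \<in> ch I \<Longrightarrow> st a c = (if 2 * a (st a I) < a c then c else st a I)"
  using ch_lev[of c I] ch_par[of c I] by (simp add: st_def)

lemma level_induct [consumes 1, case_names root ch]:
  assumes "I \<in> D" and root: "P root" and ch: "\<And>I c. c \<in> ch I \<Longrightarrow> P I \<Longrightarrow> P c"
  shows "P I"
  using assms(1)
proof (induction "lev I" arbitrary: I)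
  case 0
  then show ?case using lev_root root by metis
next
  case (Suc n)
  then have ne: "I \<noteq> root" using lev_root[of I] by auto
  moreover have "P (par I)" using Suc par_in[OF Suc.prems ne] par_lev[OF Suc.prems ne] by auto
  ultimately show ?case by (intro ch[OF in_ch_par[OF Suc.prems ne]])
qed

lemma st_below: "I \<in> D \<Longrightarrow> I \<in> below (st a I)"
proof (induction rule: level_induct)
  case (ch I c)
  have "c \<in> below (st a I)" by (rule below_trans[OF ch_below[OF ch(1)] ch(2)])
  moreover have "c \<in> below c" by (rule below_self[OF ch_in[OF ch(1)]])
  ultimately show ?case by (simp add: st_ch[OF ch(1)])
qed (simp add: root_in)

lemma st_in: "I \<in> D \<Longrightarrow> st a I \<in> D"
  using st_below below_in' by blast

lemma st_st: "I \<in> D \<Longrightarrow> st a (st a I) = st a I"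
proof (induction rule: level_induct)
  case (ch I c)
  then show ?case using st_ch[OF ch(1), of a] by (cases "2 * a (st a I) < a c") auto
qed simp

lemma st_neq_ch: "c \<in> ch I \<Longrightarrow> st a I \<noteq> c"
proof
  assume c: "c \<in> ch I" "st a I = c"
  then have "lev c \<le> lev I" using st_below[OF ch_par_in[OF c(1)], of a] below_lev by auto
  then show False using ch_lev[OF c(1)] by simp
qed

lemma st_stop: "c \<in> ch I \<Longrightarrow> st a c = c \<longleftrightarrow> 2 * a (st a I) < a c"
  using st_neq_ch[of c I a] st_ch[of c I a] by auto

lemma st_nonstop: "c \<in> ch I \<Longrightarrow> st a c \<noteq> c \<Longrightarrow> st a c = st a I"
  using st_ch[of c I a] by (auto split: if_splits)

text \<open>A cube that fails the stopping test is bounded by twice the value on the current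
  principal cube; a principal cube is compared with itself.\<close>

lemma st_av_le:
  assumes "I \<in> D" and a: "\<And>J. J \<in> D \<Longrightarrow> 0 \<le> a J" shows "a I \<le> 2 * a (st a I)"
  using assms(1)
proof (induction rule: level_induct)
  case root
  then show ?case using a[OF root_in] by simp
next
  case (ch I c)
  then show ?case using a[OF ch_in[OF ch(1)]] st_ch[OF ch(1), of a] by (auto split: if_splits)
qed

lemma st_pos:
  assumes "I \<in> D" and a: "\<And>J. J \<in> D \<Longrightarrow> 0 \<le> a J" and r: "0 < a root" shows "0 < a (st a I)"
  using assms(1)
proof (induction rule: level_induct)
  case (ch I c)
  then show ?case using a[OF ch_in[OF ch(1)]] st_ch[OF ch(1), of a] by (auto split: if_splits)
qed (use r in simp)

text \<open>The dichotomy used in \<open>osc_bound\<close>: either no principal cube occurs among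
  the first \<open>i\<close> ancestors (counting \<open>I\<close> itself), and then the principal
  cube is the same all the way up to the \<open>i\<close>-th ancestor, or the principal cube of
  \<open>I\<close> is one of them.\<close>

lemma st_chain:
  assumes "I \<in> D" shows "i \<le> lev I \<Longrightarrow>
    (\<forall>k<i. st a (anc k I) = st a (anc i I) \<and> st a (anc k I) \<noteq> anc k I) \<or> (\<exists>k<i. st a I = anc k I)"
proof (induction i)
  case (Suc i)
  have Q: "anc i I \<in> D" "anc i I \<noteq> root"
    using anc_in_lev[OF assms, of i] Suc.prems lev_root[of "anc i I"] by auto
  have ch: "anc i I \<in> ch (anc (Suc i) I)" using in_ch_par[OF Q] by (simp add: anc_Suc')
  consider "\<exists>k<i. st a I = anc k I" | "\<forall>k<i. st a (anc k I) = st a (anc i I) \<and> st a (anc k I) \<noteq> anc k I"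
    using Suc by auto
  then show ?case
  proof cases
    case 1
    then show ?thesis using less_Suc_eq by blast
  next
    case 2
    show ?thesis
    proof (cases "st a (anc i I) = anc i I")
      case True
      have "st a I = anc i I" using 2 True by (cases "i = 0") force+
      then show ?thesis by blast
    next
      case False
      then have "st a (anc i I) = st a (anc (Suc i) I)" using st_nonstop[OF ch] by blast
      then show ?thesis using 2 False less_Suc_eq by metis
    qed
  qed
qed simp

end

context dyadic_tree begin

text \<open>Positivity at the root makes all stopping values positive, so they may serve as
  denominators. If it fails, \<open>g\<close> vanishes on all leaves, a case settled in
  \<open>half_estimate\<close>.\<close>

context
  fixes w :: "'c \<Rightarrow> real" and g :: "'c \<Rightarrow> complex"
  assumes w: "weight w" and g0: "0 < avn w g root"
begin

private abbreviation "a \<equiv> avn w g"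

lemma m_pos: "I \<in> D \<Longrightarrow> 0 < a (st a I)"
  using st_pos avn_nonneg[OF w] g0 by blast

lemma a_le_m: "I \<in> D \<Longrightarrow> a I \<le> 2 * a (st a I)"
  using st_av_le avn_nonneg[OF w] by blast

lemma norm_av_le_m: "I \<in> D \<Longrightarrow> norm (av w g I) \<le> 2 * a (st a I)"
  using a_le_m norm_av_le[OF w] order_trans by blast

text \<open>The total mass of the principal cubes strictly below \<open>I\<close>, nested ones
  counted repeatedly.\<close>

definition stopw :: "'c \<Rightarrow> real" where "stopw I = (\<Sum>c\<in>ch I. \<Sum>S\<in>below c. if st a S = S then w S else 0)"

lemma stopw_ch: assumes "I \<in> D"
  shows "stopw I = (\<Sum>c\<in>ch I. (if st a c = c then w c else 0) + stopw c)"
  unfolding stopw_def by (intro sum.cong refl) (simp add: sum_below ch_in)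

text \<open>A stopping child \<open>c\<close> has average above \<open>2 * a (st a I)\<close>, so
  its share \<open>w c * a c / a (st a I)\<close> is at least twice its mass: one copy pays for
  \<open>c\<close>, the other for all principal cubes below it. The shares of the children add up to
  that of \<open>I\<close>.\<close>

lemma stopw_bound: "I \<in> D \<Longrightarrow> stopw I \<le> w I * a I / a (st a I)"
proof (induction rule: tree_induct)
  case (step I)
  show ?case
  proof (cases "lev I = N")
    case True
    then show ?thesis using step weight_pos[OF w step(1)] avn_nonneg[OF w step(1), of g] m_pos[OF step(1)]
      by (simp add: stopw_def ch_leaf)
  next
    case False
    then have l: "lev I < N" using lev_le step by fastforce
    have "stopw I \<le> (\<Sum>c\<in>ch I. w c * a c / a (st a I))"
      unfolding stopw_ch[OF step(1)]
    proof (intro sum_mono)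
      fix c assume c: "c \<in> ch I"
      have cD: "c \<in> D" using c ch_in by auto
      have wc: "0 < w c" using weight_pos[OF w cD] .
      have m: "0 < a (st a I)" using m_pos[OF step(1)] .
      show "(if st a c = c then w c else 0) + stopw c \<le> w c * a c / a (st a I)"
      proof (cases "st a c = c")
        case True
        then have gt: "2 * a (st a I) < a c" using st_stop[OF c] by auto
        then have "0 < a c" using m by linarith
        then have "stopw c \<le> w c" using step(2)[OF c] True by simp
        moreover have "2 * w c \<le> w c * a c / a (st a I)"
          using gt m wc by (simp add: pos_le_divide_eq)
        ultimately show ?thesis using True by simp
      next
        case False
        then show ?thesis using step(2)[OF c] st_nonstop[OF c False] by simp
      qed
    qed
    also have "\<dots> = w I * a I / a (st a I)"
      using avn_ch[OF w step(1) l, of g] by (simp flip: sum_divide_distrib)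
    finally show ?thesis .
  qed
qed

lemma stopw_le: assumes "I \<in> D" shows "stopw I \<le> 2 * w I"
proof -
  have "w I * a I \<le> w I * (2 * a (st a I))"
    using a_le_m[OF assms] weight_pos[OF w assms] by (intro mult_left_mono) auto
  then have "w I * a I / a (st a I) \<le> 2 * w I" using m_pos[OF assms] by (simp add: pos_divide_le_eq)
  then show ?thesis using stopw_bound[OF assms] by linarith
qed

text \<open>Carleson embedding for the principal cubes without a maximal function. With
  \<open>X\<close> the sum in question and \<open>?h\<close> the sum of the stopping values over the
  principal cubes containing a point, Fubini writes \<open>X\<close> as the integral of
  \<open>norm (g x) * ?h x\<close>. Stopping values more than double, so \<open>?h\<close> is at
  most twice its last term and the squared norm of \<open>?h\<close> is at most
  \<open>4 * X\<close>. Cauchy-Schwarz then bounds \<open>X\<close> by a multiple of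
  \<open>sqrt X\<close>.\<close>

lemma stop_norm: "(\<Sum>S\<in>D. if st a S = S then (a S)\<^sup>2 * w S else 0) \<le> 4 * nrm w g root"
proof -
  define b where "b S = (if st a S = S then a S else 0)" for S
  define X where "X = (\<Sum>S\<in>D. (b S)\<^sup>2 * w S)"
  have b0: "0 \<le> b S" if "S \<in> D" for S using avn_nonneg[OF w that] by (simp add: b_def)
  \<comment> \<open>The geometric growth of the stopping values along a branch: all earlier ones
    together do not exceed the current one.\<close>
  have H: "(\<Sum>k\<le>lev I. b (anc k I)) \<le> 2 * a (st a I)" if "I \<in> D" for I
    using that
  proof (induction rule: level_induct)
    case root
    then show ?case using lev_root[OF root_in] g0 by (simp add: b_def)
  next
    case (ch I c)
    have "(\<Sum>k\<le>lev c. b (anc k c)) = b c + (\<Sum>k\<le>lev I. b (anc k I))"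
      unfolding ch_lev[OF ch(1)] by (subst sum.atMost_Suc_shift) (simp add: anc_Suc ch_par[OF ch(1)])
    then show ?case using ch st_ch[OF ch(1), of a] st_stop[OF ch(1), of a] by (auto simp: b_def)
  qed
  let ?h = "acc b root"
  have h: "?h x = (\<Sum>k\<le>N. b (anc k x))" for x using lev_root[OF root_in] by (simp add: acc_def)
  have h0: "0 \<le> ?h x" if "x \<in> leaves root" for x unfolding h
    using that by (intro sum_nonneg b0 anc_in) (auto simp: leaves_iff)
  \<comment> \<open>One factor \<open>a S\<close> is merged with the weight:
    \<open>w S * a S\<close> is the additive mass of \<open>norm g\<close>, to which
    \<open>acc_sum\<close> applies.\<close>
  have "X = (\<Sum>S\<in>below root. b S * (w S * a S))" unfolding X_def below_root
    by (intro sum.cong refl) (simp add: b_def power2_eq_square)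
  also have "\<dots> = (\<Sum>x\<in>leaves root. (w x * a x) * ?h x)"
    by (rule acc_sum) (use avn_sum[OF w] avn_leaf[OF w] leaves_in leaves_lev root_in in auto)
  also have "\<dots> = (\<Sum>x\<in>leaves root. (w x * norm (g x)) * ?h x)"
    by (intro sum.cong refl) (use avn_leaf[OF w] leaves_in leaves_lev in auto)
  also have "\<dots> = (\<Sum>x\<in>leaves root. sqrt (w x * (norm (g x))\<^sup>2) * sqrt (w x * (?h x)\<^sup>2))"
  proof (rule sum.cong[OF refl])
    fix x assume x: "x \<in> leaves root"
    have "0 \<le> w x" using weight_nonneg[OF w leaves_in[OF x]] .
    then have "sqrt (w x) * sqrt (w x) = w x" by simp
    then show "(w x * norm (g x)) * ?h x = sqrt (w x * (norm (g x))\<^sup>2) * sqrt (w x * (?h x)\<^sup>2)"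
      using h0[OF x] by (simp add: real_sqrt_mult)
  qed
  also have "\<dots> \<le> sqrt (\<Sum>x\<in>leaves root. w x * (norm (g x))\<^sup>2) * sqrt (\<Sum>x\<in>leaves root. w x * (?h x)\<^sup>2)"
    by (rule cs_sum) (use weight_nonneg[OF w leaves_in] in auto)
  finally have X1: "X \<le> sqrt (nrm w g root) * sqrt (\<Sum>x\<in>leaves root. w x * (?h x)\<^sup>2)" by (simp add: nrm_def)
  have "(\<Sum>x\<in>leaves root. w x * (?h x)\<^sup>2) \<le> (\<Sum>x\<in>leaves root. w x * (4 * acc (\<lambda>S. (b S)\<^sup>2) root x))"
  proof (intro sum_mono mult_left_mono)
    fix x assume x: "x \<in> leaves root"
    have xD: "x \<in> D" "lev x = N" using x leaves_in leaves_lev by auto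
    have "?h x \<le> 2 * a (st a x)" using H[OF xD(1)] xD by (simp add: h)
    then have "(?h x)\<^sup>2 \<le> (2 * a (st a x))\<^sup>2" using h0[OF x] by (intro power_mono)
    moreover have "(a (st a x))\<^sup>2 \<le> (\<Sum>k\<le>N. (b (anc k x))\<^sup>2)"
    proof -
      have sb: "x \<in> below (st a x)" using st_below xD by blast
      define k where "k = lev x - lev (st a x)"
      have k: "anc k x = st a x" "k \<le> N" using sb xD by (auto simp: below_iff k_def)
      have "(b (anc k x))\<^sup>2 \<le> (\<Sum>k\<le>N. (b (anc k x))\<^sup>2)"
        using k by (intro member_le_sum) auto
      then show ?thesis using k st_st[OF xD(1), of a] by (simp add: b_def)
    qed
    ultimately show "(?h x)\<^sup>2 \<le> 4 * acc (\<lambda>S. (b S)\<^sup>2) root x"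
      using lev_root[OF root_in] by (simp add: acc_def)
    show "0 \<le> w x" using weight_nonneg[OF w xD(1)] .
  qed
  also have "\<dots> = 4 * (\<Sum>x\<in>leaves root. w x * acc (\<lambda>S. (b S)\<^sup>2) root x)"
    by (simp only: sum_distrib_left mult.left_commute)
  also have "\<dots> = 4 * X"
    using acc_sum[OF weight_leaves[OF w] root_in, of "\<lambda>S. (b S)\<^sup>2"] by (simp add: X_def below_root)
  finally have X2: "(\<Sum>x\<in>leaves root. w x * (?h x)\<^sup>2) \<le> 4 * X" .
  have X0: "0 \<le> X" unfolding X_def using weight_nonneg[OF w] by (intro sum_nonneg mult_nonneg_nonneg) auto
  have "X \<le> sqrt (nrm w g root) * sqrt (4 * X)"
    using X1 mult_left_mono[OF real_sqrt_le_mono[OF X2], of "sqrt (nrm w g root)"] nrm_nonneg[OF w] by auto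
  then have "X\<^sup>2 \<le> (sqrt (nrm w g root) * sqrt (4 * X))\<^sup>2" using X0 by (intro power_mono)
  also have "\<dots> = nrm w g root * (4 * X)" using X0 nrm_nonneg[OF w] by (simp add: power_mult_distrib)
  finally have "X * X \<le> (4 * nrm w g root) * X" by (simp add: power2_eq_square)
  then have "X \<le> 4 * nrm w g root" using X0 nrm_nonneg[OF w, of g root] by (cases "X = 0") auto
  moreover have "X = (\<Sum>S\<in>D. if st a S = S then (a S)\<^sup>2 * w S else 0)"
    unfolding X_def b_def by (intro sum.cong) auto
  ultimately show ?thesis by simp
qed

text \<open>The squared increment of the average from the parent to \<open>L\<close>, in units of
  the stopping value. At a principal cube the stopping value gives no control of the jump from the
  parent, so the coefficient is set to 1 and the packing of the principal cubes is used instead. The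
  root is principal, hence its meaningless parent never enters.\<close>

definition cL :: "'c \<Rightarrow> real" where
  "cL L = (if st a L = L then 1 else (norm (av w g L - av w g (par L)))\<^sup>2 / (a (st a L))\<^sup>2)"

lemma cL_nonneg: "0 \<le> cL L"
  by (simp add: cL_def)

lemma cL_le: assumes "L \<in> D" shows "cL L \<le> 16"
proof (cases "st a L = L")
  case False
  then have "L \<noteq> root" by auto
  then have c: "L \<in> ch (par L)" using in_ch_par assms by auto
  let ?m = "a (st a L)"
  have "st a (par L) = st a L" using st_nonstop[OF c False] by simp
  then have "norm (av w g (par L)) \<le> 2 * ?m" using norm_av_le_m[OF ch_par_in[OF c]] by simp
  then have "norm (av w g L - av w g (par L)) \<le> 4 * ?m"
    using norm_av_le_m[OF assms] norm_triangle_ineq4[of "av w g L" "av w g (par L)"] by linarith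
  then have "(norm (av w g L - av w g (par L)))\<^sup>2 \<le> (4 * ?m)\<^sup>2" by (intro power_mono) auto
  then show ?thesis using False m_pos[OF assms] by (simp add: cL_def power_mult_distrib pos_divide_le_eq)
qed (simp add: cL_def)

text \<open>By induction on the sum over the cubes strictly below \<open>I\<close> plus \<open>w I * (norm (av w g I))\<^sup>2 / (a (st a I))\<^sup>2\<close>:
  the increments of the second term telescope as long as the stopping value stays the same.\<close>

lemma cL_carleson:
  assumes d: "\<And>I c. c \<in> ch I \<Longrightarrow> w I \<le> d * w c" and d0: "0 \<le> d"
  shows "carleson w cL (22 + 8 * d\<^sup>2)"
proof -
  define W where "W I = (\<Sum>c\<in>ch I. \<Sum>L\<in>below c. cL L * w L)" for I
  \<comment> \<open>At a stopping child, 1 pays for \<open>cL c = 1\<close> and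
    \<open>4 * d\<^sup>2\<close> for the energy term that no longer telescopes: by doubling, the
    average of \<open>norm g\<close> over the child is at most \<open>d\<close> times that over
    \<open>I\<close>, hence at most \<open>2 * d\<close> times the stopping value.\<close>
  let ?k = "1 + 4 * d\<^sup>2"
  have Wch: "W I = (\<Sum>c\<in>ch I. cL c * w c + W c)" if "I \<in> D" for I
    unfolding W_def by (intro sum.cong refl) (simp add: sum_below ch_in)
  have G: "W I + w I * ((norm (av w g I))\<^sup>2 / (a (st a I))\<^sup>2) \<le> 4 * w I + ?k * stopw I" if "I \<in> D" for I
    using that
  proof (induction rule: tree_induct)
    case (step I)
    let ?m = "a (st a I)"
    have m: "0 < ?m" using m_pos[OF step(1)] .
    show ?case
    proof (cases "lev I = N")
      case True
      have "(norm (av w g I))\<^sup>2 \<le> (2 * ?m)\<^sup>2" using norm_av_le_m[OF step(1)] by (intro power_mono) auto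
      then have "(norm (av w g I))\<^sup>2 / ?m\<^sup>2 \<le> 4" using m by (simp add: power_mult_distrib pos_divide_le_eq)
      then have "w I * ((norm (av w g I))\<^sup>2 / ?m\<^sup>2) \<le> w I * 4"
        using weight_nonneg[OF w step(1)] by (intro mult_left_mono)
      then show ?thesis using True step(1) by (simp add: W_def stopw_def ch_leaf)
    next
      case False
      then have l: "lev I < N" using lev_le step by fastforce
      let ?E = "\<lambda>c. (norm (av w g c))\<^sup>2 / ?m\<^sup>2"
      let ?e = "\<lambda>c. w c * ((norm (av w g c - av w g I))\<^sup>2 / ?m\<^sup>2)"
      have b: "cL c * w c + W c \<le> ?e c - w c * ?E c + 4 * w c + ?k * ((if st a c = c then w c else 0) + stopw c)"
        if c: "c \<in> ch I" for c
      proof -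
        have cD: "c \<in> D" using c ch_in by auto
        have wc: "0 \<le> w c" using weight_nonneg[OF w cD] .
        note IH = step(2)[OF c]
        show ?thesis
        proof (cases "st a c = c")
          case True
          have "a c \<le> d * a I"
          proof -
            have "w c * a c \<le> (\<Sum>c\<in>ch I. w c * a c)"
              using c weight_nonneg[OF w] avn_nonneg[OF w] ch_in
              by (intro member_le_sum[where f="\<lambda>c. w c * a c"]) auto
            also have "\<dots> = w I * a I" by (rule avn_ch[OF w step(1) l])
            also have "\<dots> \<le> (d * w c) * a I" using d[OF c] avn_nonneg[OF w step(1)] by (intro mult_right_mono) auto
            finally show ?thesis using weight_pos[OF w cD] by (simp add: mult.commute mult.left_commute)
          qed
          also have "\<dots> \<le> d * (2 * ?m)" using a_le_m[OF step(1)] d0 by (intro mult_left_mono)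
          finally have "norm (av w g c) \<le> 2 * d * ?m" using norm_av_le[OF w cD, of g] by simp
          then have "(norm (av w g c))\<^sup>2 \<le> (2 * d * ?m)\<^sup>2" by (intro power_mono) auto
          then have "?E c \<le> 4 * d\<^sup>2" using m by (simp add: power_mult_distrib pos_divide_le_eq)
          then have 1: "w c * ?E c \<le> w c * (4 * d\<^sup>2)" using wc by (intro mult_left_mono)
          have "W c \<le> W c + w c * ((norm (av w g c))\<^sup>2 / (a (st a c))\<^sup>2)" using wc by simp
          also note IH
          finally have "W c \<le> 4 * w c + ?k * stopw c" .
          moreover have "0 \<le> ?e c" using wc by simp
          ultimately show ?thesis using 1 True by (simp add: cL_def distrib_left distrib_right mult.commute)
        next
          case False
          have s: "st a c = st a I" using st_nonstop[OF c False] .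
          have p: "par c = I" using ch_par[OF c] .
          show ?thesis using IH False by (simp add: cL_def s p mult.commute)
        qed
      qed
      have v: "(\<Sum>c\<in>ch I. ?e c) = (\<Sum>c\<in>ch I. w c * ?E c) - w I * ?E I"
        using variance[OF w step(1) l, of g 0]
        by (simp add: dl_def flip: sum_divide_distrib diff_divide_distrib)
      have "W I \<le> (\<Sum>c\<in>ch I. ?e c - w c * ?E c + 4 * w c + ?k * ((if st a c = c then w c else 0) + stopw c))"
        unfolding Wch[OF step(1)] by (intro sum_mono b)
      also have "\<dots> = (\<Sum>c\<in>ch I. ?e c) - (\<Sum>c\<in>ch I. w c * ?E c) + 4 * (\<Sum>c\<in>ch I. w c) + ?k * stopw I"
        unfolding stopw_ch[OF step(1)] by (simp only: sum_distrib_left) (simp only: sum.distrib sum_subtractf)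
      also have "\<dots> = 4 * w I + ?k * stopw I - w I * ?E I"
        unfolding v weight_ch[OF w step(1) l] by simp
      finally show ?thesis by simp
    qed
  qed
  show ?thesis unfolding carleson_def
  proof
    fix I assume I: "I \<in> D"
    have wI: "0 \<le> w I" using weight_nonneg[OF w I] .
    have "W I \<le> W I + w I * ((norm (av w g I))\<^sup>2 / (a (st a I))\<^sup>2)" using wI by simp
    also have "\<dots> \<le> 4 * w I + ?k * stopw I" by (rule G[OF I])
    also have "\<dots> \<le> 4 * w I + ?k * (2 * w I)" using stopw_le[OF I] by (intro add_left_mono mult_left_mono) auto
    finally have 1: "W I \<le> 4 * w I + ?k * (2 * w I)" .
    \<comment> \<open>The total \<open>22 + 8 * d\<^sup>2\<close> consists of 16 for the cube
      itself, 4 from the bounded energy, and \<open>2 * ?k\<close> from the packing of the principal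
      cubes.\<close>
    have "cL I * w I \<le> 16 * w I" using cL_le[OF I] wI by (intro mult_right_mono)
    moreover have "(\<Sum>L\<in>below I. cL L * w L) = cL I * w I + W I" using I by (simp add: sum_below W_def)
    ultimately show "(\<Sum>L\<in>below I. cL L * w L) \<le> (22 + 8 * d\<^sup>2) * w I"
      using 1 by (simp add: algebra_simps)
  qed
qed

end

section \<open>Moving Carleson sequences between two weights\<close>

definition transfers :: "('c \<Rightarrow> real) \<Rightarrow> ('c \<Rightarrow> real) \<Rightarrow> real \<Rightarrow> bool" where
  "transfers \<mu> \<nu> k \<longleftrightarrow>
    (\<forall>a M. 0 < M \<longrightarrow> (\<forall>I\<in>D. 0 \<le> a I) \<longrightarrow> carleson \<mu> a M \<longrightarrow> carleson \<nu> a (k * M))"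

text \<open>The \<open>s\<close>-mean over \<open>Q\<close> of the function that collects the
  coefficients \<open>c\<close> of the \<open>j\<close> generations strictly below
  \<open>Q\<close>.\<close>

definition red :: "('c \<Rightarrow> real) \<Rightarrow> ('c \<Rightarrow> real) \<Rightarrow> nat \<Rightarrow> 'c \<Rightarrow> real" where
  "red s c j Q = (\<Sum>i\<in>{1..j}. \<Sum>L\<in>desc i Q. c L * s L) / s Q"

lemma red_nonneg:
  assumes "weight s" "\<And>L. L \<in> D \<Longrightarrow> 0 \<le> c L" "Q \<in> D" shows "0 \<le> red s c j Q"
  unfolding red_def using assms desc_in weight_nonneg[OF assms(1)]
  by (intro divide_nonneg_nonneg sum_nonneg mult_nonneg_nonneg) auto

text \<open>A cube enters the windows of at most \<open>j\<close> ancestors; the detour through \<open>s\<close> turns the \<open>s\<close>-averages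
  into plain sums.\<close>

lemma red_carleson:
  assumes s: "weight s" and c: "\<And>L. L \<in> D \<Longrightarrow> 0 \<le> c L" and car: "carleson w c M" and M: "0 < M"
    and k: "transfers w s k" "transfers s w k" and k0: "0 < k" and j: "0 < j"
  shows "carleson w (red s c j) (k * (real j * (k * M)))"
proof -
  have cs: "carleson s c (k * M)" using k(1) c car M by (auto simp: transfers_def)
  have "carleson s (red s c j) (real j * (k * M))"
    unfolding carleson_def
  proof
    fix M' assume M': "M' \<in> D"
    have "(\<Sum>Q\<in>below M'. red s c j Q * s Q) = (\<Sum>Q\<in>below M'. \<Sum>i\<in>{1..j}. \<Sum>L\<in>desc i Q. c L * s L)"
    proof (rule sum.cong[OF refl])
      fix Q assume "Q \<in> below M'"
      then have "s Q \<noteq> 0" using weight_pos[OF s below_in[of Q M']] by simp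
      then show "red s c j Q * s Q = (\<Sum>i\<in>{1..j}. \<Sum>L\<in>desc i Q. c L * s L)" by (simp add: red_def)
    qed
    also have "\<dots> = (\<Sum>i\<in>{1..j}. \<Sum>Q\<in>below M'. \<Sum>L\<in>desc i Q. c L * s L)" by (rule sum.swap)
    also have "\<dots> \<le> (\<Sum>i\<in>{1..j}. \<Sum>L\<in>below M'. c L * s L)"
    proof (rule sum_mono)
      fix i
      have "(\<Sum>Q\<in>below M'. \<Sum>L\<in>desc i Q. c L * s L) = (\<Sum>L\<in>(\<Union>Q\<in>below M'. desc i Q). c L * s L)"
        by (rule sum.UNION_disjoint[symmetric]) (auto simp: desc_def fin_D)
      also have "\<dots> \<le> (\<Sum>L\<in>below M'. c L * s L)"
      proof (rule sum_mono2)
        show "(\<Union>Q\<in>below M'. desc i Q) \<subseteq> below M'" by (blast intro: below_trans desc_below)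
        fix L assume "L \<in> below M' - (\<Union>Q\<in>below M'. desc i Q)"
        then have "L \<in> D" by (auto dest: below_in)
        then show "0 \<le> c L * s L" using c weight_nonneg[OF s] by simp
      qed simp
      finally show "(\<Sum>Q\<in>below M'. \<Sum>L\<in>desc i Q. c L * s L) \<le> (\<Sum>L\<in>below M'. c L * s L)" .
    qed
    also have "\<dots> \<le> (\<Sum>i\<in>{1..j}. (k * M) * s M')"
      using cs M' by (intro sum_mono) (simp add: carleson_def)
    finally show "(\<Sum>Q\<in>below M'. red s c j Q * s Q) \<le> real j * (k * M) * s M'" by simp
  qed
  then show ?thesis using k(2) red_nonneg[OF s c] j k0 M unfolding transfers_def by simp
qed

end

context dyadic_tree begin

lemma sum_desc_group:
  assumes "k \<le> j" "Q \<in> D"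
  shows "(\<Sum>I\<in>desc j Q. F I (anc k I)) = (\<Sum>L\<in>desc (j - k) Q. \<Sum>I\<in>desc k L. F I L)"
proof -
  have m: "anc k I \<in> desc (j - k) Q" if I: "I \<in> desc j Q" for I
  proof -
    have a: "I \<in> D" "j \<le> lev I" "anc j I = Q" using I by (auto simp: desc_def)
    have "anc (j - k) (anc k I) = Q" using assms(1) a by (simp flip: anc_add)
    then show ?thesis using a assms anc_in_lev[of I k] by (auto simp: desc_def)
  qed
  have "(\<Sum>I\<in>desc j Q. F I (anc k I)) = (\<Sum>L\<in>desc (j - k) Q. \<Sum>I\<in>{I\<in>desc j Q. anc k I = L}. F I (anc k I))"
    by (rule sum.group[symmetric]) (use m in auto)
  also have "\<dots> = (\<Sum>L\<in>desc (j - k) Q. \<Sum>I\<in>desc k L. F I L)"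
  proof (rule sum.cong[OF refl])
    fix L assume L: "L \<in> desc (j - k) Q"
    have "{I\<in>desc j Q. anc k I = L} = desc k L"
    proof (intro set_eqI iffI)
      fix I assume "I \<in> desc k L"
      then have a: "I \<in> D" "k \<le> lev I" "anc k I = L" by (auto simp: desc_def)
      have l: "L \<in> D" "j - k \<le> lev L" "anc (j - k) L = Q" using L by (auto simp: desc_def)
      have "anc j I = anc (j - k) (anc k I)" using assms(1) by (simp flip: anc_add)
      then show "I \<in> {I\<in>desc j Q. anc k I = L}" using a l lev_anc[OF a(1,2)] assms(1)
        by (auto simp: desc_def)
    qed (use assms(1) in \<open>auto simp: desc_def\<close>)
    then show "(\<Sum>I\<in>{I\<in>desc j Q. anc k I = L}. F I (anc k I)) = (\<Sum>I\<in>desc k L. F I L)"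
      by (simp add: desc_anc cong: sum.cong)
  qed
  finally show ?thesis .
qed

lemma desc_disj: "Q \<noteq> Q' \<Longrightarrow> desc i Q \<inter> desc i Q' = {}"
  by (auto simp: desc_def)

lemma sum_group_st:
  "sum F D = (\<Sum>S\<in>D. \<Sum>Q\<in>{Q\<in>D. st a Q = S}. F Q)"
  by (rule sum.group[symmetric]) (use fin_D st_in in auto)

definition B :: "('c \<Rightarrow> 'c \<Rightarrow> complex) \<Rightarrow> ('c \<Rightarrow> complex) \<Rightarrow> ('c \<Rightarrow> complex) \<Rightarrow> complex" where
  "B b u v = (\<Sum>x\<in>leaves root. \<Sum>y\<in>leaves root. b x y * u x * v y)"

lemma B_left: "B b (\<lambda>x. \<Sum>i\<in>P. c i * u i x) v = (\<Sum>i\<in>P. c i * B b (u i) v)"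
proof -
  have "B b (\<lambda>x. \<Sum>i\<in>P. c i * u i x) v
      = (\<Sum>x\<in>leaves root. \<Sum>i\<in>P. \<Sum>y\<in>leaves root. c i * (b x y * u i x * v y))"
    unfolding B_def by (rule sum.cong[OF refl], subst sum.swap)
      (simp add: sum_distrib_left sum_distrib_right mult_ac)
  also have "\<dots> = (\<Sum>i\<in>P. c i * B b (u i) v)"
    unfolding B_def by (subst sum.swap) (simp only: sum_distrib_left)
  finally show ?thesis .
qed

lemma B_transpose: "B b u v = B (\<lambda>x y. b y x) v u"
  unfolding B_def by (subst sum.swap) (simp only: mult_ac)

lemma B_right: "B b u (\<lambda>x. \<Sum>i\<in>P. c i * v i x) = (\<Sum>i\<in>P. c i * B b u (v i))"
  using B_left[where b="\<lambda>x y. b y x" and P=P and c=c and u=v and v=u] by (simp only: B_transpose[of b])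

lemma B_cong: "(\<And>x. x \<in> leaves root \<Longrightarrow> u x = u' x) \<Longrightarrow> (\<And>x. x \<in> leaves root \<Longrightarrow> v x = v' x) \<Longrightarrow> B b u v = B b u' v'"
  unfolding B_def by (intro sum.cong refl) auto

lemma indic_desc:
  assumes "S \<in> D" "lev S + i \<le> N" "x \<in> leaves root"
  shows "indic S x = (\<Sum>J\<in>desc i S. indic J x)"
proof -
  have x: "x \<in> D" "lev x = N" using assms leaves_in leaves_lev by auto
  define J where "J = anc (N - (lev S + i)) x"
  have J: "J \<in> D" "lev J = lev S + i" using anc_in_lev[OF x(1), of "N - (lev S + i)"] assms x by (auto simp: J_def)
  have e: "K = J" if "K \<in> D" "lev K = lev S + i" "x \<in> leaves K" for K
    using that by (simp add: leaves_iff J_def)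
  have xJ: "x \<in> leaves J" using x J assms J_def by (simp add: leaves_iff)
  have iff: "x \<in> leaves S \<longleftrightarrow> J \<in> desc i S"
  proof
    assume "x \<in> leaves S"
    then have "J \<in> below S" using below_comparable[of x S J] leaves_below xJ J by auto
    then show "J \<in> desc i S" using below_desc[of J S] J by simp
  next
    assume "J \<in> desc i S"
    then show "x \<in> leaves S" using leaves_mono[OF desc_below] xJ by blast
  qed
  have "(\<Sum>K\<in>desc i S. indic K x) = (\<Sum>K\<in>desc i S. if K = J then 1 else (0::complex))"
    by (intro sum.cong refl) (use e xJ desc_in desc_lev in \<open>auto simp: indic_def\<close>)
  then show ?thesis using iff by (simp add: indic_def)
qed

end

section \<open>The stopping estimate\<close>

lemma sum_weighted_powers: "(\<Sum>j\<le>n. (1 + real j) / 2 ^ j) \<le> 4"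
proof -
  have "(\<Sum>j\<le>n. (1 + real j) / 2 ^ j) = 4 - (real n + 3) / 2 ^ n"
    by (induction n) (auto simp: field_simps)
  then show ?thesis by simp
qed

lemma norm_three_sq_le:
  "(norm (p - t))\<^sup>2 \<le> 3 * (norm (p - q))\<^sup>2 + 3 * (norm (q - r))\<^sup>2 + 3 * (norm (r - t :: complex))\<^sup>2"
proof -
  let ?a = "norm (p - q)" and ?b = "norm (q - r)" and ?c = "norm (r - t)"
  have "norm (p - t) \<le> ?a + ?b + ?c"
    using norm_triangle_ineq[of "p - q" "q - r"] norm_triangle_ineq[of "p - r" "r - t"] by simp
  then have "(norm (p - t))\<^sup>2 \<le> (?a + ?b + ?c)\<^sup>2" by (intro power_mono) auto
  moreover have "0 \<le> (?a - ?b)\<^sup>2 + (?b - ?c)\<^sup>2 + (?a - ?c)\<^sup>2" by simp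
  ultimately show ?thesis by (simp add: power2_eq_square algebra_simps)
qed

locale two_weight_tree = dyadic_adj D lev par root N adj deg
  for D :: "'c set" and lev par root N adj deg +
  fixes s w :: "'c \<Rightarrow> real" and d C \<eta> k :: real
  assumes ws: "weight s" and ww: "weight w"
    and dw: "doubling w d" and d0: "1 \<le> d"
    and thin: "thin_boundary w C \<eta>" and C0: "0 \<le> C" and eta: "0 < \<eta>" "\<eta> < 1"
    and tr: "transfers w s k" "transfers s w k" and k0: "0 < k"
begin

text \<open>Bounds the joint mass of all neighbours of a cube by a multiple of its own mass.\<close>

definition "\<kappa> = real deg * d"
definition "KB = 2 * (1 + d) * real deg * C / (1 - sqrt \<eta>)\<^sup>2"
definition "KC = k * k * (22 + 8 * d\<^sup>2)"
text \<open>The factor 3 comes from splitting a square into three differences, the summands from the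
  five sums in \<open>X_terms\<close>: oscillation inside a neighbour, adjacent averages, windows of
  increments, boundary cubes, and principal cubes within the window. Each of the last three contains
  the 4 of \<open>stop_norm\<close>; in addition
  \<open>(j + 8) * j \<le> 8 * (1 + j)\<^sup>2\<close> gives the first 32.\<close>

definition "KX = 3 * (real deg + d * KB + (32 * \<kappa> * KC + 16 * \<kappa> * C / (1 - \<eta>) + 32))"

lemma kappa0: "0 \<le> \<kappa>" and KB0: "0 \<le> KB" and KC0: "0 \<le> KC" and KX0: "0 \<le> KX"
proof -
  show 1: "0 \<le> \<kappa>" using d0 by (simp add: \<kappa>_def)
  show 2: "0 \<le> KB" using d0 C0 by (simp add: KB_def)
  show 3: "0 \<le> KC" using k0 by (simp add: KC_def)
  show "0 \<le> KX" unfolding KX_def using 1 2 3 d0 C0 eta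
    by (intro mult_nonneg_nonneg add_nonneg_nonneg divide_nonneg_nonneg) auto
qed

lemma nb_desc_sum_le: assumes "Q \<in> D" shows "(\<Sum>R\<in>nb Q. sum w (desc j R)) \<le> \<kappa> * w Q"
proof -
  have "(\<Sum>R\<in>nb Q. sum w (desc j R)) \<le> sum w (nb Q)"
    by (intro sum_mono weight_desc_le[OF ww] nb_in)
  then show ?thesis using nb_sum_le[OF dw ww assms] by (simp add: \<kappa>_def)
qed

context
  fixes g :: "'c \<Rightarrow> complex"
  assumes g0: "0 < avn w g root"
begin

private abbreviation "ag \<equiv> avn w g"
private abbreviation "E \<equiv> av w g"
private abbreviation "c \<equiv> cL w g"
private abbreviation "G \<equiv> nrm w g root"

text \<open>The error of the paraproduct: \<open>E J\<close> is compared with \<open>E I\<close> on the principal cube of \<open>I\<close> and with \<open>0\<close>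
  outside, which is what remains of \<open>E\<^sub>k g\<close> after subtracting \<open>E I\<close> times the indicator of \<open>st ag I\<close>.\<close>

definition tau :: "'c \<Rightarrow> 'c \<Rightarrow> real" where
  "tau I J = norm (E J - (if J \<in> below (st ag I) then E I else 0))"

definition Y :: "nat \<Rightarrow> 'c \<Rightarrow> 'c \<Rightarrow> real" where
  "Y j Q I = (\<Sum>R\<in>nb Q. \<Sum>J\<in>desc j R. w J * (tau I J)\<^sup>2)"

text \<open>The ratio \<open>s I / s Q\<close> is what Cauchy-Schwarz leaves in
  \<open>half_estimate\<close> from the square roots of the same ratio in the coefficients. This is
  the place where the two weights meet.\<close>

definition X :: "nat \<Rightarrow> real" where
  "X j = (\<Sum>Q\<in>D. \<Sum>I\<in>desc j Q. (s I / s Q) * Y j Q I)"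

private definition "V j R = (\<Sum>J\<in>desc j R. w J * (norm (E J - E R))\<^sup>2)"
private definition "cs j I = (\<Sum>k<j. c (anc k I))"
text \<open>Records the squared stopping value of \<open>I\<close> when its principal cube lies
  within the window of \<open>j\<close> generations and contains \<open>J\<close>. In that case
  \<open>E I\<close> is not controlled by the stopping value of \<open>Q\<close>.\<close>

private definition "cst j I J = (\<Sum>k<j. if st ag I = anc k I \<and> J \<in> below (anc k I) then (ag (anc k I))\<^sup>2 else 0)"

lemma c_carleson: "carleson w c (22 + 8 * d\<^sup>2)"
  using cL_carleson[OF ww g0, of d] dw d0 ch_par_in by (auto simp: doubling_def)

lemma red_sum_le: assumes S: "S \<in> D"
  shows "(\<Sum>Q\<in>below S. red s c j Q * w Q) \<le> (KC * real j) * w S"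
proof (cases "j = 0")
  case False
  have M: "0 < 22 + 8 * d\<^sup>2" by (simp add: add_pos_nonneg)
  have "carleson w (red s c j) (k * (real j * (k * (22 + 8 * d\<^sup>2))))"
    using False by (intro red_carleson[OF ws _ c_carleson M tr k0]) (auto simp: cL_nonneg[OF ww g0])
  then show ?thesis using S unfolding carleson_def KC_def by (simp add: mult_ac)
qed (simp add: red_def)

text \<open>By \<open>st_chain\<close> there are two cases. Without a principal cube between
  \<open>I\<close> and \<open>Q\<close>, the difference \<open>E I - E Q\<close> telescopes into
  increments measured by \<open>cL\<close>; and if \<open>J\<close> lies outside the common
  principal cube, then so does \<open>R\<close>, which makes \<open>Q\<close> a boundary cube. With
  a principal cube in between, one coefficient \<open>cL\<close> equals 1, so \<open>E Q\<close>
  itself is absorbed into the first term and \<open>E I\<close> into \<open>cst\<close>.\<close>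

lemma osc_bound:
  assumes Q: "Q \<in> D" and I: "I \<in> desc j Q" and R: "R \<in> nb Q" and J: "J \<in> desc j R"
  shows "(norm (E Q - (if J \<in> below (st ag I) then E I else 0)))\<^sup>2
    \<le> (real j + 8) * (ag (st ag Q))\<^sup>2 * cs j I
      + (if boundary Q (st ag Q) then 4 * (ag (st ag Q))\<^sup>2 else 0) + 8 * cst j I J"
proof -
  have I': "I \<in> D" "j \<le> lev I" "anc j I = Q" using I by (auto simp: desc_def)
  let ?m = "ag (st ag Q)"
  have mQ: "0 < ?m" using m_pos[OF ww g0 Q] .
  have EQ: "(norm (E Q))\<^sup>2 \<le> 4 * ?m\<^sup>2"
    using power_mono[OF norm_av_le_m[OF ww g0 Q], of 2] by (simp add: power_mult_distrib)
  have cs0: "0 \<le> cs j I" unfolding cs_def by (intro sum_nonneg cL_nonneg[OF ww g0])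
  have cst0: "0 \<le> cst j I J" unfolding cst_def by (intro sum_nonneg) auto
  consider "\<forall>k<j. st ag (anc k I) = st ag Q \<and> st ag (anc k I) \<noteq> anc k I" | k where "k < j" "st ag I = anc k I"
    using st_chain[OF I'(1,2), of ag] I'(3) by auto
  then show ?thesis
  proof cases
    case 1
    have stI: "st ag I = st ag Q" using 1 I'(3) by (cases "j = 0") force+
    show ?thesis
    proof (cases "J \<in> below (st ag I)")
      case True
      have cc: "c (anc k I) = (norm (E (anc k I) - E (anc (Suc k) I)))\<^sup>2 / ?m\<^sup>2" if "k < j" for k
      proof -
        have e: "st ag (anc k I) = st ag Q" and "st ag (anc k I) \<noteq> anc k I" using 1 that by blast+
        then have "st ag Q \<noteq> anc k I" by metis
        then show ?thesis by (simp add: cL_def[OF ww g0] e anc_Suc')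
      qed
      have "(norm (E I - E Q))\<^sup>2 \<le> (\<Sum>k<j. norm (E (anc k I) - E (anc (Suc k) I)))\<^sup>2"
        using anc_chain[of E I j] I'(3) by (intro power_mono) auto
      also have "\<dots> \<le> real j * (\<Sum>k<j. (norm (E (anc k I) - E (anc (Suc k) I)))\<^sup>2)"
        using sum_sq_le_card[of _ "{..<j}"] by simp
      also have "(\<Sum>k<j. (norm (E (anc k I) - E (anc (Suc k) I)))\<^sup>2) = (\<Sum>k<j. ?m\<^sup>2 * c (anc k I))"
        by (intro sum.cong refl) (use cc mQ in simp)
      also have "real j * \<dots> = real j * ?m\<^sup>2 * cs j I" by (simp add: cs_def sum_distrib_left mult.assoc)
      also have "\<dots> \<le> (real j + 8) * ?m\<^sup>2 * cs j I" using cs0 by (intro mult_right_mono) auto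
      finally show ?thesis using True cst0 by (simp add: norm_minus_commute add_increasing2)
    next
      case False
      have "R \<notin> below (st ag Q)" using False stI desc_below[OF J] below_trans by metis
      then have "boundary Q (st ag Q)" using R by (auto simp: boundary_def)
      moreover have "0 \<le> (real j + 8) * ?m\<^sup>2 * cs j I" using cs0 by simp
      ultimately show ?thesis using EQ False cst0 by simp
    qed
  next
    case 2
    let ?z = "if J \<in> below (st ag I) then E I else 0"
    have "c (anc k I) = 1" using st_st[OF I'(1), of ag] 2 by (simp add: cL_def[OF ww g0])
    then have "1 \<le> cs j I" unfolding cs_def using member_le_sum[of k "{..<j}" "\<lambda>k. c (anc k I)"] 2
      by (simp add: cL_nonneg[OF ww g0])
    then have A: "4 * ?m\<^sup>2 \<le> 4 * ?m\<^sup>2 * cs j I"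
      using mult_left_mono[of 1 "cs j I" "4 * ?m\<^sup>2"] by simp
    have Bz: "(norm ?z)\<^sup>2 \<le> 4 * cst j I J"
    proof (cases "J \<in> below (st ag I)")
      case True
      have "(if st ag I = anc k I \<and> J \<in> below (anc k I) then (ag (anc k I))\<^sup>2 else 0) \<le> cst j I J"
        unfolding cst_def using 2 by (intro member_le_sum[where f="\<lambda>k. if st ag I = anc k I \<and> J \<in> below (anc k I) then (ag (anc k I))\<^sup>2 else 0"]) auto
      then have "(ag (st ag I))\<^sup>2 \<le> cst j I J" using True 2 by simp
      moreover have "(norm (E I))\<^sup>2 \<le> 4 * (ag (st ag I))\<^sup>2"
        using power_mono[OF norm_av_le_m[OF ww g0 I'(1)], of 2] by (simp add: power_mult_distrib)
      ultimately show ?thesis using True by simp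
    qed (use cst0 in simp)
    have "(norm (E Q - ?z))\<^sup>2 \<le> 2 * (norm (E Q))\<^sup>2 + 2 * (norm ?z)\<^sup>2"
      using norm_diff_sq_le[of "E Q" ?z 0] by simp
    also have "\<dots> \<le> 8 * ?m\<^sup>2 * cs j I + 8 * cst j I J" using EQ A Bz by linarith
    also have "\<dots> \<le> (real j + 8) * ?m\<^sup>2 * cs j I + 8 * cst j I J"
      using cs0 by (intro add_right_mono mult_right_mono) auto
    also have "\<dots> \<le> (real j + 8) * ?m\<^sup>2 * cs j I
      + (if boundary Q (st ag Q) then 4 * ?m\<^sup>2 else 0) + 8 * cst j I J" by simp
    finally show ?thesis .
  qed
qed

text \<open>Cubes are grouped by their principal cube. A packing bound inside each group is then all
  that is required, since the squared stopping values are summed by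
  \<open>stop_norm\<close>.\<close>

lemma stop_sum_le:
  assumes F: "\<And>S. S \<in> D \<Longrightarrow> st ag S = S \<Longrightarrow> (\<Sum>Q\<in>{Q\<in>D. st ag Q = S}. F Q) \<le> M * w S" and M: "0 \<le> M"
  shows "(\<Sum>Q\<in>D. (ag (st ag Q))\<^sup>2 * F Q) \<le> M * (4 * G)"
proof -
  have "(\<Sum>Q\<in>D. (ag (st ag Q))\<^sup>2 * F Q) = (\<Sum>S\<in>D. \<Sum>Q\<in>{Q\<in>D. st ag Q = S}. (ag S)\<^sup>2 * F Q)"
    unfolding sum_group_st[of "\<lambda>Q. (ag (st ag Q))\<^sup>2 * F Q" ag] by (intro sum.cong refl) auto
  also have "\<dots> \<le> (\<Sum>S\<in>D. M * (if st ag S = S then (ag S)\<^sup>2 * w S else 0))"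
  proof (intro sum_mono)
    fix S assume S: "S \<in> D"
    show "(\<Sum>Q\<in>{Q\<in>D. st ag Q = S}. (ag S)\<^sup>2 * F Q) \<le> M * (if st ag S = S then (ag S)\<^sup>2 * w S else 0)"
    proof (cases "st ag S = S")
      case True
      have "(ag S)\<^sup>2 * (\<Sum>Q\<in>{Q\<in>D. st ag Q = S}. F Q) \<le> (ag S)\<^sup>2 * (M * w S)"
        using F[OF S True] by (intro mult_left_mono) auto
      then show ?thesis using True by (simp add: sum_distrib_left mult_ac)
    next
      case False
      then have "{Q\<in>D. st ag Q = S} = {}" using st_st by auto
      then show ?thesis using False by (simp only: sum.empty if_False)
    qed
  qed
  also have "\<dots> = M * (\<Sum>S\<in>D. if st ag S = S then (ag S)\<^sup>2 * w S else 0)" by (simp only: sum_distrib_left)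
  also have "\<dots> \<le> M * (4 * G)" using stop_norm[OF ww g0] M by (intro mult_left_mono)
  finally show ?thesis .
qed

text \<open>The value \<open>E J\<close> is compared with the averages over \<open>R\<close> and
  \<open>Q\<close> in turn and then with the target by \<open>osc_bound\<close>. Only the last step
  depends on \<open>I\<close>, and averaging it over \<open>I\<close> with the weights
  \<open>s I / s Q\<close>, of sum at most 1, produces \<open>red\<close>.\<close>

lemma X_terms:
  "X j \<le> 3 * (\<Sum>Q\<in>D. \<Sum>R\<in>nb Q. V j R) + 3 * (\<Sum>Q\<in>D. \<Sum>R\<in>nb Q. w R * (norm (E R - E Q))\<^sup>2)
    + 3 * ((real j + 8) * \<kappa> * (\<Sum>Q\<in>D. (ag (st ag Q))\<^sup>2 * (red s c j Q * w Q))
      + \<kappa> * (\<Sum>Q\<in>D. (ag (st ag Q))\<^sup>2 * (if boundary Q (st ag Q) then 4 * w Q else 0))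
      + 8 * (\<Sum>Q\<in>D. \<Sum>I\<in>desc j Q. (s I / s Q) * (\<Sum>R\<in>nb Q. \<Sum>J\<in>desc j R. w J * cst j I J)))"
proof -
  define W where "W Q = (\<Sum>R\<in>nb Q. sum w (desc j R))" for Q
  define U where "U Q I = (\<Sum>R\<in>nb Q. \<Sum>J\<in>desc j R. w J * cst j I J)" for Q I
  define P where "P Q = (\<Sum>R\<in>nb Q. 3 * V j R) + (\<Sum>R\<in>nb Q. 3 * (w R * (norm (E R - E Q))\<^sup>2))" for Q
  define bd where "bd Q = (if boundary Q (st ag Q) then 4 * (ag (st ag Q))\<^sup>2 else 0)" for Q
  have Yb: "Y j Q I \<le> P Q + 3 * ((real j + 8) * (ag (st ag Q))\<^sup>2 * cs j I * W Q + bd Q * W Q + 8 * U Q I)"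
    if Q: "Q \<in> D" and I: "I \<in> desc j Q" for Q I
  proof -
    let ?T = "(real j + 8) * (ag (st ag Q))\<^sup>2 * cs j I + bd Q"
    have "Y j Q I \<le> (\<Sum>R\<in>nb Q. \<Sum>J\<in>desc j R. 3 * (w J * (norm (E J - E R))\<^sup>2)
       + 3 * (w J * (norm (E R - E Q))\<^sup>2) + 3 * (w J * ?T + 8 * (w J * cst j I J)))"
      unfolding Y_def
    proof (intro sum_mono)
      fix R J assume RJ: "R \<in> nb Q" "J \<in> desc j R"
      let ?t = "if J \<in> below (st ag I) then E I else 0"
      have "(tau I J)\<^sup>2 \<le> 3 * (norm (E J - E R))\<^sup>2 + 3 * (norm (E R - E Q))\<^sup>2 + 3 * (norm (E Q - ?t))\<^sup>2"
        unfolding tau_def by (rule norm_three_sq_le)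
      also have "\<dots> \<le> 3 * (norm (E J - E R))\<^sup>2 + 3 * (norm (E R - E Q))\<^sup>2 + 3 * (?T + 8 * cst j I J)"
        using osc_bound[OF Q I RJ] unfolding bd_def by (intro add_left_mono mult_left_mono) auto
      finally have "w J * (tau I J)\<^sup>2 \<le> w J * \<dots>"
        using weight_nonneg[OF ww desc_in[OF RJ(2)]] by (intro mult_left_mono)
      then show "w J * (tau I J)\<^sup>2 \<le> 3 * (w J * (norm (E J - E R))\<^sup>2)
       + 3 * (w J * (norm (E R - E Q))\<^sup>2) + 3 * (w J * ?T + 8 * (w J * cst j I J))"
        by (simp only: distrib_left mult.left_commute)
    qed
    also have "\<dots> = (\<Sum>R\<in>nb Q. 3 * V j R) + (\<Sum>R\<in>nb Q. 3 * (sum w (desc j R) * (norm (E R - E Q))\<^sup>2))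
        + 3 * (W Q * ?T + 8 * U Q I)"
      unfolding V_def W_def U_def
      by (simp only: sum.distrib sum_distrib_left sum_distrib_right distrib_left)
    also have "\<dots> \<le> P Q + 3 * (W Q * ?T + 8 * U Q I)"
      unfolding P_def by (intro add_right_mono add_left_mono sum_mono mult_left_mono mult_right_mono weight_desc_le[OF ww])
        (auto dest: nb_in)
    also have "W Q * ?T = (real j + 8) * (ag (st ag Q))\<^sup>2 * cs j I * W Q + bd Q * W Q"
      by (simp only: distrib_left mult_ac)
    finally show ?thesis .
  qed
  have WQ: "W Q \<le> \<kappa> * w Q" if "Q \<in> D" for Q unfolding W_def using nb_desc_sum_le[OF that] .
  have P0: "0 \<le> P Q" if "Q \<in> D" for Q
    unfolding P_def V_def using weight_nonneg[OF ww] desc_in nb_in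
    by (intro add_nonneg_nonneg sum_nonneg mult_nonneg_nonneg) auto
  have X1: "(\<Sum>I\<in>desc j Q. (s I / s Q) * Y j Q I)
     \<le> P Q + 3 * ((real j + 8) * \<kappa> * ((ag (st ag Q))\<^sup>2 * (red s c j Q * w Q))
        + \<kappa> * ((ag (st ag Q))\<^sup>2 * (if boundary Q (st ag Q) then 4 * w Q else 0))
        + 8 * (\<Sum>I\<in>desc j Q. (s I / s Q) * U Q I))" if Q: "Q \<in> D" for Q
  proof -
    have sQ: "0 < s Q" using weight_pos[OF ws Q] .
    have r0: "0 \<le> s I / s Q" if "I \<in> desc j Q" for I
      using weight_nonneg[OF ws desc_in[OF that]] sQ by simp
    have r1: "(\<Sum>I\<in>desc j Q. s I / s Q) \<le> 1"
      using weight_desc_le[OF ws Q, of j] sQ by (simp flip: sum_divide_distrib add: pos_divide_le_eq)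
    \<comment> \<open>The \<open>k\<close>-th ancestor of \<open>I\<close> lies \<open>j - k\<close>
      generations below \<open>Q\<close>; with \<open>k < j\<close> this covers exactly the
      generations 1 to \<open>j\<close> of \<open>red\<close>.\<close>
    have rc: "(\<Sum>I\<in>desc j Q. (s I / s Q) * cs j I) \<le> red s c j Q"
    proof -
      have "(\<Sum>I\<in>desc j Q. s I * cs j I) = (\<Sum>k<j. \<Sum>I\<in>desc j Q. s I * c (anc k I))"
        unfolding cs_def sum_distrib_left by (rule sum.swap)
      also have "\<dots> = (\<Sum>k<j. \<Sum>L\<in>desc (j - k) Q. \<Sum>I\<in>desc k L. s I * c L)"
        by (intro sum.cong refl sum_desc_group[OF _ Q]) auto
      also have "\<dots> \<le> (\<Sum>k<j. \<Sum>L\<in>desc (j - k) Q. c L * s L)"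
        unfolding sum_distrib_right[symmetric] mult.commute[of "c _"]
        by (intro sum_mono mult_right_mono weight_desc_le[OF ws] cL_nonneg[OF ww g0] desc_in)
      also have "\<dots> = (\<Sum>i\<in>{1..j}. \<Sum>L\<in>desc i Q. c L * s L)"
        by (rule sum.reindex_bij_witness[of _ "\<lambda>i. j - i" "\<lambda>i. j - i"]) auto
      finally show ?thesis using sQ
        by (simp add: red_def divide_right_mono flip: sum_divide_distrib)
    qed
    have "(\<Sum>I\<in>desc j Q. (s I / s Q) * Y j Q I) \<le> (\<Sum>I\<in>desc j Q. (s I / s Q) *
       (P Q + 3 * ((real j + 8) * (ag (st ag Q))\<^sup>2 * cs j I * W Q + bd Q * W Q + 8 * U Q I)))"
      using Yb[OF Q] r0 by (intro sum_mono mult_left_mono)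
    also have "\<dots> = (\<Sum>I\<in>desc j Q. (s I / s Q) * P Q + 3 * ((real j + 8) * (ag (st ag Q))\<^sup>2 * W Q * ((s I / s Q) * cs j I)
        + (s I / s Q) * (bd Q * W Q) + 8 * ((s I / s Q) * U Q I)))"
      by (intro sum.cong refl) (simp only: distrib_left mult_ac)
    also have "\<dots> = (\<Sum>I\<in>desc j Q. s I / s Q) * P Q
        + 3 * ((real j + 8) * (ag (st ag Q))\<^sup>2 * W Q * (\<Sum>I\<in>desc j Q. (s I / s Q) * cs j I)
        + (\<Sum>I\<in>desc j Q. s I / s Q) * (bd Q * W Q) + 8 * (\<Sum>I\<in>desc j Q. (s I / s Q) * U Q I))"
      unfolding sum_distrib_left sum_distrib_right sum.distrib[symmetric] ..
    also have "\<dots> \<le> 1 * P Q + 3 * ((real j + 8) * (ag (st ag Q))\<^sup>2 * (\<kappa> * w Q) * red s c j Q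
        + 1 * (bd Q * (\<kappa> * w Q)) + 8 * (\<Sum>I\<in>desc j Q. (s I / s Q) * U Q I))"
    proof -
      have W0: "0 \<le> W Q" unfolding W_def using weight_nonneg[OF ww] desc_in by (intro sum_nonneg) auto
      have red0: "0 \<le> red s c j Q" by (intro red_nonneg[OF ws _ Q] cL_nonneg[OF ww g0])
      have bd0: "0 \<le> bd Q" by (simp add: bd_def)
      have i: "(\<Sum>I\<in>desc j Q. s I / s Q) * P Q \<le> 1 * P Q" using r1 P0[OF Q] by (intro mult_right_mono)
      have "(real j + 8) * (ag (st ag Q))\<^sup>2 * W Q * (\<Sum>I\<in>desc j Q. (s I / s Q) * cs j I)
          \<le> (real j + 8) * (ag (st ag Q))\<^sup>2 * W Q * red s c j Q"
        using rc W0 by (intro mult_left_mono) auto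
      also have "\<dots> \<le> (real j + 8) * (ag (st ag Q))\<^sup>2 * (\<kappa> * w Q) * red s c j Q"
        using WQ[OF Q] red0 by (intro mult_right_mono mult_left_mono) auto
      finally have ii: "(real j + 8) * (ag (st ag Q))\<^sup>2 * W Q * (\<Sum>I\<in>desc j Q. (s I / s Q) * cs j I)
          \<le> (real j + 8) * (ag (st ag Q))\<^sup>2 * (\<kappa> * w Q) * red s c j Q" .
      have "(\<Sum>I\<in>desc j Q. s I / s Q) * (bd Q * W Q) \<le> 1 * (bd Q * W Q)"
        using r1 bd0 W0 by (intro mult_right_mono) auto
      also have "\<dots> \<le> 1 * (bd Q * (\<kappa> * w Q))" using WQ[OF Q] bd0 by (intro mult_left_mono) auto
      finally have iii: "(\<Sum>I\<in>desc j Q. s I / s Q) * (bd Q * W Q) \<le> 1 * (bd Q * (\<kappa> * w Q))" .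
      show ?thesis by (intro add_mono mult_left_mono i ii iii order_refl) auto
    qed
    also have "\<dots> = P Q + 3 * ((real j + 8) * \<kappa> * ((ag (st ag Q))\<^sup>2 * (red s c j Q * w Q))
        + \<kappa> * ((ag (st ag Q))\<^sup>2 * (if boundary Q (st ag Q) then 4 * w Q else 0))
        + 8 * (\<Sum>I\<in>desc j Q. (s I / s Q) * U Q I))"
      by (simp add: bd_def mult_ac)
    finally show ?thesis .
  qed
  have "X j \<le> (\<Sum>Q\<in>D. P Q + 3 * ((real j + 8) * \<kappa> * ((ag (st ag Q))\<^sup>2 * (red s c j Q * w Q))
        + \<kappa> * ((ag (st ag Q))\<^sup>2 * (if boundary Q (st ag Q) then 4 * w Q else 0))
        + 8 * (\<Sum>I\<in>desc j Q. (s I / s Q) * U Q I)))"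
    unfolding X_def by (intro sum_mono X1)
  also have "\<dots> = (\<Sum>Q\<in>D. P Q) + 3 * ((real j + 8) * \<kappa> * (\<Sum>Q\<in>D. (ag (st ag Q))\<^sup>2 * (red s c j Q * w Q))
      + \<kappa> * (\<Sum>Q\<in>D. (ag (st ag Q))\<^sup>2 * (if boundary Q (st ag Q) then 4 * w Q else 0))
      + 8 * (\<Sum>Q\<in>D. \<Sum>I\<in>desc j Q. (s I / s Q) * U Q I))"
    unfolding sum_distrib_left[of _ _ D] sum.distrib[symmetric] ..
  also have "(\<Sum>Q\<in>D. P Q) = 3 * (\<Sum>Q\<in>D. \<Sum>R\<in>nb Q. V j R) + 3 * (\<Sum>Q\<in>D. \<Sum>R\<in>nb Q. w R * (norm (E R - E Q))\<^sup>2)"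
    unfolding P_def by (simp only: sum.distrib sum_distrib_left)
  finally show ?thesis unfolding U_def .
qed

text \<open>By \<open>variance_desc\<close> the deviation over \<open>j\<close> generations consists
  of martingale differences, and each single generation contributes at most the full norm.\<close>

lemma V_sum_le: "(\<Sum>Q\<in>D. \<Sum>R\<in>nb Q. V j R) \<le> real deg * (real j * G)"
proof -
  have V0: "0 \<le> V j R" for R unfolding V_def using weight_nonneg[OF ww] desc_in
    by (intro sum_nonneg mult_nonneg_nonneg) auto
  have Vb: "V j R \<le> (\<Sum>i<j. \<Sum>L\<in>desc i R. dl w g L)" if R: "R \<in> D" for R
  proof (cases "lev R + j \<le> N")
    case True
    then show ?thesis using variance_desc[OF ww R, of j g "E R"] by (simp add: V_def)
  next
    case False
    then have "desc j R = {}" using desc_in desc_lev lev_le by fastforce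
    then show ?thesis by (simp add: V_def sum_nonneg dl_nonneg[OF ww])
  qed
  have "(\<Sum>Q\<in>D. \<Sum>R\<in>nb Q. V j R) = (\<Sum>Q\<in>D. \<Sum>R\<in>nb Q. V j Q)" by (rule sum_nb_swap)
  also have "\<dots> = (\<Sum>Q\<in>D. real (card (nb Q)) * V j Q)" by simp
  also have "\<dots> \<le> (\<Sum>Q\<in>D. real deg * (\<Sum>i<j. \<Sum>L\<in>desc i Q. dl w g L))"
    using nb_card Vb V0 by (intro sum_mono mult_mono) auto
  also have "\<dots> = real deg * (\<Sum>i<j. \<Sum>Q\<in>D. \<Sum>L\<in>desc i Q. dl w g L)"
    by (subst sum.swap) (simp only: sum_distrib_left)
  also have "\<dots> \<le> real deg * (\<Sum>i<j. G)"
  proof (intro mult_left_mono sum_mono)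
    fix i
    have "(\<Sum>Q\<in>D. \<Sum>L\<in>desc i Q. dl w g L) = sum (dl w g) {L\<in>D. i \<le> lev L}" by (rule sum_desc_all[symmetric])
    also have "\<dots> \<le> sum (dl w g) D" using fin_D dl_nonneg[OF ww] by (intro sum_mono2) auto
    also have "\<dots> \<le> G" by (rule energy_root_le[OF ww])
    finally show "(\<Sum>Q\<in>D. \<Sum>L\<in>desc i Q. dl w g L) \<le> G" .
  qed simp
  finally show ?thesis by simp
qed

lemma adj_sum_le: "(\<Sum>Q\<in>D. \<Sum>R\<in>nb Q. w R * (norm (E R - E Q))\<^sup>2) \<le> KB * G"
proof -
  have "(\<Sum>Q\<in>D. \<Sum>R\<in>nb Q. w R * (norm (E R - E Q))\<^sup>2) = (\<Sum>Q\<in>D. \<Sum>R\<in>nb Q. w Q * (norm (E Q - E R))\<^sup>2)"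
    by (rule sum_nb_swap)
  then show ?thesis using adjacent_differences[OF ww dw _ thin C0 eta, of g] d0 by (simp add: KB_def)
qed

text \<open>Inside one principal cube, the boundary cubes of all generations have total mass bounded
  by a geometric series, by \<open>thin_boundary\<close>.\<close>

lemma boundary_sum_le:
  "(\<Sum>Q\<in>D. (ag (st ag Q))\<^sup>2 * (if boundary Q (st ag Q) then 4 * w Q else 0)) \<le> (4 * C / (1 - \<eta>)) * (4 * G)"
proof (rule stop_sum_le)
  fix S assume S: "S \<in> D" "st ag S = S"
  have "(\<Sum>Q\<in>{Q\<in>D. st ag Q = S}. if boundary Q (st ag Q) then 4 * w Q else 0)
      = (\<Sum>Q\<in>{Q\<in>D. st ag Q = S}. if boundary Q S then 4 * w Q else 0)" by (intro sum.cong) auto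
  also have "\<dots> = (\<Sum>Q\<in>{Q\<in>{Q\<in>D. st ag Q = S}. boundary Q S}. 4 * w Q)"
    by (rule sum.inter_filter[symmetric]) (use fin_D in simp)
  also have "{Q\<in>{Q\<in>D. st ag Q = S}. boundary Q S} = {Q\<in>D. st ag Q = S \<and> boundary Q S}" by blast
  also have "(\<Sum>Q\<in>{Q\<in>D. st ag Q = S \<and> boundary Q S}. 4 * w Q) = 4 * sum w {Q\<in>D. st ag Q = S \<and> boundary Q S}"
    by (simp only: sum_distrib_left)
  finally have eq: "(\<Sum>Q\<in>{Q\<in>D. st ag Q = S}. if boundary Q (st ag Q) then 4 * w Q else 0)
      = 4 * sum w {Q\<in>D. st ag Q = S \<and> boundary Q S}" .
  have "sum w {Q\<in>D. st ag Q = S \<and> boundary Q S} \<le> sum w (\<Union>i<Suc N. {Q\<in>desc i S. boundary Q S})"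
  proof (rule sum_mono2)
    show "{Q\<in>D. st ag Q = S \<and> boundary Q S} \<subseteq> (\<Union>i<Suc N. {Q\<in>desc i S. boundary Q S})"
    proof
      fix Q assume Q: "Q \<in> {Q\<in>D. st ag Q = S \<and> boundary Q S}"
      then have "Q \<in> desc (lev Q - lev S) S" using below_desc[OF st_below[of Q ag]] by auto
      moreover have "lev Q - lev S < Suc N" using lev_le[of Q] Q by auto
      ultimately show "Q \<in> (\<Union>i<Suc N. {Q\<in>desc i S. boundary Q S})" using Q by auto
    qed
    fix Q assume "Q \<in> (\<Union>i<Suc N. {Q\<in>desc i S. boundary Q S}) - {Q\<in>D. st ag Q = S \<and> boundary Q S}"
    then have "Q \<in> D" using desc_in by blast
    then show "0 \<le> w Q" by (rule weight_nonneg[OF ww])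
  qed simp
  also have "\<dots> = (\<Sum>i<Suc N. sum w {Q\<in>desc i S. boundary Q S})"
  proof (rule sum.UNION_disjoint)
    show "\<forall>i\<in>{..<Suc N}. \<forall>i'\<in>{..<Suc N}. i \<noteq> i' \<longrightarrow>
      {Q \<in> desc i S. boundary Q S} \<inter> {Q \<in> desc i' S. boundary Q S} = {}"
    proof (intro ballI impI)
      fix i i' :: nat assume "i \<noteq> i'"
      moreover have "i = i'" if "Q \<in> desc i S" "Q \<in> desc i' S" for Q
        using desc_lev[OF that(1)] desc_lev[OF that(2)] by simp
      ultimately show "{Q \<in> desc i S. boundary Q S} \<inter> {Q \<in> desc i' S. boundary Q S} = {}" by blast
    qed
  qed simp_all
  also have "\<dots> \<le> (\<Sum>i<Suc N. C * \<eta> ^ i * w S)" using thin S by (intro sum_mono) (simp add: thin_boundary_def)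
  also have "\<dots> = C * w S * (\<Sum>i<Suc N. \<eta> ^ i)" unfolding sum_distrib_left by (intro sum.cong refl) (simp only: mult_ac)
  also have "\<dots> \<le> C * w S * (1 / (1 - \<eta>))"
    using eta C0 weight_nonneg[OF ww S(1)] by (intro mult_left_mono sum_geometric_le) auto
  finally show "(\<Sum>Q\<in>{Q\<in>D. st ag Q = S}. if boundary Q (st ag Q) then 4 * w Q else 0) \<le> 4 * C / (1 - \<eta>) * w S"
    unfolding eq by simp
qed (use C0 eta in simp)

text \<open>For fixed \<open>k\<close> only cubes \<open>J\<close> below \<open>L = anc k I\<close>
  count, so their mass is at most \<open>w L\<close>. The \<open>s\<close>-averages over
  \<open>I\<close> are at most 1, and every principal cube \<open>L\<close> is met at most once for
  each of the \<open>j\<close> values of \<open>k\<close>.\<close>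

lemma cst_sum_le:
  "(\<Sum>Q\<in>D. \<Sum>I\<in>desc j Q. (s I / s Q) * (\<Sum>R\<in>nb Q. \<Sum>J\<in>desc j R. w J * cst j I J)) \<le> real j * (4 * G)"
proof -
  define q where "q L = (if st ag L = L then (ag L)\<^sup>2 * w L else 0)" for L
  have q0: "0 \<le> q L" if "L \<in> D" for L using weight_nonneg[OF ww that] by (simp add: q_def)
  have U: "(\<Sum>R\<in>nb Q. \<Sum>J\<in>desc j R. w J * cst j I J) \<le> (\<Sum>k<j. q (anc k I))"
    if Q: "Q \<in> D" and I: "I \<in> desc j Q" for Q I
  proof -
    have I': "I \<in> D" "j \<le> lev I" "anc j I = Q" using I by (auto simp: desc_def)
    let ?t = "\<lambda>k J. if st ag I = anc k I \<and> J \<in> below (anc k I) then (ag (anc k I))\<^sup>2 else 0"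
    have "(\<Sum>R\<in>nb Q. \<Sum>J\<in>desc j R. w J * cst j I J) = (\<Sum>J\<in>(\<Union>R\<in>nb Q. desc j R). w J * cst j I J)"
      by (rule sum.UNION_disjoint[symmetric]) (use desc_disj in auto)
    also have "\<dots> = (\<Sum>k<j. \<Sum>J\<in>(\<Union>R\<in>nb Q. desc j R). w J * ?t k J)"
      unfolding cst_def sum_distrib_left by (rule sum.swap)
    also have "\<dots> \<le> (\<Sum>k<j. q (anc k I))"
    proof (intro sum_mono)
      fix k assume k: "k \<in> {..<j}"
      show "(\<Sum>J\<in>(\<Union>R\<in>nb Q. desc j R). w J * ?t k J) \<le> q (anc k I)"
      proof (cases "st ag I = anc k I")
        case True
        let ?L = "anc k I"
        have L: "?L \<in> D" "lev ?L = lev I - k" using anc_in_lev[OF I'(1), of k] k I'(2) by auto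
        have "(\<Sum>J\<in>(\<Union>R\<in>nb Q. desc j R). w J * ?t k J)
            = (\<Sum>J\<in>(\<Union>R\<in>nb Q. desc j R). if J \<in> below ?L then w J * (ag ?L)\<^sup>2 else 0)"
          by (intro sum.cong refl) (simp add: True)
        also have "\<dots> = (\<Sum>J\<in>{J\<in>(\<Union>R\<in>nb Q. desc j R). J \<in> below ?L}. w J * (ag ?L)\<^sup>2)"
          by (rule sum.inter_filter[symmetric]) simp
        also have "\<dots> \<le> (\<Sum>J\<in>desc k ?L. w J * (ag ?L)\<^sup>2)"
        proof (rule sum_mono2)
          show "{J\<in>(\<Union>R\<in>nb Q. desc j R). J \<in> below ?L} \<subseteq> desc k ?L"
          proof
            fix J assume "J \<in> {J\<in>(\<Union>R\<in>nb Q. desc j R). J \<in> below ?L}"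
            then obtain R where R: "R \<in> nb Q" "J \<in> desc j R" "J \<in> below ?L" by auto
            have "lev J = lev I" using desc_lev[OF R(2)] nb_lev[OF Q R(1)] desc_lev[OF I] by simp
            then show "J \<in> desc k ?L" using below_desc[OF R(3)] L k I'(2) by simp
          qed
        qed (auto intro!: mult_nonneg_nonneg weight_nonneg[OF ww] desc_in)
        also have "\<dots> = sum w (desc k ?L) * (ag ?L)\<^sup>2" by (simp only: sum_distrib_right)
        also have "\<dots> \<le> w ?L * (ag ?L)\<^sup>2" using weight_desc_le[OF ww L(1)] by (intro mult_right_mono) auto
        also have "\<dots> = q ?L" using st_st[OF I'(1), of ag] True by (simp add: q_def)
        finally show ?thesis .
      next
        case False
        then show ?thesis using q0 anc_in[OF I'(1), of k] k I'(2) by (simp add: sum.neutral)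
      qed
    qed
    finally show ?thesis .
  qed
  have "(\<Sum>Q\<in>D. \<Sum>I\<in>desc j Q. (s I / s Q) * (\<Sum>R\<in>nb Q. \<Sum>J\<in>desc j R. w J * cst j I J))
      \<le> (\<Sum>Q\<in>D. \<Sum>I\<in>desc j Q. (s I / s Q) * (\<Sum>k<j. q (anc k I)))"
    using weight_nonneg[OF ws] desc_in by (intro sum_mono mult_left_mono U divide_nonneg_nonneg) auto
  also have "\<dots> = (\<Sum>k<j. \<Sum>Q\<in>D. \<Sum>I\<in>desc j Q. (s I / s Q) * q (anc k I))"
  proof -
    have "(\<Sum>I\<in>desc j Q. (s I / s Q) * (\<Sum>k<j. q (anc k I))) = (\<Sum>k<j. \<Sum>I\<in>desc j Q. (s I / s Q) * q (anc k I))" for Q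
      unfolding sum_distrib_left by (rule sum.swap)
    then show ?thesis by (simp only:) (rule sum.swap)
  qed
  also have "\<dots> \<le> (\<Sum>k<j. sum q D)"
  proof (rule sum_mono)
    fix k assume k: "k \<in> {..<j}"
    have "(\<Sum>Q\<in>D. \<Sum>I\<in>desc j Q. (s I / s Q) * q (anc k I)) \<le> (\<Sum>Q\<in>D. sum q (desc (j - k) Q))"
    proof (intro sum_mono)
      fix Q assume Q: "Q \<in> D"
      have sQ: "0 < s Q" using weight_pos[OF ws Q] .
      have "(\<Sum>I\<in>desc j Q. (s I / s Q) * q (anc k I)) = (\<Sum>L\<in>desc (j - k) Q. \<Sum>I\<in>desc k L. (s I / s Q) * q L)"
        using k Q by (intro sum_desc_group) auto
      also have "\<dots> = (\<Sum>L\<in>desc (j - k) Q. (sum s (desc k L) / s Q) * q L)"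
        by (simp only: sum_distrib_right sum_divide_distrib)
      also have "\<dots> \<le> (\<Sum>L\<in>desc (j - k) Q. 1 * q L)"
      proof (intro sum_mono mult_right_mono)
        fix L assume L: "L \<in> desc (j - k) Q"
        show "0 \<le> q L" using q0 desc_in[OF L] by blast
        have "sum s (desc k L) \<le> s Q"
          using weight_desc_le[OF ws desc_in[OF L], of k] weight_mono[OF ws desc_below[OF L]] by linarith
        then show "sum s (desc k L) / s Q \<le> 1" using sQ by (simp add: pos_divide_le_eq)
      qed
      finally show "(\<Sum>I\<in>desc j Q. (s I / s Q) * q (anc k I)) \<le> sum q (desc (j - k) Q)" by simp
    qed
    also have "\<dots> = sum q {L\<in>D. j - k \<le> lev L}" by (rule sum_desc_all[symmetric])
    also have "\<dots> \<le> sum q D" using fin_D q0 by (intro sum_mono2) auto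
    finally show "(\<Sum>Q\<in>D. \<Sum>I\<in>desc j Q. (s I / s Q) * q (anc k I)) \<le> sum q D" .
  qed
  also have "\<dots> \<le> (\<Sum>k<j. 4 * G)" using stop_norm[OF ww g0] by (intro sum_mono) (simp add: q_def)
  finally show ?thesis by simp
qed

lemma red_stop_sum_le: "(\<Sum>Q\<in>D. (ag (st ag Q))\<^sup>2 * (red s c j Q * w Q)) \<le> (KC * real j) * (4 * G)"
proof (rule stop_sum_le)
  fix S assume S: "S \<in> D" "st ag S = S"
  have "(\<Sum>Q\<in>{Q\<in>D. st ag Q = S}. red s c j Q * w Q) \<le> (\<Sum>Q\<in>below S. red s c j Q * w Q)"
  proof (rule sum_mono2)
    show "{Q\<in>D. st ag Q = S} \<subseteq> below S" using st_below by auto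
    fix Q assume "Q \<in> below S - {Q\<in>D. st ag Q = S}"
    then have "Q \<in> D" using below_in by auto
    then show "0 \<le> red s c j Q * w Q"
      using weight_nonneg[OF ww] red_nonneg[OF ws cL_nonneg[OF ww g0]] by simp
  qed simp
  also have "\<dots> \<le> (KC * real j) * w S" by (rule red_sum_le[OF S(1)])
  finally show "(\<Sum>Q\<in>{Q\<in>D. st ag Q = S}. red s c j Q * w Q) \<le> (KC * real j) * w S" .
qed (use KC0 in simp)

text \<open>Quadratic growth in \<open>j\<close> is harmless: its square root is summed against
  \<open>2 ^ (- j)\<close>.\<close>

lemma X_le: "X j \<le> KX * (1 + real j)\<^sup>2 * G"
proof -
  have G0: "0 \<le> G" by (rule nrm_nonneg[OF ww])
  let ?j = "(1 + real j)\<^sup>2"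
  have j1: "1 \<le> ?j" "real j \<le> ?j" "(real j + 8) * real j \<le> 8 * ?j"
    by (auto simp: power2_eq_square algebra_simps)
  have 1: "(\<Sum>Q\<in>D. \<Sum>R\<in>nb Q. V j R) \<le> real deg * (?j * G)"
    using V_sum_le[of j] mult_left_mono[OF mult_right_mono[OF j1(2) G0], of "real deg"] by simp
  have 2: "(\<Sum>Q\<in>D. \<Sum>R\<in>nb Q. w R * (norm (E R - E Q))\<^sup>2) \<le> d * KB * (?j * G)"
  proof -
    have "KB * G \<le> d * KB * (?j * G)"
    proof -
      have "1 * (1 * G) \<le> d * (?j * G)" using d0 j1(1) G0 by (intro mult_mono) auto
      then have "KB * G \<le> KB * (d * (?j * G))" using KB0 by (intro mult_left_mono) auto
      then show ?thesis by (simp only: mult_ac)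
    qed
    then show ?thesis using adj_sum_le by linarith
  qed
  have 3: "(real j + 8) * \<kappa> * (\<Sum>Q\<in>D. (ag (st ag Q))\<^sup>2 * (red s c j Q * w Q)) \<le> 32 * \<kappa> * KC * (?j * G)"
  proof -
    have "(real j + 8) * \<kappa> * (\<Sum>Q\<in>D. (ag (st ag Q))\<^sup>2 * (red s c j Q * w Q))
        \<le> (real j + 8) * \<kappa> * ((KC * real j) * (4 * G))"
      using red_stop_sum_le kappa0 by (intro mult_left_mono) auto
    also have "\<dots> = ((real j + 8) * real j) * (4 * \<kappa> * KC * G)" by (simp only: mult_ac)
    also have "\<dots> \<le> (8 * ?j) * (4 * \<kappa> * KC * G)" using j1(3) kappa0 KC0 G0 by (intro mult_right_mono) auto
    finally show ?thesis by (simp add: mult_ac)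
  qed
  have 4: "\<kappa> * (\<Sum>Q\<in>D. (ag (st ag Q))\<^sup>2 * (if boundary Q (st ag Q) then 4 * w Q else 0))
      \<le> 16 * \<kappa> * C / (1 - \<eta>) * (?j * G)"
  proof -
    have "\<kappa> * (\<Sum>Q\<in>D. (ag (st ag Q))\<^sup>2 * (if boundary Q (st ag Q) then 4 * w Q else 0))
        \<le> \<kappa> * ((4 * C / (1 - \<eta>)) * (4 * G))"
      using boundary_sum_le kappa0 by (intro mult_left_mono)
    also have "\<dots> = (16 * \<kappa> * C / (1 - \<eta>)) * (1 * G)" by simp
    also have "\<dots> \<le> (16 * \<kappa> * C / (1 - \<eta>)) * (?j * G)"
      using j1(1) G0 kappa0 C0 eta by (intro mult_left_mono mult_right_mono) auto
    finally show ?thesis .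
  qed
  have 5: "8 * (\<Sum>Q\<in>D. \<Sum>I\<in>desc j Q. (s I / s Q) * (\<Sum>R\<in>nb Q. \<Sum>J\<in>desc j R. w J * cst j I J)) \<le> 32 * (?j * G)"
  proof -
    have "8 * (\<Sum>Q\<in>D. \<Sum>I\<in>desc j Q. (s I / s Q) * (\<Sum>R\<in>nb Q. \<Sum>J\<in>desc j R. w J * cst j I J)) \<le> 8 * (real j * (4 * G))"
      by (rule mult_left_mono[OF cst_sum_le]) simp
    also have "\<dots> = 32 * (real j * G)" by simp
    also have "\<dots> \<le> 32 * (?j * G)" using mult_right_mono[OF j1(2) G0] by (intro mult_left_mono) auto
    finally show ?thesis .
  qed
  have "X j \<le> 3 * (real deg * (?j * G)) + 3 * (d * KB * (?j * G))
      + 3 * (32 * \<kappa> * KC * (?j * G) + 16 * \<kappa> * C / (1 - \<eta>) * (?j * G) + 32 * (?j * G))"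
    by (rule order.trans[OF X_terms]) (intro add_mono mult_left_mono 1 2 3 4 5, auto)
  also have "\<dots> = KX * ?j * G" unfolding KX_def by (simp only: distrib_left distrib_right mult.assoc)
  finally show ?thesis .
qed

end
end

section \<open>The bilinear estimate on a tree\<close>

context dyadic_adj begin

text \<open>Each pair is charged to some generation at which its ancestors are adjacent. Since
  \<open>h\<close> is nonnegative, pairs that are adjacent at several generations may be counted at
  all of them, which turns the sum into independent sums over \<open>Q\<close>, its neighbours and
  their descendants.\<close>

lemma near_sum:
  fixes h :: "nat \<Rightarrow> 'c \<Rightarrow> 'c \<Rightarrow> real"
  assumes h0: "\<And>I J j. I \<in> D \<Longrightarrow> J \<in> D \<Longrightarrow> j \<le> lev I \<Longrightarrow> 0 \<le> h j I J"
    and near: "\<And>I J. I \<in> D \<Longrightarrow> J \<in> D \<Longrightarrow> lev J = lev I \<Longrightarrow> \<exists>j\<le>lev I. anc j J \<in> nb (anc j I) \<and> F I J \<le> h j I J"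
  shows "(\<Sum>I\<in>D. \<Sum>J\<in>{J\<in>D. lev J = lev I}. F I J)
    \<le> (\<Sum>j\<le>N. \<Sum>Q\<in>D. \<Sum>I\<in>desc j Q. \<Sum>R\<in>nb Q. \<Sum>J\<in>desc j R. h j I J)"
proof -
  define L where "L I = {J\<in>D. lev J = lev I}" for I
  have finL: "finite (L I)" for I using fin_D by (simp add: L_def)
  let ?H = "\<lambda>j I. \<Sum>R\<in>nb (anc j I). \<Sum>J\<in>desc j R. h j I J"
  have inn: "(\<Sum>J\<in>L I. F I J) \<le> (\<Sum>j\<le>lev I. ?H j I)" if I: "I \<in> D" for I
  proof -
    have "(\<Sum>J\<in>L I. F I J) \<le> (\<Sum>J\<in>L I. \<Sum>j\<le>lev I. if anc j J \<in> nb (anc j I) then h j I J else 0)"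
    proof (rule sum_mono)
      fix J assume "J \<in> L I"
      then have J: "J \<in> D" "lev J = lev I" by (auto simp: L_def)
      obtain j where j: "j \<le> lev I" "anc j J \<in> nb (anc j I)" and n: "F I J \<le> h j I J"
        using near[OF I J] by blast
      note n
      also have "h j I J = (if anc j J \<in> nb (anc j I) then h j I J else 0)" using j by simp
      also have "\<dots> \<le> (\<Sum>j\<le>lev I. if anc j J \<in> nb (anc j I) then h j I J else 0)"
        using j h0[OF I J(1)] by (intro member_le_sum[where f="\<lambda>j. if anc j J \<in> nb (anc j I) then h j I J else 0"]) auto
      finally show "F I J \<le> (\<Sum>j\<le>lev I. if anc j J \<in> nb (anc j I) then h j I J else 0)" .
    qed
    also have "\<dots> = (\<Sum>j\<le>lev I. \<Sum>J\<in>L I. if anc j J \<in> nb (anc j I) then h j I J else 0)" by (rule sum.swap)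
    also have "\<dots> = (\<Sum>j\<le>lev I. ?H j I)"
    proof (rule sum.cong[OF refl])
      fix j assume "j \<in> {..lev I}"
      then have j: "j \<le> lev I" by simp
      have "(\<Sum>J\<in>L I. if anc j J \<in> nb (anc j I) then h j I J else 0) = sum (h j I) {J\<in>L I. anc j J \<in> nb (anc j I)}"
        by (rule sum.inter_filter[OF finL, symmetric])
      also have "{J\<in>L I. anc j J \<in> nb (anc j I)} = (\<Union>R\<in>nb (anc j I). desc j R)"
      proof (intro set_eqI iffI)
        fix J assume "J \<in> {J\<in>L I. anc j J \<in> nb (anc j I)}"
        then show "J \<in> (\<Union>R\<in>nb (anc j I). desc j R)" using j by (auto simp: L_def desc_def)
      next
        fix J assume "J \<in> (\<Union>R\<in>nb (anc j I). desc j R)"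
        then obtain R where R: "R \<in> nb (anc j I)" "J \<in> desc j R" by auto
        have "lev J = lev I" using desc_lev[OF R(2)] nb_lev[OF anc_in[OF I j] R(1)] lev_anc[OF I j] j by simp
        then show "J \<in> {J\<in>L I. anc j J \<in> nb (anc j I)}" using R desc_anc[OF R(2)] desc_in[OF R(2)] by (simp add: L_def)
      qed
      also have "sum (h j I) (\<Union>R\<in>nb (anc j I). desc j R) = ?H j I"
        by (rule sum.UNION_disjoint) (use desc_disj in auto)
      finally show "(\<Sum>J\<in>L I. if anc j J \<in> nb (anc j I) then h j I J else 0) = ?H j I" .
    qed
    finally show ?thesis .
  qed
  have "(\<Sum>I\<in>D. \<Sum>J\<in>L I. F I J) \<le> (\<Sum>I\<in>D. \<Sum>j\<le>lev I. ?H j I)" by (rule sum_mono[OF inn])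
  also have "\<dots> = (\<Sum>I\<in>D. \<Sum>j\<le>N. if j \<le> lev I then ?H j I else 0)"
  proof (rule sum.cong[OF refl])
    fix I assume "I \<in> D"
    then have "{..lev I} = {j\<in>{..N}. j \<le> lev I}" using lev_le[of I] by auto
    then show "(\<Sum>j\<le>lev I. ?H j I) = (\<Sum>j\<le>N. if j \<le> lev I then ?H j I else 0)"
      by (simp only: sum.inter_filter finite_atMost)
  qed
  also have "\<dots> = (\<Sum>j\<le>N. \<Sum>I\<in>D. if j \<le> lev I then ?H j I else 0)" by (rule sum.swap)
  also have "\<dots> = (\<Sum>j\<le>N. \<Sum>Q\<in>D. \<Sum>I\<in>desc j Q. ?H j I)"
    by (rule sum.cong[OF refl]) (simp only: sum.inter_filter[OF fin_D, symmetric] sum_desc_all)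
  also have "\<dots> = (\<Sum>j\<le>N. \<Sum>Q\<in>D. \<Sum>I\<in>desc j Q. \<Sum>R\<in>nb Q. \<Sum>J\<in>desc j R. h j I J)"
  proof (intro sum.cong[OF refl, where h="\<lambda>j. \<Sum>Q\<in>D. \<Sum>I\<in>desc j Q. \<Sum>R\<in>nb Q. \<Sum>J\<in>desc j R. h j I J"])
    fix j
    have e: "?H j I = (\<Sum>R\<in>nb Q. \<Sum>J\<in>desc j R. h j I J)" if "I \<in> desc j Q" for Q I
      by (simp only: desc_anc[OF that])
    show "(\<Sum>Q\<in>D. \<Sum>I\<in>desc j Q. ?H j I) = (\<Sum>Q\<in>D. \<Sum>I\<in>desc j Q. \<Sum>R\<in>nb Q. \<Sum>J\<in>desc j R. h j I J)"
      by (rule sum.cong[OF refl], rule sum.cong[OF refl], rule e)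
  qed
  finally show ?thesis unfolding L_def .
qed

end

context two_weight_tree begin

definition half_const :: "real \<Rightarrow> real \<Rightarrow> real" where
  "half_const T C0 = 4 * T + 4 * C0 * sqrt \<kappa> * sqrt KX"

text \<open>The principal part becomes testing on principal cubes, summed by
  \<open>stop_norm\<close>; the rest is handled by the decay of the coefficients and
  \<open>X_le\<close>. In \<open>4 * T\<close> one factor 2 is the bound of an average by twice the
  stopping value, the other is the square root of the 4 in \<open>stop_norm\<close>; the second 4 is
  the sum in \<open>sum_weighted_powers\<close>.\<close>

lemma half_estimate:
  fixes f g :: "'c \<Rightarrow> complex"
  assumes test: "\<And>u L. L \<in> D \<Longrightarrow> norm (B b u (indic L)) \<le> T * (sqrt (w L) * sqrt (nrm s u root))"
    and T0: "0 \<le> T" and c0: "0 \<le> C0"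
    and coef: "\<And>I J. I \<in> D \<Longrightarrow> J \<in> D \<Longrightarrow> lev J = lev I \<Longrightarrow> \<exists>j\<le>lev I. anc j J \<in> nb (anc j I) \<and>
      norm (B b (Df s f I) (indic J))
        \<le> C0 / 2 ^ j * (sqrt (dl s f I) * (sqrt (s I / s (anc j I)) * (w J / sqrt (w (anc j I)))))"
  shows "norm (\<Sum>I\<in>D. \<Sum>J\<in>{J\<in>D. lev J = lev I}. av w g J * B b (Df s f I) (indic J))
    \<le> half_const T C0 * (sqrt (nrm s f root) * sqrt (nrm w g root))"
proof (cases "0 < avn w g root")
  case False
  have "avn w g root = 0" using False avn_nonneg[OF ww root_in, of g] by simp
  then have "(\<Sum>x\<in>leaves root. w x * norm (g x)) = 0"
    using avn_sum[OF ww root_in, of g] by simp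
  then have z: "g x = 0" if "x \<in> leaves root" for x
    using that weight_pos[OF ww leaves_in]
    by (subst (asm) sum_nonneg_eq_0_iff) (auto simp: weight_nonneg[OF ww leaves_in], force)
  have "av w g J = 0" if "J \<in> D" for J
    using z leaves_mono[of J root] that below_root unfolding av_def by (auto intro!: sum.neutral)
  then have "(\<Sum>I\<in>D. \<Sum>J\<in>{J\<in>D. lev J = lev I}. av w g J * B b (Df s f I) (indic J)) = 0"
    by (intro sum.neutral ballI) auto
  moreover have "0 \<le> half_const T C0" using T0 c0 kappa0 KX0 by (simp add: half_const_def)
  ultimately show ?thesis using nrm_nonneg[OF ws] nrm_nonneg[OF ww] by simp
next
  case g0: True
  let ?a = "avn w g" and ?E = "av w g"
  let ?F = "nrm s f root" and ?G = "nrm w g root"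
  let ?b = "\<lambda>I J. B b (Df s f I) (indic J)"
  have F0: "0 \<le> ?F" and G0: "0 \<le> ?G" using nrm_nonneg ws ww by auto
  define sg where "sg I J = (if J \<in> below (st ?a I) then ?E I else 0)" for I J
  define L where "L I = {J\<in>D. lev J = lev I}" for I
  have finL: "finite (L I)" for I using fin_D by (simp add: L_def)
  have split: "(\<Sum>I\<in>D. \<Sum>J\<in>L I. ?E J * ?b I J)
      = (\<Sum>I\<in>D. \<Sum>J\<in>L I. sg I J * ?b I J) + (\<Sum>I\<in>D. \<Sum>J\<in>L I. (?E J - sg I J) * ?b I J)"
    by (simp only: sum.distrib[symmetric] distrib_right[symmetric]) simp
  have para: "norm (\<Sum>I\<in>D. \<Sum>J\<in>L I. sg I J * ?b I J) \<le> 4 * T * (sqrt ?F * sqrt ?G)"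
  proof -
    define q where "q S I = (if st ?a I = S then ?E I else 0)" for S I
    define e where "e S = (\<Sum>I\<in>{I\<in>D. st ?a I = S}. dl s f I)" for S
    \<comment> \<open>The cubes \<open>J\<close> of the level of \<open>I\<close> inside the
      principal cube partition it, so their indicators add up to the indicator of the principal
      cube, which testing accepts.\<close>
    have in1: "(\<Sum>J\<in>L I. sg I J * ?b I J) = ?E I * ?b I (st ?a I)" if I: "I \<in> D" for I
    proof -
      let ?S = "st ?a I"
      have S: "?S \<in> D" "I \<in> below ?S" using st_in st_below I by auto
      have l: "lev ?S + (lev I - lev ?S) = lev I" using below_lev[OF S(2)] by simp
      have set: "{J\<in>L I. J \<in> below ?S} = desc (lev I - lev ?S) ?S"
        using below_desc[of _ ?S] desc_below[of _ _ ?S] desc_in[of _ _ ?S] desc_lev[of _ _ ?S] l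
        by (force simp: L_def)
      have "(\<Sum>J\<in>L I. sg I J * ?b I J) = (\<Sum>J\<in>L I. if J \<in> below ?S then ?E I * ?b I J else 0)"
        by (intro sum.cong refl) (simp add: sg_def)
      also have "\<dots> = (\<Sum>J\<in>{J\<in>L I. J \<in> below ?S}. ?E I * ?b I J)"
        by (rule sum.inter_filter[OF finL, symmetric])
      also have "\<dots> = ?E I * (\<Sum>J\<in>desc (lev I - lev ?S) ?S. 1 * ?b I J)" unfolding set by (simp add: sum_distrib_left)
      also have "(\<Sum>J\<in>desc (lev I - lev ?S) ?S. 1 * ?b I J) = B b (Df s f I) (\<lambda>x. \<Sum>J\<in>desc (lev I - lev ?S) ?S. 1 * indic J x)"
        by (rule B_right[symmetric])
      also have "\<dots> = ?b I ?S"
      proof (rule B_cong)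
        fix x assume "x \<in> leaves root"
        then have "indic ?S x = (\<Sum>J\<in>desc (lev I - lev ?S) ?S. indic J x)"
          by (intro indic_desc[OF S(1)]) (simp_all only: l lev_le[OF I])
        then show "(\<Sum>J\<in>desc (lev I - lev ?S) ?S. 1 * indic J x) = indic ?S x" by (simp only: mult_1)
      qed (rule refl)
      finally show ?thesis .
    qed
    have "(\<Sum>I\<in>D. \<Sum>J\<in>L I. sg I J * ?b I J) = (\<Sum>I\<in>D. ?E I * ?b I (st ?a I))" using in1 by simp
    also have "\<dots> = (\<Sum>S\<in>D. \<Sum>I\<in>{I\<in>D. st ?a I = S}. ?E I * ?b I (st ?a I))" by (rule sum_group_st)
    also have "\<dots> = (\<Sum>S\<in>D. \<Sum>I\<in>D. q S I * ?b I S)"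
    proof (rule sum.cong[OF refl])
      fix S
      have "(\<Sum>I\<in>D. q S I * ?b I S) = (\<Sum>I\<in>D. if st ?a I = S then ?E I * ?b I S else 0)"
        by (intro sum.cong refl) (simp add: q_def)
      also have "\<dots> = (\<Sum>I\<in>{I\<in>D. st ?a I = S}. ?E I * ?b I S)" by (rule sum.inter_filter[OF fin_D, symmetric])
      finally show "(\<Sum>I\<in>{I\<in>D. st ?a I = S}. ?E I * ?b I (st ?a I)) = (\<Sum>I\<in>D. q S I * ?b I S)" by simp
    qed
    also have "\<dots> = (\<Sum>S\<in>D. B b (\<lambda>x. \<Sum>I\<in>D. q S I * Df s f I x) (indic S))" by (simp only: B_left)
    finally have eq: "(\<Sum>I\<in>D. \<Sum>J\<in>L I. sg I J * ?b I J)
       = (\<Sum>S\<in>D. B b (\<lambda>x. \<Sum>I\<in>D. q S I * Df s f I x) (indic S))" .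
    \<comment> \<open>For fixed \<open>S\<close> the first argument is a martingale transform of
      \<open>f\<close> with multipliers at most \<open>2 * a S\<close>. Its norm only sees the
      differences of \<open>f\<close> on cubes with principal cube \<open>S\<close>, and these
      groups are disjoint.\<close>
    have n: "norm (B b (\<lambda>x. \<Sum>I\<in>D. q S I * Df s f I x) (indic S))
        \<le> 2 * T * (sqrt (if st ?a S = S then (?a S)\<^sup>2 * w S else 0) * sqrt (e S))" if S: "S \<in> D" for S
    proof -
      have "nrm s (\<lambda>x. \<Sum>I\<in>D. q S I * Df s f I x) root = (\<Sum>I\<in>D. (norm (q S I))\<^sup>2 * dl s f I)"
        by (rule martingale_transform[OF ws])
      also have "\<dots> = (\<Sum>I\<in>D. if st ?a I = S then (norm (?E I))\<^sup>2 * dl s f I else 0)"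
        by (intro sum.cong refl) (simp add: q_def)
      also have "\<dots> = (\<Sum>I\<in>{I\<in>D. st ?a I = S}. (norm (?E I))\<^sup>2 * dl s f I)"
        by (rule sum.inter_filter[OF fin_D, symmetric])
      also have "\<dots> \<le> (\<Sum>I\<in>{I\<in>D. st ?a I = S}. (2 * ?a S)\<^sup>2 * dl s f I)"
      proof (intro sum_mono mult_right_mono dl_nonneg[OF ws])
        fix I assume "I \<in> {I\<in>D. st ?a I = S}"
        then show "(norm (?E I))\<^sup>2 \<le> (2 * ?a S)\<^sup>2" using norm_av_le_m[OF ww g0, of I] by (intro power_mono) auto
      qed
      also have "\<dots> = (2 * ?a S)\<^sup>2 * e S" by (simp add: e_def sum_distrib_left)
      finally have nn: "nrm s (\<lambda>x. \<Sum>I\<in>D. q S I * Df s f I x) root \<le> (2 * ?a S)\<^sup>2 * e S" .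
      have a0: "0 \<le> ?a S" using avn_nonneg[OF ww S] .
      show ?thesis
      proof (cases "st ?a S = S")
        case True
        have "norm (B b (\<lambda>x. \<Sum>I\<in>D. q S I * Df s f I x) (indic S))
            \<le> T * (sqrt (w S) * sqrt (nrm s (\<lambda>x. \<Sum>I\<in>D. q S I * Df s f I x) root))" by (rule test[OF S])
        also have "\<dots> \<le> T * (sqrt (w S) * sqrt ((2 * ?a S)\<^sup>2 * e S))"
          using nn T0 weight_nonneg[OF ww S] by (intro mult_left_mono real_sqrt_le_mono) auto
        also have "\<dots> = 2 * T * (sqrt ((?a S)\<^sup>2 * w S) * sqrt (e S))" using a0
          by (simp add: real_sqrt_mult)
        finally show ?thesis using True by simp
      next
        case False
        then have "q S I = 0" if "I \<in> D" for I using st_st[OF that, of ?a] by (auto simp: q_def)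
        then have "B b (\<lambda>x. \<Sum>I\<in>D. q S I * Df s f I x) (indic S) = 0" by (simp add: B_def)
        then show ?thesis using False by simp
      qed
    qed
    have "norm (\<Sum>I\<in>D. \<Sum>J\<in>L I. sg I J * ?b I J)
        \<le> (\<Sum>S\<in>D. 2 * T * (sqrt (if st ?a S = S then (?a S)\<^sup>2 * w S else 0) * sqrt (e S)))"
      unfolding eq by (rule sum_norm_le[OF n])
    also have "\<dots> = 2 * T * (\<Sum>S\<in>D. sqrt (if st ?a S = S then (?a S)\<^sup>2 * w S else 0) * sqrt (e S))"
      by (simp only: sum_distrib_left)
    also have "\<dots> \<le> 2 * T * (sqrt (\<Sum>S\<in>D. if st ?a S = S then (?a S)\<^sup>2 * w S else 0) * sqrt (\<Sum>S\<in>D. e S))"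
      using T0 weight_nonneg[OF ww] dl_nonneg[OF ws]
      by (intro mult_left_mono cs_sum) (auto simp: e_def intro!: sum_nonneg)
    also have "\<dots> \<le> 2 * T * (sqrt (4 * ?G) * sqrt ?F)"
    proof -
      have "(\<Sum>S\<in>D. e S) = (\<Sum>I\<in>D. dl s f I)" unfolding e_def by (rule sum_group_st[symmetric])
      then have "(\<Sum>S\<in>D. e S) \<le> ?F" using energy_root_le[OF ws] by simp
      then show ?thesis using stop_norm[OF ww g0] T0 G0 e_def dl_nonneg[OF ws]
        by (intro mult_left_mono mult_mono real_sqrt_le_mono) (auto intro!: sum_nonneg)
    qed
    also have "\<dots> = 4 * T * (sqrt ?F * sqrt ?G)" by (simp add: real_sqrt_mult)
    finally show ?thesis .
  qed
  have rest: "norm (\<Sum>I\<in>D. \<Sum>J\<in>L I. (?E J - sg I J) * ?b I J) \<le> 4 * C0 * sqrt \<kappa> * sqrt KX * (sqrt ?F * sqrt ?G)"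
  proof -
    let ?t = "tau g"
    define h where "h j I J = C0 / 2 ^ j * (sqrt (dl s f I) * (sqrt (s I / s (anc j I)) * (w J / sqrt (w (anc j I))))) * ?t I J" for j I J
    have t0: "0 \<le> ?t I J" for I J by (simp add: tau_def[OF g0])
    have anc0: "0 < s (anc j I)" "0 < w (anc j I)" if "I \<in> D" "j \<le> lev I" for j I
      using weight_pos[OF ws anc_in[OF that]] weight_pos[OF ww anc_in[OF that]] .
    have h0: "0 \<le> h j I J" if "I \<in> D" "J \<in> D" "j \<le> lev I" for j I J
      unfolding h_def using c0 t0 anc0[OF that(1,3)] weight_nonneg[OF ws that(1)] weight_nonneg[OF ww that(2)]
        dl_nonneg[OF ws, of f I] by (intro mult_nonneg_nonneg divide_nonneg_nonneg) auto
    have "norm (\<Sum>I\<in>D. \<Sum>J\<in>L I. (?E J - sg I J) * ?b I J)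
        \<le> (\<Sum>I\<in>D. \<Sum>J\<in>{J\<in>D. lev J = lev I}. norm ((?E J - sg I J) * ?b I J))"
      unfolding L_def by (rule sum_norm_le, rule norm_sum)
    also have "\<dots> \<le> (\<Sum>j\<le>N. \<Sum>Q\<in>D. \<Sum>I\<in>desc j Q. \<Sum>R\<in>nb Q. \<Sum>J\<in>desc j R. h j I J)"
    proof (rule near_sum[OF h0])
      fix I J assume IJ: "I \<in> D" "J \<in> D" "lev J = lev I"
      obtain j where j: "j \<le> lev I" "anc j J \<in> nb (anc j I)"
        and n: "norm (?b I J) \<le> C0 / 2 ^ j * (sqrt (dl s f I) * (sqrt (s I / s (anc j I)) * (w J / sqrt (w (anc j I)))))"
        using coef[OF IJ] by blast
      have "norm ((?E J - sg I J) * ?b I J) = norm (?b I J) * ?t I J"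
        by (simp add: norm_mult tau_def[OF g0] sg_def mult.commute)
      also have "\<dots> \<le> h j I J" unfolding h_def using n t0 by (intro mult_right_mono)
      finally show "\<exists>j\<le>lev I. anc j J \<in> nb (anc j I) \<and> norm ((?E J - sg I J) * ?b I J) \<le> h j I J"
        using j by blast
    qed
    also have "\<dots> \<le> (\<Sum>j\<le>N. (1 + real j) / 2 ^ j * (C0 * sqrt \<kappa> * sqrt KX * (sqrt ?F * sqrt ?G)))"
    proof (rule sum_mono)
      fix j
      define z where "z Q I = (s I / s Q) * Y g j Q I" for Q I
      have Y0: "0 \<le> Y g j Q I" for Q I
        unfolding Y_def[OF g0] using weight_nonneg[OF ww] desc_in by (intro sum_nonneg mult_nonneg_nonneg) auto
      have z0: "0 \<le> z Q I" if "I \<in> desc j Q" for Q I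
        unfolding z_def using Y0 weight_nonneg[OF ws desc_in[OF that]] weight_nonneg[OF ws desc_in'[OF that]] by simp
      \<comment> \<open>Cauchy-Schwarz in \<open>J\<close> alone: the mass of the descendants of the
        neighbours of \<open>Q\<close> is at most \<open>\<kappa> * w Q\<close>, which cancels
        \<open>sqrt (w Q)\<close> in the coefficient and leaves \<open>Y\<close>.\<close>
      have b1: "(\<Sum>R\<in>nb Q. \<Sum>J\<in>desc j R. h j I J) \<le> C0 / 2 ^ j * sqrt \<kappa> * (sqrt (dl s f I) * sqrt (z Q I))"
        if Q: "Q \<in> D" and I: "I \<in> desc j Q" for Q I
      proof -
        have aQ: "anc j I = Q" using desc_anc[OF I] .
        have ID: "I \<in> D" using desc_in[OF I] .
        have wQ: "0 < w Q" and sQ: "0 < s Q" using weight_pos[OF ww Q] weight_pos[OF ws Q] .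
        let ?U = "\<Union>R\<in>nb Q. desc j R"
        have U: "(\<Sum>R\<in>nb Q. sum p (desc j R)) = sum p ?U" for p :: "'c \<Rightarrow> real"
          by (rule sum.UNION_disjoint[symmetric]) (use desc_disj in auto)
        have UD: "J \<in> D" if "J \<in> ?U" for J using that desc_in by auto
        let ?p = "C0 / 2 ^ j * (sqrt (dl s f I) * (sqrt (s I / s Q) * (1 / sqrt (w Q))))"
        have "(\<Sum>R\<in>nb Q. \<Sum>J\<in>desc j R. h j I J) = (\<Sum>J\<in>?U. h j I J)" by (rule U)
        also have "\<dots> = ?p * (\<Sum>J\<in>?U. w J * ?t I J)"
          unfolding sum_distrib_left h_def aQ by (intro sum.cong refl) simp
        also have "(\<Sum>J\<in>?U. w J * ?t I J) = (\<Sum>J\<in>?U. sqrt (w J) * sqrt (w J * (?t I J)\<^sup>2))"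
        proof (rule sum.cong[OF refl])
          fix J assume "J \<in> ?U"
          then have "0 \<le> w J" using weight_nonneg[OF ww UD] by blast
          then show "w J * ?t I J = sqrt (w J) * sqrt (w J * (?t I J)\<^sup>2)"
            using t0[of I J] by (simp add: real_sqrt_mult)
        qed
        also have "?p * \<dots> \<le> ?p * (sqrt (sum w ?U) * sqrt (\<Sum>J\<in>?U. w J * (?t I J)\<^sup>2))"
        proof (rule mult_left_mono)
          show "0 \<le> ?p" using c0 dl_nonneg[OF ws, of f I] weight_nonneg[OF ws ID] sQ wQ by simp
          show "(\<Sum>J\<in>?U. sqrt (w J) * sqrt (w J * (?t I J)\<^sup>2)) \<le> sqrt (sum w ?U) * sqrt (\<Sum>J\<in>?U. w J * (?t I J)\<^sup>2)"
            by (rule cs_sum) (use weight_nonneg[OF ww UD] in auto)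
        qed
        also have "\<dots> \<le> ?p * (sqrt (\<kappa> * w Q) * sqrt (Y g j Q I))"
        proof (rule mult_left_mono)
          show "0 \<le> ?p" using c0 dl_nonneg[OF ws, of f I] weight_nonneg[OF ws ID] sQ wQ by simp
          have "sum w ?U \<le> \<kappa> * w Q" using nb_desc_sum_le[OF Q, of j] by (simp only: U)
          moreover have "(\<Sum>J\<in>?U. w J * (?t I J)\<^sup>2) = Y g j Q I" unfolding Y_def[OF g0] by (rule U[symmetric])
          ultimately show "sqrt (sum w ?U) * sqrt (\<Sum>J\<in>?U. w J * (?t I J)\<^sup>2) \<le> sqrt (\<kappa> * w Q) * sqrt (Y g j Q I)"
            using Y0 kappa0 wQ by (intro mult_mono real_sqrt_le_mono) auto
        qed
        also have "\<dots> = C0 / 2 ^ j * sqrt \<kappa> * (sqrt (dl s f I) * sqrt (z Q I))"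
          using wQ by (simp add: z_def real_sqrt_mult real_sqrt_divide)
        finally show ?thesis .
      qed
      have "(\<Sum>Q\<in>D. \<Sum>I\<in>desc j Q. \<Sum>R\<in>nb Q. \<Sum>J\<in>desc j R. h j I J) \<le> (\<Sum>Q\<in>D. \<Sum>I\<in>desc j Q. C0 / 2 ^ j * sqrt \<kappa> * (sqrt (dl s f I) * sqrt (z Q I)))"
        by (rule sum_mono, rule sum_mono, rule b1)
      also have "\<dots> = C0 / 2 ^ j * sqrt \<kappa> * (\<Sum>I\<in>{I\<in>D. j \<le> lev I}. sqrt (dl s f I) * sqrt (z (anc j I) I))"
        unfolding sum_desc_all sum_distrib_left by (intro sum.cong refl) (simp add: desc_anc)
      also have "\<dots> \<le> C0 / 2 ^ j * sqrt \<kappa> * (sqrt (\<Sum>I\<in>{I\<in>D. j \<le> lev I}. dl s f I) * sqrt (\<Sum>I\<in>{I\<in>D. j \<le> lev I}. z (anc j I) I))"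
        using c0 kappa0 dl_nonneg[OF ws] z0[OF in_desc_anc] by (intro mult_left_mono cs_sum) auto
      also have "\<dots> \<le> C0 / 2 ^ j * sqrt \<kappa> * (sqrt ?F * sqrt (KX * (1 + real j)\<^sup>2 * ?G))"
      proof -
        have "(\<Sum>I\<in>{I\<in>D. j \<le> lev I}. dl s f I) \<le> (\<Sum>I\<in>D. dl s f I)"
          using fin_D dl_nonneg[OF ws] by (intro sum_mono2) auto
        then have 1: "(\<Sum>I\<in>{I\<in>D. j \<le> lev I}. dl s f I) \<le> ?F" using energy_root_le[OF ws, of f] by linarith
        have "(\<Sum>I\<in>{I\<in>D. j \<le> lev I}. z (anc j I) I) = X g j"
          unfolding sum_desc_all X_def[OF g0] z_def by (intro sum.cong refl) (simp add: desc_anc)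
        then have 2: "(\<Sum>I\<in>{I\<in>D. j \<le> lev I}. z (anc j I) I) \<le> KX * (1 + real j)\<^sup>2 * ?G" using X_le[OF g0] by simp
        have 3: "0 \<le> (\<Sum>I\<in>{I\<in>D. j \<le> lev I}. z (anc j I) I)" using z0[OF in_desc_anc] by (intro sum_nonneg) auto
        show ?thesis using 1 2 3 c0 kappa0 F0 by (intro mult_left_mono mult_mono real_sqrt_le_mono) auto
      qed
      also have "\<dots> = (1 + real j) / 2 ^ j * (C0 * sqrt \<kappa> * sqrt KX * (sqrt ?F * sqrt ?G))"
        by (simp add: real_sqrt_mult)
      finally show "(\<Sum>Q\<in>D. \<Sum>I\<in>desc j Q. \<Sum>R\<in>nb Q. \<Sum>J\<in>desc j R. h j I J) \<le> (1 + real j) / 2 ^ j * (C0 * sqrt \<kappa> * sqrt KX * (sqrt ?F * sqrt ?G))" .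
    qed
    also have "\<dots> = (\<Sum>j\<le>N. (1 + real j) / 2 ^ j) * (C0 * sqrt \<kappa> * sqrt KX * (sqrt ?F * sqrt ?G))"
      by (simp only: sum_distrib_right)
    also have "\<dots> \<le> 4 * (C0 * sqrt \<kappa> * sqrt KX * (sqrt ?F * sqrt ?G))"
      using c0 kappa0 KX0 F0 G0 by (intro mult_right_mono sum_weighted_powers) auto
    finally show ?thesis by simp
  qed
  have "norm (\<Sum>I\<in>D. \<Sum>J\<in>L I. ?E J * ?b I J) \<le> 4 * T * (sqrt ?F * sqrt ?G) + 4 * C0 * sqrt \<kappa> * sqrt KX * (sqrt ?F * sqrt ?G)"
    unfolding split by (rule order.trans[OF norm_triangle_ineq add_mono[OF para rest]])
  then show ?thesis unfolding L_def half_const_def by (simp only: distrib_right)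
qed

text \<open>With a difference on both sides no paraproduct arises. One Cauchy-Schwarz over all
  quadruples \<open>(Q, I, R, J)\<close> pairs the difference of \<open>f\<close> with
  \<open>w J / w Q\<close> and that of \<open>g\<close> with \<open>s I / s Q\<close>. Summing the
  first over \<open>J\<close> gives \<open>\<kappa>\<close>; the second sums over \<open>I\<close>
  to at most 1 and over neighbours to at most \<open>deg\<close>.\<close>

lemma diag_estimate:
  fixes f g :: "'c \<Rightarrow> complex"
  assumes c0: "0 \<le> C0"
    and coef: "\<And>I J. I \<in> D \<Longrightarrow> J \<in> D \<Longrightarrow> lev J = lev I \<Longrightarrow> \<exists>j\<le>lev I. anc j J \<in> nb (anc j I) \<and>
      norm (B b (Df s f I) (Df w g J))
        \<le> C0 / 2 ^ j * (sqrt (dl s f I) * sqrt (dl w g J) * (sqrt (s I / s (anc j I)) * sqrt (w J / w (anc j I))))"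
  shows "norm (\<Sum>I\<in>D. \<Sum>J\<in>{J\<in>D. lev J = lev I}. B b (Df s f I) (Df w g J))
    \<le> 4 * C0 * sqrt \<kappa> * sqrt (real deg) * (sqrt (nrm s f root) * sqrt (nrm w g root))"
proof -
  let ?F = "nrm s f root" and ?G = "nrm w g root"
  have F0: "0 \<le> ?F" and G0: "0 \<le> ?G" using nrm_nonneg ws ww by auto
  define h where "h j I J = C0 / 2 ^ j * (sqrt (dl s f I) * sqrt (dl w g J) * (sqrt (s I / s (anc j I)) * sqrt (w J / w (anc j I))))" for j I J
  have h0: "0 \<le> h j I J" if "I \<in> D" "J \<in> D" "j \<le> lev I" for j I J
    unfolding h_def using c0 weight_nonneg[OF ws that(1)] weight_nonneg[OF ww that(2)]
      weight_nonneg[OF ws anc_in[OF that(1,3)]] weight_nonneg[OF ww anc_in[OF that(1,3)]]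
      dl_nonneg[OF ws, of f I] dl_nonneg[OF ww, of g J] by (intro mult_nonneg_nonneg divide_nonneg_nonneg) auto
  have "norm (\<Sum>I\<in>D. \<Sum>J\<in>{J\<in>D. lev J = lev I}. B b (Df s f I) (Df w g J))
      \<le> (\<Sum>I\<in>D. \<Sum>J\<in>{J\<in>D. lev J = lev I}. norm (B b (Df s f I) (Df w g J)))"
    by (rule sum_norm_le, rule norm_sum)
  also have "\<dots> \<le> (\<Sum>j\<le>N. \<Sum>Q\<in>D. \<Sum>I\<in>desc j Q. \<Sum>R\<in>nb Q. \<Sum>J\<in>desc j R. h j I J)"
    by (rule near_sum[OF h0]) (use coef in \<open>auto simp: h_def\<close>)
  also have "\<dots> \<le> (\<Sum>j\<le>N. (1 + real j) / 2 ^ j * (C0 * sqrt \<kappa> * sqrt (real deg) * (sqrt ?F * sqrt ?G)))"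
  proof (rule sum_mono)
    fix j
    let ?T = "SIGMA Q:D. SIGMA I:desc j Q. SIGMA R:nb Q. desc j R"
    have T: "(\<Sum>Q\<in>D. \<Sum>I\<in>desc j Q. \<Sum>R\<in>nb Q. \<Sum>J\<in>desc j R. p Q I J) = (\<Sum>(Q, I, R, J)\<in>?T. p Q I J)" for p :: "'c \<Rightarrow> 'c \<Rightarrow> 'c \<Rightarrow> real"
      using fin_D by (simp add: sum.Sigma split_def)
    define u where "u = (\<lambda>(Q, I, R :: 'c, J). dl s f I * (w J / w Q))"
    define v where "v = (\<lambda>(Q, I, R :: 'c, J). dl w g J * (s I / s Q))"
    have u0: "0 \<le> u t" and v0: "0 \<le> v t" if tT: "t \<in> ?T" for t
    proof -
      obtain Q I R J where t: "t = (Q, I, R, J)" "Q \<in> D" "I \<in> desc j Q" "R \<in> nb Q" "J \<in> desc j R" using tT by (cases t) auto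
      note n = weight_nonneg[OF ws] weight_nonneg[OF ww]
      show "0 \<le> u t" "0 \<le> v t" using t(2) dl_nonneg[OF ws, of f I] dl_nonneg[OF ww, of g J]
          n(1)[OF desc_in[OF t(3)]] n(2)[OF desc_in[OF t(5)]] n(1)[OF t(2)] n(2)[OF t(2)]
        by (auto simp: u_def v_def t(1))
    qed
    have "(\<Sum>Q\<in>D. \<Sum>I\<in>desc j Q. \<Sum>R\<in>nb Q. \<Sum>J\<in>desc j R. h j I J)
        = (\<Sum>Q\<in>D. \<Sum>I\<in>desc j Q. \<Sum>R\<in>nb Q. \<Sum>J\<in>desc j R. C0 / 2 ^ j *
            (sqrt (dl s f I * (w J / w Q)) * sqrt (dl w g J * (s I / s Q))))"
      by (rule sum.cong[OF refl], rule sum.cong[OF refl]) (simp only: h_def desc_anc real_sqrt_mult mult_ac)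
    also have "\<dots> = C0 / 2 ^ j * (\<Sum>t\<in>?T. sqrt (u t) * sqrt (v t))"
      unfolding T sum_distrib_left by (intro sum.cong refl) (simp add: u_def v_def split_def)
    also have "\<dots> \<le> C0 / 2 ^ j * (sqrt (sum u ?T) * sqrt (sum v ?T))"
      using c0 by (intro mult_left_mono cs_sum u0 v0) auto
    also have "\<dots> \<le> C0 / 2 ^ j * (sqrt (\<kappa> * ?F) * sqrt (real deg * ?G))"
    proof -
      have "sum u ?T = (\<Sum>Q\<in>D. \<Sum>I\<in>desc j Q. \<Sum>R\<in>nb Q. \<Sum>J\<in>desc j R. dl s f I * (w J / w Q))"
        unfolding T u_def by (intro sum.cong refl)
      also have "\<dots> = (\<Sum>Q\<in>D. \<Sum>I\<in>desc j Q. dl s f I * ((\<Sum>R\<in>nb Q. sum w (desc j R)) / w Q))"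
        by (simp only: sum_distrib_left sum_divide_distrib)
      also have "\<dots> \<le> (\<Sum>Q\<in>D. \<Sum>I\<in>desc j Q. dl s f I * \<kappa>)"
      proof (rule sum_mono, rule sum_mono)
        fix Q I assume Q: "Q \<in> D"
        have "(\<Sum>R\<in>nb Q. sum w (desc j R)) / w Q \<le> \<kappa>"
          using nb_desc_sum_le[OF Q, of j] weight_pos[OF ww Q] by (simp add: pos_divide_le_eq)
        then show "dl s f I * ((\<Sum>R\<in>nb Q. sum w (desc j R)) / w Q) \<le> dl s f I * \<kappa>"
          using dl_nonneg[OF ws] by (intro mult_left_mono)
      qed
      also have "\<dots> = (\<Sum>I\<in>{I\<in>D. j \<le> lev I}. dl s f I) * \<kappa>" unfolding sum_desc_all by (simp only: sum_distrib_right)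
      also have "\<dots> \<le> ?F * \<kappa>"
      proof (rule mult_right_mono[OF _ kappa0])
        have "(\<Sum>I\<in>{I\<in>D. j \<le> lev I}. dl s f I) \<le> (\<Sum>I\<in>D. dl s f I)"
          using fin_D dl_nonneg[OF ws] by (intro sum_mono2) auto
        then show "(\<Sum>I\<in>{I\<in>D. j \<le> lev I}. dl s f I) \<le> ?F" using energy_root_le[OF ws, of f] by linarith
      qed
      finally have 1: "sum u ?T \<le> \<kappa> * ?F" by (simp only: mult.commute)
      have "sum v ?T = (\<Sum>Q\<in>D. \<Sum>I\<in>desc j Q. \<Sum>R\<in>nb Q. \<Sum>J\<in>desc j R. dl w g J * (s I / s Q))"
        unfolding T v_def by (intro sum.cong refl)
      also have "\<dots> = (\<Sum>Q\<in>D. (\<Sum>I\<in>desc j Q. s I) / s Q * (\<Sum>R\<in>nb Q. \<Sum>J\<in>desc j R. dl w g J))"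
      proof (rule sum.cong[OF refl])
        fix Q
        let ?X = "\<Sum>R\<in>nb Q. \<Sum>J\<in>desc j R. dl w g J"
        have "(\<Sum>I\<in>desc j Q. \<Sum>R\<in>nb Q. \<Sum>J\<in>desc j R. dl w g J * (s I / s Q)) = (\<Sum>I\<in>desc j Q. ?X * (s I / s Q))"
          by (simp only: sum_distrib_right)
        also have "\<dots> = ?X * ((\<Sum>I\<in>desc j Q. s I) / s Q)" by (simp only: sum_distrib_left sum_divide_distrib)
        finally show "(\<Sum>I\<in>desc j Q. \<Sum>R\<in>nb Q. \<Sum>J\<in>desc j R. dl w g J * (s I / s Q))
          = (\<Sum>I\<in>desc j Q. s I) / s Q * ?X" by (simp only: mult.commute)
      qed
      also have "\<dots> \<le> (\<Sum>Q\<in>D. 1 * (\<Sum>R\<in>nb Q. \<Sum>J\<in>desc j R. dl w g J))"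
      proof (rule sum_mono, rule mult_right_mono)
        fix Q assume Q: "Q \<in> D"
        show "(\<Sum>I\<in>desc j Q. s I) / s Q \<le> 1"
          using weight_desc_le[OF ws Q, of j] weight_pos[OF ws Q] by (simp add: pos_divide_le_eq)
      qed (intro sum_nonneg dl_nonneg[OF ww])
      also have "\<dots> = (\<Sum>Q\<in>D. \<Sum>R\<in>nb Q. \<Sum>J\<in>desc j Q. dl w g J)"
        unfolding mult_1 by (rule sum_nb_swap)
      also have "\<dots> = (\<Sum>Q\<in>D. real (card (nb Q)) * (\<Sum>J\<in>desc j Q. dl w g J))" by simp
      also have "\<dots> \<le> (\<Sum>Q\<in>D. real deg * (\<Sum>J\<in>desc j Q. dl w g J))"
        using nb_card by (intro sum_mono mult_right_mono) (auto intro!: sum_nonneg dl_nonneg[OF ww])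
      also have "\<dots> = real deg * (\<Sum>I\<in>{I\<in>D. j \<le> lev I}. dl w g I)" unfolding sum_desc_all by (simp only: sum_distrib_left)
      also have "\<dots> \<le> real deg * ?G"
      proof (rule mult_left_mono)
        have "(\<Sum>I\<in>{I\<in>D. j \<le> lev I}. dl w g I) \<le> (\<Sum>I\<in>D. dl w g I)"
          using fin_D dl_nonneg[OF ww] by (intro sum_mono2) auto
        then show "(\<Sum>I\<in>{I\<in>D. j \<le> lev I}. dl w g I) \<le> ?G" using energy_root_le[OF ww, of g] by linarith
      qed simp
      finally have 2: "sum v ?T \<le> real deg * ?G" .
      have 3: "0 \<le> sum v ?T" by (rule sum_nonneg[OF v0])
      show ?thesis using 1 2 3 c0 F0 kappa0 by (intro mult_left_mono mult_mono real_sqrt_le_mono) auto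
    qed
    also have "\<dots> = 1 / 2 ^ j * (C0 * sqrt \<kappa> * sqrt (real deg) * (sqrt ?F * sqrt ?G))"
      by (simp add: real_sqrt_mult)
    also have "\<dots> \<le> (1 + real j) / 2 ^ j * (C0 * sqrt \<kappa> * sqrt (real deg) * (sqrt ?F * sqrt ?G))"
      using c0 kappa0 F0 G0 by (intro mult_right_mono divide_right_mono) auto
    finally show "(\<Sum>Q\<in>D. \<Sum>I\<in>desc j Q. \<Sum>R\<in>nb Q. \<Sum>J\<in>desc j R. h j I J)
      \<le> (1 + real j) / 2 ^ j * (C0 * sqrt \<kappa> * sqrt (real deg) * (sqrt ?F * sqrt ?G))" .
  qed
  also have "\<dots> = (\<Sum>j\<le>N. (1 + real j) / 2 ^ j) * (C0 * sqrt \<kappa> * sqrt (real deg) * (sqrt ?F * sqrt ?G))"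
    by (simp only: sum_distrib_right)
  also have "\<dots> \<le> 4 * (C0 * sqrt \<kappa> * sqrt (real deg) * (sqrt ?F * sqrt ?G))"
    using c0 kappa0 F0 G0 by (intro mult_right_mono sum_weighted_powers) auto
  finally show ?thesis by simp
qed

end

section \<open>Telescoping over the levels and the full bilinear bound\<close>

context dyadic_tree begin

definition lv :: "nat \<Rightarrow> 'c set" where "lv k = {J\<in>D. lev J = k}"

lemma fin_lv [simp]: "finite (lv k)"
  using fin_D by (simp add: lv_def)

definition Ek :: "('c \<Rightarrow> real) \<Rightarrow> ('c \<Rightarrow> complex) \<Rightarrow> nat \<Rightarrow> 'c \<Rightarrow> complex" where
  "Ek \<mu> f k x = (\<Sum>J\<in>lv k. av \<mu> f J * indic J x)"

lemma indic_lv: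
  assumes x: "x \<in> leaves root" and k: "k \<le> N" and J: "J \<in> lv k"
  shows "indic J x = (if J = anc (N - k) x then 1 else 0)"
  using assms by (auto simp: indic_def leaves_iff lv_def)

lemma Ek_anc: assumes "x \<in> leaves root" "k \<le> N" shows "Ek \<mu> f k x = av \<mu> f (anc (N - k) x)"
proof -
  have x: "x \<in> D" "lev x = N" using assms leaves_in leaves_lev by auto
  have a: "anc (N - k) x \<in> lv k" using anc_in_lev[OF x(1), of "N - k"] x assms by (auto simp: lv_def)
  have "Ek \<mu> f k x = (\<Sum>J\<in>lv k. if J = anc (N - k) x then av \<mu> f J else 0)"
    unfolding Ek_def by (intro sum.cong refl) (simp add: indic_lv[OF assms])
  then show ?thesis using a by simp
qed

lemma Ek_N: assumes "weight \<mu>" "x \<in> leaves root" shows "Ek \<mu> f N x = f x"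
  using Ek_anc[OF assms(2) order_refl] av_leaf[OF assms(1) leaves_in leaves_lev] assms(2) by simp

lemma lv_0: "lv 0 = {root}"
  using lev_root root_in by (auto simp: lv_def)

lemma Ek_Suc:
  assumes "weight \<mu>" "x \<in> leaves root" "k < N"
  shows "Ek \<mu> f (Suc k) x = Ek \<mu> f k x + (\<Sum>I\<in>lv k. Df \<mu> f I x)"
proof -
  have x: "x \<in> D" "lev x = N" using assms leaves_in leaves_lev by auto
  let ?I = "anc (N - k) x" and ?c = "anc (N - Suc k) x"
  have I: "?I \<in> D" "lev ?I = k" using anc_in_lev[OF x(1), of "N - k"] x assms by auto
  have c: "?c \<in> D" "lev ?c = Suc k" using anc_in_lev[OF x(1), of "N - Suc k"] x assms by auto
  have "par ?c = ?I" using assms(3) by (simp flip: anc_Suc' add: Suc_diff_Suc)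
  moreover have "?c \<noteq> root" using c lev_root[OF c(1)] by auto
  ultimately have ch: "?c \<in> ch ?I" using c by (simp add: ch_def)
  have xc: "x \<in> leaves ?c" using x c assms(3) by (simp add: leaves_iff)
  have z: "Df \<mu> f J x = 0" if "J \<in> lv k" "J \<noteq> ?I" for J
    using that x by (intro Df_zero) (auto simp: leaves_iff lv_def)
  have "(\<Sum>J\<in>lv k. Df \<mu> f J x) = (\<Sum>J\<in>lv k. if J = ?I then Df \<mu> f J x else 0)"
    by (intro sum.cong refl) (simp add: z)
  also have "\<dots> = Df \<mu> f ?I x"
  proof -
    have "?I \<in> lv k" using I by (simp add: lv_def)
    then show ?thesis by simp
  qed
  also have "\<dots> = av \<mu> f ?c - av \<mu> f ?I" by (rule Df_val[OF ch xc])
  finally show ?thesis using Ek_anc[OF assms(2)] assms(3) by simp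
qed

lemma B_add_left: "B b (\<lambda>x. u x + u' x) v = B b u v + B b u' v"
  by (simp add: B_def algebra_simps sum.distrib)

lemma B_add_right: "B b u (\<lambda>x. v x + v' x) = B b u v + B b u v'"
  by (simp add: B_def algebra_simps sum.distrib)

text \<open>Product rule: passing from level \<open>k\<close> to \<open>k + 1\<close> in both
  arguments adds the three mixed terms, and all of them involve cubes of the same level
  \<open>k\<close>.\<close>

lemma B_telescope:
  assumes \<mu>: "weight \<mu>" and \<nu>: "weight \<nu>"
  shows "n \<le> N \<Longrightarrow> B b (Ek \<mu> f n) (Ek \<nu> g n) = B b (Ek \<mu> f 0) (Ek \<nu> g 0) +
    (\<Sum>k<n. (\<Sum>I\<in>lv k. \<Sum>J\<in>lv k. av \<nu> g J * B b (Df \<mu> f I) (indic J))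
      + (\<Sum>J\<in>lv k. \<Sum>I\<in>lv k. av \<mu> f I * B b (indic I) (Df \<nu> g J))
      + (\<Sum>I\<in>lv k. \<Sum>J\<in>lv k. B b (Df \<mu> f I) (Df \<nu> g J)))"
proof (induction n)
  case (Suc n)
  then have n: "n < N" by simp
  let ?P = "\<lambda>x. \<Sum>I\<in>lv n. 1 * Df \<mu> f I x" and ?R = "\<lambda>x. \<Sum>J\<in>lv n. 1 * Df \<nu> g J x"
  have "B b (Ek \<mu> f (Suc n)) (Ek \<nu> g (Suc n)) = B b (\<lambda>x. Ek \<mu> f n x + ?P x) (\<lambda>x. Ek \<nu> g n x + ?R x)"
    by (rule B_cong) (simp_all add: Ek_Suc \<mu> \<nu> n)
  also have "\<dots> = B b (Ek \<mu> f n) (Ek \<nu> g n) + (B b ?P (Ek \<nu> g n) + B b (Ek \<mu> f n) ?R + B b ?P ?R)"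
    by (simp only: B_add_left B_add_right) (simp only: ac_simps)
  also have "B b ?P (Ek \<nu> g n) = (\<Sum>I\<in>lv n. \<Sum>J\<in>lv n. av \<nu> g J * B b (Df \<mu> f I) (indic J))"
    unfolding Ek_def[abs_def] B_left B_right by simp
  also have "B b (Ek \<mu> f n) ?R = (\<Sum>J\<in>lv n. \<Sum>I\<in>lv n. av \<mu> f I * B b (indic I) (Df \<nu> g J))"
    unfolding Ek_def[abs_def] B_right B_left by simp
  also have "B b ?P ?R = (\<Sum>I\<in>lv n. \<Sum>J\<in>lv n. B b (Df \<mu> f I) (Df \<nu> g J))"
    unfolding B_right B_left by (subst sum.swap) simp
  finally show ?case using Suc by simp
qed simp

text \<open>The telescoping sum stops before level \<open>N\<close>, whereas \<open>near_sum\<close>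
  runs over all of \<open>D\<close>; leaves have no children, so the missing level contributes
  nothing.\<close>

lemma sum_levels:
  assumes "\<And>I J. I \<in> lv N \<Longrightarrow> J \<in> lv N \<Longrightarrow> F I J = 0"
  shows "(\<Sum>k<N. \<Sum>I\<in>lv k. \<Sum>J\<in>lv k. F I J) = (\<Sum>I\<in>D. \<Sum>J\<in>{J\<in>D. lev J = lev I}. (F I J :: complex))"
proof -
  have "(\<Sum>I\<in>D. \<Sum>J\<in>{J\<in>D. lev J = lev I}. F I J) = (\<Sum>k\<in>{..N}. \<Sum>I\<in>{I\<in>D. lev I = k}. \<Sum>J\<in>{J\<in>D. lev J = lev I}. F I J)"
    by (rule sum.group[symmetric]) (use fin_D lev_le in auto)
  also have "\<dots> = (\<Sum>k\<in>{..N}. \<Sum>I\<in>lv k. \<Sum>J\<in>lv k. F I J)"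
    by (rule sum.cong[OF refl])+ (auto simp: lv_def intro: sum.cong)
  also have "{..N} = insert N {..<N}" by auto
  also have "(\<Sum>k\<in>insert N {..<N}. \<Sum>I\<in>lv k. \<Sum>J\<in>lv k. F I J) = (\<Sum>k<N. \<Sum>I\<in>lv k. \<Sum>J\<in>lv k. F I J)"
    using assms by simp
  finally show ?thesis by simp
qed

lemma nrm_indic: assumes "weight \<mu>" "I \<in> D" shows "nrm \<mu> (indic I) root = \<mu> I"
proof -
  have "nrm \<mu> (indic I) root = (\<Sum>x\<in>leaves root. if x \<in> leaves I then \<mu> x else 0)"
    unfolding nrm_def by (intro sum.cong refl) (simp add: indic_def)
  also have "\<dots> = sum \<mu> {x\<in>leaves root. x \<in> leaves I}" by (rule sum.inter_filter[symmetric]) simp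
  also have "{x\<in>leaves root. x \<in> leaves I} = leaves I" using leaves_mono[of I root] assms below_root by auto
  finally show ?thesis using weight_leaves[OF assms] by simp
qed

end

context dyadic_adj begin

definition core_const :: "real \<Rightarrow> real \<Rightarrow> real \<Rightarrow> real \<Rightarrow> real \<Rightarrow> real \<Rightarrow> real" where
  "core_const d C \<eta> k T C1 =
    (let C0 = C1 + T * sqrt (real deg * d) in T
      + 2 * two_weight_tree.half_const deg d C \<eta> k T C0
      + 4 * C0 * sqrt (real deg * d) * sqrt (real deg))"

text \<open>Non-adjacent pairs (\<open>0 < j\<close>) get their coefficient bounds from
  \<open>far\<close>, adjacent ones from testing. In \<open>far\<close> the generation
  \<open>j\<close> is chosen before the functions, since the geometry alone determines it; one
  hypothesis then serves indicators and differences in the second argument alike.\<close>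

theorem core_bound:
  assumes ws: "weight s" and ww: "weight w" and ds: "doubling s d" and dw: "doubling w d" and d1: "1 \<le> d"
    and thin: "thin_boundary s C \<eta>" "thin_boundary w C \<eta>" and C: "0 \<le> C" and eta: "0 < \<eta>" "\<eta> < 1"
    and tr: "transfers s w k" "transfers w s k" and k0: "0 < k"
    and T0: "0 \<le> T" and C1: "0 \<le> C1" and chdeg: "\<And>I. I \<in> D \<Longrightarrow> card (ch I) \<le> deg"
    and test1: "\<And>u L. L \<in> D \<Longrightarrow> norm (B b u (indic L)) \<le> T * (sqrt (w L) * sqrt (nrm s u root))"
    and test2: "\<And>v L. L \<in> D \<Longrightarrow> norm (B b (indic L) v) \<le> T * (sqrt (s L) * sqrt (nrm w v root))"
    and far: "\<And>I J. I \<in> D \<Longrightarrow> J \<in> D \<Longrightarrow> lev J = lev I \<Longrightarrow> \<exists>j\<le>lev I. anc j J \<in> nb (anc j I) \<and> (0 < j \<longrightarrow>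
      (\<forall>f v. (\<forall>x\<in>leaves root - leaves J. v x = 0) \<longrightarrow> norm (B b (Df s f I) v)
        \<le> C1 / 2 ^ j * (sqrt (dl s f I) * sqrt (nrm w v root) * (sqrt (s I / s (anc j I)) * sqrt (w J / w (anc j I))))) \<and>
      (\<forall>u g. (\<forall>x\<in>leaves root - leaves I. u x = 0) \<longrightarrow> norm (B b u (Df w g J))
        \<le> C1 / 2 ^ j * (sqrt (nrm s u root) * sqrt (dl w g J) * (sqrt (s I / s (anc j J)) * sqrt (w J / w (anc j J))))))"
  shows "norm (B b f g) \<le> core_const d C \<eta> k T C1 * (sqrt (nrm s f root) * sqrt (nrm w g root))"
proof -
  interpret A: two_weight_tree D lev par root N adj deg s w d C \<eta> k
    by unfold_locales (use assms in auto)
  interpret A': two_weight_tree D lev par root N adj deg w s d C \<eta> k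
    by unfold_locales (use assms in auto)
  \<comment> \<open>The second summand is the price of adjacent pairs: \<open>sqrt d\<close> for
    comparing their masses and \<open>sqrt (real deg)\<close> for splitting a difference over the
    children.\<close>
  define C0 where "C0 = C1 + T * sqrt (real deg * d)"
  have "root \<in> nb root" using adj_refl root_in by (simp add: nb_def)
  then have "card (nb root) \<noteq> 0" by auto
  then have deg1: "1 \<le> real deg" using nb_card[OF root_in] by linarith
  have dd: "d \<le> real deg * d" using mult_right_mono[OF deg1, of d] d1 by simp
  have c0: "0 \<le> C0" "C1 \<le> C0" "T * sqrt (real deg * d) \<le> C0"
    using C1 T0 d1 by (auto simp: C0_def)
  have Td: "T * sqrt d \<le> C0" using c0(3) mult_left_mono[OF real_sqrt_le_mono[OF dd] T0] by linarith
  let ?F = "nrm s f root" and ?G = "nrm w g root"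
  \<comment> \<open>Testing produces \<open>sqrt (\<mu> J)\<close>; for adjacent cubes doubling
    rewrites this in the shape that the decaying coefficients have at \<open>j = 0\<close>.\<close>
  have near0: "sqrt (\<mu> J) \<le> sqrt d * (\<mu> J / sqrt (\<mu> I))" if "weight \<mu>" "doubling \<mu> d" "I \<in> D" "J \<in> D" "J \<in> nb I" for \<mu> I J
  proof -
    have p: "0 < \<mu> I" "0 < \<mu> J" using weight_pos that by auto
    have "\<mu> I \<le> d * \<mu> J" using that nb_sym[OF that(3,5)] by (auto simp: doubling_def)
    then have "sqrt (\<mu> I) \<le> sqrt d * sqrt (\<mu> J)" by (simp flip: real_sqrt_mult)
    then have "sqrt (\<mu> J) * sqrt (\<mu> I) \<le> sqrt (\<mu> J) * (sqrt d * sqrt (\<mu> J))" using p by (intro mult_left_mono) auto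
    also have "\<dots> = sqrt d * \<mu> J" using p by simp
    finally show ?thesis using p by (simp add: pos_le_divide_eq)
  qed
  have ratio0: "1 \<le> sqrt d * sqrt (w J / w I)" if "I \<in> D" "J \<in> D" "J \<in> nb I" for I J
  proof -
    have p: "0 < w I" "0 < w J" using weight_pos[OF ww] that by auto
    have "w I \<le> d * w J" using dw that nb_sym[OF that(1,3)] by (auto simp: doubling_def)
    then have "1 \<le> d * (w J / w I)" using p by (simp add: pos_le_divide_eq)
    then show ?thesis by (simp flip: real_sqrt_mult)
  qed
  have nrm_ind: "sqrt (\<mu> J) * sqrt (\<mu> J / \<mu> Q) = \<mu> J / sqrt (\<mu> Q)" if "0 < \<mu> J" for \<mu> :: "'c \<Rightarrow> real" and J Q
    using that by (simp add: real_sqrt_divide)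
  have coef1: "\<exists>j\<le>lev I. anc j J \<in> nb (anc j I) \<and> norm (B b (Df s f I) (indic J))
        \<le> C0 / 2 ^ j * (sqrt (dl s f I) * (sqrt (s I / s (anc j I)) * (w J / sqrt (w (anc j I)))))"
    if IJ: "I \<in> D" "J \<in> D" "lev J = lev I" for I J
  proof -
    obtain j where j: "j \<le> lev I" "anc j J \<in> nb (anc j I)" and e: "0 < j \<Longrightarrow> norm (B b (Df s f I) (indic J))
        \<le> C1 / 2 ^ j * (sqrt (dl s f I) * sqrt (nrm w (indic J) root) * (sqrt (s I / s (anc j I)) * sqrt (w J / w (anc j I))))"
    proof -
      have "\<forall>x\<in>leaves root - leaves J. indic J x = 0" by (simp add: indic_def)
      then show ?thesis using far[OF IJ] that by blast
    qed
    have pos: "0 < w J" "0 < s I" "0 < s (anc j I)" "0 < w (anc j I)"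
      using weight_pos[OF ww] weight_pos[OF ws] IJ anc_in[OF IJ(1) j(1)] by auto
    have dl0: "0 \<le> dl s f I" by (rule dl_nonneg[OF ws])
    have "norm (B b (Df s f I) (indic J)) \<le> C0 / 2 ^ j * (sqrt (dl s f I) * (sqrt (s I / s (anc j I)) * (w J / sqrt (w (anc j I)))))"
    proof (cases "j = 0")
      case True
      have "norm (B b (Df s f I) (indic J)) \<le> T * (sqrt (w J) * sqrt (dl s f I))"
        using test1[OF IJ(2), of "Df s f I"] nrm_Df[OF ws IJ(1)] by simp
      also have "\<dots> \<le> T * ((sqrt d * (w J / sqrt (w I))) * sqrt (dl s f I))"
        using near0[OF ww dw IJ(1,2)] j True T0 dl0 by (intro mult_left_mono mult_right_mono) auto
      also have "\<dots> = (T * sqrt d) * (sqrt (dl s f I) * (w J / sqrt (w I)))" by simp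
      also have "\<dots> \<le> C0 * (sqrt (dl s f I) * (w J / sqrt (w I)))"
        using Td dl0 pos weight_pos[OF ww IJ(1)] by (intro mult_right_mono) auto
      finally show ?thesis using True pos by simp
    next
      case False
      have "norm (B b (Df s f I) (indic J)) \<le> C1 / 2 ^ j * (sqrt (dl s f I) * sqrt (w J) * (sqrt (s I / s (anc j I)) * sqrt (w J / w (anc j I))))"
        using e False nrm_indic[OF ww IJ(2)] by simp
      also have "\<dots> = C1 / 2 ^ j * (sqrt (dl s f I) * (sqrt (s I / s (anc j I)) * (sqrt (w J) * sqrt (w J / w (anc j I)))))"
        by (simp only: mult_ac)
      also have "\<dots> = C1 / 2 ^ j * (sqrt (dl s f I) * (sqrt (s I / s (anc j I)) * (w J / sqrt (w (anc j I)))))"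
        by (simp only: nrm_ind[of w J, OF pos(1)])
      also have "\<dots> \<le> C0 / 2 ^ j * (sqrt (dl s f I) * (sqrt (s I / s (anc j I)) * (w J / sqrt (w (anc j I)))))"
        using c0 dl0 pos by (intro mult_right_mono divide_right_mono) auto
      finally show ?thesis .
    qed
    then show ?thesis using j by blast
  qed
  have coef2: "\<exists>j\<le>lev J. anc j I \<in> nb (anc j J) \<and> norm (B b (indic I) (Df w g J))
        \<le> C0 / 2 ^ j * (sqrt (dl w g J) * (sqrt (w J / w (anc j J)) * (s I / sqrt (s (anc j J)))))"
    if JI: "J \<in> D" "I \<in> D" "lev I = lev J" for J I
  proof -
    note IJ = JI(2,1) JI(3)[symmetric]
    obtain j where j0: "j \<le> lev I" "anc j J \<in> nb (anc j I)" and e: "0 < j \<Longrightarrow> norm (B b (indic I) (Df w g J))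
        \<le> C1 / 2 ^ j * (sqrt (nrm s (indic I) root) * sqrt (dl w g J) * (sqrt (s I / s (anc j J)) * sqrt (w J / w (anc j J))))"
    proof -
      have "\<forall>x\<in>leaves root - leaves I. indic I x = 0" by (simp add: indic_def)
      then show ?thesis using far[OF IJ] that by blast
    qed
    have j: "j \<le> lev J" "anc j I \<in> nb (anc j J)" using j0 JI(3) nb_sym[OF anc_in[OF IJ(1) j0(1)] j0(2)] by auto
    have pos: "0 < w J" "0 < s I" "0 < s (anc j J)" "0 < w (anc j J)"
      using weight_pos[OF ww] weight_pos[OF ws] IJ anc_in[OF JI(1) j(1)] by auto
    have dl0: "0 \<le> dl w g J" by (rule dl_nonneg[OF ww])
    have "norm (B b (indic I) (Df w g J)) \<le> C0 / 2 ^ j * (sqrt (dl w g J) * (sqrt (w J / w (anc j J)) * (s I / sqrt (s (anc j J)))))"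
    proof (cases "j = 0")
      case True
      have "norm (B b (indic I) (Df w g J)) \<le> T * (sqrt (s I) * sqrt (dl w g J))"
        using test2[OF IJ(1), of "Df w g J"] nrm_Df[OF ww IJ(2)] by simp
      also have "\<dots> \<le> T * ((sqrt d * (s I / sqrt (s J))) * sqrt (dl w g J))"
        using near0[OF ws ds JI(1,2)] j True T0 dl0 by (intro mult_left_mono mult_right_mono) auto
      also have "\<dots> = (T * sqrt d) * (sqrt (dl w g J) * (s I / sqrt (s J)))" by simp
      also have "\<dots> \<le> C0 * (sqrt (dl w g J) * (s I / sqrt (s J)))"
        using Td dl0 pos weight_pos[OF ws JI(1)] by (intro mult_right_mono) auto
      finally show ?thesis using True pos by simp
    next
      case False
      have "norm (B b (indic I) (Df w g J)) \<le> C1 / 2 ^ j * (sqrt (s I) * sqrt (dl w g J) * (sqrt (s I / s (anc j J)) * sqrt (w J / w (anc j J))))"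
        using e False nrm_indic[OF ws IJ(1)] by simp
      also have "\<dots> = C1 / 2 ^ j * (sqrt (dl w g J) * (sqrt (w J / w (anc j J)) * (sqrt (s I) * sqrt (s I / s (anc j J)))))"
        by (simp only: mult_ac)
      also have "\<dots> = C1 / 2 ^ j * (sqrt (dl w g J) * (sqrt (w J / w (anc j J)) * (s I / sqrt (s (anc j J)))))"
        by (simp only: nrm_ind[of s I, OF pos(2)])
      also have "\<dots> \<le> C0 / 2 ^ j * (sqrt (dl w g J) * (sqrt (w J / w (anc j J)) * (s I / sqrt (s (anc j J)))))"
        using c0 dl0 pos by (intro mult_right_mono divide_right_mono) auto
      finally show ?thesis .
    qed
    then show ?thesis using j by blast
  qed
  have coef3: "\<exists>j\<le>lev I. anc j J \<in> nb (anc j I) \<and> norm (B b (Df s f I) (Df w g J))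
        \<le> C0 / 2 ^ j * (sqrt (dl s f I) * sqrt (dl w g J) * (sqrt (s I / s (anc j I)) * sqrt (w J / w (anc j I))))"
    if IJ: "I \<in> D" "J \<in> D" "lev J = lev I" for I J
  proof -
    obtain j where j: "j \<le> lev I" "anc j J \<in> nb (anc j I)" and e: "0 < j \<Longrightarrow> norm (B b (Df s f I) (Df w g J))
        \<le> C1 / 2 ^ j * (sqrt (dl s f I) * sqrt (nrm w (Df w g J) root) * (sqrt (s I / s (anc j I)) * sqrt (w J / w (anc j I))))"
    proof -
      have "\<forall>x\<in>leaves root - leaves J. Df w g J x = 0" by (simp add: Df_zero)
      then show ?thesis using far[OF IJ] that by blast
    qed
    have pos: "0 < w J" "0 < s I" "0 < s (anc j I)" "0 < w (anc j I)"
      using weight_pos[OF ww] weight_pos[OF ws] IJ anc_in[OF IJ(1) j(1)] by auto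
    have dl0: "0 \<le> dl s f I" "0 \<le> dl w g J" by (rule dl_nonneg[OF ws], rule dl_nonneg[OF ww])
    have "norm (B b (Df s f I) (Df w g J)) \<le> C0 / 2 ^ j * (sqrt (dl s f I) * sqrt (dl w g J) * (sqrt (s I / s (anc j I)) * sqrt (w J / w (anc j I))))"
    proof (cases "j = 0")
      case True
      \<comment> \<open>Testing only accepts indicators, so the difference is expanded over its at
        most \<open>deg\<close> children.\<close>
      let ?e = "\<lambda>c. av w g c - av w g J"
      have "B b (Df s f I) (Df w g J) = (\<Sum>c\<in>ch J. ?e c * B b (Df s f I) (indic c))"
        unfolding Df_def[of w g J, abs_def] B_right ..
      then have "norm (B b (Df s f I) (Df w g J)) \<le> (\<Sum>c\<in>ch J. norm (?e c * B b (Df s f I) (indic c)))"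
        by (simp only: norm_sum)
      also have "\<dots> \<le> (\<Sum>c\<in>ch J. T * sqrt (dl s f I) * (sqrt 1 * sqrt (w c * (norm (?e c))\<^sup>2)))"
      proof (rule sum_mono)
        fix c assume c: "c \<in> ch J"
        have "norm (?e c * B b (Df s f I) (indic c)) \<le> norm (?e c) * (T * (sqrt (w c) * sqrt (dl s f I)))"
          unfolding norm_mult using test1[OF ch_in[OF c], of "Df s f I"] nrm_Df[OF ws IJ(1)]
          by (intro mult_left_mono) auto
        then show "norm (?e c * B b (Df s f I) (indic c)) \<le> T * sqrt (dl s f I) * (sqrt 1 * sqrt (w c * (norm (?e c))\<^sup>2))"
          by (simp add: real_sqrt_mult mult_ac)
      qed
      also have "\<dots> = T * sqrt (dl s f I) * (\<Sum>c\<in>ch J. sqrt 1 * sqrt (w c * (norm (?e c))\<^sup>2))"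
        by (simp only: sum_distrib_left)
      also have "\<dots> \<le> T * sqrt (dl s f I) * (sqrt (\<Sum>c\<in>ch J. 1) * sqrt (dl w g J))"
        unfolding dl_def[of w g J] using T0 dl0 weight_nonneg[OF ww ch_in] by (intro mult_left_mono cs_sum) auto
      also have "\<dots> \<le> T * sqrt (dl s f I) * (sqrt (real deg) * sqrt (dl w g J))"
        using chdeg[OF IJ(2)] T0 dl0 by (intro mult_left_mono mult_right_mono real_sqrt_le_mono) auto
      also have "\<dots> = T * sqrt (real deg) * (sqrt (dl s f I) * sqrt (dl w g J)) * 1" by simp
      also have "\<dots> \<le> T * sqrt (real deg) * (sqrt (dl s f I) * sqrt (dl w g J)) * (sqrt d * sqrt (w J / w I))"
        using ratio0[OF IJ(1,2)] j True T0 dl0 by (intro mult_left_mono) auto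
      also have "\<dots> = (T * sqrt (real deg * d)) * (sqrt (dl s f I) * sqrt (dl w g J) * sqrt (w J / w I))"
        by (simp only: real_sqrt_mult mult_ac)
      also have "\<dots> \<le> C0 * (sqrt (dl s f I) * sqrt (dl w g J) * sqrt (w J / w I))"
        using c0 dl0 pos weight_pos[OF ww IJ(1)] by (intro mult_right_mono) auto
      finally show ?thesis using True pos by simp
    next
      case False
      have "norm (B b (Df s f I) (Df w g J)) \<le> C1 / 2 ^ j * (sqrt (dl s f I) * sqrt (dl w g J) * (sqrt (s I / s (anc j I)) * sqrt (w J / w (anc j I))))"
        using e False nrm_Df[OF ww IJ(2)] by simp
      also have "\<dots> \<le> C0 / 2 ^ j * (sqrt (dl s f I) * sqrt (dl w g J) * (sqrt (s I / s (anc j I)) * sqrt (w J / w (anc j I))))"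
        using c0 dl0 pos by (intro mult_right_mono divide_right_mono) auto
      finally show ?thesis .
    qed
    then show ?thesis using j by blast
  qed
  let ?H1 = "\<Sum>I\<in>D. \<Sum>J\<in>{J\<in>D. lev J = lev I}. av w g J * B b (Df s f I) (indic J)"
  let ?H2 = "\<Sum>J\<in>D. \<Sum>I\<in>{I\<in>D. lev I = lev J}. av s f I * B b (indic I) (Df w g J)"
  let ?H3 = "\<Sum>I\<in>D. \<Sum>J\<in>{J\<in>D. lev J = lev I}. B b (Df s f I) (Df w g J)"
  have leaf0: "Df \<mu> h I = (\<lambda>_. 0)" if "I \<in> lv N" for \<mu> h I
    using that ch_leaf by (auto simp: Df_def[abs_def] lv_def)
  have B0: "B b (\<lambda>_. 0) v = 0" "B b u (\<lambda>_. 0) = 0" for u v by (simp_all add: B_def)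
  have "B b f g = B b (Ek s f N) (Ek w g N)" by (rule B_cong) (simp_all add: Ek_N ws ww)
  also have "\<dots> = B b (Ek s f 0) (Ek w g 0) + (?H1 + ?H2 + ?H3)"
    unfolding B_telescope[OF ws ww order_refl] sum.distrib
    by (subst (1 2 3) sum_levels) (simp_all add: leaf0 B0)
  also have "B b (Ek s f 0) (Ek w g 0) = av s f root * (av w g root * B b (indic root) (indic root))"
    by (simp add: Ek_def[abs_def] lv_0 B_def sum_distrib_left mult_ac)
  finally have eq: "B b f g = av s f root * (av w g root * B b (indic root) (indic root)) + (?H1 + ?H2 + ?H3)" .
  have b0: "norm (av s f root * (av w g root * B b (indic root) (indic root))) \<le> T * (sqrt ?F * sqrt ?G)"
  proof -
    have "norm (B b (indic root) (indic root)) \<le> T * (sqrt (w root) * sqrt (s root))"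
      using test1[OF root_in, of "indic root"] nrm_indic[OF ws root_in] by simp
    then have "norm (av s f root * (av w g root * B b (indic root) (indic root)))
        \<le> norm (av s f root) * (norm (av w g root) * (T * (sqrt (w root) * sqrt (s root))))"
      unfolding norm_mult by (intro mult_left_mono) auto
    also have "\<dots> = T * (sqrt (s root * (norm (av s f root))\<^sup>2) * sqrt (w root * (norm (av w g root))\<^sup>2))"
      by (simp add: real_sqrt_mult)
    also have "\<dots> \<le> T * (sqrt ?F * sqrt ?G)"
      using energy_av_le[OF ws root_in, of f] energy_av_le[OF ww root_in, of g] T0 nrm_nonneg[OF ws] weight_nonneg[OF ww root_in]
      by (intro mult_left_mono mult_mono real_sqrt_le_mono) auto
    finally show ?thesis .
  qed
  have b1: "norm ?H1 \<le> A.half_const T C0 * (sqrt ?F * sqrt ?G)"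
    by (rule A.half_estimate[OF test1 T0 c0(1) coef1])
  \<comment> \<open>The same half estimate with the weights exchanged, applied to the transposed
    matrix.\<close>
  have b2: "norm ?H2 \<le> A'.half_const T C0 * (sqrt ?G * sqrt ?F)"
  proof -
    have t: "norm (B (\<lambda>x y. b y x) u (indic L)) \<le> T * (sqrt (s L) * sqrt (nrm w u root))" if "L \<in> D" for u L
      using test2[OF that, of u] by (simp only: B_transpose[of b])
    show ?thesis using A'.half_estimate[OF t T0 c0(1), of g f] coef2 by (simp only: B_transpose[of b])
  qed
  have b3: "norm ?H3 \<le> 4 * C0 * sqrt A.\<kappa> * sqrt (real deg) * (sqrt ?F * sqrt ?G)"
    by (rule A.diag_estimate[OF c0(1) coef3])
  have "norm (B b f g) \<le> norm (av s f root * (av w g root * B b (indic root) (indic root))) + (norm ?H1 + norm ?H2 + norm ?H3)"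
    unfolding eq by (intro norm_triangle_le add_mono order_refl)
  also have "\<dots> \<le> T * (sqrt ?F * sqrt ?G) + (A.half_const T C0 * (sqrt ?F * sqrt ?G) + A'.half_const T C0 * (sqrt ?G * sqrt ?F)
      + 4 * C0 * sqrt A.\<kappa> * sqrt (real deg) * (sqrt ?F * sqrt ?G))"
    by (intro add_mono b0 b1 b2 b3)
  also have "\<dots> = core_const d C \<eta> k T C1 * (sqrt ?F * sqrt ?G)"
    unfolding core_const_def Let_def C0_def[symmetric] A.\<kappa>_def by (simp add: algebra_simps)
  finally show ?thesis .
qed

end

section \<open>Measures in \<open>A\<^sub>\<infinity>\<close>\<close>

definition cb :: "real ^ 'n \<Rightarrow> real \<Rightarrow> (real ^ 'n) set" where
  "cb a l = cbox a (\<chi> i. a $ i + l)"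

lemma cubes_cb: "cubes = {cb a l | a l. 0 < l}"
  by (simp add: cubes_def cb_def)

lemma in_cb: "x \<in> cb a l \<longleftrightarrow> (\<forall>i. a $ i \<le> x $ i \<and> x $ i \<le> a $ i + l)"
  by (simp add: cb_def mem_box_cart)

lemma cb_borel [measurable]: "cb a l \<in> sets borel"
  by (simp add: cb_def)

lemma cb_bounded: "bounded (cb a l)"
  by (simp add: cb_def bounded_cbox)

lemma measure_cb: "0 \<le> l \<Longrightarrow> measure lborel (cb (a :: real ^ 'n) l) = l ^ CARD('n)"
proof -
  assume l: "0 \<le> l"
  have "a \<in> cb a l" using l by (simp add: in_cb)
  then have "cbox a (\<chi> i. a $ i + l) \<noteq> {}" unfolding cb_def by blast
  then show ?thesis by (simp add: cb_def content_cbox_cart)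
qed

lemma powr_ratio_le:
  fixes E L \<delta> \<epsilon> :: real
  assumes "0 \<le> E" "E \<le> \<delta> * L" "0 < L" "0 < \<epsilon>" shows "(E / L) powr \<epsilon> \<le> \<delta> powr \<epsilon>"
  using assms by (intro powr_mono2) (auto simp: pos_divide_le_eq)

text \<open>Instead of the density only its consequences are kept: local finiteness, absolute
  continuity and nontriviality. Lebesgue measure is itself an instance, which is used for the
  comparison of weights.\<close>

locale A_inf_measure =
  fixes \<mu> :: "(real ^ 'n) measure" and C \<epsilon> :: real
  assumes C: "0 < C" and eps: "0 < \<epsilon>"
    and sets_mu: "sets \<mu> = sets borel"
    and finite_bounded: "bounded S \<Longrightarrow> S \<in> sets borel \<Longrightarrow> emeasure \<mu> S < \<infinity>"
    and null_mu: "S \<in> null_sets lborel \<Longrightarrow> S \<in> null_sets \<mu>"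
    and nontrivial: "emeasure \<mu> UNIV \<noteq> 0"
    and A_inf: "0 < l \<Longrightarrow> E \<in> sets borel \<Longrightarrow> E \<subseteq> cb a l \<Longrightarrow>
      measure \<mu> E / measure \<mu> (cb a l) \<le> C * (measure lborel E / measure lborel (cb a l)) powr \<epsilon>"
begin

lemma fm: "bounded S \<Longrightarrow> S \<in> sets borel \<Longrightarrow> S \<in> fmeasurable \<mu>"
  using finite_bounded[of S] sets_mu by (auto simp: fmeasurable_def)

lemma cb_fin: "emeasure \<mu> (cb a l) \<noteq> \<infinity>"
  using finite_bounded[OF cb_bounded cb_borel, of a l] by auto

lemma mono: "S \<subseteq> S' \<Longrightarrow> bounded S' \<Longrightarrow> S \<in> sets borel \<Longrightarrow> S' \<in> sets borel \<Longrightarrow> measure \<mu> S \<le> measure \<mu> S'"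
  using fm sets_mu by (intro measure_mono_fmeasurable) auto

lemma mono_cb: "E \<subseteq> cb a l \<Longrightarrow> E \<in> sets borel \<Longrightarrow> measure \<mu> E \<le> measure \<mu> (cb a l)"
  by (rule mono) (auto simp: cb_bounded)

lemma le_powr:
  assumes "0 < l" "E \<in> sets borel" "E \<subseteq> cb a l"
  shows "measure \<mu> E \<le> C * (measure lborel E / measure lborel (cb a l)) powr \<epsilon> * measure \<mu> (cb a l)"
\<comment> \<open>Here the quotient in \<open>A_inf\<close> is 0 by the convention for division and
  gives no information; monotonicity replaces it.\<close>
proof (cases "measure \<mu> (cb a l) = 0")
  case True
  then show ?thesis using mono_cb[OF assms(3,2)] by simp
next
  case False
  then have "0 < measure \<mu> (cb a l)" using zero_less_measure_iff by blast
  then show ?thesis using A_inf[OF assms] by (simp add: pos_divide_le_eq)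
qed

lemma le_powr':
  assumes "0 < l" "E \<in> sets borel" "E \<subseteq> cb a l" "measure lborel E \<le> \<delta> * measure lborel (cb a l)"
  shows "measure \<mu> E \<le> C * \<delta> powr \<epsilon> * measure \<mu> (cb a l)"
proof -
  have "(measure lborel E / measure lborel (cb a l)) powr \<epsilon> \<le> \<delta> powr \<epsilon>"
    by (rule powr_ratio_le) (use assms eps measure_cb[of l a] in auto)
  then have "C * (measure lborel E / measure lborel (cb a l)) powr \<epsilon> * measure \<mu> (cb a l)
      \<le> C * \<delta> powr \<epsilon> * measure \<mu> (cb a l)" using C by (intro mult_right_mono mult_left_mono) auto
  then show ?thesis using le_powr[OF assms(1-3)] by linarith
qed

text \<open>The relative size of a set that carries at most half of the mass of a cube.\<close>

definition small :: real where "small = min (1/2) ((1 / (2 * C)) powr (1 / \<epsilon>))"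

lemma small: "0 < small" "small \<le> 1/2" "C * small powr \<epsilon> \<le> 1/2"
proof -
  show s: "0 < small" "small \<le> 1/2" using C by (auto simp: small_def)
  have "small powr \<epsilon> \<le> ((1 / (2 * C)) powr (1 / \<epsilon>)) powr \<epsilon>"
    using s eps by (intro powr_mono2) (auto simp: small_def)
  also have "\<dots> = 1 / (2 * C)" using eps C by (simp add: powr_powr)
  finally show "C * small powr \<epsilon> \<le> 1/2" using C by (simp add: pos_le_divide_eq mult.commute)
qed

lemma small_set:
  assumes "0 < l" "E \<in> sets borel" "E \<subseteq> cb a l" "measure lborel E \<le> small * measure lborel (cb a l)"
  shows "measure \<mu> E \<le> 1/2 * measure \<mu> (cb a l)"
  using le_powr'[OF assms] mult_right_mono[OF small(3), of "measure \<mu> (cb a l)"] by simp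

text \<open>The annulus between concentric cubes with side ratio \<open>grow\<close> is small, so that ratio at most doubles the mass.\<close>

definition grow :: real where "grow = root CARD('n) (1 / (1 - small))"

lemma grow: "1 < grow" "grow ^ CARD('n) = 1 / (1 - small)"
  using small by (auto simp: grow_def)

abbreviation cq :: "real ^ 'n \<Rightarrow> real \<Rightarrow> (real ^ 'n) set" where
  "cq c r \<equiv> cb (\<chi> i. c $ i - r) (2 * r)"

lemma in_cq: "x \<in> cq c r \<longleftrightarrow> (\<forall>i. \<bar>x $ i - c $ i\<bar> \<le> r)"
proof -
  have "(\<chi> i. c $ i - r) $ i \<le> x $ i \<and> x $ i \<le> (\<chi> i. c $ i - r) $ i + 2 * r \<longleftrightarrow> \<bar>x $ i - c $ i\<bar> \<le> r" for i
    by (simp add: abs_le_iff) linarith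
  then show ?thesis unfolding in_cb by simp
qed

lemma grow_step:
  assumes r: "0 < r" shows "measure \<mu> (cq c (grow * r)) \<le> 2 * measure \<mu> (cq c r)"
proof -
  let ?I = "cq c r" and ?I' = "cq c (grow * r)"
  have gr: "r \<le> grow * r" using grow(1) r by simp
  have sub: "?I \<subseteq> ?I'" unfolding subset_iff in_cq using order_trans[OF _ gr] by blast
  let ?E = "?I' - ?I"
  have "measure lborel ?E = measure lborel ?I' - measure lborel ?I"
    using sub by (intro measure_Diff) (auto simp: cb_def emeasure_lborel_cbox_eq)
  also have "measure lborel ?I = (1 - small) * measure lborel ?I'"
    using r grow small by (simp add: measure_cb power_mult_distrib)
  finally have "measure lborel ?E \<le> small * measure lborel ?I'" by (simp add: algebra_simps)
  then have "measure \<mu> ?E \<le> 1/2 * measure \<mu> ?I'"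
    using grow r by (intro small_set) auto
  moreover have "measure \<mu> ?E = measure \<mu> ?I' - measure \<mu> ?I"
    using sub cb_fin sets_mu by (intro measure_Diff) auto
  ultimately show ?thesis by simp
qed

lemma grow_iter: assumes "0 < r" shows "measure \<mu> (cq c (grow ^ k * r)) \<le> 2 ^ k * measure \<mu> (cq c r)"
proof (induction k)
  case (Suc k)
  have "measure \<mu> (cq c (grow * (grow ^ k * r))) \<le> 2 * measure \<mu> (cq c (grow ^ k * r))"
    using assms grow by (intro grow_step) auto
  then show ?case using Suc by (simp add: mult.assoc)
qed simp

lemma cb_cq: "cb a l = cq (\<chi> i. a $ i + l / 2) (l / 2)"
  by (auto simp: in_cb)

text \<open>A cube without mass would, by \<open>grow_iter\<close>, make all its concentric
  enlargements massless; these exhaust the space.\<close>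

lemma cb_pos: assumes "0 < l" shows "0 < measure \<mu> (cb a l)"
proof (rule ccontr)
  assume "\<not> 0 < measure \<mu> (cb a l)"
  then have "measure \<mu> (cb a l) = 0" using zero_less_measure_iff by blast
  then have z: "measure \<mu> (cq (\<chi> i. a $ i + l / 2) (grow ^ k * (l / 2))) = 0" for k
    using grow_iter[of "l / 2" "\<chi> i. a $ i + l / 2" k] assms measure_nonneg
    by (simp only: cb_cq[of a l, symmetric]) (simp add: order_antisym)
  let ?Q = "\<lambda>k. cq (\<chi> i. a $ i + l / 2) (grow ^ k * (l / 2))"
  have "?Q k \<in> null_sets \<mu>" for k
  proof -
    have "emeasure \<mu> (?Q k) = ennreal (measure \<mu> (?Q k))"
      using finite_bounded[OF cb_bounded cb_borel] by (intro emeasure_eq_ennreal_measure) (simp add: less_top)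
    then have "emeasure \<mu> (?Q k) = 0" by (simp only: z ennreal_0)
    then show ?thesis using sets_mu by (simp add: null_sets_def)
  qed
  then have "(\<Union>k. ?Q k) \<in> null_sets \<mu>" by auto
  moreover have "(\<Union>k. ?Q k) = UNIV"
  proof (intro equalityI subset_UNIV subsetI)
    fix x :: "real ^ 'n"
    let ?M = "norm (x - (\<chi> i. a $ i + l / 2)) / (l / 2)"
    obtain k where "?M < grow ^ k" using real_arch_pow[OF grow(1)] by blast
    then have "norm (x - (\<chi> i. a $ i + l / 2)) \<le> grow ^ k * (l / 2)"
      using assms by (simp add: pos_divide_less_eq)
    moreover have "\<bar>x $ i - (\<chi> i. a $ i + l / 2) $ i\<bar> \<le> norm (x - (\<chi> i. a $ i + l / 2))" for i
      using component_le_norm_cart[of "x - (\<chi> i. a $ i + l / 2)" i] by (simp only: vector_minus_component)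
    ultimately have "x \<in> ?Q k" unfolding in_cq using order_trans by blast
    then show "x \<in> (\<Union>k. ?Q k)" by blast
  qed
  ultimately show False using nontrivial by (auto simp: null_sets_def)
qed

lemma doubling_ex:
  "\<exists>d\<ge>1. \<forall>a l a' l'. 0 < l \<longrightarrow> l' \<le> 4 * l \<longrightarrow> cb a l \<inter> cb a' l' \<noteq> {} \<longrightarrow>
    measure \<mu> (cb a' l') \<le> d * measure \<mu> (cb a l)"
proof -
  \<comment> \<open>Each coordinate of a point of the second cube differs from the centre of the
    first by at most \<open>l / 2 + 4 * l = 9 * (l / 2)\<close>. Factor 4 covers parents and
    adjacent cubes.\<close>
  obtain k where k: "9 < grow ^ k" using real_arch_pow[OF grow(1)] by blast
  have "measure \<mu> (cb a' l') \<le> 2 ^ k * measure \<mu> (cb a l)"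
    if l: "0 < l" "l' \<le> 4 * l" "cb a l \<inter> cb a' l' \<noteq> {}" for a l a' l'
  proof -
    let ?c = "\<chi> i. a $ i + l / 2"
    obtain p where p: "p \<in> cb a l" "p \<in> cb a' l'" using l by blast
    have "cb a' l' \<subseteq> cq ?c (grow ^ k * (l / 2))"
    proof
      fix x assume x: "x \<in> cb a' l'"
      have "\<bar>x $ i - ?c $ i\<bar> \<le> grow ^ k * (l / 2)" for i
      proof -
        have "a' $ i \<le> x $ i" "x $ i \<le> a' $ i + l'" "a' $ i \<le> p $ i" "p $ i \<le> a' $ i + l'"
          "a $ i \<le> p $ i" "p $ i \<le> a $ i + l" using x p by (auto simp: in_cb)
        then have "x $ i - (a $ i + l / 2) \<le> 9 * (l / 2)" "- (x $ i - (a $ i + l / 2)) \<le> 9 * (l / 2)"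
          using l by linarith+
        then have "\<bar>x $ i - ?c $ i\<bar> \<le> 9 * (l / 2)" by (simp only: abs_le_iff vec_lambda_beta)
        also have "\<dots> \<le> grow ^ k * (l / 2)" using k l by (intro mult_right_mono) auto
        finally show ?thesis .
      qed
      then show "x \<in> cq ?c (grow ^ k * (l / 2))" unfolding in_cq by blast
    qed
    then have "measure \<mu> (cb a' l') \<le> measure \<mu> (cq ?c (grow ^ k * (l / 2)))" by (rule mono_cb) simp
    also have "\<dots> \<le> 2 ^ k * measure \<mu> (cq ?c (l / 2))" using l by (intro grow_iter) auto
    finally show ?thesis by (simp only: cb_cq[of a l, symmetric])
  qed
  then show ?thesis by (intro exI[of _ "2 ^ k"]) auto
qed

end

lemma A_infty_imp:
  assumes "A_infty (\<mu> :: (real ^ 'n) measure)" shows "\<exists>C \<epsilon>. A_inf_measure \<mu> C \<epsilon>"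
proof -
  obtain w where W: "w \<in> borel_measurable lborel \<and> (\<forall>x. 0 \<le> w x) \<and>
      (\<forall>S. compact S \<longrightarrow> set_integrable lborel S w) \<and> \<not> (AE x in lborel. w x = 0) \<and>
      \<mu> = density lborel (\<lambda>x. ennreal (w x))"
    using conjunct1[OF assms[unfolded A_infty_def]] by (rule exE)
  have w: "w \<in> borel_measurable lborel" "\<And>x. 0 \<le> w x"
    "\<And>S. compact S \<Longrightarrow> set_integrable lborel S w" "\<not> (AE x in lborel. w x = 0)"
    and \<mu>: "\<mu> = density lborel (\<lambda>x. ennreal (w x))"
    using W by simp_all
  obtain C \<epsilon> where CA: "0 < C \<and> 0 < \<epsilon> \<and> (\<forall>I\<in>cubes. \<forall>E\<in>sets lborel. E \<subseteq> I \<longrightarrow>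
        measure \<mu> E / measure \<mu> I \<le> C * (measure lborel E / measure lborel I) powr \<epsilon>)"
    using conjunct2[OF assms[unfolded A_infty_def]] by (elim exE)
  have C: "0 < C" "0 < \<epsilon>" and A: "\<And>I E. I \<in> cubes \<Longrightarrow> E \<in> sets lborel \<Longrightarrow> E \<subseteq> I \<Longrightarrow>
        measure \<mu> E / measure \<mu> I \<le> C * (measure lborel E / measure lborel I) powr \<epsilon>"
    using CA by simp_all
  have wm: "(\<lambda>x. ennreal (w x)) \<in> borel_measurable lborel" using w(1) by simp
  have fin: "emeasure \<mu> S < \<infinity>" if S: "bounded S" "S \<in> sets borel" for S
  proof -
    let ?K = "closure S"
    have K: "compact ?K" using S by simp
    have i: "integrable lborel (\<lambda>x. indicator ?K x *\<^sub>R w x)"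
      using w(3)[OF K] by (simp add: set_integrable_def)
    have "emeasure \<mu> ?K = (\<integral>\<^sup>+x. ennreal (w x) * indicator ?K x \<partial>lborel)"
      unfolding \<mu> using K by (intro emeasure_density[OF wm]) (auto simp: borel_closed)
    also have "\<dots> = (\<integral>\<^sup>+x. ennreal (indicator ?K x *\<^sub>R w x) \<partial>lborel)"
      by (intro nn_integral_cong) (simp add: indicator_def)
    also have "\<dots> < \<infinity>"
      using i w(2) by (subst nn_integral_eq_integral) (auto simp: indicator_def)
    finally have "emeasure \<mu> ?K < \<infinity>" .
    moreover have "emeasure \<mu> S \<le> emeasure \<mu> ?K"
      using closure_subset by (intro emeasure_mono) (auto simp: \<mu> borel_closed)
    ultimately show ?thesis by (rule le_less_trans[rotated])
  qed
  have "A_inf_measure \<mu> C \<epsilon>"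
  proof
    show "S \<in> null_sets \<mu>" if "S \<in> null_sets lborel" for S
    proof -
      have "AE x in lborel. x \<in> S \<longrightarrow> ennreal (w x) = 0"
        by (rule AE_mp[OF AE_not_in[OF that]]) simp
      then show ?thesis unfolding \<mu> null_sets_density_iff[OF wm] using that by (simp add: null_sets_def)
    qed
    show "emeasure \<mu> UNIV \<noteq> 0"
    proof
      assume "emeasure \<mu> UNIV = 0"
      then have "(\<integral>\<^sup>+x. ennreal (w x) \<partial>lborel) = 0"
        using emeasure_density[OF wm, of UNIV] by (simp add: \<mu>)
      then have "AE x in lborel. ennreal (w x) = 0" by (simp only: nn_integral_0_iff_AE[OF wm])
      then have "AE x in lborel. w x = 0"
      proof (rule AE_mp)
        show "AE x in lborel. ennreal (w x) = 0 \<longrightarrow> w x = 0" using w(2) by (simp add: ennreal_eq_0_iff order_antisym)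
      qed
      then show False using w(4) by simp
    qed
    show "measure \<mu> E / measure \<mu> (cb a l) \<le> C * (measure lborel E / measure lborel (cb a l)) powr \<epsilon>"
      if "0 < l" "E \<in> sets borel" "E \<subseteq> cb a l" for l E a
      by (rule A) (use that in \<open>auto simp: cubes_cb\<close>)
    show "sets \<mu> = sets borel" by (simp add: \<mu>)
  qed (rule C fin, assumption?)+
  then show ?thesis by blast
qed

section \<open>Truncated kernels\<close>

lemma cutoff_lipschitz:
  assumes "cutoff_profile \<phi>"
  obtains a b L where "0 < a" "a < b" "\<And>t. t \<le> a \<Longrightarrow> \<phi> t = 0" "\<And>t. b \<le> t \<Longrightarrow> \<phi> t = 1" "0 \<le> L"
    "\<And>s t. \<bar>\<phi> s - \<phi> t\<bar> \<le> L * \<bar>s - t\<bar>"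
proof -
  obtain a b where ab: "0 < a" "a < b" "\<And>t. t \<le> a \<Longrightarrow> \<phi> t = 0" "\<And>t. b \<le> t \<Longrightarrow> \<phi> t = 1"
    using assms unfolding cutoff_profile_def by metis
  have sm: "(deriv ^^ k) \<phi> field_differentiable (at t)" for k t
    using assms by (simp add: cutoff_profile_def smooth_def)
  have d1: "(\<phi> has_field_derivative deriv \<phi> t) (at t)" for t
    using sm[of 0 t] by (simp add: DERIV_deriv_iff_field_differentiable)
  have "deriv \<phi> field_differentiable (at t)" for t using sm[of 1 t] by simp
  then have "continuous_on {a..b} (deriv \<phi>)"
    by (intro continuous_at_imp_continuous_on ballI field_differentiable_imp_continuous_at)
  then have "bounded (deriv \<phi> ` {a..b})" by (intro compact_imp_bounded compact_continuous_image) auto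
  then obtain L where L': "\<forall>x\<in>deriv \<phi> ` {a..b}. norm x \<le> L" unfolding bounded_iff by (rule exE)
  have L: "norm (deriv \<phi> t) \<le> L" if "t \<in> {a..b}" for t using L' that by blast
  have L0: "0 \<le> L" using L[of a] ab norm_ge_zero order_trans by (metis atLeastAtMost_iff less_imp_le order_refl)
  have lip: "\<bar>\<phi> s - \<phi> t\<bar> \<le> L * \<bar>s - t\<bar>" if "s \<in> {a..b}" "t \<in> {a..b}" for s t
    using field_differentiable_bound[of "{a..b}" \<phi> "deriv \<phi>" L s t] that L
      has_field_derivative_at_within[OF d1] by (simp add: real_norm_def)
  \<comment> \<open>Clamping to \<open>{a..b}\<close> does not change the value of
    \<open>\<phi>\<close> and does not increase distances, so the Lipschitz bound on the interval
    extends to the line.\<close>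
  define c where "c t = max a (min b t)" for t
  have c: "c t \<in> {a..b}" "\<phi> (c t) = \<phi> t" for t
    using ab by (auto simp: c_def max_def min_def)
  have "\<bar>\<phi> s - \<phi> t\<bar> \<le> L * \<bar>s - t\<bar>" for s t
  proof -
    have "\<bar>\<phi> s - \<phi> t\<bar> \<le> L * \<bar>c s - c t\<bar>" using lip[OF c(1) c(1), of s t] by (simp only: c(2))
    also have "\<dots> \<le> L * \<bar>s - t\<bar>" using L0 ab by (intro mult_left_mono) (auto simp: c_def max_def min_def abs_if)
    finally show ?thesis .
  qed
  then show thesis using that ab L0 by blast
qed

lemma frechet_onorm_le_grad:
  fixes f :: "real ^ 'n \<Rightarrow> complex"
  assumes "f differentiable (at x)"
  shows "onorm (frechet_derivative f (at x)) \<le> norm (\<chi> i. frechet_derivative f (at x) (axis i 1))"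
proof (rule onorm_le)
  fix v :: "real ^ 'n"
  let ?F = "frechet_derivative f (at x)"
  have lin: "linear ?F" using assms by (rule linear_frechet_derivative)
  have "?F v = ?F (\<Sum>i\<in>UNIV. v $ i *\<^sub>R axis i 1)" using basis_expansion[of v] by (simp add: scalar_mult_eq_scaleR)
  also have "\<dots> = (\<Sum>i\<in>UNIV. v $ i *\<^sub>R ?F (axis i 1))" using lin by (simp add: linear_sum linear_scale)
  finally have "norm (?F v) \<le> (\<Sum>i\<in>UNIV. \<bar>norm (v $ i)\<bar> * \<bar>norm (?F (axis i 1))\<bar>)"
    by (simp add: order_trans[OF norm_sum])
  also have "\<dots> \<le> L2_set (\<lambda>i. norm (v $ i)) UNIV * L2_set (\<lambda>i. norm (?F (axis i 1))) UNIV"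
    by (rule L2_set_mult_ineq)
  finally show "norm (?F v) \<le> norm (\<chi> i. ?F (axis i 1)) * norm v"
    by (simp add: norm_vec_def mult.commute)
qed

text \<open>The cutoffs depend on \<open>norm (x - y)\<close> only, so truncation commutes with
  taking the adjoint.\<close>

lemma trunc_adjoint: "truncated_kernel \<phi> r R (adjoint_kernel K) x y = truncated_kernel \<phi> r R K y x"
  by (simp add: truncated_kernel_def adjoint_kernel_def norm_minus_commute)

text \<open>The constant is free of \<open>r\<close> and \<open>R\<close>: each cutoff varies only
  where the distance to \<open>y\<close> is at most \<open>b\<close> times its own scale, so its
  variation at distance \<open>d\<close> is of order \<open>1 / d\<close>, just like that of the
  kernel. The product of two cutoffs accounts for the 2.\<close>

lemma trunc_lipschitz1:
  fixes K :: "real ^ 'n \<Rightarrow> real ^ 'n \<Rightarrow> complex"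
  assumes K: "kernel_estimates \<alpha> C \<delta> K" and C: "0 < C" and \<alpha>: "\<alpha> < real CARD('n)"
    and range: "\<And>t. 0 \<le> \<phi> t \<and> \<phi> t \<le> 1"
    and one: "\<And>t. b \<le> t \<Longrightarrow> \<phi> t = 1" and b: "0 < b" and L: "0 \<le> L" "\<And>s t. \<bar>\<phi> s - \<phi> t\<bar> \<le> L * \<bar>s - t\<bar>"
    and rR: "0 < r" "0 < R" and d: "0 < d" and seg: "\<And>z. z \<in> closed_segment x x' \<Longrightarrow> d \<le> norm (z - y)"
  shows "norm (truncated_kernel \<phi> r R K x y - truncated_kernel \<phi> r R K x' y)
    \<le> (1 + 2 * L * b) * C * norm (x - x') * d powr (\<alpha> - real CARD('n) - 1)"
proof -
  let ?n = "real CARD('n)"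
  let ?S = "closed_segment x x'"
  have ends: "x \<in> ?S" "x' \<in> ?S" by auto
  have Kb: "norm (K x y - K x' y) \<le> C * d powr (\<alpha> - ?n - 1) * norm (x - x')"
  proof (rule differentiable_bound[OF convex_closed_segment])
    fix z assume z: "z \<in> ?S"
    have zy: "z \<noteq> y" "d \<le> norm (z - y)" using seg[OF z] d by auto
    have D: "(\<lambda>u. K u y) differentiable (at z)" and g: "norm (grad1 K z y) \<le> C * norm (z - y) powr (\<alpha> - ?n - 1)"
      using K zy(1) unfolding kernel_estimates_def by blast+
    show "((\<lambda>u. K u y) has_derivative frechet_derivative (\<lambda>u. K u y) (at z)) (at z within ?S)"
      using D frechet_derivative_works has_derivative_at_withinI by blast
    have "onorm (frechet_derivative (\<lambda>u. K u y) (at z)) \<le> C * norm (z - y) powr (\<alpha> - ?n - 1)"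
      using frechet_onorm_le_grad[OF D] g by (simp add: grad1_def)
    also have "\<dots> \<le> C * d powr (\<alpha> - ?n - 1)" using zy d \<alpha> C by (intro mult_left_mono powr_mono2') auto
    finally show "onorm (frechet_derivative (\<lambda>u. K u y) (at z)) \<le> C * d powr (\<alpha> - ?n - 1)" .
  qed (use ends in auto)
  define ct where "ct t = \<phi> (t / r) * (1 - \<phi> (t / R))" for t
  \<comment> \<open>If \<open>b * q \<le> d\<close>, both arguments lie where \<open>\<phi>\<close>
    is 1; otherwise \<open>1 / q < b / d\<close>, which eliminates the scale
    \<open>q\<close>.\<close>
  have sc: "\<bar>\<phi> (s / q) - \<phi> (t / q)\<bar> \<le> L * b * \<bar>s - t\<bar> / d" if "d \<le> s" "d \<le> t" "0 < q" for s t q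
  proof (cases "b * q \<le> d")
    case True
    then have "b \<le> s / q" "b \<le> t / q" using that by (auto simp: pos_le_divide_eq)
    then show ?thesis using one L b d by simp
  next
    case False
    have "\<bar>\<phi> (s / q) - \<phi> (t / q)\<bar> \<le> L * \<bar>s / q - t / q\<bar>" by (rule L(2))
    also have "\<dots> = L * \<bar>s - t\<bar> * (1 / q)" using that by (simp flip: diff_divide_distrib)
    also have "\<dots> \<le> L * \<bar>s - t\<bar> * (b / d)" using False that L d by (intro mult_left_mono) (auto simp: field_simps)
    finally show ?thesis by (simp add: mult_ac)
  qed
  let ?s = "norm (x - y)" and ?t = "norm (x' - y)"
  have st: "d \<le> ?s" "d \<le> ?t" using seg ends by auto
  have dist: "\<bar>?s - ?t\<bar> \<le> norm (x - x')" using norm_triangle_ineq3[of "x - y" "x' - y"] by simp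
  have chi: "\<bar>ct ?s - ct ?t\<bar> \<le> 2 * L * b * norm (x - x') / d"
  proof -
    have "ct ?s - ct ?t = (\<phi> (?s / r) - \<phi> (?t / r)) * (1 - \<phi> (?s / R)) + \<phi> (?t / r) * (\<phi> (?t / R) - \<phi> (?s / R))"
      by (simp add: ct_def algebra_simps)
    also have "\<bar>\<dots>\<bar> \<le> \<bar>\<phi> (?s / r) - \<phi> (?t / r)\<bar> * 1 + 1 * \<bar>\<phi> (?t / R) - \<phi> (?s / R)\<bar>"
      using range by (intro order_trans[OF abs_triangle_ineq] add_mono) (auto simp: abs_mult intro!: mult_left_le mult_right_le_one_le mult_left_le_one_le)
    also have "\<dots> \<le> L * b * \<bar>?s - ?t\<bar> / d + L * b * \<bar>?s - ?t\<bar> / d"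
      using sc[OF st rR(1)] sc[OF st(2,1) rR(2)] by (simp add: abs_minus_commute)
    also have "\<dots> \<le> L * b * norm (x - x') / d + L * b * norm (x - x') / d"
      using dist L b d by (intro add_mono divide_right_mono mult_left_mono) auto
    finally show ?thesis by simp
  qed
  have chi1: "\<bar>ct t\<bar> \<le> 1" for t using range[of "t / r"] range[of "t / R"]
    by (auto simp: ct_def abs_mult intro!: mult_le_one)
  have Kx': "norm (K x' y) \<le> C * d powr (\<alpha> - ?n)"
  proof -
    have "x' \<noteq> y" using st d by auto
    then have "norm (K x' y) \<le> C * ?t powr (\<alpha> - ?n)" using K unfolding kernel_estimates_def by blast
    also have "\<dots> \<le> C * d powr (\<alpha> - ?n)" using st d \<alpha> C by (intro mult_left_mono powr_mono2') auto
    finally show ?thesis .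
  qed
  have "truncated_kernel \<phi> r R K x y - truncated_kernel \<phi> r R K x' y
      = of_real (ct ?s) * (K x y - K x' y) + of_real (ct ?s - ct ?t) * K x' y"
    by (simp add: truncated_kernel_def ct_def algebra_simps)
  also have "norm \<dots> \<le> \<bar>ct ?s\<bar> * norm (K x y - K x' y) + \<bar>ct ?s - ct ?t\<bar> * norm (K x' y)"
    by (rule order_trans[OF norm_triangle_ineq]) (simp only: norm_mult norm_of_real order_refl)
  also have "\<dots> \<le> 1 * (C * d powr (\<alpha> - ?n - 1) * norm (x - x')) + (2 * L * b * norm (x - x') / d) * (C * d powr (\<alpha> - ?n))"
    using chi1 Kb chi Kx' L b d C by (intro add_mono mult_mono) auto
  also have "d powr (\<alpha> - ?n) = d * d powr (\<alpha> - ?n - 1)" using d by (simp add: powr_diff)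
  finally show ?thesis using d by (simp add: algebra_simps)
qed

text \<open>\<open>Ck\<close> must be uniform over truncations and enters the final constant. The
  last three conditions have constants depending on the truncation; they serve only for
  integrability, continuity and localisation. The exponent \<open>\<beta>\<close> is
  \<open>\<alpha>\<close> minus the dimension.\<close>

locale good_kernel =
  fixes k :: "real ^ 'n \<Rightarrow> real ^ 'n \<Rightarrow> complex" and Ck \<beta> :: real
  assumes Ck: "0 < Ck"
    and lip1: "0 < d \<Longrightarrow> (\<And>z. z \<in> closed_segment x x' \<Longrightarrow> d \<le> norm (z - y)) \<Longrightarrow>
      norm (k x y - k x' y) \<le> Ck * norm (x - x') * d powr (\<beta> - 1)"
    and lip2: "0 < d \<Longrightarrow> (\<And>z. z \<in> closed_segment y y' \<Longrightarrow> d \<le> norm (z - x)) \<Longrightarrow>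
      norm (k x y - k x y') \<le> Ck * norm (y - y') * d powr (\<beta> - 1)"
    and bounded_k: "\<exists>M. \<forall>x y. norm (k x y) \<le> M"
    and supp_out: "\<exists>\<rho>. \<forall>x y. \<rho> \<le> norm (x - y) \<longrightarrow> k x y = 0"
    and supp_in: "\<exists>\<rho>>0. \<forall>x y. norm (x - y) \<le> \<rho> \<longrightarrow> k x y = 0"
begin

lemma good_swap: "good_kernel (\<lambda>x y. k y x) Ck \<beta>"
proof
  show "0 < Ck" by (rule Ck)
  show "\<exists>M. \<forall>x y. norm (k y x) \<le> M" using bounded_k by blast
  show "\<exists>\<rho>. \<forall>x y. \<rho> \<le> norm (x - y) \<longrightarrow> k y x = 0" using supp_out by (metis norm_minus_commute)
  show "\<exists>\<rho>>0. \<forall>x y. norm (x - y) \<le> \<rho> \<longrightarrow> k y x = 0" using supp_in by (metis norm_minus_commute)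
qed (rule lip1 lip2; assumption)+

text \<open>The kernel vanishes within distance \<open>q\<close> of the diagonal. For steps of
  length at most \<open>q / 4\<close>, either both values vanish or the whole segment stays at
  distance \<open>q / 4\<close> from \<open>y\<close>, where \<open>lip1\<close> applies.\<close>

lemma local_lip1:
  obtains \<rho> L where "0 < \<rho>" "0 \<le> L" "\<And>x x' y. norm (x - x') \<le> \<rho> \<Longrightarrow> norm (k x y - k x' y) \<le> L * norm (x - x')"
proof -
  obtain q where q: "0 < q" "\<And>x y. norm (x - y) \<le> q \<Longrightarrow> k x y = 0" using supp_in by blast
  let ?L = "Ck * (q / 4) powr (\<beta> - 1)"
  have "norm (k x y - k x' y) \<le> ?L * norm (x - x')" if h: "norm (x - x') \<le> q / 4" for x x' y
  proof (cases "norm (x - y) \<le> q / 2")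
    case True
    have "norm (x' - y) \<le> norm (x - y) + norm (x - x')"
      using norm_triangle_ineq4[of "x - y" "x - x'"] by simp
    then have "k x' y = 0" "k x y = 0" using True h q by auto
    then show ?thesis using Ck by simp
  next
    case False
    have "q / 4 \<le> norm (z - y)" if "z \<in> closed_segment x x'" for z
    proof -
      have "norm (z - x) \<le> norm (x - x')" using segment_bound(1)[OF that] by (simp add: norm_minus_commute)
      moreover have "norm (x - y) \<le> norm (z - y) + norm (z - x)"
        using norm_triangle_ineq4[of "z - y" "z - x"] by simp
      ultimately show ?thesis using False h by linarith
    qed
    then show ?thesis using lip1[of "q / 4" x x' y] q by (simp add: mult_ac)
  qed
  then show thesis using that[of "q / 4" ?L] q Ck by simp
qed

text \<open>Joint continuity is required for measurability on the product space, on which the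
  bilinear form is defined.\<close>

lemma continuous_k: "continuous_on UNIV (\<lambda>p. k (fst p) (snd p))"
proof -
  interpret S: good_kernel "\<lambda>x y. k y x" Ck \<beta> by (rule good_swap)
  obtain \<rho>1 L1 where 1: "0 < \<rho>1" "0 \<le> L1" "\<And>x x' y. norm (x - x') \<le> \<rho>1 \<Longrightarrow> norm (k x y - k x' y) \<le> L1 * norm (x - x')"
    by (rule local_lip1) blast
  obtain \<rho>2 L2 where 2: "0 < \<rho>2" "0 \<le> L2" "\<And>x x' y. norm (x - x') \<le> \<rho>2 \<Longrightarrow> norm (k y x - k y x') \<le> L2 * norm (x - x')"
    by (rule S.local_lip1) blast
  show ?thesis unfolding continuous_on_iff
  proof (intro ballI allI impI)
    fix p :: "(real ^ 'n) \<times> (real ^ 'n)" and e :: real assume e: "0 < e"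
    define \<delta> where "\<delta> = min (min \<rho>1 \<rho>2) (e / (L1 + L2 + 1))"
    have \<delta>: "0 < \<delta>" using 1 2 e by (simp add: \<delta>_def)
    have "dist (k (fst q) (snd q)) (k (fst p) (snd p)) < e" if q: "dist q p < \<delta>" for q
    proof -
      have f: "norm (fst q - fst p) \<le> dist q p" "norm (snd q - snd p) \<le> dist q p"
        using dist_fst_le[of q p] dist_snd_le[of q p] by (simp_all add: dist_norm)
      have "norm (k (fst q) (snd q) - k (fst p) (snd q)) \<le> L1 * norm (fst q - fst p)"
        using f q by (intro 1(3)) (simp add: \<delta>_def)
      also have "\<dots> \<le> L1 * dist q p" using f 1 by (intro mult_left_mono)
      finally have A: "norm (k (fst q) (snd q) - k (fst p) (snd q)) \<le> L1 * dist q p" .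
      have "norm (k (fst p) (snd q) - k (fst p) (snd p)) \<le> L2 * norm (snd q - snd p)"
        using f q by (intro 2(3)) (simp add: \<delta>_def)
      also have "\<dots> \<le> L2 * dist q p" using f 2 by (intro mult_left_mono)
      finally have B: "norm (k (fst p) (snd q) - k (fst p) (snd p)) \<le> L2 * dist q p" .
      have "norm (k (fst q) (snd q) - k (fst p) (snd p)) \<le> L1 * dist q p + L2 * dist q p"
        using norm_triangle_ineq[of "k (fst q) (snd q) - k (fst p) (snd q)" "k (fst p) (snd q) - k (fst p) (snd p)"] A B by simp
      also have "\<dots> \<le> (L1 + L2 + 1) * dist q p" by (simp add: algebra_simps)
      also have "\<dots> < (L1 + L2 + 1) * (e / (L1 + L2 + 1))"
        using q 1 2 by (intro mult_strict_left_mono) (auto simp: \<delta>_def)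
      also have "\<dots> = e" using 1 2 by simp
      finally show ?thesis by (simp add: dist_norm)
    qed
    then show "\<exists>d>0. \<forall>q\<in>UNIV. dist q p < d \<longrightarrow> dist (k (fst q) (snd q)) (k (fst p) (snd p)) < e"
      using \<delta> by blast
  qed
qed

end

text \<open>The order of quantifiers is the point: one \<open>Ck\<close> for all
  truncations.\<close>

lemma truncation_good:
  fixes K :: "real ^ 'n \<Rightarrow> real ^ 'n \<Rightarrow> complex"
  assumes K: "fractional_kernel \<alpha> K" and \<phi>: "cutoff_profile \<phi>" and \<alpha>: "\<alpha> < real CARD('n)"
  shows "\<exists>Ck. \<forall>r R. 0 < r \<longrightarrow> r < R \<longrightarrow> good_kernel (truncated_kernel \<phi> r R K) Ck (\<alpha> - real CARD('n))"
proof -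
  obtain C \<delta> where C: "0 < C" and KE: "kernel_estimates \<alpha> C \<delta> K" "kernel_estimates \<alpha> C \<delta> (adjoint_kernel K)"
    using K unfolding fractional_kernel_def by metis
  obtain a b L where ab: "0 < a" "a < b" "\<And>t. t \<le> a \<Longrightarrow> \<phi> t = 0" "\<And>t. b \<le> t \<Longrightarrow> \<phi> t = 1" "0 \<le> L"
    "\<And>s t. \<bar>\<phi> s - \<phi> t\<bar> \<le> L * \<bar>s - t\<bar>" by (rule cutoff_lipschitz[OF \<phi>]) blast
  have range: "0 \<le> \<phi> t \<and> \<phi> t \<le> 1" for t using \<phi> by (simp add: cutoff_profile_def)
  have b0: "0 < b" using ab by simp
  let ?C = "(1 + 2 * L * b) * C" and ?\<beta> = "\<alpha> - real CARD('n)"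
  have "good_kernel (truncated_kernel \<phi> r R K) ?C ?\<beta>" if rR: "0 < r" "r < R" for r R
  proof
    have R: "0 < R" using rR by simp
    let ?k = "truncated_kernel \<phi> r R K"
    show "0 < ?C" using C ab b0 by (simp add: add_pos_nonneg)
    show "norm (?k x y - ?k x' y) \<le> ?C * norm (x - x') * d powr (?\<beta> - 1)"
      if "0 < d" "\<And>z. z \<in> closed_segment x x' \<Longrightarrow> d \<le> norm (z - y)" for d x x' y
      by (rule trunc_lipschitz1[where b=b and L=L, OF KE(1) C \<alpha> range ab(4) b0 ab(5,6) rR(1) R that])
    show "norm (?k x y - ?k x y') \<le> ?C * norm (y - y') * d powr (?\<beta> - 1)"
      if "0 < d" "\<And>z. z \<in> closed_segment y y' \<Longrightarrow> d \<le> norm (z - x)" for d x y y'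
      using trunc_lipschitz1[where b=b and L=L, OF KE(2) C \<alpha> range ab(4) b0 ab(5,6) rR(1) R that]
      by (simp only: trunc_adjoint)
    have near: "?k x y = 0" if "norm (x - y) \<le> a * r" for x y
    proof -
      have "norm (x - y) / r \<le> a" using that rR by (simp add: pos_divide_le_eq)
      then show ?thesis by (simp add: truncated_kernel_def ab(3))
    qed
    then show "\<exists>\<rho>>0. \<forall>x y. norm (x - y) \<le> \<rho> \<longrightarrow> ?k x y = 0" using ab rR by (intro exI[of _ "a * r"]) auto
    have "?k x y = 0" if "b * R \<le> norm (x - y)" for x y
    proof -
      have "b \<le> norm (x - y) / R" using that R by (simp add: pos_le_divide_eq)
      then show ?thesis by (simp add: truncated_kernel_def ab(4))
    qed
    then show "\<exists>\<rho>. \<forall>x y. \<rho> \<le> norm (x - y) \<longrightarrow> ?k x y = 0" by blast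
    have "norm (?k x y) \<le> C * (a * r) powr ?\<beta>" for x y
    proof (cases "norm (x - y) \<le> a * r")
      case True
      then show ?thesis using near C by simp
    next
      case False
      have ar: "0 < a * r" using ab rR by simp
      then have "x \<noteq> y" using False by auto
      then have "norm (K x y) \<le> C * norm (x - y) powr ?\<beta>" using KE(1) unfolding kernel_estimates_def by blast
      also have "\<dots> \<le> C * (a * r) powr ?\<beta>" using False ar \<alpha> C by (intro mult_left_mono powr_mono2') auto
      finally have Kb: "norm (K x y) \<le> C * (a * r) powr ?\<beta>" .
      let ?c = "\<phi> (norm (x - y) / r) * (1 - \<phi> (norm (x - y) / R))"
      have "\<bar>?c\<bar> \<le> 1" using range[of "norm (x - y) / r"] range[of "norm (x - y) / R"]
        by (auto simp: abs_mult intro!: mult_le_one)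
      then have "\<bar>?c\<bar> * norm (K x y) \<le> 1 * (C * (a * r) powr ?\<beta>)" using Kb by (intro mult_mono) auto
      then show ?thesis by (simp only: truncated_kernel_def norm_mult norm_of_real mult_1)
    qed
    then show "\<exists>M. \<forall>x y. norm (?k x y) \<le> M" by blast
  qed
  then show ?thesis by blast
qed

section \<open>Dyadic grids of half-open cubes\<close>

locale cube_grid =
  fixes t :: "real ^ 'n" and l :: real and N :: nat
  assumes l: "0 < l"
begin

definition idx :: "nat \<Rightarrow> real ^ 'n \<Rightarrow> 'n \<Rightarrow> int" where
  "idx k x = (\<lambda>i. \<lfloor>(x $ i - t $ i) * 2 ^ k / l\<rfloor>)"

definition DD :: "(nat \<times> ('n \<Rightarrow> int)) set" where
  "DD = {I. fst I \<le> N \<and> (\<forall>i. 0 \<le> snd I i \<and> snd I i < 2 ^ fst I)}"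

definition parc :: "nat \<times> ('n \<Rightarrow> int) \<Rightarrow> nat \<times> ('n \<Rightarrow> int)" where
  "parc I = (fst I - 1, \<lambda>i. snd I i div 2)"

definition rt :: "nat \<times> ('n \<Rightarrow> int)" where "rt = (0, \<lambda>_. 0)"

text \<open>Cells are half-open so that those of one level partition the space exactly. A cube is
  encoded by its level and integer coordinates, which turns parents and adjacency into integer
  arithmetic.\<close>

definition cell :: "nat \<times> ('n \<Rightarrow> int) \<Rightarrow> (real ^ 'n) set" where
  "cell I = {x. idx (fst I) x = snd I}"

definition adjc :: "nat \<times> ('n \<Rightarrow> int) \<Rightarrow> nat \<times> ('n \<Rightarrow> int) \<Rightarrow> bool" where
  "adjc I J \<longleftrightarrow> fst I = fst J \<and> (\<forall>i. \<bar>snd I i - snd J i\<bar> \<le> 1)"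

definition side :: "nat \<times> ('n \<Rightarrow> int) \<Rightarrow> real" where "side I = l / 2 ^ fst I"

definition corner :: "nat \<times> ('n \<Rightarrow> int) \<Rightarrow> real ^ 'n" where
  "corner I = (\<chi> i. t $ i + of_int (snd I i) * side I)"

lemma snd_parc: "snd (parc I) i = snd I i div 2"
  by (simp add: parc_def)

lemma side_pos: "0 < side I"
  using l by (simp add: side_def)

lemma idx_div: "idx k x i = idx (Suc k) x i div 2"
proof -
  have "\<lfloor>((x $ i - t $ i) * 2 ^ Suc k / l) / real_of_int 2\<rfloor> = \<lfloor>(x $ i - t $ i) * 2 ^ Suc k / l\<rfloor> div 2"
    by (rule floor_divide_real_eq_div) simp
  then show ?thesis by (simp add: idx_def)
qed

lemma in_cell: "x \<in> cell I \<longleftrightarrow> (\<forall>i. corner I $ i \<le> x $ i \<and> x $ i < corner I $ i + side I)"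
proof -
  have "\<lfloor>(x $ i - t $ i) * 2 ^ fst I / l\<rfloor> = snd I i \<longleftrightarrow> corner I $ i \<le> x $ i \<and> x $ i < corner I $ i + side I" for i
    unfolding floor_eq_iff corner_def side_def using l by (auto simp: field_simps)
  then show ?thesis by (simp add: cell_def idx_def fun_eq_iff)
qed

lemma cell_cb: "cell I \<subseteq> cb (corner I) (side I)"
proof
  fix x assume "x \<in> cell I"
  then show "x \<in> cb (corner I) (side I)" unfolding in_cell in_cb using less_imp_le by blast
qed

lemma corner_cell: "corner I \<in> cell I"
  using side_pos by (simp add: in_cell)

lemma cell_borel [measurable]: "cell I \<in> sets borel"
proof -
  have "cell I = (\<Inter>i\<in>UNIV. {x. corner I $ i \<le> x $ i} \<inter> {x. x $ i < corner I $ i + side I})"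
    by (auto simp: in_cell)
  also have "\<dots> \<in> sets borel" by (intro sets.finite_INT sets.Int borel_closed borel_open
        closed_halfspace_component_ge_cart open_halfspace_component_lt_cart) auto
  finally show ?thesis .
qed

lemma cell_bounded: "bounded (cell I)"
  using cell_cb cb_bounded bounded_subset by blast

text \<open>Testing and the fractional condition speak of closed cubes; the faces by which these
  differ from cells are null for Lebesgue measure and hence for both weights.\<close>

lemma cell_null: "cb (corner I) (side I) - cell I \<in> null_sets lborel"
proof -
  let ?H = "\<lambda>i. {x. x $ i = corner I $ i + side I}"
  have "cb (corner I) (side I) - cell I \<subseteq> (\<Union>i\<in>UNIV. ?H i)"
  proof
    fix x assume x: "x \<in> cb (corner I) (side I) - cell I"
    then obtain i where "\<not> (corner I $ i \<le> x $ i \<and> x $ i < corner I $ i + side I)" by (auto simp: in_cell)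
    moreover have "corner I $ i \<le> x $ i" "x $ i \<le> corner I $ i + side I" using x by (simp_all add: in_cb)
    ultimately have "x $ i = corner I $ i + side I" by linarith
    then show "x \<in> (\<Union>i\<in>UNIV. ?H i)" by blast
  qed
  moreover have "negligible (\<Union>i\<in>UNIV. ?H i)"
  proof (intro negligible_Union)
    fix S assume "S \<in> range ?H"
    then obtain i where "S = {x. x \<bullet> axis i 1 = corner I $ i + side I}" by (auto simp: cart_eq_inner_axis)
    then show "negligible S" by (simp add: negligible_standard_hyperplane axis_in_Basis_iff)
  qed simp
  ultimately have "negligible (cb (corner I) (side I) - cell I)" using negligible_subset by blast
  then show ?thesis
    by (simp add: negligible_iff_null_sets null_sets_def)
qed

lemma finite_DD: "finite DD"
proof -
  have "DD \<subseteq> (\<Union>k\<in>{..N}. (\<lambda>z. (k, z)) ` PiE UNIV (\<lambda>_. {0..<2 ^ k}))"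
  proof
    fix I assume I: "I \<in> DD"
    then have "snd I \<in> PiE UNIV (\<lambda>_. {0..<2 ^ fst I})" by (simp add: DD_def PiE_def)
    moreover have "I = (\<lambda>z. (fst I, z)) (snd I)" by simp
    ultimately have "I \<in> (\<lambda>z. (fst I, z)) ` PiE UNIV (\<lambda>_. {0..<2 ^ fst I})" by (intro image_eqI)
    moreover have "fst I \<in> {..N}" using I by (simp add: DD_def)
    ultimately show "I \<in> (\<Union>k\<in>{..N}. (\<lambda>z. (k, z)) ` PiE UNIV (\<lambda>_. {0..<2 ^ k}))" by blast
  qed
  moreover have "finite (\<Union>k\<in>{..N}. (\<lambda>z. (k, z)) ` PiE (UNIV :: 'n set) (\<lambda>_. {0..<2 ^ k :: int}))"
    by (intro finite_UN_I finite_imageI finite_PiE) simp_all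
  ultimately show ?thesis by (rule finite_subset)
qed

lemma DD_pos: "I \<in> DD \<Longrightarrow> I \<noteq> rt \<Longrightarrow> 0 < fst I"
proof (rule ccontr)
  assume a: "I \<in> DD" "I \<noteq> rt" "\<not> 0 < fst I"
  have "snd I i = 0" for i
  proof -
    have "0 \<le> snd I i" "snd I i < 2 ^ fst I" using a(1) by (simp_all add: DD_def)
    then show ?thesis using a(3) by simp
  qed
  then have "I = rt" using a(3) by (auto simp: rt_def prod_eq_iff)
  then show False using a by simp
qed

lemma parc_DD: assumes "I \<in> DD" "I \<noteq> rt" shows "parc I \<in> DD"
proof -
  obtain m where m: "fst I = Suc m" using DD_pos[OF assms] by (cases "fst I") auto
  have "0 \<le> snd I i div 2 \<and> snd I i div 2 < 2 ^ m" for i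
  proof -
    have "0 \<le> snd I i" "snd I i < 2 * 2 ^ m" using assms(1) m by (auto simp: DD_def)
    then show ?thesis by linarith
  qed
  then show ?thesis using assms(1) m by (simp add: DD_def parc_def)
qed

lemma adjc_card: "card {J\<in>DD. adjc I J} \<le> 3 ^ CARD('n)"
proof -
  have "{J\<in>DD. adjc I J} \<subseteq> (\<lambda>v. (fst I, \<lambda>i. snd I i + v i)) ` PiE UNIV (\<lambda>_. {-1, 0, 1})"
  proof
    fix J assume J: "J \<in> {J\<in>DD. adjc I J}"
    let ?v = "\<lambda>i. snd J i - snd I i"
    have "?v i \<in> {-1, 0, 1}" for i
    proof -
      have "\<bar>snd I i - snd J i\<bar> \<le> 1" using J by (simp add: adjc_def)
      then show ?thesis by auto
    qed
    then have "?v \<in> PiE UNIV (\<lambda>_. {-1, 0, 1})" by (simp add: PiE_def)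
    moreover have "J = (\<lambda>v. (fst I, \<lambda>i. snd I i + v i)) ?v" using J by (simp add: adjc_def prod_eq_iff)
    ultimately show "J \<in> (\<lambda>v. (fst I, \<lambda>i. snd I i + v i)) ` PiE UNIV (\<lambda>_. {-1, 0, 1})" by (intro image_eqI)
  qed
  then have "card {J\<in>DD. adjc I J} \<le> card ((\<lambda>v. (fst I, \<lambda>i. snd I i + v i)) ` PiE UNIV (\<lambda>_. {-1, 0, 1::int}))"
    by (intro card_mono finite_imageI finite_PiE) auto
  also have "\<dots> \<le> card (PiE (UNIV :: 'n set) (\<lambda>_. {-1, 0, 1::int}))" by (intro card_image_le finite_PiE) auto
  also have "\<dots> = 3 ^ CARD('n)" by (simp add: card_PiE numeral_3_eq_3)
  finally show ?thesis .
qed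

sublocale T: dyadic_adj DD fst parc rt N adjc "3 ^ CARD('n)"
proof
  show "finite DD" by (rule finite_DD)
  show "rt \<in> DD" by (simp add: rt_def DD_def)
  show "fst I \<le> N" if "I \<in> DD" for I using that by (simp add: DD_def)
  show "(fst I = 0) = (I = rt)" if "I \<in> DD" for I
  proof
    show "I = rt" if "fst I = 0" using DD_pos[OF \<open>I \<in> DD\<close>] that by (cases "I = rt") auto
  qed (simp add: rt_def)
  show "parc I \<in> DD" if "I \<in> DD" "I \<noteq> rt" for I using that by (rule parc_DD)
  show "fst I = Suc (fst (parc I))" if "I \<in> DD" "I \<noteq> rt" for I using DD_pos[OF that] by (simp add: parc_def)
  show "adjc I I" for I by (simp add: adjc_def)
  show "adjc J I" if "adjc I J" for I J using that by (simp add: adjc_def abs_minus_commute)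
  show "fst I = fst J" if "adjc I J" for I J using that by (simp add: adjc_def)
  show "adjc (parc I) (parc J)" if "adjc I J" for I J
  proof -
    have "\<bar>a div 2 - b div 2\<bar> \<le> 1" if "\<bar>a - b\<bar> \<le> 1" for a b :: int using that by linarith
    then show ?thesis using that by (simp add: adjc_def parc_def)
  qed
  show "card {J\<in>DD. adjc I J} \<le> 3 ^ CARD('n)" for I by (rule adjc_card)
qed

lemma ch_card: "card (T.ch I) \<le> 3 ^ CARD('n)"
proof -
  have "T.ch I \<subseteq> (\<lambda>v. (Suc (fst I), \<lambda>i. 2 * snd I i + v i)) ` PiE UNIV (\<lambda>_. {0, 1})"
  proof
    fix J assume J: "J \<in> T.ch I"
    let ?v = "\<lambda>i. snd J i mod 2"
    have "?v \<in> PiE UNIV (\<lambda>_. {0, 1})" by (auto simp: PiE_def)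
    moreover have "J = (\<lambda>v. (Suc (fst I), \<lambda>i. 2 * snd I i + v i)) ?v"
    proof -
      have "snd I i = snd J i div 2" for i using arg_cong[OF T.ch_par[OF J], of "\<lambda>p. snd p i"] by (simp add: parc_def)
      then show ?thesis using T.ch_lev[OF J] by (simp add: prod_eq_iff)
    qed
    ultimately show "J \<in> (\<lambda>v. (Suc (fst I), \<lambda>i. 2 * snd I i + v i)) ` PiE UNIV (\<lambda>_. {0, 1})" by (intro image_eqI)
  qed
  then have "card (T.ch I) \<le> card ((\<lambda>v. (Suc (fst I), \<lambda>i. 2 * snd I i + v i)) ` PiE UNIV (\<lambda>_. {0, 1::int}))"
    by (intro card_mono finite_imageI finite_PiE) auto
  also have "\<dots> \<le> card (PiE (UNIV :: 'n set) (\<lambda>_. {0, 1::int}))" by (intro card_image_le finite_PiE) auto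
  also have "\<dots> = 2 ^ CARD('n)" by (simp add: card_PiE numeral_2_eq_2)
  also have "\<dots> \<le> 3 ^ CARD('n)" by (intro power_mono) auto
  finally show ?thesis .
qed

lemma cell_ch: assumes "I \<in> DD" "fst I < N" shows "cell I = (\<Union>c\<in>T.ch I. cell c)"
proof (intro set_eqI iffI)
  fix x assume x: "x \<in> cell I"
  let ?c = "(Suc (fst I), idx (Suc (fst I)) x)"
  have p: "parc ?c = I" using x by (simp add: parc_def cell_def prod_eq_iff fun_eq_iff idx_div[of "fst I", symmetric])
  have "0 \<le> snd ?c i \<and> snd ?c i < 2 ^ Suc (fst I)" for i
  proof -
    have "snd ?c i div 2 = snd I i" using arg_cong[OF p, of "\<lambda>p. snd p i"] by (simp add: parc_def)
    moreover have "0 \<le> snd I i" "snd I i < 2 ^ fst I" using assms by (auto simp: DD_def)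
    ultimately have "0 \<le> snd ?c i" "snd ?c i < 2 * 2 ^ fst I" by linarith+
    then show ?thesis by simp
  qed
  then have "?c \<in> DD" using assms by (simp add: DD_def)
  moreover have "?c \<noteq> rt" by (simp add: rt_def)
  ultimately have "?c \<in> T.ch I" using p by (simp add: T.ch_def)
  moreover have "x \<in> cell ?c" by (simp add: cell_def)
  ultimately show "x \<in> (\<Union>c\<in>T.ch I. cell c)" by blast
next
  fix x assume "x \<in> (\<Union>c\<in>T.ch I. cell c)"
  then obtain c where c: "c \<in> T.ch I" "x \<in> cell c" by blast
  have "idx (fst I) x i = snd I i" for i
  proof -
    have "idx (fst I) x i = idx (fst c) x i div 2" by (simp only: T.ch_lev[OF c(1)] idx_div[of "fst I" x i])
    also have "\<dots> = snd I i" using c(2) T.ch_par[OF c(1)] by (auto simp: cell_def parc_def)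
    finally show ?thesis .
  qed
  then show "x \<in> cell I" by (simp add: cell_def fun_eq_iff)
qed

lemma cell_disjoint: "fst I = fst J \<Longrightarrow> I \<noteq> J \<Longrightarrow> cell I \<inter> cell J = {}"
  by (auto simp: cell_def prod_eq_iff)

lemma cell_leaves: "I \<in> DD \<Longrightarrow> cell I = (\<Union>x\<in>T.leaves I. cell x)"
proof (induction I rule: T.tree_induct)
  case (step I)
  show ?case
  proof (cases "fst I = N")
    case True
    then show ?thesis using step(1) by (simp add: T.leaves_leaf)
  next
    case False
    then have l: "fst I < N" using T.lev_le[OF step(1)] by simp
    show ?thesis unfolding cell_ch[OF step(1) l] T.leaves_decomp[OF step(1) l] using step(2) by auto
  qed
qed

lemma cell_below: assumes "J \<in> T.below I" shows "cell J \<subseteq> cell I"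
proof -
  have "(\<Union>x\<in>T.leaves J. cell x) \<subseteq> (\<Union>x\<in>T.leaves I. cell x)"
    using T.leaves_mono[OF assms] by (rule UN_mono) simp
  then show ?thesis
    by (simp only: cell_leaves[OF T.below_in[OF assms], symmetric] cell_leaves[OF T.below_in'[OF assms], symmetric])
qed

lemma leaves_cell_disjoint: "disjoint_family_on cell (T.leaves L)"
  unfolding disjoint_family_on_def by (intro ballI impI cell_disjoint) (simp_all add: T.leaves_lev)

lemma side_anc: "I \<in> DD \<Longrightarrow> j \<le> fst I \<Longrightarrow> side (T.anc j I) = 2 ^ j * side I"
  using l T.lev_anc[of I j] by (simp add: side_def power_diff)

end

section \<open>Weights of grid cells: doubling, transfer and thin boundaries\<close>

locale grid_measure = cube_grid t l N + A_inf_measure \<mu> C \<epsilon>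
  for t :: "real ^ 'n" and l N and \<mu> :: "(real ^ 'n) measure" and C \<epsilon>
begin

definition wt :: "nat \<times> ('n \<Rightarrow> int) \<Rightarrow> real" where "wt I = measure \<mu> (cell I)"

lemma AE_cell: "AE x in \<mu>. x \<in> cell I \<longleftrightarrow> x \<in> cb (corner I) (side I)"
proof (rule AE_mp[OF AE_not_in[OF null_mu[OF cell_null[of I]]]], intro AE_I2 impI)
  fix x assume "x \<notin> cb (corner I) (side I) - cell I"
  then show "x \<in> cell I \<longleftrightarrow> x \<in> cb (corner I) (side I)" using cell_cb[of I] by blast
qed

lemma wt_cb: "wt I = measure \<mu> (cb (corner I) (side I))"
  unfolding wt_def by (rule measure_eq_AE[OF AE_cell]) (simp_all add: sets_mu)

lemma cell_fin: "emeasure \<mu> (cell I) \<noteq> \<infinity>"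
  using finite_bounded[OF cell_bounded cell_borel, of I] by auto

lemma measure_cells:
  assumes "finite E" "disjoint_family_on cell E" shows "measure \<mu> (\<Union>x\<in>E. cell x) = sum wt E"
  unfolding wt_def by (rule measure_finite_Union) (use assms cell_fin sets_mu in auto)

lemma weight_wt: "T.weight wt"
  unfolding T.weight_def
proof (intro conjI ballI impI)
  fix I show "0 < wt I" unfolding wt_cb by (rule cb_pos[OF side_pos])
next
  fix I assume I: "I \<in> DD" "fst I < N"
  have "disjoint_family_on cell (T.ch I)"
    unfolding disjoint_family_on_def by (intro ballI impI cell_disjoint) (simp_all add: T.ch_lev)
  then show "wt I = sum wt (T.ch I)" using measure_cells[of "T.ch I"] cell_ch[OF I] by (simp add: wt_def)
qed

lemma measure_leaves: assumes "E \<subseteq> T.leaves L" shows "measure \<mu> (\<Union>x\<in>E. cell x) = sum wt E"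
  using assms leaves_cell_disjoint[of L] finite_subset[OF assms]
  by (intro measure_cells) (auto intro: disjoint_family_on_mono)

lemma leaves_sub: assumes "E \<subseteq> T.leaves L" "L \<in> DD" shows "(\<Union>x\<in>E. cell x) \<subseteq> cb (corner L) (side L)"
  using cell_leaves[OF assms(2)] assms(1) cell_cb[of L] by auto

lemma finite_leaves_sub: "E \<subseteq> T.leaves L \<Longrightarrow> finite E"
  by (rule finite_subset[OF _ T.fin_leaves])

lemma cells_borel: "E \<subseteq> T.leaves L \<Longrightarrow> (\<Union>x\<in>E. cell x) \<in> sets borel"
  using finite_leaves_sub by (intro sets.finite_UN) auto

lemma doubling_wt:
  assumes d: "\<And>a l a' l'. 0 < l \<Longrightarrow> l' \<le> 4 * l \<Longrightarrow> cb a l \<inter> cb a' l' \<noteq> {} \<Longrightarrow>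
    measure \<mu> (cb a' l') \<le> d * measure \<mu> (cb a l)"
  shows "T.doubling wt d"
  unfolding T.doubling_def
proof (intro conjI ballI)
  fix I J assume "I \<in> DD" "J \<in> T.nb I"
  then have adj: "adjc I J" by (simp add: T.nb_def)
  then have s: "side J = side I" by (simp add: adjc_def side_def)
  \<comment> \<open>In each coordinate adjacent cubes have equal or consecutive indices, so the
    larger lower endpoint belongs to both closed cubes.\<close>
  let ?p = "\<chi> i. t $ i + max (snd I i) (snd J i) * side I"
  have "?p \<in> cb (corner I) (side I) \<inter> cb (corner J) (side J)"
  proof -
    have "real_of_int z * side I \<le> real_of_int (max (snd I i) (snd J i)) * side I \<and>
      real_of_int (max (snd I i) (snd J i)) * side I \<le> real_of_int z * side I + side I"
      if "z = snd I i \<or> z = snd J i" for i z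
    proof -
      have "\<bar>snd I i - snd J i\<bar> \<le> 1" using adj by (simp add: adjc_def)
      then have m: "z \<le> max (snd I i) (snd J i)" "max (snd I i) (snd J i) \<le> z + 1" using that by auto
      have "real_of_int z * side I \<le> real_of_int (max (snd I i) (snd J i)) * side I"
        using m(1) side_pos[of I] by (intro mult_right_mono) (simp_all only: of_int_le_iff less_imp_le)
      moreover have "real_of_int (max (snd I i) (snd J i)) * side I \<le> real_of_int (z + 1) * side I"
        using m(2) side_pos[of I] by (intro mult_right_mono) (simp_all only: of_int_le_iff less_imp_le)
      ultimately show ?thesis by (simp only: of_int_add of_int_1 distrib_right mult_1)
    qed
    then have "\<forall>i. \<forall>z\<in>{snd I i, snd J i}. real_of_int z * side I \<le> real_of_int (max (snd I i) (snd J i)) * side I \<and>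
      real_of_int (max (snd I i) (snd J i)) * side I \<le> real_of_int z * side I + side I" by blast
    then show ?thesis by (simp only: Int_iff in_cb corner_def s vec_lambda_beta add.assoc add_le_cancel_left) simp
  qed
  then show "wt J \<le> d * wt I" unfolding wt_cb using side_pos[of I] s by (intro d) auto
next
  fix I c assume c: "c \<in> T.ch I"
  have s: "side I = 2 * side c" using T.ch_lev[OF c] l by (simp add: side_def)
  have "corner c \<in> cell I" using corner_cell cell_below[OF T.ch_below[OF c]] by blast
  then have "corner c \<in> cb (corner c) (side c) \<inter> cb (corner I) (side I)" using corner_cell cell_cb by blast
  then show "wt I \<le> d * wt c" unfolding wt_cb using side_pos[of c] s by (intro d) auto
qed

end

text \<open>With exponent 1 the condition is an equality. This makes Lebesgue measure available as
  the intermediary between the two weights.\<close>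

lemma lborel_A_inf: "A_inf_measure (lborel :: (real ^ 'n) measure) 1 1"
proof
  show "emeasure lborel S < \<infinity>" if "bounded S" "S \<in> sets borel" for S :: "(real ^ 'n) set"
    using emeasure_bounded_finite[OF that(1)] by simp
  show "emeasure lborel (UNIV :: (real ^ 'n) set) \<noteq> 0" by simp
  show "measure lborel E / measure lborel (cb a l) \<le> 1 * (measure lborel E / measure lborel (cb a l)) powr 1"
    for E a l by simp
qed auto

context grid_measure begin

interpretation L: grid_measure t l N lborel 1 1
  by (intro grid_measure.intro lborel_A_inf cube_grid_axioms)

lemma comparable_from_lborel: "T.comparable L.wt wt small (1/2)"
  unfolding T.comparable_def
proof (intro ballI allI impI)
  fix Q E assume Q: "Q \<in> DD" and E: "E \<subseteq> T.leaves Q" and s: "sum L.wt E \<le> small * L.wt Q"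
  have "measure \<mu> (\<Union>x\<in>E. cell x) \<le> 1/2 * measure \<mu> (cb (corner Q) (side Q))"
    using s side_pos leaves_sub[OF E Q] cells_borel[OF E]
    by (intro small_set) (auto simp: L.measure_leaves[OF E] L.wt_cb[symmetric])
  then show "sum wt E \<le> 1/2 * wt Q" by (simp add: measure_leaves[OF E] wt_cb[symmetric])
qed

text \<open>Obtained by complements: if \<open>E\<close> had more than the proportion
  \<open>1 - small\<close> of the volume, the remainder would be small in volume and carry at most
  half of \<open>\<mu>\<close>, leaving at least half for \<open>E\<close>. The number 1/3 could be
  anything below one half.\<close>

lemma comparable_to_lborel: "T.comparable wt L.wt (1/3) (1 - small)"
  unfolding T.comparable_def
proof (intro ballI allI impI)
  fix Q E assume Q: "Q \<in> DD" and E: "E \<subseteq> T.leaves Q" and s: "sum wt E \<le> 1/3 * wt Q"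
  show "sum L.wt E \<le> (1 - small) * L.wt Q"
  proof (rule ccontr)
    assume n: "\<not> sum L.wt E \<le> (1 - small) * L.wt Q"
    let ?F = "T.leaves Q - E"
    have "sum L.wt ?F = sum L.wt (T.leaves Q) - sum L.wt E" using E by (intro sum_diff) auto
    then have "sum L.wt ?F \<le> small * L.wt Q"
      using n T.weight_leaves[OF L.weight_wt Q] by (simp add: algebra_simps)
    then have "sum wt ?F \<le> 1/2 * wt Q" using comparable_from_lborel Q unfolding T.comparable_def by blast
    moreover have "sum wt ?F = sum wt (T.leaves Q) - sum wt E" using E by (intro sum_diff) auto
    ultimately show False using s T.weight_leaves[OF weight_wt Q] T.weight_pos[OF weight_wt Q] by linarith
  qed
qed

lemma transfer_from_lborel: "T.transfers L.wt wt (2 / small)"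
  unfolding T.transfers_def
proof (intro allI impI)
  fix a M assume "0 < M" "\<forall>I\<in>DD. 0 \<le> a I" "T.carleson L.wt a M"
  then have "T.carleson wt a (M / (small * (1 - 1/2)))"
    using small by (intro T.carleson_transfer[OF L.weight_wt weight_wt comparable_from_lborel]) auto
  then show "T.carleson wt a (2 / small * M)" by (simp add: mult.commute)
qed

lemma transfer_to_lborel: "T.transfers wt L.wt (3 / small)"
  unfolding T.transfers_def
proof (intro allI impI)
  fix a M assume "0 < M" "\<forall>I\<in>DD. 0 \<le> a I" "T.carleson wt a M"
  then have "T.carleson L.wt a (M / (1/3 * (1 - (1 - small))))"
    using small by (intro T.carleson_transfer[OF weight_wt L.weight_wt comparable_to_lborel]) auto
  then show "T.carleson L.wt a (3 / small * M)" by (simp add: mult.commute)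
qed

text \<open>The boundary cubes of generation \<open>s\<close> lie in \<open>2 * CARD('n)\<close>
  slabs along the faces, each of relative volume \<open>2 ^ (- s)\<close>, and
  \<open>le_powr'\<close> converts this proportion into mass.\<close>

lemma thin_wt: "T.thin_boundary wt (C * (2 * real CARD('n)) powr \<epsilon>) ((1/2) powr \<epsilon>)"
  unfolding T.thin_boundary_def
proof (intro ballI allI)
  fix L s assume L: "L \<in> DD"
  let ?P = "{Q\<in>T.desc s L. T.boundary Q L}"
  let ?E = "\<Union>Q\<in>?P. cell Q"
  let ?h = "side L / 2 ^ s"
  let ?a = "corner L"
  \<comment> \<open>The layer of width \<open>?h\<close> along the face orthogonal to direction
    \<open>i\<close>; the flag \<open>b\<close> selects the upper face.\<close>
  define slab where "slab i b = cbox (\<chi> j. if j = i \<and> b then ?a $ j + side L - ?h else ?a $ j)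
      (\<chi> j. if j = i \<and> \<not> b then ?a $ j + ?h else ?a $ j + side L)" for i b
  have h: "0 < ?h" "?h \<le> side L" using side_pos[of L] by (auto simp: pos_divide_le_eq)
  have sl: "measure lborel (slab i b) = side L ^ CARD('n) / 2 ^ s" for i b
  proof -
    have ne: "(\<chi> j. if j = i \<and> b then ?a $ j + side L - ?h else ?a $ j) \<in> slab i b"
      unfolding slab_def mem_box_cart using h side_pos[of L] by auto
    then have "measure lborel (slab i b) = (\<Prod>j\<in>UNIV. if j = i then ?h else side L)"
      unfolding slab_def by (subst content_cbox_cart) (auto intro!: prod.cong)
    also have "\<dots> = ?h * side L ^ (CARD('n) - 1)" by (subst prod.If_cases) (auto simp: Compl_eq_Diff_UNIV card_Diff_subset)
    also have "\<dots> = side L ^ CARD('n) / 2 ^ s"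
      using power_minus_mult[of "CARD('n)" "side L"] by (simp add: mult.commute)
    finally show ?thesis .
  qed
  have sub: "?E \<subseteq> (\<Union>(i, b)\<in>UNIV. slab i b)"
  proof
    fix x assume "x \<in> ?E"
    then obtain Q where Q: "Q \<in> T.desc s L" "T.boundary Q L" "x \<in> cell Q" by auto
    obtain R where R: "R \<in> T.nb Q" "R \<notin> T.below L" using Q(2) by (auto simp: T.boundary_def)
    have QD: "Q \<in> DD" "fst Q = fst L + s" "T.anc s Q = L" using T.desc_in T.desc_lev T.desc_anc Q(1) by blast+
    have RD: "R \<in> DD" "adjc Q R" "fst R = fst L + s" using R(1) QD by (auto simp: T.nb_def adjc_def)
    have anc_snd: "snd (T.anc m J) i = snd J i div 2 ^ m" for m J i
    proof (induction m)
      case (Suc m)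
      have "snd J i div 2 ^ m div 2 = snd J i div 2 ^ Suc m"
        unfolding power_Suc2 by (rule zdiv_zmult2_eq[symmetric]) simp
      then show ?case using Suc by (simp add: T.anc_Suc' snd_parc)
    qed simp
    have "T.anc s R \<noteq> L" using R(2) RD T.below_anc[of R s] by auto
    moreover have "fst (T.anc s R) = fst L" using T.lev_anc[OF RD(1), of s] RD by simp
    ultimately obtain i where i: "snd R i div 2 ^ s \<noteq> snd L i" by (auto simp: prod_eq_iff fun_eq_iff anc_snd)
    let ?q = "snd Q i" and ?z = "snd L i"
    have qz: "?q div 2 ^ s = ?z" using QD(3) anc_snd[of s Q i] by simp
    have qr: "\<bar>?q - snd R i\<bar> \<le> 1" using RD(2) by (simp add: adjc_def)
    have p2: "(0::int) < 2 ^ s" by simp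
    have zs: "(?z + 1) * 2 ^ s = ?z * 2 ^ s + 2 ^ s" by (simp add: algebra_simps)
    have "?z * 2 ^ s + ?q mod 2 ^ s = ?q" using div_mult_mod_eq[of ?q "2 ^ s"] unfolding qz .
    then have qlo: "?z * 2 ^ s \<le> ?q" "?q < (?z + 1) * 2 ^ s"
      using pos_mod_bound[OF p2, of ?q] pos_mod_sign[OF p2, of ?q] unfolding zs by linarith+
    \<comment> \<open>The neighbour leaves \<open>L\<close> in direction \<open>i\<close>. Since its
      index differs from that of \<open>Q\<close> by at most 1, \<open>Q\<close> must be in the
      first or the last position inside \<open>L\<close>.\<close>
    have "snd R i < ?z * 2 ^ s \<or> (?z + 1) * 2 ^ s \<le> snd R i"
    proof (rule ccontr)
      assume "\<not> ?thesis"
      then have "?z * 2 ^ s \<le> snd R i" "snd R i < ?z * 2 ^ s + 2 ^ s" unfolding zs by linarith+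
      then have "snd R i div 2 ^ s = ?z"
        by (intro int_div_pos_eq[where r="snd R i - ?z * 2 ^ s"]) (simp_all add: mult.commute)
      then show False using i by simp
    qed
    then have q: "?q = ?z * 2 ^ s \<or> ?q = (?z + 1) * 2 ^ s - 1" using qr qlo by linarith
    have sQ: "side Q = ?h" using QD(2) by (simp add: side_def power_add)
    have xL: "x \<in> cb ?a (side L)" using cell_cb cell_below[OF T.desc_below[OF Q(1)]] Q(3) by blast
    have xi: "corner Q $ i \<le> x $ i" "x $ i \<le> corner Q $ i + ?h"
      using Q(3) by (auto simp: in_cell sQ intro: less_imp_le)
    from q show "x \<in> (\<Union>(i, b)\<in>UNIV. slab i b)"
    proof
      assume "?q = ?z * 2 ^ s"
      then have "corner Q $ i = ?a $ i" by (simp add: corner_def sQ)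
      then have "x \<in> slab i False" using xi xL unfolding slab_def mem_box_cart in_cb by auto
      then show ?thesis by blast
    next
      assume "?q = (?z + 1) * 2 ^ s - 1"
      then have "real_of_int ?q = (real_of_int ?z + 1) * 2 ^ s - 1" by simp
      then have "real_of_int ?q * ?h = (real_of_int ?z + 1) * side L - ?h" by (simp add: left_diff_distrib diff_divide_distrib)
      then have "corner Q $ i = ?a $ i + side L - ?h" by (simp add: corner_def sQ distrib_right)
      then have "x \<in> slab i True" using xi xL unfolding slab_def mem_box_cart in_cb by auto
      then show ?thesis by blast
    qed
  qed
  have dis: "disjoint_family_on cell ?P"
    unfolding disjoint_family_on_def by (intro ballI impI cell_disjoint) (auto dest!: T.desc_lev)
  have Eb: "?E \<in> sets borel" by (intro sets.finite_UN) auto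
  have "cell Q \<subseteq> cb ?a (side L)" if "Q \<in> T.desc s L" for Q
    by (rule subset_trans[OF cell_below[OF T.desc_below[OF that]] cell_cb])
  then have Esub: "?E \<subseteq> cb ?a (side L)" by blast
  have fs: "(\<Union>(i, b)\<in>UNIV. slab i b) \<in> fmeasurable lborel"
    unfolding split_def by (rule fmeasurable.finite_UN) (simp_all add: slab_def)
  have "measure lborel ?E \<le> measure lborel (\<Union>(i, b)\<in>UNIV. slab i b)"
    using Eb by (intro measure_mono_fmeasurable[OF sub _ fs]) simp
  also have "\<dots> \<le> (\<Sum>(i, b)\<in>UNIV. measure lborel (slab i b))"
    unfolding split_def by (intro measure_UNION_le) (auto simp: slab_def)
  also have "\<dots> = (2 * real CARD('n) / 2 ^ s) * measure lborel (cb ?a (side L))"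
    using side_pos[of L] by (simp add: sl measure_cb split_def UNIV_bool)
  finally have "measure \<mu> ?E \<le> C * (2 * real CARD('n) / 2 ^ s) powr \<epsilon> * measure \<mu> (cb ?a (side L))"
    by (rule le_powr'[OF side_pos Eb Esub])
  also have "measure \<mu> ?E = sum wt ?P" by (rule measure_cells[OF _ dis]) simp
  also have "(2 * real CARD('n) / 2 ^ s) powr \<epsilon> = (2 * real CARD('n)) powr \<epsilon> * ((1/2) powr \<epsilon>) ^ s"
  proof -
    have "(2 * real CARD('n) / 2 ^ s) powr \<epsilon> = (2 * real CARD('n) * (1/2) ^ s) powr \<epsilon>"
      by (simp add: power_divide)
    also have "\<dots> = (2 * real CARD('n)) powr \<epsilon> * ((1/2) ^ s) powr \<epsilon>" by (rule powr_mult)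
    also have "((1/2::real) ^ s) powr \<epsilon> = ((1/2) powr real s) powr \<epsilon>" by (simp add: powr_realpow)
    also have "\<dots> = ((1/2) powr \<epsilon>) powr real s" by (simp only: powr_powr mult.commute)
    also have "\<dots> = ((1/2) powr \<epsilon>) ^ s" by (rule powr_realpow) simp
    finally show ?thesis .
  qed
  finally show "sum wt ?P \<le> C * (2 * real CARD('n)) powr \<epsilon> * ((1/2) powr \<epsilon>) ^ s * wt L"
    by (simp add: wt_cb mult_ac)
qed

end

section \<open>The bilinear form of a tested kernel\<close>

text \<open>Stated without a conjugate, to match the bilinear form. Integrability of the product
  comes first; the inequality then follows from a nonnegative real quadratic.\<close>

lemma cs_integral:
  fixes f g :: "'a \<Rightarrow> complex"
  assumes [measurable]: "f \<in> borel_measurable M" "g \<in> borel_measurable M"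
    and f: "integrable M (\<lambda>x. (norm (f x))\<^sup>2)" and g: "integrable M (\<lambda>x. (norm (g x))\<^sup>2)"
  shows "integrable M (\<lambda>x. f x * g x)"
    and "norm (LINT x|M. f x * g x) \<le> sqrt (LINT x|M. (norm (f x))\<^sup>2) * sqrt (LINT x|M. (norm (g x))\<^sup>2)"
proof -
  let ?F = "LINT x|M. (norm (f x))\<^sup>2" and ?G = "LINT x|M. (norm (g x))\<^sup>2" and ?P = "LINT x|M. norm (f x) * norm (g x)"
  have am: "norm (f x) * norm (g x) \<le> (norm (f x))\<^sup>2 + (norm (g x))\<^sup>2" for x
    using sum_squares_bound[of "norm (f x)" "norm (g x)"] mult_nonneg_nonneg[OF norm_ge_zero[of "f x"] norm_ge_zero[of "g x"]] by linarith
  show I: "integrable M (\<lambda>x. f x * g x)"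
    by (rule Bochner_Integration.integrable_bound[OF Bochner_Integration.integrable_add[OF f g]])
      (use am in \<open>auto simp: norm_mult\<close>)
  have IP: "integrable M (\<lambda>x. norm (f x) * norm (g x))" using integrable_norm[OF I] by (simp add: norm_mult)
  have P0: "0 \<le> ?P" by (rule integral_nonneg_AE) auto
  have quad: "0 \<le> s\<^sup>2 * ?F - 2 * s * ?P + ?G" for s :: real
  proof -
    have "0 \<le> (LINT x|M. (s * norm (f x) - norm (g x))\<^sup>2)" by (rule integral_nonneg_AE) auto
    also have "(\<lambda>x. (s * norm (f x) - norm (g x))\<^sup>2)
        = (\<lambda>x. s\<^sup>2 * (norm (f x))\<^sup>2 - 2 * s * (norm (f x) * norm (g x)) + (norm (g x))\<^sup>2)"
      by (simp add: power2_eq_square algebra_simps fun_eq_iff)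
    also have "(LINT x|M. s\<^sup>2 * (norm (f x))\<^sup>2 - 2 * s * (norm (f x) * norm (g x)) + (norm (g x))\<^sup>2)
        = s\<^sup>2 * ?F - 2 * s * ?P + ?G" using f g IP by simp
    finally show ?thesis .
  qed
  have F0: "0 \<le> ?F" and G0: "0 \<le> ?G" by (auto intro: integral_nonneg_AE)
  have PP: "?P\<^sup>2 \<le> ?F * ?G"
  proof (cases "?F = 0")
    case True
    have "?P = 0"
    proof (rule ccontr)
      assume "?P \<noteq> 0"
      then have "0 < ?P" by (intro le_neq_trans[OF P0]) (rule not_sym)
      \<comment> \<open>When the leading coefficient vanishes, this value of \<open>s\<close> makes
        the quadratic equal to -1.\<close>
      then show False using quad[of "(?G + 1) / (2 * ?P)"] True by simp
    qed
    then show ?thesis using True by simp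
  next
    case False
    then have "0 < ?F" by (intro le_neq_trans[OF F0]) (rule not_sym)
    have "(?P / ?F)\<^sup>2 * ?F - 2 * (?P / ?F) * ?P + ?G = ?G - ?P\<^sup>2 / ?F"
      using \<open>0 < ?F\<close> by (simp add: power2_eq_square)
    then have "?P\<^sup>2 / ?F \<le> ?G" using quad[of "?P / ?F"] by linarith
    then show ?thesis using \<open>0 < ?F\<close> by (simp add: divide_le_eq mult.commute)
  qed
  have "norm (LINT x|M. f x * g x) \<le> (LINT x|M. norm (f x * g x))" by (rule integral_norm_bound)
  also have "\<dots> = ?P" by (simp add: norm_mult)
  also have "\<dots> \<le> sqrt ?F * sqrt ?G" using real_le_rsqrt[OF PP] by (simp only: real_sqrt_mult)
  finally show "norm (LINT x|M. f x * g x) \<le> sqrt ?F * sqrt ?G" .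
qed

lemma (in A_inf_measure) space_mu: "space \<mu> = UNIV"
  using sets_eq_imp_space_eq[OF sets_mu] by simp

lemma (in A_inf_measure) sigma_finite: "sigma_finite_measure \<mu>"
proof
  have "(\<Union>n. cball (0 :: real ^ 'n) (real n)) = UNIV"
    by (auto intro: real_arch_simple)
  moreover have "emeasure \<mu> (cball 0 (real n)) \<noteq> \<infinity>" for n
    using finite_bounded[OF bounded_cball, of 0 "real n"] by simp
  ultimately show "\<exists>A. countable A \<and> A \<subseteq> sets \<mu> \<and> \<Union> A = space \<mu> \<and> (\<forall>a\<in>A. emeasure \<mu> a \<noteq> \<infinity>)"
    by (intro exI[of _ "range (\<lambda>n::nat. cball 0 (real n))"]) (auto simp: sets_mu space_mu)
qed

lemma (in A_inf_measure) borel_measurable_mu: "borel_measurable \<mu> = borel_measurable borel"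
  by (rule measurable_cong_sets[OF sets_mu refl])

locale two_measures = S: A_inf_measure \<sigma> Cs es + W: A_inf_measure \<omega> Cw ew
  for \<sigma> \<omega> :: "(real ^ 'n) measure" and Cs es Cw ew
begin

sublocale PW: pair_sigma_finite \<omega> \<sigma>
  by (intro pair_sigma_finite.intro W.sigma_finite S.sigma_finite)

lemma sets_pair: "sets (\<omega> \<Otimes>\<^sub>M \<sigma>) = sets borel"
  unfolding sets_pair_measure_cong[OF W.sets_mu S.sets_mu] borel_prod by (rule refl)

text \<open>Defined on the product space so that Fubini gives it as an integral of
  \<open>T f\<close> or of its transpose, whichever side is tested.\<close>

definition PP :: "(real ^ 'n \<Rightarrow> real ^ 'n \<Rightarrow> complex) \<Rightarrow> (real ^ 'n \<Rightarrow> complex) \<Rightarrow> (real ^ 'n \<Rightarrow> complex) \<Rightarrow> complex" where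
  "PP K f g = (LINT p|(\<omega> \<Otimes>\<^sub>M \<sigma>). K (fst p) (snd p) * f (snd p) * g (fst p))"

definition nice :: "(real ^ 'n \<Rightarrow> real ^ 'n \<Rightarrow> complex) \<Rightarrow> bool" where
  "nice K \<longleftrightarrow> (\<lambda>p. K (fst p) (snd p)) \<in> borel_measurable borel \<and> (\<exists>M. \<forall>x y. norm (K x y) \<le> M)"

lemma int_PP:
  assumes K: "nice K" and f: "integrable \<sigma> f" and g: "integrable \<omega> g"
  shows "integrable (\<omega> \<Otimes>\<^sub>M \<sigma>) (\<lambda>p. K (fst p) (snd p) * f (snd p) * g (fst p))"
proof -
  obtain M where M: "\<And>x y. norm (K x y) \<le> M" using K unfolding nice_def by blast
  have Km: "(\<lambda>p. K (fst p) (snd p)) \<in> borel_measurable (\<omega> \<Otimes>\<^sub>M \<sigma>)"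
    using K unfolding nice_def measurable_cong_sets[OF sets_pair refl] by blast
  have [measurable]: "f \<in> borel_measurable \<sigma>" "g \<in> borel_measurable \<omega>" using f g by auto
  have h: "integrable (\<omega> \<Otimes>\<^sub>M \<sigma>) (\<lambda>p. f (snd p) * g (fst p))"
  proof (rule PW.Fubini_integrable)
    show "integrable \<omega> (\<lambda>x. LINT y|\<sigma>. norm (f (snd (x, y)) * g (fst (x, y))))"
      using f g by (simp add: norm_mult)
    show "AE x in \<omega>. integrable \<sigma> (\<lambda>y. f (snd (x, y)) * g (fst (x, y)))" using f by simp
  qed measurable
  have "0 \<le> M" using M[of 0 0] norm_ge_zero order_trans by blast
  show ?thesis
  proof (rule Bochner_Integration.integrable_bound[OF integrable_mult_right[OF integrable_norm[OF h], of M]])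
    show "(\<lambda>p. K (fst p) (snd p) * f (snd p) * g (fst p)) \<in> borel_measurable (\<omega> \<Otimes>\<^sub>M \<sigma>)"
      using Km by measurable
    show "AE p in \<omega> \<Otimes>\<^sub>M \<sigma>. norm (K (fst p) (snd p) * f (snd p) * g (fst p)) \<le> norm (M * norm (f (snd p) * g (fst p)))"
      using M \<open>0 \<le> M\<close> by (intro AE_I2) (simp add: norm_mult mult.assoc mult_right_mono)
  qed
qed

lemma PP_1: assumes "nice K" "integrable \<sigma> f" "integrable \<omega> g"
  shows "PP K f g = (LINT x|\<omega>. (LINT y|\<sigma>. K x y * f y) * g x)"
proof -
  have "PP K f g = (LINT x|\<omega>. LINT y|\<sigma>. K x y * f y * g x)"
    unfolding PP_def using PW.integral_fst'[OF int_PP[OF assms]] by simp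
  then show ?thesis by simp
qed

lemma PP_2: assumes "nice K" "integrable \<sigma> f" "integrable \<omega> g"
  shows "PP K f g = (LINT y|\<sigma>. (LINT x|\<omega>. K x y * g x) * f y)"
proof -
  have "PP K f g = (LINT y|\<sigma>. LINT x|\<omega>. K x y * f y * g x)"
    unfolding PP_def using PW.integral_snd[of "\<lambda>x y. K x y * f y * g x"] int_PP[OF assms] by (simp add: case_prod_beta')
  also have "\<dots> = (LINT y|\<sigma>. LINT x|\<omega>. (K x y * g x) * f y)" by (simp only: mult_ac)
  finally show ?thesis by simp
qed

lemma PP_sum:
  assumes K: "nice K" and f: "\<And>i. i \<in> A \<Longrightarrow> integrable \<sigma> (f i)" and g: "\<And>j. j \<in> A \<Longrightarrow> integrable \<omega> (g j)"
  shows "PP K (\<lambda>y. \<Sum>i\<in>A. u i * f i y) (\<lambda>x. \<Sum>j\<in>A. v j * g j x) = (\<Sum>i\<in>A. \<Sum>j\<in>A. PP K (f i) (g j) * u i * v j)"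
proof -
  have "PP K (\<lambda>y. \<Sum>i\<in>A. u i * f i y) (\<lambda>x. \<Sum>j\<in>A. v j * g j x)
      = (LINT p|(\<omega> \<Otimes>\<^sub>M \<sigma>). (\<Sum>i\<in>A. \<Sum>j\<in>A. (K (fst p) (snd p) * f i (snd p) * g j (fst p)) * (u i * v j)))"
    unfolding PP_def by (intro Bochner_Integration.integral_cong refl)
      (simp add: sum_distrib_left sum_distrib_right mult_ac)
  also have "\<dots> = (\<Sum>i\<in>A. \<Sum>j\<in>A. (LINT p|(\<omega> \<Otimes>\<^sub>M \<sigma>). (K (fst p) (snd p) * f i (snd p) * g j (fst p)) * (u i * v j)))"
    using int_PP[OF K f g] by (subst Bochner_Integration.integral_sum, simp, intro sum.cong refl, subst Bochner_Integration.integral_sum) auto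
  also have "\<dots> = (\<Sum>i\<in>A. \<Sum>j\<in>A. PP K (f i) (g j) * u i * v j)"
    unfolding PP_def Bochner_Integration.integral_mult_left_zero by (simp only: mult.assoc)
  finally show ?thesis .
qed

end

text \<open>Both testing conditions share one constant, so that the locale is symmetric under
  \<open>swap\<close> and one-sided arguments are carried out once. In \<open>A2\<close>,
  \<open>l powr (- \<beta>)\<close> is the volume of the cube to the power
  \<open>1 - \<alpha> / n\<close>.\<close>

locale tested_kernel = two_measures \<sigma> \<omega> Cs es Cw ew + good_kernel k Ck \<beta>
  for \<sigma> \<omega> :: "(real ^ 'n) measure" and Cs es Cw ew k Ck \<beta> +
  fixes Tc A :: real
  assumes Tc: "0 \<le> Tc" and A: "0 \<le> A" and beta: "\<beta> \<le> 0"
    and test_W: "0 < l \<Longrightarrow> (\<lambda>x. LINT y|\<sigma>. k x y * indicator (cb a l) y) \<in> L2_space \<omega> \<and>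
      (L2_norm \<omega> (\<lambda>x. LINT y|\<sigma>. k x y * indicator (cb a l) y))\<^sup>2 \<le> Tc\<^sup>2 * measure \<sigma> (cb a l)"
    and test_S: "0 < l \<Longrightarrow> (\<lambda>y. LINT x|\<omega>. k x y * indicator (cb a l) x) \<in> L2_space \<sigma> \<and>
      (L2_norm \<sigma> (\<lambda>y. LINT x|\<omega>. k x y * indicator (cb a l) x))\<^sup>2 \<le> Tc\<^sup>2 * measure \<omega> (cb a l)"
    and A2: "0 < l \<Longrightarrow> sqrt (measure \<sigma> (cb a l)) * sqrt (measure \<omega> (cb a l)) \<le> A * l powr (- \<beta>)"
begin

lemma nice_k: "nice k"
  using continuous_k bounded_k by (simp add: nice_def borel_measurable_continuous_onI)

lemma swap: "tested_kernel \<omega> \<sigma> Cw ew Cs es (\<lambda>x y. k y x) Ck \<beta> Tc A"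
  by (intro tested_kernel.intro two_measures.intro S.A_inf_measure_axioms W.A_inf_measure_axioms
      good_swap tested_kernel_axioms.intro Tc A beta test_S test_W)
    (use A2 in \<open>auto simp: mult.commute\<close>)

end

locale grid_kernel = cube_grid t l N + tested_kernel \<sigma> \<omega> Cs es Cw ew k Ck \<beta> Tc A
  for t :: "real ^ 'n" and l N and \<sigma> \<omega> :: "(real ^ 'n) measure" and Cs es Cw ew k Ck \<beta> Tc A
begin

sublocale GS: grid_measure t l N \<sigma> Cs es
  by (intro grid_measure.intro cube_grid_axioms S.A_inf_measure_axioms)

sublocale GW: grid_measure t l N \<omega> Cw ew
  by (intro grid_measure.intro cube_grid_axioms W.A_inf_measure_axioms)

abbreviation "s \<equiv> GS.wt"
abbreviation "w \<equiv> GW.wt"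

definition stp :: "(nat \<times> ('n \<Rightarrow> int) \<Rightarrow> complex) \<Rightarrow> real ^ 'n \<Rightarrow> complex" where
  "stp u \<xi> = (\<Sum>x\<in>T.leaves rt. u x * indicator (cell x) \<xi>)"

text \<open>The first index belongs to the variable of \<open>\<sigma>\<close>, which is the second
  variable of \<open>k\<close>; this matches the order of arguments in \<open>PP\<close>.\<close>

definition b :: "nat \<times> ('n \<Rightarrow> int) \<Rightarrow> nat \<times> ('n \<Rightarrow> int) \<Rightarrow> complex" where
  "b x y = PP k (indicator (cell x)) (indicator (cell y))"

lemma int_cell_real: "integrable \<sigma> (indicator (cell x) :: _ \<Rightarrow> real)" "integrable \<omega> (indicator (cell x) :: _ \<Rightarrow> real)"
  using GS.cell_fin[of x] GW.cell_fin[of x] S.sets_mu W.sets_mu by (auto simp: less_top)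

lemma int_cell: "integrable \<sigma> (indicator (cell x) :: _ \<Rightarrow> complex)" "integrable \<omega> (indicator (cell x) :: _ \<Rightarrow> complex)"
proof -
  have "indicator (cell x) \<in> borel_measurable \<sigma>" "indicator (cell x) \<in> borel_measurable \<omega>"
    using S.sets_mu W.sets_mu by (auto intro!: borel_measurable_indicator)
  moreover have "norm (indicator (cell x) \<xi> :: complex) \<le> norm (indicator (cell x) \<xi> :: real)" for \<xi>
    by (simp add: indicator_def)
  ultimately show "integrable \<sigma> (indicator (cell x) :: _ \<Rightarrow> complex)" "integrable \<omega> (indicator (cell x) :: _ \<Rightarrow> complex)"
    by - (rule Bochner_Integration.integrable_bound[OF int_cell_real(1)[of x]], assumption, rule AE_I2, assumption,
      rule Bochner_Integration.integrable_bound[OF int_cell_real(2)[of x]], assumption, rule AE_I2, assumption)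
qed

lemma stp_in: assumes "x \<in> T.leaves rt" "\<xi> \<in> cell x" shows "stp u \<xi> = u x"
proof -
  have "stp u \<xi> = (\<Sum>y\<in>T.leaves rt. if y = x then u y else 0)"
    unfolding stp_def
  proof (intro sum.cong refl)
    fix y assume y: "y \<in> T.leaves rt"
    have "y = x" if "\<xi> \<in> cell y"
      using cell_disjoint[of x y] that assms(2) T.leaves_lev[OF y] T.leaves_lev[OF assms(1)] by (metis disjoint_iff)
    then show "u y * indicator (cell y) \<xi> = (if y = x then u y else 0)"
      by (cases "\<xi> \<in> cell y") (use assms(2) in \<open>auto simp: indicator_def\<close>)
  qed
  then show ?thesis using assms by simp
qed

lemma stp_out: assumes "\<xi> \<notin> cell rt" shows "stp u \<xi> = 0"
proof -
  have "\<xi> \<notin> cell x" if "x \<in> T.leaves rt" for x using assms cell_below[OF T.leaves_below[OF that]] by blast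
  then show ?thesis unfolding stp_def by (intro sum.neutral) auto
qed

lemma cell_rt_cases: obtains x where "\<xi> \<in> cell rt" "x \<in> T.leaves rt" "\<xi> \<in> cell x" | "\<xi> \<notin> cell rt"
  using cell_leaves[OF T.root_in] by blast

lemma int_stp: "integrable \<sigma> (stp u)" "integrable \<omega> (stp u)"
  unfolding stp_def[abs_def]
  by (rule Bochner_Integration.integrable_sum, rule integrable_mult_right, rule int_cell)+

lemma B_stp: "T.B b u v = PP k (stp u) (stp v)"
  unfolding T.B_def b_def stp_def[abs_def] by (rule PP_sum[OF nice_k int_cell, symmetric])

lemma stp_indic: assumes "L \<in> DD" shows "stp (T.indic L) = indicator (cell L)"
proof
  fix \<xi>
  have sub: "cell L \<subseteq> cell rt" using cell_below[of L rt] assms T.below_root by simp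
  show "stp (T.indic L) \<xi> = indicator (cell L) \<xi>"
  proof (cases \<xi> rule: cell_rt_cases)
    case (1 x)
    have "\<xi> \<in> cell L \<longleftrightarrow> x \<in> T.leaves L"
    proof
      assume "\<xi> \<in> cell L"
      then obtain y where y: "y \<in> T.leaves L" "\<xi> \<in> cell y" using cell_leaves[OF assms] by blast
      have "y = x" using cell_disjoint[of x y] 1 y T.leaves_lev by auto
      then show "x \<in> T.leaves L" using y by simp
    next
      assume "x \<in> T.leaves L"
      then show "\<xi> \<in> cell L" using 1 cell_leaves[OF assms] by blast
    qed
    then show ?thesis using stp_in[OF 1(2,3)] by (simp add: T.indic_def indicator_def)
  next
    case 2
    then show ?thesis using stp_out sub by (auto simp: indicator_def)
  qed
qed

lemma norm_stp_sq: "(norm (stp u \<xi>))\<^sup>2 = (\<Sum>x\<in>T.leaves rt. (norm (u x))\<^sup>2 * indicator (cell x) \<xi>)"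
proof -
  have "(\<Sum>x\<in>T.leaves rt. of_real ((norm (u x))\<^sup>2) * indicator (cell x) \<xi>) = stp (\<lambda>x. of_real ((norm (u x))\<^sup>2)) \<xi>"
    by (simp add: stp_def)
  also have "\<dots> = of_real ((norm (stp u \<xi>))\<^sup>2)"
    by (cases \<xi> rule: cell_rt_cases) (simp_all add: stp_in stp_out)
  finally have "complex_of_real (\<Sum>x\<in>T.leaves rt. (norm (u x))\<^sup>2 * indicator (cell x) \<xi>) = of_real ((norm (stp u \<xi>))\<^sup>2)"
    by (simp add: indicator_def if_distrib cong: if_cong)
  then show ?thesis by (simp only: of_real_eq_iff)
qed

lemma stp_L2:
  "integrable \<sigma> (\<lambda>\<xi>. (norm (stp u \<xi>))\<^sup>2)" "(LINT \<xi>|\<sigma>. (norm (stp u \<xi>))\<^sup>2) = T.nrm s u rt"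
  "integrable \<omega> (\<lambda>\<xi>. (norm (stp u \<xi>))\<^sup>2)" "(LINT \<xi>|\<omega>. (norm (stp u \<xi>))\<^sup>2) = T.nrm w u rt"
proof -
  have i: "integrable \<sigma> (\<lambda>\<xi>. (norm (u x))\<^sup>2 * indicator (cell x) \<xi>)" "integrable \<omega> (\<lambda>\<xi>. (norm (u x))\<^sup>2 * indicator (cell x) \<xi>)" for x
    by (rule integrable_mult_right, rule int_cell_real)+
  show "integrable \<sigma> (\<lambda>\<xi>. (norm (stp u \<xi>))\<^sup>2)" "integrable \<omega> (\<lambda>\<xi>. (norm (stp u \<xi>))\<^sup>2)"
    unfolding norm_stp_sq by (rule Bochner_Integration.integrable_sum, rule i)+
  show "(LINT \<xi>|\<sigma>. (norm (stp u \<xi>))\<^sup>2) = T.nrm s u rt" "(LINT \<xi>|\<omega>. (norm (stp u \<xi>))\<^sup>2) = T.nrm w u rt"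
    unfolding norm_stp_sq T.nrm_def Bochner_Integration.integral_sum[OF i(1)] Bochner_Integration.integral_sum[OF i(2)]
    by (rule sum.cong[OF refl], simp add: GS.wt_def GW.wt_def S.space_mu W.space_mu mult.commute)+
qed

lemma T_cell: "(LINT y|\<sigma>. k x y * indicator (cell L) y) = (LINT y|\<sigma>. k x y * indicator (cb (corner L) (side L)) y)"
proof (rule integral_cong_AE)
  have k: "(\<lambda>y. k x y) \<in> borel_measurable borel"
    using measurable_compose[OF _ nice_k[unfolded nice_def, THEN conjunct1], of "\<lambda>y. (x, y)" borel] by simp
  show "(\<lambda>y. k x y * indicator (cell L) y) \<in> borel_measurable \<sigma>"
    "(\<lambda>y. k x y * indicator (cb (corner L) (side L)) y) \<in> borel_measurable \<sigma>"
    unfolding S.borel_measurable_mu using k by measurable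
  show "AE y in \<sigma>. k x y * indicator (cell L) y = k x y * indicator (cb (corner L) (side L)) y"
    using GS.AE_cell[of L] by eventually_elim (simp add: indicator_def)
qed

text \<open>By Fubini the form is the integral of \<open>T (indicator (cell L))\<close> against the
  step function of \<open>v\<close>; Cauchy-Schwarz and testing finish. No relation between
  \<open>v\<close> and \<open>L\<close> is assumed, because testing bounds the norm over the whole
  space.\<close>

lemma test2: assumes L: "L \<in> DD"
  shows "norm (T.B b (T.indic L) v) \<le> Tc * (sqrt (s L) * sqrt (T.nrm w v rt))"
proof -
  let ?h = "\<lambda>x. LINT y|\<sigma>. k x y * indicator (cell L) y"
  have h: "?h \<in> L2_space \<omega>" "(L2_norm \<omega> ?h)\<^sup>2 \<le> Tc\<^sup>2 * s L"
    using test_W[OF side_pos, of "corner L"] unfolding T_cell[abs_def] GS.wt_cb by auto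
  have B: "T.B b (T.indic L) v = (LINT x|\<omega>. ?h x * stp v x)"
    unfolding B_stp stp_indic[OF L] using PP_1[OF nice_k int_cell(1) int_stp(2)] by simp
  have "norm (T.B b (T.indic L) v) \<le> L2_norm \<omega> ?h * sqrt (T.nrm w v rt)"
    unfolding B L2_norm_def stp_L2(4)[symmetric]
    using h(1) stp_L2(3) int_stp(2) by (intro cs_integral(2)) (auto simp: L2_space_def)
  also have "L2_norm \<omega> ?h \<le> Tc * sqrt (s L)"
    using real_sqrt_le_mono[OF h(2)] Tc by (simp add: real_sqrt_mult L2_norm_def)
  finally show ?thesis
    using T.nrm_nonneg[OF GW.weight_wt] by (simp add: mult.assoc mult_right_mono)
qed

lemma swap_grid: "grid_kernel l \<omega> \<sigma> Cw ew Cs es (\<lambda>x y. k y x) Ck \<beta> Tc A"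
  by (intro grid_kernel.intro cube_grid_axioms swap)

lemma test1: assumes L: "L \<in> DD"
  shows "norm (T.B b u (T.indic L)) \<le> Tc * (sqrt (w L) * sqrt (T.nrm s u rt))"
proof -
  interpret X: grid_kernel t l N \<omega> \<sigma> Cw ew Cs es "\<lambda>x y. k y x" Ck \<beta> Tc A by (rule swap_grid)
  have "X.b y x = b x y" for x y unfolding b_def X.b_def
    by (subst PP_2[OF nice_k int_cell], subst X.PP_1[OF X.nice_k X.int_cell]) (rule refl)
  then have "T.B X.b (T.indic L) u = T.B b u (T.indic L)"
    by (simp add: T.B_transpose[of X.b])
  then show ?thesis using X.test2[OF L, of u] by simp
qed

text \<open>The Lipschitz bound over a cube whose diameter is at most
  \<open>CARD('n) * side I\<close>, at distance at least
  \<open>2 ^ (j - 1) * side I\<close>.\<close>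

definition osc :: "nat \<times> ('n \<Rightarrow> int) \<Rightarrow> nat \<Rightarrow> real" where
  "osc I j = Ck * (real CARD('n) * side I) * (2 ^ (j - 1) * side I) powr (\<beta> - 1)"

text \<open>Non-adjacent ancestors have indices differing by at least 2 in some direction, so one
  full ancestor side separates them there. The segment on which the kernel is differentiated stays
  in the convex closed ancestor cube of \<open>I\<close>.\<close>

lemma kernel_osc:
  assumes I: "I \<in> DD" and J: "J \<in> DD" "fst J = fst I" and j: "0 < j" "j \<le> fst I"
    and na: "\<not> adjc (T.anc (j - 1) I) (T.anc (j - 1) J)"
    and eta: "\<eta> \<in> cell I" and xi: "\<xi> \<in> cell J"
  shows "norm (k \<xi> \<eta> - k \<xi> (corner I)) \<le> osc I j"
proof -
  let ?I = "T.anc (j - 1) I" and ?J = "T.anc (j - 1) J"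
  let ?d = "2 ^ (j - 1) * side I"
  have lev: "fst ?I = fst I - (j - 1)" "fst ?J = fst I - (j - 1)"
    using T.lev_anc[OF I, of "j - 1"] T.lev_anc[OF J(1), of "j - 1"] J(2) j by auto
  have sd: "side ?I = ?d" using side_anc[OF I, of "j - 1"] j by auto
  have sJ: "side ?J = ?d" using lev sd by (simp add: side_def)
  obtain i where i: "1 < \<bar>snd ?I i - snd ?J i\<bar>" using na lev by (auto simp: adjc_def not_le)
  have cI: "cell I \<subseteq> cb (corner ?I) ?d"
    using order_trans[OF cell_below[OF T.below_anc[OF I]] cell_cb, of "j - 1"] j unfolding sd by simp
  have cJ: "cell J \<subseteq> cb (corner ?J) ?d"
    using order_trans[OF cell_below[OF T.below_anc[OF J(1)]] cell_cb, of "j - 1"] j J(2) unfolding sJ by simp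
  have "?d \<le> norm (z - \<xi>)" if z: "z \<in> closed_segment \<eta> (corner I)" for z
  proof -
    have "closed_segment \<eta> (corner I) \<subseteq> cb (corner ?I) ?d"
      using cI eta corner_cell[of I] unfolding cb_def by (intro closed_segment_subset) auto
    then have zi: "corner ?I $ i \<le> z $ i" "z $ i \<le> corner ?I $ i + ?d" using z by (auto simp: in_cb)
    have xii: "corner ?J $ i \<le> \<xi> $ i" "\<xi> $ i \<le> corner ?J $ i + ?d" using cJ xi by (auto simp: in_cb)
    have c: "corner ?I $ i - corner ?J $ i = real_of_int (snd ?I i - snd ?J i) * ?d"
      unfolding corner_def vec_lambda_beta sd sJ by (simp add: left_diff_distrib)
    have d0: "0 < ?d" using side_pos[of I] by simp
    have "?d \<le> \<bar>z $ i - \<xi> $ i\<bar>"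
    proof (cases "0 < snd ?I i - snd ?J i")
      case True
      then have "2 \<le> snd ?I i - snd ?J i" using i by simp
      then have "2 * ?d \<le> real_of_int (snd ?I i - snd ?J i) * ?d" using d0 by (intro mult_right_mono) linarith+
      then show ?thesis using c zi xii by linarith
    next
      case False
      then have "snd ?I i - snd ?J i \<le> - 2" using i by simp
      then have "real_of_int (snd ?I i - snd ?J i) * ?d \<le> (- 2) * ?d" using d0 by (intro mult_right_mono) linarith+
      then show ?thesis using c zi xii by linarith
    qed
    also have "\<dots> \<le> norm (z - \<xi>)" using component_le_norm_cart[of "z - \<xi>" i] by simp
    finally show ?thesis .
  qed
  then have "norm (k \<xi> \<eta> - k \<xi> (corner I)) \<le> Ck * norm (\<eta> - corner I) * ?d powr (\<beta> - 1)"
    using side_pos[of I] by (intro lip2) auto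
  also have "norm (\<eta> - corner I) \<le> real CARD('n) * side I"
  proof -
    have "norm (\<eta> - corner I) \<le> (\<Sum>i\<in>UNIV. \<bar>(\<eta> - corner I) $ i\<bar>)" by (rule norm_le_l1_cart)
    also have "\<dots> \<le> (\<Sum>i\<in>(UNIV :: 'n set). side I)"
    proof (rule sum_mono)
      fix i
      have "corner I $ i \<le> \<eta> $ i \<and> \<eta> $ i < corner I $ i + side I" using eta by (simp add: in_cell)
      then show "\<bar>(\<eta> - corner I) $ i\<bar> \<le> side I" unfolding vector_minus_component by linarith
    qed
    finally show ?thesis by simp
  qed
  finally show ?thesis using Ck by (simp add: osc_def mult_left_mono mult_right_mono)
qed

text \<open>Since \<open>u\<close> has mean zero on \<open>I\<close>, the kernel may be replaced by
  its increment from the corner of \<open>I\<close>; what is left is a uniform bound times two norms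
  of integrable functions, estimated by Cauchy-Schwarz on each cube.\<close>

lemma far_one:
  assumes I: "I \<in> DD" and J: "J \<in> DD" "fst J = fst I" and j: "0 < j" "j \<le> fst I"
    and na: "\<not> adjc (T.anc (j - 1) I) (T.anc (j - 1) J)"
    and u: "\<And>x. x \<in> T.leaves rt - T.leaves I \<Longrightarrow> u x = 0" "(\<Sum>x\<in>T.leaves I. of_real (s x) * u x) = 0"
    and v: "\<And>x. x \<in> T.leaves rt - T.leaves J \<Longrightarrow> v x = 0"
  shows "norm (T.B b u v) \<le> osc I j * (sqrt (s I) * sqrt (T.nrm s u rt)) * (sqrt (w J) * sqrt (T.nrm w v rt))"
proof -
  have lI: "T.leaves I \<subseteq> T.leaves rt" and lJ: "T.leaves J \<subseteq> T.leaves rt"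
    using T.leaves_mono[of _ rt] I J T.below_root by auto
  have o0: "0 \<le> osc I j" using Ck side_pos[of I] by (simp add: osc_def)
  define K' where "K' = (\<lambda>\<xi> (\<eta> :: real ^ 'n). k \<xi> (corner I))"
  have kc: "(\<lambda>\<xi>. k \<xi> (corner I)) \<in> borel_measurable borel"
    using measurable_compose[OF _ nice_k[unfolded nice_def, THEN conjunct1], of "\<lambda>\<xi>. (\<xi>, corner I)" borel] by simp
  have nK': "nice K'" unfolding nice_def K'_def
    using measurable_compose[OF measurable_fst kc, of "borel :: (real ^ 'n) measure", unfolded borel_prod] bounded_k by blast
  have n1: "nice (\<lambda>_ _. 1)" by (auto simp: nice_def)
  define \<gamma> where "\<gamma> y = (LINT \<xi>|\<omega>. k \<xi> (corner I) * indicator (cell y) \<xi>)" for y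
  have isx: "(LINT \<eta>|\<sigma>. indicator (cell x) \<eta>) = complex_of_real (s x)"
    and isy: "(LINT \<eta>|\<omega>. indicator (cell x) \<eta>) = complex_of_real (w x)" for x

    using integral_complex_of_real[of \<sigma> "indicator (cell x)"] integral_complex_of_real[of \<omega> "indicator (cell x)"]
    by (simp_all add: GS.wt_def GW.wt_def S.space_mu W.space_mu of_real_indicator)
  have bb: "norm (b x y - of_real (s x) * \<gamma> y) \<le> osc I j * (s x * w y)"
    if x: "x \<in> T.leaves I" and y: "y \<in> T.leaves J" for x y
  proof -
    let ?f = "indicator (cell x) :: _ \<Rightarrow> complex" and ?g = "indicator (cell y) :: _ \<Rightarrow> complex"
    have sx: "cell x \<subseteq> cell I" and sy: "cell y \<subseteq> cell J" using cell_below T.leaves_below x y by blast+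
    have e1: "PP K' ?f ?g = of_real (s x) * \<gamma> y"
    proof -
      have "(\<lambda>\<xi>. k \<xi> (corner I) * of_real (s x) * ?g \<xi>) = (\<lambda>\<xi>. of_real (s x) * (k \<xi> (corner I) * ?g \<xi>))"
        by (rule ext) (simp only: mult_ac)
      then show ?thesis
        unfolding PP_1[OF nK' int_cell(1) int_cell(2)] \<gamma>_def unfolding K'_def integral_mult_right_zero isx
        by (simp only: integral_mult_right_zero)
    qed
    have e2: "PP (\<lambda>_ _. 1) ?f ?g = of_real (s x * w y)"
      unfolding PP_1[OF n1 int_cell(1) int_cell(2)] by (simp add: isx isy)
    have "b x y - of_real (s x) * \<gamma> y = (LINT p|(\<omega> \<Otimes>\<^sub>M \<sigma>). k (fst p) (snd p) * ?f (snd p) * ?g (fst p)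
        - K' (fst p) (snd p) * ?f (snd p) * ?g (fst p))"
      unfolding b_def e1[symmetric] PP_def
      by (rule Bochner_Integration.integral_diff[OF int_PP[OF nice_k int_cell(1) int_cell(2)] int_PP[OF nK' int_cell(1) int_cell(2)], symmetric])
    also have "norm \<dots> \<le> (LINT p|(\<omega> \<Otimes>\<^sub>M \<sigma>). osc I j * Re (1 * ?f (snd p) * ?g (fst p)))"
    proof (rule Bochner_Integration.integral_norm_bound_integral)
      show "integrable (\<omega> \<Otimes>\<^sub>M \<sigma>) (\<lambda>p. osc I j * Re (1 * ?f (snd p) * ?g (fst p)))"
        by (intro integrable_mult_right integrable_Re int_PP[OF n1 int_cell(1) int_cell(2)])
      show "norm (k (fst p) (snd p) * ?f (snd p) * ?g (fst p) - K' (fst p) (snd p) * ?f (snd p) * ?g (fst p))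
          \<le> osc I j * Re (1 * ?f (snd p) * ?g (fst p))" for p
        using kernel_osc[OF I J j na, of "snd p" "fst p"] sx sy o0 by (auto simp: K'_def indicator_def)
    qed (intro Bochner_Integration.integrable_diff int_PP[OF nice_k int_cell(1) int_cell(2)] int_PP[OF nK' int_cell(1) int_cell(2)])
    also have "\<dots> = osc I j * Re (PP (\<lambda>_ _. 1) ?f ?g)"
      unfolding PP_def integral_mult_right_zero integral_Re[OF int_PP[OF n1 int_cell(1) int_cell(2)]] by (rule refl)
    also have "\<dots> = osc I j * (s x * w y)" unfolding e2 by simp
    finally show ?thesis .
  qed
  have "T.B b u v = (\<Sum>x\<in>T.leaves I. \<Sum>y\<in>T.leaves J. b x y * u x * v y)"
  proof -
    have "T.B b u v = (\<Sum>x\<in>T.leaves I. \<Sum>y\<in>T.leaves rt. b x y * u x * v y)"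
      unfolding T.B_def by (rule sum.mono_neutral_right) (use lI u(1) in auto)
    also have "\<dots> = (\<Sum>x\<in>T.leaves I. \<Sum>y\<in>T.leaves J. b x y * u x * v y)"
      by (rule sum.cong[OF refl], rule sum.mono_neutral_right) (use lJ v in auto)
    finally show ?thesis .
  qed
  also have "\<dots> = (\<Sum>x\<in>T.leaves I. \<Sum>y\<in>T.leaves J. (b x y - of_real (s x) * \<gamma> y) * u x * v y)"
  proof -
    have "(\<Sum>x\<in>T.leaves I. \<Sum>y\<in>T.leaves J. (of_real (s x) * u x) * (\<gamma> y * v y)) = 0"
      unfolding sum_product[symmetric] u(2) by simp
    then show ?thesis by (simp add: algebra_simps sum_subtractf)
  qed
  finally have "norm (T.B b u v) \<le> (\<Sum>x\<in>T.leaves I. \<Sum>y\<in>T.leaves J. norm ((b x y - of_real (s x) * \<gamma> y) * u x * v y))"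
    by (simp only: order_trans[OF norm_sum sum_mono[OF norm_sum]])
  also have "\<dots> \<le> (\<Sum>x\<in>T.leaves I. \<Sum>y\<in>T.leaves J. osc I j * ((s x * norm (u x)) * (w y * norm (v y))))"
  proof (intro sum_mono)
    fix x y assume "x \<in> T.leaves I" "y \<in> T.leaves J"
    then have "norm (b x y - of_real (s x) * \<gamma> y) * (norm (u x) * norm (v y)) \<le> osc I j * (s x * w y) * (norm (u x) * norm (v y))"
      by (intro mult_right_mono bb) auto
    then show "norm ((b x y - of_real (s x) * \<gamma> y) * u x * v y) \<le> osc I j * ((s x * norm (u x)) * (w y * norm (v y)))"
      by (simp add: norm_mult mult_ac)
  qed
  also have "\<dots> = osc I j * (\<Sum>x\<in>T.leaves I. s x * norm (u x)) * (\<Sum>y\<in>T.leaves J. w y * norm (v y))"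
    by (simp only: mult.assoc sum_product) (simp only: sum_distrib_left mult.assoc)
  also have "\<dots> \<le> osc I j * (sqrt (s I) * sqrt (T.nrm s u rt)) * (sqrt (w J) * sqrt (T.nrm w v rt))"
  proof -
    have cs: "(\<Sum>x\<in>T.leaves L. m x * norm (z x)) \<le> sqrt (m L) * sqrt (T.nrm m z rt)"
      if m: "T.weight m" and L: "L \<in> DD" for m z L
    proof -
      have n: "0 \<le> m x" if "x \<in> T.leaves L'" for x L' using T.weight_nonneg[OF m T.leaves_in[OF that]] .
      have "(\<Sum>x\<in>T.leaves L. m x * norm (z x)) = (\<Sum>x\<in>T.leaves L. sqrt (m x) * sqrt (m x * (norm (z x))\<^sup>2))"
        using n by (intro sum.cong refl) (simp add: real_sqrt_mult)
      also have "\<dots> \<le> sqrt (sum m (T.leaves L)) * sqrt (\<Sum>x\<in>T.leaves L. m x * (norm (z x))\<^sup>2)"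
        using n by (intro cs_sum) auto
      also have "\<dots> \<le> sqrt (m L) * sqrt (T.nrm m z rt)"
        unfolding T.weight_leaves[OF m L] T.nrm_def
      proof (intro mult_left_mono real_sqrt_le_mono sum_mono2)
        show "T.leaves L \<subseteq> T.leaves rt" using T.leaves_mono[of L rt] T.below_root L by simp
        show "0 \<le> m x * (norm (z x))\<^sup>2" if "x \<in> T.leaves rt - T.leaves L" for x
          using that n by (intro mult_nonneg_nonneg zero_le_power2) blast
      qed (use T.weight_nonneg[OF m L] in auto)
      finally show ?thesis .
    qed
    have "0 \<le> (\<Sum>y\<in>T.leaves J. w y * norm (v y))"
      by (intro sum_nonneg mult_nonneg_nonneg T.weight_nonneg[OF GW.weight_wt]) (auto dest: T.leaves_in)
    then show ?thesis using o0 cs[OF GS.weight_wt I, of u] cs[OF GW.weight_wt J(1), of v]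
        T.nrm_nonneg[OF GS.weight_wt, of u rt] T.weight_nonneg[OF GS.weight_wt I]
      by (intro mult_mono[OF mult_left_mono]) auto
  qed
  finally show ?thesis .
qed

definition "Cfar = Ck * real CARD('n) * A * 2 powr (1 - \<beta>)"

text \<open>The side of \<open>I\<close> relative to \<open>Q\<close> gives the gain
  \<open>2 ^ (- j)\<close>. The powers of the side of \<open>Q\<close> are cancelled by the
  fractional condition on \<open>Q\<close>. The cubes are a distance of half that side apart, whence
  \<open>2 powr (1 - \<beta>)\<close> in \<open>Cfar\<close>.\<close>

lemma osc_A2:
  assumes Q: "side Q = 2 ^ j * side I" and j: "0 < j"
  shows "osc I j * sqrt (s I) * sqrt (w J) \<le> Cfar / 2 ^ j * (sqrt (s I / s Q) * sqrt (w J / w Q))"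
proof -
  let ?X = "side Q"
  have X: "0 < ?X" by (rule side_pos)
  have p: "0 < s Q" "0 < w Q" unfolding GS.wt_cb GW.wt_cb by (rule S.cb_pos[OF X], rule W.cb_pos[OF X])
  have pI: "0 < s I" "0 < w J" unfolding GS.wt_cb GW.wt_cb by (rule S.cb_pos[OF side_pos], rule W.cb_pos[OF side_pos])
  have half: "2 ^ (j - 1) * side I = ?X / 2"
  proof -
    obtain j' where "j = Suc j'" using j by (auto simp: gr0_conv_Suc)
    then show ?thesis unfolding Q by simp
  qed
  have sI: "side I = ?X / 2 ^ j" using Q by simp
  have "osc I j = Ck * real CARD('n) * (?X / 2 ^ j) * (?X / 2) powr (\<beta> - 1)"
    unfolding osc_def half by (simp add: sI)
  also have "(?X / 2) powr (\<beta> - 1) = (?X powr \<beta> / ?X) * 2 powr (1 - \<beta>)"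
  proof -
    have "(?X / 2) powr (\<beta> - 1) = ?X powr (\<beta> - 1) / 2 powr (\<beta> - 1)" using X by (simp add: powr_divide)
    also have "\<dots> = (?X powr \<beta> / ?X) * 2 powr (- (\<beta> - 1))"
      unfolding powr_minus_divide using X by (simp add: powr_diff[of ?X])
    finally show ?thesis by simp
  qed
  finally have osc: "osc I j = Ck * real CARD('n) * 2 powr (1 - \<beta>) / 2 ^ j * ?X powr \<beta>" using X by simp
  have "osc I j * (sqrt (s Q) * sqrt (w Q)) \<le> osc I j * (A * ?X powr (- \<beta>))"
    unfolding GS.wt_cb GW.wt_cb
    by (rule mult_left_mono[OF A2[OF X]]) (use Ck side_pos[of I] in \<open>simp add: osc_def\<close>)
  also have "\<dots> = Cfar / 2 ^ j * (?X powr \<beta> * ?X powr (- \<beta>))" unfolding osc Cfar_def by simp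
  also have "\<dots> = Cfar / 2 ^ j" using X by (simp flip: powr_add)
  finally have m: "osc I j * (sqrt (s Q) * sqrt (w Q)) \<le> Cfar / 2 ^ j" .
  have "osc I j * sqrt (s I) * sqrt (w J) = osc I j * (sqrt (s Q) * sqrt (w Q)) * (sqrt (s I / s Q) * sqrt (w J / w Q))"
  proof -
    have "sqrt (s I) = sqrt (s Q) * sqrt (s I / s Q)" "sqrt (w J) = sqrt (w Q) * sqrt (w J / w Q)"
      using p by (simp_all flip: real_sqrt_mult)
    then show ?thesis by (simp only: mult_ac)
  qed
  also have "\<dots> \<le> Cfar / 2 ^ j * (sqrt (s I / s Q) * sqrt (w J / w Q))"
    using m p pI by (intro mult_right_mono) auto
  finally show ?thesis .
qed

lemma far_two:
  assumes I: "I \<in> DD" and J: "J \<in> DD" "fst J = fst I" and j: "0 < j" "j \<le> fst I"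
    and na: "\<not> adjc (T.anc (j - 1) I) (T.anc (j - 1) J)"
    and v: "\<And>x. x \<in> T.leaves rt - T.leaves J \<Longrightarrow> v x = 0"
  shows "norm (T.B b (T.Df s f I) v)
    \<le> Cfar / 2 ^ j * (sqrt (T.dl s f I) * sqrt (T.nrm w v rt) * (sqrt (s I / s (T.anc j I)) * sqrt (w J / w (T.anc j I))))"
proof -
  have "norm (T.B b (T.Df s f I) v)
      \<le> osc I j * (sqrt (s I) * sqrt (T.nrm s (T.Df s f I) rt)) * (sqrt (w J) * sqrt (T.nrm w v rt))"
    by (rule far_one[OF I J j na _ _ v]) (use T.Df_zero T.sum_Df_zero[OF GS.weight_wt T.below_self[OF I]] in auto)
  also have "\<dots> = osc I j * sqrt (s I) * sqrt (w J) * (sqrt (T.dl s f I) * sqrt (T.nrm w v rt))"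
    unfolding T.nrm_Df[OF GS.weight_wt I] by (simp only: mult_ac)
  also have "\<dots> \<le> Cfar / 2 ^ j * (sqrt (s I / s (T.anc j I)) * sqrt (w J / w (T.anc j I))) * (sqrt (T.dl s f I) * sqrt (T.nrm w v rt))"
    using T.dl_nonneg[OF GS.weight_wt] T.nrm_nonneg[OF GW.weight_wt] side_anc[OF I j(2)] j
    by (intro mult_right_mono osc_A2) auto
  finally show ?thesis by (simp only: mult_ac)
qed

end

context dyadic_adj begin

lemma thin_boundary_mono:
  assumes "thin_boundary \<mu> C \<eta>" "weight \<mu>" "C \<le> C'" "0 \<le> C" "0 \<le> \<eta>" "\<eta> \<le> \<eta>'"
  shows "thin_boundary \<mu> C' \<eta>'"
  unfolding thin_boundary_def
proof (intro ballI allI)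
  fix L s assume L: "L \<in> D"
  have "sum \<mu> {Q\<in>desc s L. boundary Q L} \<le> C * \<eta> ^ s * \<mu> L" using assms(1) L by (simp add: thin_boundary_def)
  also have "\<dots> \<le> C' * \<eta>' ^ s * \<mu> L"
    by (rule mult_right_mono[OF mult_mono[OF assms(3) power_mono[OF assms(6,5)]] weight_nonneg[OF assms(2) L]])
      (use assms(3-5) in simp_all)
  finally show "sum \<mu> {Q\<in>desc s L. boundary Q L} \<le> C' * \<eta>' ^ s * \<mu> L" .
qed

lemma transfers_trans:
  assumes "transfers \<mu> \<nu> k" "transfers \<nu> \<rho> k'" "0 < k" shows "transfers \<mu> \<rho> (k' * k)"
  unfolding transfers_def
proof (intro allI impI)
  fix a M assume a: "0 < M" "\<forall>I\<in>D. 0 \<le> a I" "carleson \<mu> a M"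
  then have "carleson \<nu> a (k * M)" using assms(1) by (simp add: transfers_def)
  then have "carleson \<rho> a (k' * (k * M))" using assms(2,3) a by (simp add: transfers_def)
  then show "carleson \<rho> a (k' * k * M)" by (simp add: mult.assoc)
qed

end

section \<open>Uniform bounds for step functions sampled on a grid\<close>

definition half_open :: "real ^ 'n \<Rightarrow> real \<Rightarrow> (real ^ 'n) set" where
  "half_open t l = {x. \<forall>i. t $ i \<le> x $ i \<and> x $ i < t $ i + l}"

definition round_down :: "real ^ 'n \<Rightarrow> real \<Rightarrow> nat \<Rightarrow> real ^ 'n \<Rightarrow> real ^ 'n" where
  "round_down t l N x = (\<chi> i. t $ i + of_int \<lfloor>(x $ i - t $ i) * 2 ^ N / l\<rfloor> * (l / 2 ^ N))"

context cube_grid begin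

lemma cell_rt: "cell rt = half_open t l"
  by (auto simp: in_cell half_open_def corner_def side_def rt_def)

lemma round_down_corner: assumes "x \<in> T.leaves rt" "\<xi> \<in> cell x" shows "round_down t l N \<xi> = corner x"
proof -
  have "idx N \<xi> = snd x" "fst x = N" using assms T.leaves_lev by (auto simp: cell_def)
  then have "of_int \<lfloor>(\<xi> $ i - t $ i) * 2 ^ N / l\<rfloor> = (of_int (snd x i) :: real)" for i
    by (simp add: idx_def fun_eq_iff)
  then show ?thesis using \<open>fst x = N\<close> by (simp add: round_down_def corner_def side_def)
qed

end

context tested_kernel begin

definition "CB = max (Cs * (2 * real CARD('n)) powr es) (Cw * (2 * real CARD('n)) powr ew)"
definition "ET = max ((1/2) powr es) ((1/2) powr ew)"
definition "KT = 6 / (S.small * W.small)"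

text \<open>Defined before any grid is fixed, hence visibly independent of position, size and depth;
  the kernel enters only through \<open>Ck\<close>, \<open>\<beta>\<close> and the testing and
  fractional constants.\<close>

definition step_const :: "real \<Rightarrow> real" where
  "step_const d = dyadic_adj.core_const (3 ^ CARD('n)) d CB ET KT Tc (Ck * real CARD('n) * A * 2 powr (1 - \<beta>))"

end

context grid_kernel begin

text \<open>The least generation with adjacent ancestors exists because the ancestors meet at the
  root; minimality is the separation one generation below.\<close>

lemma separation:
  assumes "I \<in> DD" "J \<in> DD" "fst J = fst I"
  shows "\<exists>j\<le>fst I. T.anc j J \<in> T.nb (T.anc j I) \<and> (0 < j \<longrightarrow> \<not> adjc (T.anc (j - 1) I) (T.anc (j - 1) J))"
proof -
  define j where "j = (LEAST j. adjc (T.anc j I) (T.anc j J))"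
  have "adjc (T.anc (fst I) I) (T.anc (fst I) J)"
    using T.anc_lev[OF assms(1)] T.anc_lev[OF assms(2)] assms(3) by (simp add: adjc_def)
  then have j: "adjc (T.anc j I) (T.anc j J)" "j \<le> fst I" unfolding j_def by (rule LeastI, rule Least_le)
  have "\<not> adjc (T.anc (j - 1) I) (T.anc (j - 1) J)" if "0 < j"
    using not_less_Least[of "j - 1" "\<lambda>j. adjc (T.anc j I) (T.anc j J)"] that unfolding j_def by simp
  then show ?thesis using j T.anc_in[OF assms(2), of j] assms(3) by (auto simp: T.nb_def)
qed

lemma far_three:
  assumes I: "I \<in> DD" and J: "J \<in> DD" "fst J = fst I" and j: "0 < j" "j \<le> fst I"
    and na: "\<not> adjc (T.anc (j - 1) I) (T.anc (j - 1) J)"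
    and u: "\<And>x. x \<in> T.leaves rt - T.leaves I \<Longrightarrow> u x = 0"
  shows "norm (T.B b u (T.Df w g J))
    \<le> Cfar / 2 ^ j * (sqrt (T.nrm s u rt) * sqrt (T.dl w g J) * (sqrt (s I / s (T.anc j J)) * sqrt (w J / w (T.anc j J))))"
proof -
  interpret X: grid_kernel t l N \<omega> \<sigma> Cw ew Cs es "\<lambda>x y. k y x" Ck \<beta> Tc A by (rule swap_grid)
  have "X.b y x = b x y" for x y unfolding b_def X.b_def
    by (subst PP_2[OF nice_k int_cell], subst X.PP_1[OF X.nice_k X.int_cell]) (rule refl)
  then have B: "T.B X.b (T.Df w g J) u = T.B b u (T.Df w g J)"
    by (simp add: T.B_transpose[of X.b])
  have na': "\<not> adjc (T.anc (j - 1) J) (T.anc (j - 1) I)" by (rule contrapos_nn[OF na T.adj_sym])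
  have "norm (T.B X.b (T.Df w g J) u)
    \<le> Cfar / 2 ^ j * (sqrt (T.dl w g J) * sqrt (T.nrm s u rt) * (sqrt (w J / w (T.anc j J)) * sqrt (s I / s (T.anc j J))))"
    by (rule X.far_two[OF J(1) I _ j(1) _ na' u]) (use J(2) j(2) in simp_all)
  then show ?thesis unfolding B by (simp only: mult_ac)
qed

lemma step_bound:
  assumes d1: "1 \<le> d"
    and dS: "\<And>a l a' l'. 0 < l \<Longrightarrow> l' \<le> 4 * l \<Longrightarrow> cb a l \<inter> cb a' l' \<noteq> {} \<Longrightarrow> measure \<sigma> (cb a' l') \<le> d * measure \<sigma> (cb a l)"
    and dW: "\<And>a l a' l'. 0 < l \<Longrightarrow> l' \<le> 4 * l \<Longrightarrow> cb a l \<inter> cb a' l' \<noteq> {} \<Longrightarrow> measure \<omega> (cb a' l') \<le> d * measure \<omega> (cb a l)"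
  shows "norm (PP k (stp u) (stp v)) \<le> step_const d * (sqrt (T.nrm s u rt) * sqrt (T.nrm w v rt))"
proof -
  note wS = GS.weight_wt and wW = GW.weight_wt
  have e: "(1/2 :: real) powr e < 1" if "0 < e" for e using powr_less_mono'[of "1/2" 0 e] that by simp
  have Cn: "0 \<le> Cs * (2 * real CARD('n)) powr es" "0 \<le> Cw * (2 * real CARD('n)) powr ew" using S.C W.C by auto
  have tS: "T.thin_boundary s CB ET"
    by (rule T.thin_boundary_mono[OF GS.thin_wt wS]) (use Cn in \<open>auto simp: CB_def ET_def\<close>)
  have tW: "T.thin_boundary w CB ET"
    by (rule T.thin_boundary_mono[OF GW.thin_wt wW]) (use Cn in \<open>auto simp: CB_def ET_def\<close>)
  have k0: "0 < 3 / S.small" "0 < 3 / W.small" "0 < KT" using S.small W.small by (auto simp: KT_def)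
  have "T.transfers s w (2 / W.small * (3 / S.small))" "T.transfers w s (2 / S.small * (3 / W.small))"
    by (rule T.transfers_trans[OF GS.transfer_to_lborel GW.transfer_from_lborel k0(1)],
        rule T.transfers_trans[OF GW.transfer_to_lborel GS.transfer_from_lborel k0(2)])
  then have tr: "T.transfers s w KT" "T.transfers w s KT" by (simp_all add: KT_def mult.commute)
  have CB0: "0 \<le> CB" and ET0: "0 < ET" "ET < 1" using Cn e[OF S.eps] e[OF W.eps] by (auto simp: CB_def ET_def less_max_iff_disj)
  have Cf0: "0 \<le> Cfar" using Ck A by (simp add: Cfar_def)
  have far: "\<exists>j\<le>fst I. T.anc j J \<in> T.nb (T.anc j I) \<and> (0 < j \<longrightarrow>
      (\<forall>f v. (\<forall>x\<in>T.leaves rt - T.leaves J. v x = 0) \<longrightarrow> norm (T.B b (T.Df s f I) v)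
        \<le> Cfar / 2 ^ j * (sqrt (T.dl s f I) * sqrt (T.nrm w v rt) * (sqrt (s I / s (T.anc j I)) * sqrt (w J / w (T.anc j I))))) \<and>
      (\<forall>u g. (\<forall>x\<in>T.leaves rt - T.leaves I. u x = 0) \<longrightarrow> norm (T.B b u (T.Df w g J))
        \<le> Cfar / 2 ^ j * (sqrt (T.nrm s u rt) * sqrt (T.dl w g J) * (sqrt (s I / s (T.anc j J)) * sqrt (w J / w (T.anc j J))))))"
    if IJ: "I \<in> DD" "J \<in> DD" "fst J = fst I" for I J
  proof -
    obtain j where j: "j \<le> fst I" "T.anc j J \<in> T.nb (T.anc j I)" "0 < j \<longrightarrow> \<not> adjc (T.anc (j - 1) I) (T.anc (j - 1) J)"
      using separation[OF IJ] by blast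
    show ?thesis
    proof (intro exI[of _ j] conjI impI allI j(1,2))
      fix f and v :: "_ \<Rightarrow> complex" assume "0 < j" "\<forall>x\<in>T.leaves rt - T.leaves J. v x = 0"
      then show "norm (T.B b (T.Df s f I) v)
        \<le> Cfar / 2 ^ j * (sqrt (T.dl s f I) * sqrt (T.nrm w v rt) * (sqrt (s I / s (T.anc j I)) * sqrt (w J / w (T.anc j I))))"
        using j by (intro far_two[OF IJ]) auto
    next
      fix g and u :: "_ \<Rightarrow> complex" assume "0 < j" "\<forall>x\<in>T.leaves rt - T.leaves I. u x = 0"
      then show "norm (T.B b u (T.Df w g J))
        \<le> Cfar / 2 ^ j * (sqrt (T.nrm s u rt) * sqrt (T.dl w g J) * (sqrt (s I / s (T.anc j J)) * sqrt (w J / w (T.anc j J))))"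
        using j by (intro far_three[OF IJ]) auto
    qed
  qed
  have "norm (T.B b u v) \<le> T.core_const d CB ET KT Tc Cfar * (sqrt (T.nrm s u rt) * sqrt (T.nrm w v rt))"
    by (rule T.core_bound[OF wS wW GS.doubling_wt[OF dS] GW.doubling_wt[OF dW] d1 tS tW CB0 ET0 tr k0(3) Tc Cf0 ch_card test1 test2 far])
  then show ?thesis unfolding B_stp step_const_def Cfar_def .
qed

lemma stp_round: "stp (\<lambda>x. f (corner x)) \<xi> = f (round_down t l N \<xi>) * indicator (half_open t l) \<xi>"
  by (cases \<xi> rule: cell_rt_cases)
    (auto simp: stp_in stp_out round_down_corner cell_rt[symmetric] indicator_def)

lemma round_bound:
  assumes "1 \<le> d"
    and "\<And>a l a' l'. 0 < l \<Longrightarrow> l' \<le> 4 * l \<Longrightarrow> cb a l \<inter> cb a' l' \<noteq> {} \<Longrightarrow> measure \<sigma> (cb a' l') \<le> d * measure \<sigma> (cb a l)"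
    and "\<And>a l a' l'. 0 < l \<Longrightarrow> l' \<le> 4 * l \<Longrightarrow> cb a l \<inter> cb a' l' \<noteq> {} \<Longrightarrow> measure \<omega> (cb a' l') \<le> d * measure \<omega> (cb a l)"
  fixes f g :: "real ^ 'n \<Rightarrow> complex"
  defines "f' \<equiv> \<lambda>\<xi>. f (round_down t l N \<xi>) * indicator (half_open t l) \<xi>"
    and "g' \<equiv> \<lambda>\<xi>. g (round_down t l N \<xi>) * indicator (half_open t l) \<xi>"
  shows "norm (PP k f' g') \<le> step_const d * (sqrt (LINT x|\<sigma>. (norm (f' x))\<^sup>2) * sqrt (LINT x|\<omega>. (norm (g' x))\<^sup>2))"
    and "f' \<in> borel_measurable borel"
proof -
  have e: "f' = stp (\<lambda>x. f (corner x))" "g' = stp (\<lambda>x. g (corner x))"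
    by (simp_all add: f'_def g'_def stp_round fun_eq_iff)
  show "norm (PP k f' g') \<le> step_const d * (sqrt (LINT x|\<sigma>. (norm (f' x))\<^sup>2) * sqrt (LINT x|\<omega>. (norm (g' x))\<^sup>2))"
    unfolding e stp_L2(2) stp_L2(4) by (rule step_bound[OF assms(1-3)])
  show "f' \<in> borel_measurable borel"
    unfolding e using borel_measurable_integrable[OF int_stp(1)] unfolding S.borel_measurable_mu .
qed

end

section \<open>From step functions to square integrable functions\<close>

lemma half_open_borel [measurable]: "half_open t l \<in> sets borel"
  unfolding half_open_def by measurable

lemma half_open_cb: "half_open t l \<subseteq> cb t l"
  by (auto simp: half_open_def in_cb less_imp_le)

lemma bounded_half_open: "bounded (half_open t l)"
  using bounded_subset[OF cb_bounded half_open_cb] .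

lemma round_down_half_open:
  assumes l: "0 < l" and x: "x \<in> half_open t l" shows "round_down t l N x \<in> half_open t l"
  unfolding half_open_def
proof (intro CollectI allI conjI)
  fix i
  define z where "z = (x $ i - t $ i) * 2 ^ N / l"
  have xi: "t $ i \<le> x $ i" "x $ i < t $ i + l" using x by (auto simp: half_open_def)
  have e: "round_down t l N x $ i = t $ i + of_int \<lfloor>z\<rfloor> * (l / 2 ^ N)" by (simp add: round_down_def z_def)
  have z0: "0 \<le> z" using xi l by (simp add: z_def)
  then have "0 \<le> of_int \<lfloor>z\<rfloor> * (l / 2 ^ N)" using l by (intro mult_nonneg_nonneg) auto
  then show "t $ i \<le> round_down t l N x $ i" unfolding e by simp
  have "of_int \<lfloor>z\<rfloor> * (l / 2 ^ N) \<le> z * (l / 2 ^ N)" using l by (intro mult_right_mono) auto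
  also have "\<dots> = x $ i - t $ i" using l by (simp add: z_def)
  finally show "round_down t l N x $ i < t $ i + l" unfolding e using xi by linarith
qed

lemma round_down_tendsto: assumes l: "0 < l" shows "(\<lambda>N. round_down t l N x) \<longlonglongrightarrow> x"
proof (rule vec_tendstoI)
  fix i
  have b: "norm (round_down t l N x $ i - x $ i) \<le> l * (1/2) ^ N" for N
  proof -
    define z where "z = (x $ i - t $ i) * 2 ^ N / l"
    have e: "round_down t l N x $ i = t $ i + of_int \<lfloor>z\<rfloor> * (l / 2 ^ N)" by (simp add: round_down_def z_def)
    have "z * (l / 2 ^ N) = x $ i - t $ i" using l by (simp add: z_def)
    then have "round_down t l N x $ i - x $ i = (of_int \<lfloor>z\<rfloor> - z) * (l / 2 ^ N)"
      unfolding e left_diff_distrib by linarith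
    also have "norm \<dots> = \<bar>of_int \<lfloor>z\<rfloor> - z\<bar> * (l / 2 ^ N)" using l by (simp add: abs_mult)
    also have "\<dots> \<le> 1 * (l / 2 ^ N)"
    proof (rule mult_right_mono)
      show "\<bar>of_int \<lfloor>z\<rfloor> - z\<bar> \<le> 1" by linarith
    qed (use l in simp)
    finally show ?thesis by (simp add: power_one_over)
  qed
  have "(\<lambda>N. l * (1/2) ^ N) \<longlonglongrightarrow> l * 0" by (intro tendsto_mult tendsto_const LIMSEQ_realpow_zero) auto
  then have "(\<lambda>N. round_down t l N x $ i - x $ i) \<longlonglongrightarrow> 0"
    by (intro Lim_null_comparison[OF always_eventually[OF allI[OF b]]]) simp
  then show "(\<lambda>N. round_down t l N x $ i) \<longlonglongrightarrow> x $ i" by (rule LIM_zero_cancel)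
qed

lemma continuous_bounded_half_open:
  fixes f :: "real ^ 'n \<Rightarrow> complex"
  assumes "continuous_on UNIV f" obtains M where "0 \<le> M" "\<And>x. x \<in> half_open t l \<Longrightarrow> norm (f x) \<le> M"
proof -
  have "compact (f ` cb t l)"
    unfolding cb_def by (intro compact_continuous_image continuous_on_subset[OF assms]) auto
  then obtain M where M: "\<And>x. x \<in> cb t l \<Longrightarrow> norm (f x) \<le> M"
    using compact_imp_bounded bounded_iff by (metis imageI)
  have h: "norm (f x) \<le> \<bar>M\<bar>" if "x \<in> half_open t l" for x
    using M[OF subsetD[OF half_open_cb that]] by linarith
  show ?thesis by (rule that[of "\<bar>M\<bar>"]) (simp_all add: h)
qed

lemma sqrt_absorb: assumes "0 \<le> x" "0 \<le> c" "x \<le> c * sqrt x" shows "sqrt x \<le> c"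
proof (cases "x = 0")
  case False
  then have "0 < sqrt x" using assms by simp
  moreover have "sqrt x * sqrt x \<le> c * sqrt x" using assms by simp
  ultimately show ?thesis by (rule mult_right_le_imp_le[rotated])
qed (use assms in simp)

lemma (in A_inf_measure) integrable_bounded_support:
  fixes f :: "real ^ 'n \<Rightarrow> 'b :: {banach, second_countable_topology}"
  assumes f: "f \<in> borel_measurable borel" and S: "bounded S" "S \<in> sets borel"
    and b: "\<And>x. norm (f x) \<le> M * indicator S x"
  shows "integrable \<mu> f"
proof -
  have "integrable \<mu> (\<lambda>x. M * indicator S x)"
    by (rule integrable_mult_right, rule integrable_real_indicator) (use S sets_mu finite_bounded in auto)
  then show ?thesis
    by (rule Bochner_Integration.integrable_bound)
      (use f borel_measurable_mu in \<open>auto intro!: AE_I2 order_trans[OF b]\<close>)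
qed

lemma (in A_inf_measure) integrable_half_open: "integrable \<mu> (\<lambda>x. c * indicator (half_open t l) x :: real)"
  by (rule integrable_mult_right, rule integrable_real_indicator)
    (use sets_mu finite_bounded[OF bounded_half_open half_open_borel] in auto)

locale bounded_kernel = tested_kernel \<sigma> \<omega> Cs es Cw ew k Ck \<beta> Tc A
  for \<sigma> \<omega> :: "(real ^ 'n) measure" and Cs es Cw ew k Ck \<beta> Tc A +
  fixes d :: real
  assumes d1: "1 \<le> d"
    and dS: "\<And>a l a' l'. 0 < l \<Longrightarrow> l' \<le> 4 * l \<Longrightarrow> cb a l \<inter> cb a' l' \<noteq> {} \<Longrightarrow> measure \<sigma> (cb a' l') \<le> d * measure \<sigma> (cb a l)"
    and dW: "\<And>a l a' l'. 0 < l \<Longrightarrow> l' \<le> 4 * l \<Longrightarrow> cb a l \<inter> cb a' l' \<noteq> {} \<Longrightarrow> measure \<omega> (cb a' l') \<le> d * measure \<omega> (cb a l)"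
begin

text \<open>The absolute value supplies nonnegativity without unfolding the explicit
  constant.\<close>

definition "D = \<bar>step_const d\<bar>"

lemma D0: "0 \<le> D" by (simp add: D_def)

lemma round_measurable:
  fixes t :: "real ^ 'n"
  assumes l: "0 < l"
  shows "(\<lambda>\<xi>. f (round_down t l N \<xi>) * indicator (half_open t l) \<xi> :: complex) \<in> borel_measurable borel"
proof -
  interpret G: grid_kernel t l N \<sigma> \<omega> Cs es Cw ew k Ck \<beta> Tc A
    by (intro grid_kernel.intro cube_grid.intro tested_kernel_axioms l)
  show ?thesis by (rule G.round_bound(2)[OF d1 dS dW])
qed

text \<open>Sampling at the corners of ever finer cells converges pointwise on the half-open cube,
  and everything is dominated by constants there. The bound for the samples is the same for every
  depth \<open>N\<close>, so it survives the limit.\<close>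

lemma continuous_bound:
  fixes t :: "real ^ 'n"
  assumes l: "0 < l" and f: "continuous_on UNIV f" and g: "continuous_on UNIV g"
  defines "f' \<equiv> \<lambda>\<xi>. f \<xi> * indicator (half_open t l) \<xi>" and "g' \<equiv> \<lambda>\<xi>. g \<xi> * indicator (half_open t l) \<xi>"
  shows "norm (PP k f' g') \<le> D * (sqrt (LINT x|\<sigma>. (norm (f' x))\<^sup>2) * sqrt (LINT x|\<omega>. (norm (g' x))\<^sup>2))"
proof -
  define fN where "fN = (\<lambda>N \<xi>. f (round_down t l N \<xi>) * indicator (half_open t l) \<xi>)"
  define gN where "gN = (\<lambda>N \<xi>. g (round_down t l N \<xi>) * indicator (half_open t l) \<xi>)"
  obtain Mf where Mf: "0 \<le> Mf" "\<And>x. x \<in> half_open t l \<Longrightarrow> norm (f x) \<le> Mf" using continuous_bounded_half_open[OF f] by blast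
  obtain Mg where Mg: "0 \<le> Mg" "\<And>x. x \<in> half_open t l \<Longrightarrow> norm (g x) \<le> Mg" using continuous_bounded_half_open[OF g] by blast
  obtain M where M: "\<And>x y. norm (k x y) \<le> M" using bounded_k by blast
  have M0: "0 \<le> M" using M[of 0 0] norm_ge_zero order_trans by blast
  have bf: "norm (fN N \<xi>) \<le> Mf * indicator (half_open t l) \<xi>" for N \<xi>
    using Mf(2)[OF round_down_half_open[OF l]] by (simp add: fN_def indicator_def)
  have bg: "norm (gN N \<xi>) \<le> Mg * indicator (half_open t l) \<xi>" for N \<xi>
    using Mg(2)[OF round_down_half_open[OF l]] by (simp add: gN_def indicator_def)
  have mf: "fN N \<in> borel_measurable borel" and mg: "gN N \<in> borel_measurable borel" for N
    unfolding fN_def gN_def by (rule round_measurable[OF l])+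
  have iF: "integrable \<sigma> (fN N)" "integrable \<omega> (gN N)" for N
    by (rule S.integrable_bounded_support[OF mf bounded_half_open half_open_borel bf],
        rule W.integrable_bounded_support[OF mg bounded_half_open half_open_borel bg])
  have lf: "(\<lambda>N. fN N \<xi>) \<longlonglongrightarrow> f' \<xi>" and lg: "(\<lambda>N. gN N \<xi>) \<longlonglongrightarrow> g' \<xi>" for \<xi>
    unfolding fN_def gN_def f'_def g'_def
    by (intro tendsto_mult tendsto_const continuous_on_tendsto_compose[OF f round_down_tendsto[OF l]]
        continuous_on_tendsto_compose[OF g round_down_tendsto[OF l]]; simp)+
  have mf': "f' \<in> borel_measurable borel" "g' \<in> borel_measurable borel"
    by (rule borel_measurable_LIMSEQ_metric[OF mf lf], rule borel_measurable_LIMSEQ_metric[OF mg lg])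
  have bf': "norm (f' \<xi>) \<le> Mf * indicator (half_open t l) \<xi>" "norm (g' \<xi>) \<le> Mg * indicator (half_open t l) \<xi>" for \<xi>
    using Mf(2) Mg(2) by (simp_all add: f'_def g'_def indicator_def)
  have iF': "integrable \<sigma> f'" "integrable \<omega> g'"
    by (rule S.integrable_bounded_support[OF mf'(1) bounded_half_open half_open_borel bf'(1)],
        rule W.integrable_bounded_support[OF mf'(2) bounded_half_open half_open_borel bf'(2)])
  define c where "c = of_real (M * Mf * Mg) * (1 :: complex)"
  have nc: "nice (\<lambda>_ _. c)" by (auto simp: nice_def)
  have ind: "integrable \<sigma> (indicator (half_open t l) :: _ \<Rightarrow> complex)" "integrable \<omega> (indicator (half_open t l) :: _ \<Rightarrow> complex)"
    by (rule S.integrable_bounded_support[OF _ bounded_half_open[of t l] half_open_borel, of _ 1], measurable, simp add: indicator_def,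
        rule W.integrable_bounded_support[OF _ bounded_half_open[of t l] half_open_borel, of _ 1], measurable, simp add: indicator_def)
  have PPl: "(\<lambda>N. PP k (fN N) (gN N)) \<longlonglongrightarrow> PP k f' g'"
    unfolding PP_def
  proof (rule integral_dominated_convergence)
    show "integrable (\<omega> \<Otimes>\<^sub>M \<sigma>) (\<lambda>p. norm (c * indicator (half_open t l) (snd p) * indicator (half_open t l) (fst p)))"
      by (rule integrable_norm[OF int_PP[OF nc ind]])
    show "AE p in \<omega> \<Otimes>\<^sub>M \<sigma>. (\<lambda>N. k (fst p) (snd p) * fN N (snd p) * gN N (fst p)) \<longlonglongrightarrow> k (fst p) (snd p) * f' (snd p) * g' (fst p)"
      by (intro AE_I2 tendsto_mult tendsto_const lf lg)
    show "AE p in \<omega> \<Otimes>\<^sub>M \<sigma>. norm (k (fst p) (snd p) * fN N (snd p) * gN N (fst p))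
        \<le> norm (c * indicator (half_open t l) (snd p) * indicator (half_open t l) (fst p))" for N
    proof (rule AE_I2)
      fix p :: "(real ^ 'n) \<times> (real ^ 'n)"
      let ?a = "indicator (half_open t l) (snd p) :: real" and ?b = "indicator (half_open t l) (fst p) :: real"
      have "norm (k (fst p) (snd p) * fN N (snd p) * gN N (fst p)) \<le> M * (Mf * ?a) * (Mg * ?b)"
        unfolding norm_mult using M bf bg M0 Mf Mg by (intro mult_mono mult_nonneg_nonneg norm_ge_zero) auto
      also have "\<dots> = norm (c * indicator (half_open t l) (snd p) * indicator (half_open t l) (fst p))"
        using M0 Mf(1) Mg(1) by (simp add: c_def norm_mult indicator_def abs_mult)
      finally show "norm (k (fst p) (snd p) * fN N (snd p) * gN N (fst p))
        \<le> norm (c * indicator (half_open t l) (snd p) * indicator (half_open t l) (fst p))" .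
    qed
  qed (rule borel_measurable_integrable[OF int_PP[OF nice_k iF']] borel_measurable_integrable[OF int_PP[OF nice_k iF]])+
  have sq: "(norm (fN N \<xi>))\<^sup>2 \<le> Mf\<^sup>2 * indicator (half_open t l) \<xi>" "(norm (gN N \<xi>))\<^sup>2 \<le> Mg\<^sup>2 * indicator (half_open t l) \<xi>" for N \<xi>
    using power_mono[OF bf[of N \<xi>] norm_ge_zero, of 2] power_mono[OF bg[of N \<xi>] norm_ge_zero, of 2] by (auto simp: indicator_def split: if_splits)
  have lF: "(\<lambda>N. LINT x|\<sigma>. (norm (fN N x))\<^sup>2) \<longlonglongrightarrow> (LINT x|\<sigma>. (norm (f' x))\<^sup>2)"
  proof (rule integral_dominated_convergence)
    show "integrable \<sigma> (\<lambda>x. Mf\<^sup>2 * indicator (half_open t l) x)"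
      by (rule S.integrable_half_open)
    show "AE x in \<sigma>. (\<lambda>N. (norm (fN N x))\<^sup>2) \<longlonglongrightarrow> (norm (f' x))\<^sup>2"
      by (intro AE_I2 tendsto_power tendsto_norm lf)
    show "AE x in \<sigma>. norm ((norm (fN N x))\<^sup>2) \<le> Mf\<^sup>2 * indicator (half_open t l) x" for N
      using sq(1) by (intro AE_I2) simp
  qed (use mf mf' in \<open>simp_all add: S.borel_measurable_mu\<close>)
  have lG: "(\<lambda>N. LINT x|\<omega>. (norm (gN N x))\<^sup>2) \<longlonglongrightarrow> (LINT x|\<omega>. (norm (g' x))\<^sup>2)"
  proof (rule integral_dominated_convergence)
    show "integrable \<omega> (\<lambda>x. Mg\<^sup>2 * indicator (half_open t l) x)"
      by (rule W.integrable_half_open)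
    show "AE x in \<omega>. (\<lambda>N. (norm (gN N x))\<^sup>2) \<longlonglongrightarrow> (norm (g' x))\<^sup>2"
      by (intro AE_I2 tendsto_power tendsto_norm lg)
    show "AE x in \<omega>. norm ((norm (gN N x))\<^sup>2) \<le> Mg\<^sup>2 * indicator (half_open t l) x" for N
      using sq(2) by (intro AE_I2) simp
  qed (use mg mf' in \<open>simp_all add: W.borel_measurable_mu\<close>)
  have step: "norm (PP k (fN N) (gN N)) \<le> D * (sqrt (LINT x|\<sigma>. (norm (fN N x))\<^sup>2) * sqrt (LINT x|\<omega>. (norm (gN N x))\<^sup>2))" for N
  proof -
    interpret G: grid_kernel t l N \<sigma> \<omega> Cs es Cw ew k Ck \<beta> Tc A
      by (intro grid_kernel.intro cube_grid.intro tested_kernel_axioms l)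
    have "norm (PP k (fN N) (gN N)) \<le> step_const d * (sqrt (LINT x|\<sigma>. (norm (fN N x))\<^sup>2) * sqrt (LINT x|\<omega>. (norm (gN N x))\<^sup>2))"
      unfolding fN_def gN_def by (rule G.round_bound(1)[OF d1 dS dW])
    also have "\<dots> \<le> D * (sqrt (LINT x|\<sigma>. (norm (fN N x))\<^sup>2) * sqrt (LINT x|\<omega>. (norm (gN N x))\<^sup>2))"
      by (rule mult_right_mono) (auto simp: D_def)
    finally show ?thesis .
  qed
  show ?thesis
    by (rule LIMSEQ_le[OF tendsto_norm[OF PPl] tendsto_mult[OF tendsto_const tendsto_mult[OF tendsto_real_sqrt[OF lF] tendsto_real_sqrt[OF lG]]]])
      (use step in blast)
qed

lemma int_k:
  assumes f: "integrable \<sigma> f" shows "integrable \<sigma> (\<lambda>y. k x y * f y)"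
proof -
  obtain M where M: "\<And>x y. norm (k x y) \<le> M" using bounded_k by blast
  have k: "(\<lambda>y. k x y) \<in> borel_measurable borel"
    using measurable_compose[OF _ nice_k[unfolded nice_def, THEN conjunct1], of "\<lambda>y. (x, y)" borel] by simp
  have M0: "0 \<le> M" using M[of 0 0] norm_ge_zero order_trans by blast
  show ?thesis
  proof (rule Bochner_Integration.integrable_bound[OF integrable_mult_right[OF integrable_norm[OF f], of M]])
    show "(\<lambda>y. k x y * f y) \<in> borel_measurable \<sigma>"
      using k borel_measurable_integrable[OF f] unfolding S.borel_measurable_mu by (rule borel_measurable_times)
    show "AE y in \<sigma>. norm (k x y * f y) \<le> norm (M * norm (f y))"
      using M M0 by (intro AE_I2) (simp add: norm_mult mult_right_mono)
  qed
qed

text \<open>The estimate of \<open>local_lip1\<close> is uniform in \<open>y\<close> and therefore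
  passes under the integral for any integrable \<open>f\<close>.\<close>

lemma continuous_T:
  assumes f: "integrable \<sigma> f" shows "continuous_on UNIV (\<lambda>x. LINT y|\<sigma>. k x y * f y)"
proof -
  obtain \<rho> L where L: "0 < \<rho>" "0 \<le> L" "\<And>x x' y. norm (x - x') \<le> \<rho> \<Longrightarrow> norm (k x y - k x' y) \<le> L * norm (x - x')"
    by (rule local_lip1) blast
  let ?F = "\<lambda>x. LINT y|\<sigma>. k x y * f y" and ?c = "L * (LINT y|\<sigma>. norm (f y))"
  have b: "norm (?F x - ?F x') \<le> ?c * norm (x - x')" if h: "norm (x - x') \<le> \<rho>" for x x'
  proof -
    have "?F x - ?F x' = (LINT y|\<sigma>. k x y * f y - k x' y * f y)"
      by (rule Bochner_Integration.integral_diff[OF int_k[OF f] int_k[OF f], symmetric])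
    also have "norm \<dots> \<le> (LINT y|\<sigma>. L * norm (x - x') * norm (f y))"
    proof (rule Bochner_Integration.integral_norm_bound_integral)
      show "integrable \<sigma> (\<lambda>y. k x y * f y - k x' y * f y)" by (intro Bochner_Integration.integrable_diff int_k f)
      show "integrable \<sigma> (\<lambda>y. L * norm (x - x') * norm (f y))" by (intro integrable_mult_right integrable_norm f)
      show "norm (k x y * f y - k x' y * f y) \<le> L * norm (x - x') * norm (f y)" for y
        unfolding left_diff_distrib[symmetric] norm_mult by (intro mult_right_mono L(3)[OF h]) auto
    qed
    finally show ?thesis by (simp add: mult_ac)
  qed
  show ?thesis unfolding continuous_on_def
  proof (intro ballI)
    fix x :: "real ^ 'n"
    have "((\<lambda>x'. ?F x' - ?F x) \<longlongrightarrow> 0) (at x)"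
    proof (rule Lim_null_comparison)
      have "\<forall>\<^sub>F x' in at x. norm (x' - x) \<le> \<rho>"
        unfolding eventually_at using L(1) by (intro exI[of _ \<rho>]) (auto simp: dist_norm)
      then show "\<forall>\<^sub>F x' in at x. norm (?F x' - ?F x) \<le> ?c * norm (x' - x)"
        by eventually_elim (rule b)
      have "((\<lambda>x'. ?c * norm (x' - x)) \<longlongrightarrow> ?c * norm (x - x)) (at x)" by (intro tendsto_intros)
      then show "((\<lambda>x'. ?c * norm (x' - x)) \<longlongrightarrow> 0) (at x)" by simp
    qed
    then show "(?F \<longlongrightarrow> ?F x) (at x)" by (rule LIM_zero_cancel)
  qed
qed

lemma swap_bounded: "bounded_kernel \<omega> \<sigma> Cw ew Cs es (\<lambda>x y. k y x) Ck \<beta> Tc A d"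
  by (intro bounded_kernel.intro swap bounded_kernel_axioms.intro d1 dS dW)

lemma int_cont:
  fixes t :: "real ^ 'n" and f :: "real ^ 'n \<Rightarrow> complex"
  assumes f: "continuous_on UNIV f"
  shows "integrable \<sigma> (\<lambda>x. f x * indicator (half_open t l) x)"
    and "integrable \<sigma> (\<lambda>x. (norm (f x * indicator (half_open t l) x))\<^sup>2)"
proof -
  obtain M where M: "0 \<le> M" "\<And>x. x \<in> half_open t l \<Longrightarrow> norm (f x) \<le> M" using continuous_bounded_half_open[OF f] by blast
  have [measurable]: "f \<in> borel_measurable borel" by (rule borel_measurable_continuous_onI[OF f])
  show "integrable \<sigma> (\<lambda>x. f x * indicator (half_open t l) x)"
    by (rule S.integrable_bounded_support[OF _ bounded_half_open[of t l] half_open_borel, of _ M], measurable)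
      (use M in \<open>simp add: indicator_def\<close>)
  show "integrable \<sigma> (\<lambda>x. (norm (f x * indicator (half_open t l) x))\<^sup>2)"
    by (rule S.integrable_bounded_support[OF _ bounded_half_open[of t l] half_open_borel, of _ "M\<^sup>2"], measurable)
      (use M in \<open>simp add: indicator_def power_mono\<close>)
qed

text \<open>Tests the bilinear form with \<open>f = cnj h\<close>, which is continuous because \<open>k\<close> is a truncation.\<close>

lemma dual_bound:
  fixes t :: "real ^ 'n"
  assumes l: "0 < l" and g: "continuous_on UNIV g"
  defines "g' \<equiv> \<lambda>x. g x * indicator (half_open t l) x"
  defines "h \<equiv> \<lambda>y. LINT x|\<omega>. k x y * g' x"
  shows "continuous_on UNIV h"
    and "sqrt (LINT y|\<sigma>. (norm (h y * indicator (half_open t l) y))\<^sup>2) \<le> D * sqrt (LINT x|\<omega>. (norm (g' x))\<^sup>2)"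
proof -
  interpret X: bounded_kernel \<omega> \<sigma> Cw ew Cs es "\<lambda>x y. k y x" Ck \<beta> Tc A d by (rule swap_bounded)
  have ig: "integrable \<omega> g'" unfolding g'_def by (rule X.int_cont[OF g])
  show ch: "continuous_on UNIV h" unfolding h_def by (rule X.continuous_T[OF ig])
  let ?Q = "half_open t l" and ?f = "\<lambda>y. cnj (h y) * indicator (half_open t l) y"
  have cc: "continuous_on UNIV (\<lambda>y. cnj (h y))" by (intro continuous_intros ch)
  let ?X = "LINT y|\<sigma>. (norm (h y * indicator ?Q y))\<^sup>2"
  have n: "norm (?f y) = norm (h y * indicator ?Q y)" for y by (simp add: norm_mult)
  have "PP k ?f g' = (LINT y|\<sigma>. h y * ?f y)" unfolding h_def by (rule PP_2[OF nice_k int_cont(1)[OF cc, unfolded h_def] ig])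
  also have "(\<lambda>y. h y * ?f y) = (\<lambda>y. of_real ((norm (h y * indicator ?Q y))\<^sup>2))"
    by (rule ext) (simp add: indicator_def flip: complex_norm_square of_real_power)
  finally have e: "PP k ?f g' = of_real ?X" unfolding integral_complex_of_real .
  have X0: "0 \<le> ?X" by (rule integral_nonneg_AE) auto
  have "?X = norm (PP k ?f g')" unfolding e using X0 by simp
  also have "\<dots> \<le> D * (sqrt (LINT x|\<sigma>. (norm (?f x))\<^sup>2) * sqrt (LINT x|\<omega>. (norm (g' x))\<^sup>2))"
    unfolding g'_def by (rule continuous_bound[OF l cc g])
  also have "\<dots> = D * sqrt (LINT x|\<omega>. (norm (g' x))\<^sup>2) * sqrt ?X" unfolding n by (simp only: mult_ac)
  finally show "sqrt ?X \<le> D * sqrt (LINT x|\<omega>. (norm (g' x))\<^sup>2)"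
    by (rule sqrt_absorb[OF X0, rotated]) (intro mult_nonneg_nonneg D0 real_sqrt_ge_zero integral_nonneg_AE AE_I2 zero_le_power2)
qed

text \<open>Here \<open>F\<close> is continuous even though \<open>f\<close> is not, so the dual bound applies to \<open>cnj F\<close>.\<close>

lemma local_bound:
  fixes t :: "real ^ 'n"
  assumes l: "0 < l" and f: "f \<in> L2_space \<sigma>"
  defines "f' \<equiv> \<lambda>y. f y * indicator (half_open t l) y"
  defines "F \<equiv> \<lambda>x. LINT y|\<sigma>. k x y * f' y"
  shows "continuous_on UNIV F"
    and "sqrt (LINT x|\<omega>. (norm (F x * indicator (half_open t l) x))\<^sup>2) \<le> D * sqrt (LINT y|\<sigma>. (norm (f' y))\<^sup>2)"
proof -
  interpret X: bounded_kernel \<omega> \<sigma> Cw ew Cs es "\<lambda>x y. k y x" Ck \<beta> Tc A d by (rule swap_bounded)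
  let ?Q = "half_open t l"
  have fm: "f \<in> borel_measurable \<sigma>" and f2: "integrable \<sigma> (\<lambda>y. (norm (f y))\<^sup>2)" using f by (auto simp: L2_space_def)
  have im: "indicator ?Q \<in> borel_measurable \<sigma>" by (simp add: S.borel_measurable_mu)
  have f'm: "f' \<in> borel_measurable \<sigma>" unfolding f'_def using fm im by (intro borel_measurable_times) (auto simp: S.borel_measurable_mu)
  have "integrable \<sigma> (\<lambda>y. (norm (1 * indicator ?Q y :: complex))\<^sup>2)" by (rule int_cont(2)) (rule continuous_on_const)
  then have "integrable \<sigma> (\<lambda>y. (norm (indicator ?Q y :: complex))\<^sup>2)" by simp
  then have "integrable \<sigma> f'" unfolding f'_def by (intro cs_integral(1) fm f2) (simp_all add: S.borel_measurable_mu)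
  note if' = this
  have f'2: "integrable \<sigma> (\<lambda>y. (norm (f' y))\<^sup>2)"
    by (rule Bochner_Integration.integrable_bound[OF f2]) (use f'm in \<open>auto simp: f'_def indicator_def\<close>)
  show cF: "continuous_on UNIV F" unfolding F_def by (rule continuous_T[OF if'])
  let ?g = "\<lambda>x. cnj (F x)" and ?g' = "\<lambda>x. cnj (F x) * indicator ?Q x"
  have cc: "continuous_on UNIV ?g" by (intro continuous_intros cF)
  define h where "h = (\<lambda>y. LINT x|\<omega>. k x y * ?g' x)"
  have db: "continuous_on UNIV h" "sqrt (LINT y|\<sigma>. (norm (h y * indicator ?Q y))\<^sup>2) \<le> D * sqrt (LINT x|\<omega>. (norm (?g' x))\<^sup>2)"
    unfolding h_def by (rule dual_bound[OF l cc])+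
  let ?X = "LINT x|\<omega>. (norm (F x * indicator ?Q x))\<^sup>2"
  have n: "norm (?g' x) = norm (F x * indicator ?Q x)" for x by (simp add: norm_mult)
  have ig: "integrable \<omega> ?g'" by (rule X.int_cont[OF cc])
  have "PP k f' ?g' = (LINT x|\<omega>. F x * ?g' x)" unfolding F_def by (rule PP_1[OF nice_k if' ig[unfolded F_def]])
  also have "(\<lambda>x. F x * ?g' x) = (\<lambda>x. of_real ((norm (F x * indicator ?Q x))\<^sup>2))"
    by (rule ext) (simp add: indicator_def flip: complex_norm_square of_real_power)
  finally have e: "PP k f' ?g' = of_real ?X" unfolding integral_complex_of_real .
  have X0: "0 \<le> ?X" by (rule integral_nonneg_AE) auto
  have "?X = norm (PP k f' ?g')" unfolding e using X0 by simp
  also have "PP k f' ?g' = (LINT y|\<sigma>. h y * f' y)" unfolding h_def by (rule PP_2[OF nice_k if' ig])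
  \<comment> \<open>\<open>f'\<close> lives on the cube, so \<open>h\<close> may be cut off there,
    which is the form in which \<open>dual_bound\<close> controls it.\<close>
  also have "(\<lambda>y. h y * f' y) = (\<lambda>y. (h y * indicator ?Q y) * f' y)" by (rule ext) (simp add: f'_def indicator_def)
  also have "norm (LINT y|\<sigma>. (h y * indicator ?Q y) * f' y)
      \<le> sqrt (LINT y|\<sigma>. (norm (h y * indicator ?Q y))\<^sup>2) * sqrt (LINT y|\<sigma>. (norm (f' y))\<^sup>2)"
    by (rule cs_integral(2)[OF borel_measurable_integrable[OF int_cont(1)[OF db(1)]] f'm int_cont(2)[OF db(1)] f'2])
  also have "\<dots> \<le> D * sqrt (LINT x|\<omega>. (norm (?g' x))\<^sup>2) * sqrt (LINT y|\<sigma>. (norm (f' y))\<^sup>2)"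
    by (rule mult_right_mono[OF db(2)]) simp
  also have "\<dots> = D * sqrt (LINT y|\<sigma>. (norm (f' y))\<^sup>2) * sqrt ?X" unfolding n by (simp only: mult_ac)
  finally show "sqrt ?X \<le> D * sqrt (LINT y|\<sigma>. (norm (f' y))\<^sup>2)"
    by (rule sqrt_absorb[OF X0, rotated]) (intro mult_nonneg_nonneg D0 real_sqrt_ge_zero integral_nonneg_AE AE_I2 zero_le_power2)
qed

text \<open>A truncated kernel has bounded range: on the cube \<open>Q m\<close> the function
  \<open>F\<close> agrees with the image of \<open>f\<close> restricted to a cube larger by
  \<open>r\<close>. The local bounds have one constant for all cubes, so monotone convergence over
  growing \<open>m\<close> gives membership in the space and the norm estimate together.\<close>

lemma global_bound:
  assumes f: "f \<in> L2_space \<sigma>"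
  defines "F \<equiv> \<lambda>x. LINT y|\<sigma>. k x y * f y"
  shows "F \<in> L2_space \<omega>" and "L2_norm \<omega> F \<le> D * L2_norm \<sigma> f"
proof -
  interpret X: bounded_kernel \<omega> \<sigma> Cw ew Cs es "\<lambda>x y. k y x" Ck \<beta> Tc A d by (rule swap_bounded)
  have fm: "f \<in> borel_measurable \<sigma>" and f2: "integrable \<sigma> (\<lambda>y. (norm (f y))\<^sup>2)" using f by (auto simp: L2_space_def)
  define Q where "Q m = half_open (\<chi> i. - real m :: real ^ 'n) (2 * real m)" for m
  have inQ: "x \<in> Q m \<longleftrightarrow> (\<forall>i. - real m \<le> x $ i \<and> x $ i < real m)" for x m by (simp add: Q_def half_open_def)
  obtain \<rho> where \<rho>: "\<And>x y. \<rho> \<le> norm (x - y) \<Longrightarrow> k x y = 0" using supp_out by blast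
  obtain r :: nat where r: "\<rho> \<le> real r" "0 < r" using real_arch_simple[of "max \<rho> 1"] by (metis max.bounded_iff of_nat_0_less_iff less_le_trans zero_less_one)
  define FQ where "FQ M = (\<lambda>x. LINT y|\<sigma>. k x y * (f y * indicator (Q M) y))" for M
  have FF: "F x = FQ (m + r) x" if x: "x \<in> Q m" for x m
  proof -
    have "k x y = 0" if y: "y \<notin> Q (m + r)" for y
    proof (rule \<rho>)
      obtain i where i: "\<not> (- real (m + r) \<le> y $ i \<and> y $ i < real (m + r))" using y inQ by blast
      have "- real m \<le> x $ i" "x $ i < real m" using x inQ by auto
      then have "real r \<le> \<bar>x $ i - y $ i\<bar>" using i by auto
      also have "\<dots> \<le> norm (x - y)" using component_le_norm_cart[of "x - y" i] by simp
      finally show "\<rho> \<le> norm (x - y)" using r by linarith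
    qed
    then have "(\<lambda>y. k x y * f y) = (\<lambda>y. k x y * (f y * indicator (Q (m + r)) y))"
      by (intro ext) (auto simp: indicator_def)
    then show ?thesis by (simp only: F_def FQ_def)
  qed
  have FQ: "continuous_on UNIV (FQ M)" "sqrt (LINT x|\<omega>. (norm (FQ M x * indicator (Q M) x))\<^sup>2)
      \<le> D * sqrt (LINT y|\<sigma>. (norm (f y * indicator (Q M) y))\<^sup>2)" if "0 < M" for M
    unfolding FQ_def Q_def using local_bound[OF _ f, of "2 * real M"] that by auto
  have fin: "F x * indicator (Q m) x = FQ (m + r) x * indicator (Q m) x" for x m
    using FF[of x m] by (simp add: indicator_def)
  let ?A = "\<lambda>m. LINT x|\<omega>. (norm (F x * indicator (Q m) x))\<^sup>2" and ?N = "LINT y|\<sigma>. (norm (f y))\<^sup>2"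
  have iA: "integrable \<omega> (\<lambda>x. (norm (F x * indicator (Q m) x))\<^sup>2)" for m
    unfolding fin unfolding Q_def using r by (intro X.int_cont(2) FQ(1)) simp
  have Qmono: "Q m \<subseteq> Q m'" if "m \<le> m'" for m m'
  proof
    fix x assume "x \<in> Q m"
    moreover have "real m \<le> real m'" using that by simp
    ultimately show "x \<in> Q m'" unfolding inQ by (smt (verit))
  qed
  have le: "(norm (F x * indicator (Q m) x))\<^sup>2 \<le> (norm (F x * indicator (Q m') x))\<^sup>2" if "m \<le> m'" for m m' x
    using Qmono[OF that] by (auto simp: indicator_def)
  have A_le: "?A m \<le> D\<^sup>2 * ?N" for m
  proof -
    let ?M = "m + r"
    have "?A m \<le> (LINT x|\<omega>. (norm (FQ ?M x * indicator (Q ?M) x))\<^sup>2)"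
    proof (rule integral_mono[OF iA])
      show "integrable \<omega> (\<lambda>x. (norm (FQ ?M x * indicator (Q ?M) x))\<^sup>2)"
        unfolding Q_def using r by (intro X.int_cont(2) FQ(1)) simp
      show "(norm (F x * indicator (Q m) x))\<^sup>2 \<le> (norm (FQ ?M x * indicator (Q ?M) x))\<^sup>2" for x
        unfolding fin using Qmono[of m ?M] by (auto simp: indicator_def)
    qed
    also have "\<dots> = (sqrt (LINT x|\<omega>. (norm (FQ ?M x * indicator (Q ?M) x))\<^sup>2))\<^sup>2"
      by (rule real_sqrt_pow2[symmetric], rule integral_nonneg_AE) auto
    also have "\<dots> \<le> (D * sqrt (LINT y|\<sigma>. (norm (f y * indicator (Q ?M) y))\<^sup>2))\<^sup>2"
      using FQ(2)[of ?M] r by (intro power_mono) (auto intro!: integral_nonneg_AE)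
    also have "\<dots> = D\<^sup>2 * (LINT y|\<sigma>. (norm (f y * indicator (Q ?M) y))\<^sup>2)"
      unfolding power_mult_distrib by (subst real_sqrt_pow2) (auto intro!: integral_nonneg_AE)
    also have "\<dots> \<le> D\<^sup>2 * ?N"
    proof (intro mult_left_mono integral_mono f2)
      have "f \<in> borel_measurable borel" "Q ?M \<in> sets borel" using fm by (simp_all add: S.borel_measurable_mu Q_def)
      then show "integrable \<sigma> (\<lambda>y. (norm (f y * indicator (Q ?M) y))\<^sup>2)"
        by (intro Bochner_Integration.integrable_bound[OF f2]) (auto simp: S.borel_measurable_mu indicator_def)
    qed (auto simp: indicator_def)
    finally show ?thesis .
  qed
  have inc: "incseq ?A" unfolding incseq_def by (intro allI impI integral_mono iA le)
  obtain L where L: "?A \<longlonglongrightarrow> L" by (rule incseq_convergent[OF inc]) (use A_le in auto)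
  have L_le: "L \<le> D\<^sup>2 * ?N" by (rule LIMSEQ_le_const2[OF L]) (use A_le in auto)
  have ev: "\<forall>\<^sub>F m in sequentially. x \<in> Q m" for x
  proof -
    obtain m0 :: nat where m0: "norm x + 1 \<le> real m0" using real_arch_simple by blast
    have "x \<in> Q m" if "m0 \<le> m" for m
    proof -
      have "\<bar>x $ i\<bar> < real m" for i using component_le_norm_cart[of x i] m0 that by linarith
      then show ?thesis unfolding inQ by (simp add: abs_less_iff less_imp_le minus_less_iff)
    qed
    then show ?thesis unfolding eventually_sequentially by blast
  qed
  have lim: "(\<lambda>m. F x * indicator (Q m) x) \<longlonglongrightarrow> F x" for x
    by (rule tendsto_eventually) (use ev[of x] in \<open>eventually_elim, simp\<close>)
  have Fm: "F \<in> borel_measurable borel"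
  proof (rule borel_measurable_LIMSEQ_metric[OF _ lim])
    show "(\<lambda>x. F x * indicator (Q m) x) \<in> borel_measurable borel" for m
      unfolding fin using borel_measurable_continuous_onI[OF FQ(1)[of "m + r"]] r
      by (intro borel_measurable_times) (simp_all add: Q_def)
  qed
  have hb: "has_bochner_integral \<omega> (\<lambda>x. (norm (F x))\<^sup>2) L"
  proof (rule has_bochner_integral_monotone_convergence[OF iA])
    show "AE x in \<omega>. mono (\<lambda>m. (norm (F x * indicator (Q m) x))\<^sup>2)" by (intro AE_I2 monoI le)
    show "AE x in \<omega>. (\<lambda>m. (norm (F x * indicator (Q m) x))\<^sup>2) \<longlonglongrightarrow> (norm (F x))\<^sup>2"
      by (intro AE_I2 tendsto_power tendsto_norm lim)
    show "(\<lambda>x. (norm (F x))\<^sup>2) \<in> borel_measurable \<omega>" unfolding W.borel_measurable_mu using Fm by measurable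
  qed (rule L)
  then show "F \<in> L2_space \<omega>"
    using Fm by (simp add: L2_space_def W.borel_measurable_mu has_bochner_integral_iff)
  have "L2_norm \<omega> F = sqrt L" using hb by (simp add: L2_norm_def has_bochner_integral_iff)
  also have "\<dots> \<le> sqrt (D\<^sup>2 * ?N)" using L_le by simp
  also have "\<dots> = D * L2_norm \<sigma> f" using D0 by (simp add: L2_norm_def real_sqrt_mult)
  finally show "L2_norm \<omega> F \<le> D * L2_norm \<sigma> f" .
qed

end

text \<open>The volume power equals \<open>l powr (n - \<alpha>)\<close>. Finiteness of the supremum
  is what makes \<open>enn2real\<close> faithful, as it sends infinity to 0.\<close>

lemma A2_frac_finite:
  fixes \<omega> \<sigma> :: "(real ^ 'n) measure"
  assumes fin: "A2_frac \<alpha> \<omega> \<sigma> < \<infinity>" and l: "0 < l"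
  shows "sqrt (measure \<sigma> (cb a l)) * sqrt (measure \<omega> (cb a l))
    \<le> enn2real (A2_frac \<alpha> \<omega> \<sigma>) * l powr (- (\<alpha> - real CARD('n)))"
proof -
  let ?n = "real CARD('n)" and ?I = "cb a l"
  define p where "p = l powr (- (\<alpha> - ?n))"
  have p: "0 < p" using l by (simp add: p_def)
  have "measure lborel ?I powr (1 - \<alpha> / ?n) = (l powr ?n) powr (1 - \<alpha> / ?n)"
    using l by (simp add: measure_cb powr_realpow)
  also have "\<dots> = p" by (simp add: powr_powr p_def right_diff_distrib)
  finally have e: "measure lborel ?I powr (1 - \<alpha> / ?n) = p" .
  have "?I \<in> cubes" using l by (auto simp: cubes_cb)
  then have "ennreal (sqrt (measure \<omega> ?I / p) * sqrt (measure \<sigma> ?I / p)) \<le> A2_frac \<alpha> \<omega> \<sigma>"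
    unfolding A2_frac_def e[symmetric] by (rule SUP_upper)
  then have "enn2real (ennreal (sqrt (measure \<omega> ?I / p) * sqrt (measure \<sigma> ?I / p))) \<le> enn2real (A2_frac \<alpha> \<omega> \<sigma>)"
    using fin by (intro enn2real_mono) (auto simp: less_top)
  then have "sqrt (measure \<omega> ?I / p) * sqrt (measure \<sigma> ?I / p) \<le> enn2real (A2_frac \<alpha> \<omega> \<sigma>)"
    using p by simp
  moreover have "sqrt (measure \<omega> ?I / p) * sqrt (measure \<sigma> ?I / p) = sqrt (measure \<sigma> ?I) * sqrt (measure \<omega> ?I) / p"
    using p by (simp add: real_sqrt_divide)
  ultimately show ?thesis using p unfolding p_def[symmetric] by (simp add: divide_le_eq)
qed

theorem theorem5:
  fixes \<alpha> :: real
    and \<omega> \<sigma> :: "(real ^ 'n) measure"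
    and K :: "real ^ 'n \<Rightarrow> real ^ 'n \<Rightarrow> complex"
    and \<phi> :: "real \<Rightarrow> real"
  assumes "0 \<le> \<alpha>" and "\<alpha> < real CARD('n)"
    and "A_infty \<omega>" and "A_infty \<sigma>"
    and "fractional_kernel \<alpha> K"
    and "cutoff_profile \<phi>"
    and "A2_frac \<alpha> \<omega> \<sigma> < \<infinity>" and "A2_frac \<alpha> \<sigma> \<omega> < \<infinity>"
    and "\<exists>\<TT>. testing_condition \<phi> K \<sigma> \<omega> \<TT>"
    and "\<exists>\<TT>'. testing_condition \<phi> (adjoint_kernel K) \<omega> \<sigma> \<TT>'"
  shows "\<exists>C. bounded_L2 \<phi> K \<sigma> \<omega> C"
proof -
  obtain Cs es where S: "A_inf_measure \<sigma> Cs es" using A_infty_imp[OF assms(4)] by blast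
  obtain Cw ew where W: "A_inf_measure \<omega> Cw ew" using A_infty_imp[OF assms(3)] by blast
  let ?D = "\<lambda>\<mu> d. \<forall>a l a' l'. 0 < l \<longrightarrow> l' \<le> 4 * l \<longrightarrow> cb a l \<inter> cb a' l' \<noteq> {} \<longrightarrow>
    measure \<mu> (cb a' l') \<le> d * measure \<mu> (cb a l)"
  have mono: "?D \<mu> d'" if "?D \<mu> d" "d \<le> d'" for \<mu> :: "(real ^ 'n) measure" and d d'
    using that(1) mult_right_mono[OF that(2) measure_nonneg] by (meson order_trans)
  obtain ds where ds: "1 \<le> ds" "?D \<sigma> ds" using A_inf_measure.doubling_ex[OF S] by blast
  obtain dw where dw: "1 \<le> dw" "?D \<omega> dw" using A_inf_measure.doubling_ex[OF W] by blast
  define d where "d = max ds dw"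
  have d: "1 \<le> d" "?D \<sigma> d" "?D \<omega> d"
    using ds(1) mono[OF ds(2), of d] mono[OF dw(2), of d] by (simp_all add: d_def)
  define \<beta> where "\<beta> = \<alpha> - real CARD('n)"
  obtain Ck where Ck: "\<And>r R. 0 < r \<Longrightarrow> r < R \<Longrightarrow> good_kernel (truncated_kernel \<phi> r R K) Ck \<beta>"
    using truncation_good[OF assms(5,6,2)] unfolding \<beta>_def by blast
  obtain T1 where T1: "testing_condition \<phi> K \<sigma> \<omega> T1" using assms(9) by blast
  obtain T2 where T2: "testing_condition \<phi> (adjoint_kernel K) \<omega> \<sigma> T2" using assms(10) by blast
  \<comment> \<open>The testing condition only involves the square of its constant, which may thus
    be negative; absolute values are taken before the maximum.\<close>
  define Tc where "Tc = max \<bar>T1\<bar> \<bar>T2\<bar>"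
  have "\<bar>T1\<bar>\<^sup>2 \<le> Tc\<^sup>2" "\<bar>T2\<bar>\<^sup>2 \<le> Tc\<^sup>2" by (rule power_mono; simp add: Tc_def)+
  then have Tc: "T1\<^sup>2 \<le> Tc\<^sup>2" "T2\<^sup>2 \<le> Tc\<^sup>2" by simp_all
  define A where "A = enn2real (A2_frac \<alpha> \<omega> \<sigma>)"
  have BK: "bounded_kernel \<sigma> \<omega> Cs es Cw ew (truncated_kernel \<phi> r R K) Ck \<beta> Tc A d"
    if rR: "0 < r" "r < R" for r R
  proof (intro bounded_kernel.intro tested_kernel.intro two_measures.intro S W Ck[OF rR]
      tested_kernel_axioms.intro bounded_kernel_axioms.intro d(1))
    show "0 \<le> Tc" "0 \<le> A" by (simp_all add: Tc_def A_def)
    show "\<beta> \<le> 0" using assms(2) by (simp add: \<beta>_def)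
    show "sqrt (measure \<sigma> (cb a l)) * sqrt (measure \<omega> (cb a l)) \<le> A * l powr (- \<beta>)" if "0 < l" for a l
      unfolding A_def \<beta>_def by (rule A2_frac_finite[OF assms(7) that])
    show "measure \<sigma> (cb a' l') \<le> d * measure \<sigma> (cb a l)" "measure \<omega> (cb a' l') \<le> d * measure \<omega> (cb a l)"
      if "0 < l" "l' \<le> 4 * l" "cb a l \<inter> cb a' l' \<noteq> {}" for a l a' l'
      using d(2,3) that by blast+
    fix a :: "real ^ 'n" and l :: real assume l: "0 < l"
    then have I: "cb a l \<in> cubes" by (auto simp: cubes_cb)
    let ?F = "\<lambda>x. LINT y|\<sigma>. truncated_kernel \<phi> r R K x y * indicator (cb a l) y"
    let ?G = "\<lambda>y. LINT x|\<omega>. truncated_kernel \<phi> r R K x y * indicator (cb a l) x"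
    have "?F = trunc_op \<phi> r R K \<sigma> (indicator (cb a l))" by (simp add: trunc_op_def fun_eq_iff)
    then have F: "?F \<in> L2_space \<omega>" "(L2_norm \<omega> ?F)\<^sup>2 \<le> T1\<^sup>2 * measure \<sigma> (cb a l)"
      using T1 rR I by (simp_all add: testing_condition_def)
    moreover have "T1\<^sup>2 * measure \<sigma> (cb a l) \<le> Tc\<^sup>2 * measure \<sigma> (cb a l)" by (rule mult_right_mono[OF Tc(1)]) simp
    ultimately show "?F \<in> L2_space \<omega> \<and> (L2_norm \<omega> ?F)\<^sup>2 \<le> Tc\<^sup>2 * measure \<sigma> (cb a l)" by linarith
    have "?G = trunc_op \<phi> r R (adjoint_kernel K) \<omega> (indicator (cb a l))" by (simp add: trunc_op_def trunc_adjoint fun_eq_iff)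
    then have G: "?G \<in> L2_space \<sigma>" "(L2_norm \<sigma> ?G)\<^sup>2 \<le> T2\<^sup>2 * measure \<omega> (cb a l)"
      using T2 rR I by (simp_all add: testing_condition_def)
    moreover have "T2\<^sup>2 * measure \<omega> (cb a l) \<le> Tc\<^sup>2 * measure \<omega> (cb a l)" by (rule mult_right_mono[OF Tc(2)]) simp
    ultimately show "?G \<in> L2_space \<sigma> \<and> (L2_norm \<sigma> ?G)\<^sup>2 \<le> Tc\<^sup>2 * measure \<omega> (cb a l)" by linarith
  qed
  \<comment> \<open>The witness \<open>D\<close> mentions the kernel only through \<open>Ck\<close>
    and so does not depend on \<open>r\<close> and \<open>R\<close>, as required of a constant
    chosen before them.\<close>
  show ?thesis
    unfolding bounded_L2_def trunc_op_def[abs_def]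
    by (intro exI allI impI ballI conjI) (blast intro: bounded_kernel.global_bound[OF BK])+
qed

end
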